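(* Let the network assumptions (A1)–(A4) (spelled out in the context) hold, and let $(\rho,w)$ be the corresponding classical solution of the network problem (GN), with $m=a\rho w$. Then there are constants $C>0$ and $\Delta\tau_0>0$, with $C$ depending only on the bounds in the assumptions but independent of $\varepsilon$, such that for $0<\Delta\tau\le\Delta\tau_0$ sufficiently small and $h\approx\Delta\tau$, the discrete admissible state solution $(\rho_h^n,m_h^n)_{0\le n\le N}$ of the scheme (DN) satisfies, for all $0\le n\le N$, $$\|\rho(\tau^n)-\rho_h^n\|_{L^2(\mathcal E)}^2+\varepsilon^2\|m(\tau^n)-m_h^n\|_{L^2(\mathcal E)}^2+\sum_{k=1}^n\Delta\tau\,\|m(\tau^k)-m_h^k\|_{L^3(\mathcal E)}^3\le C\big(\Delta\tau^2+h^2\big).$$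
   Context: Network. A finite directed connected graph has vertices $\mathcal V$ and edges $\mathcal E$; edge $e$ (a pipe) is identified with $(0,\ell^e)$. $\mathcal E(v)$ is the set of edges incident to $v$; $\mathcal V_\partial=\{v\in\mathcal V:|\mathcal E(v)|=1\}$ are boundary vertices and $\mathcal V_0=\mathcal V\setminus\mathcal V_\partial$ inner vertices. For $e=(v_1,v_2)$ set $n^e(v_1)=-1$, $n^e(v_2)=1$, and $n^e(v)=0$ for all other $v$. For functions $u$ on the network, $u^e=u|_e$; $L^p(\mathcal E)=\{u:u^e\in L^p(e)\ \forall e\}$ with $\|u\|_{L^p(\mathcal E)}^p=\sum_e\|u^e\|_{L^p(e)}^p$; $\langle u,v\rangle_{\mathcal E}=\sum_e\int_0^{\ell^e}u^ev^e\,dx$; $H^1_{pw}(\mathcal E)=\{u:u^e\in H^1(e)\ \forall e\}$ with $\|u\|^2_{H^1_{pw}(\mathcal E)}=\sum_e\|u^e\|^2_{H^1(e)}$; $H(\mathrm{div};\mathcal E)=\{u\in H^1_{pw}(\mathcal E):\sum_{e\in\mathcal E(v)}u^e(v)n^e(v)=0\ \forall v\in\mathcal V_0\}$. Problem (GN). To avoid a clash with the mesh size $h$, the enthalpy is denoted by $\eta$. With edgewise constants $a^e,\gamma^e>0$ and a constant $\varepsilon\ge0$, on each $e\in\mathcal E$, for $0<x<\ell^e$, $\tau>0$: $$a^e\partial_\tau\rho^e+\partial_xm^e=0,\quad \varepsilon^2\partial_\tau w^e+\partial_x\eta^e=-\gamma^e|w^e|w^e,\quad m^e=a^e\rho^ew^e,\quad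 \eta^e=\tfrac12\varepsilon^2(w^e)^2+P'(\rho^e);$$ at $v\in\mathcal V_0$: $\sum_{e\in\mathcal E(v)}m^e(v)n^e(v)=0$ and $\eta^e(v)=\eta^v$ for all $e\in\mathcal E(v)$, with $\eta^v$ an additional unknown; at $v\in\mathcal V_\partial$, $e\in\mathcal E(v)$: $\eta^e(v)=\eta^v_\partial$ with given functions $\eta_\partial^v(\tau)$. A classical solution is a pair $\rho,w\in C^1([0,\tau_{\max}];L^2(\mathcal E))\cap C^0([0,\tau_{\max}];H^1_{pw}(\mathcal E))$ with $\rho>0$ satisfying these equations pointwise. Assumptions. $\bar\varepsilon,\underline\gamma,\bar\gamma,\underline a,\bar a,\underline\rho,\bar\rho,\bar w,\bar C$ are fixed positive constants. (A1) $P:(0,\infty)\to\mathbb R$ is smooth and strongly convex. (A2) $0\le\varepsilon\le\bar\varepsilon$; $\underline\gamma\le\gamma^e\le\bar\gamma$ and $\underline a\le a^e\le\bar a$ for all $e$; and $\rho P''(\rho)\ge4\bar\varepsilon^2|\bar w|^2$ for all $2\underline\rho/3\le\rho\le3\bar\rho/2$. (A3) There is a classical solution $(\rho,w)$ with $\underline\rho\le\rho\le\bar\rho$ and $-\bar w\le w\le\bar w$ for all $0\le\tau\le\tau_{\max}$ and almost everywhere on the network. (A4) This $\rho$ and $w$ are bounded in $W^{2,\infty}(0,\tau_{\max};L^2(\mathcal E))$ and $W^{1,\infty}(0,\tau_{\max};H^1_{pw}(\mathcal E))$ by $\bar C$. Discretization. Each pipe $e$ is divided into $M^e$ intervals of equal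 length $h^e=\ell^e/M^e$, $\mathcal T_h$ is the resulting mesh and $h=\max_eh^e$; $h\approx\Delta\tau$ means that $c_1\Delta\tau\le h^e\le c_2\Delta\tau$ for all $e$ with fixed constants $c_1,c_2>0$. $Q_h$ is the space of piecewise constant functions over $\mathcal T_h$, and $R_h$ the space of piecewise linear functions over $\mathcal T_h$ belonging to $H(\mathrm{div};\mathcal E)$. $\Pi_h:L^2(\mathcal E)\to Q_h$ is the $L^2$-projection and $I_h:H(\mathrm{div};\mathcal E)\to R_h$ the edgewise nodal piecewise linear interpolation. $\tau^n=n\Delta\tau$, $\Delta\tau=\tau_{\max}/N$, $\bar d_\tau u^n=\frac1{\Delta\tau}(u^n-u^{n-1})$. Scheme (DN): $\rho_h^0=\Pi_h\rho(0)$, $m_h^0=I_hm(0)$; for $1\le n\le N$ find $\rho_h^n\in Q_h$, $m_h^n\in R_h$ with $$\langle a\,\bar d_\tau\rho_h^n,q_h\rangle_{\mathcal E}+\langle\partial_xm_h^n,q_h\rangle_{\mathcal E}=0\quad\forall q_h\in Q_h,$$ $$\langle\varepsilon^2\bar d_\tau w_h^n,r_h\rangle_{\mathcal E}-\langle\eta_h^n,\partial_xr_h\rangle_{\mathcal E}+\langle\gamma|w_h^n|w_h^n,r_h\rangle_{\mathcal E}=-\sum_{v\in\mathcal V_\partial}\sum_{e\in\mathcal E(v)}\eta_\partial^v(\tau^n)\,r_h^e(v)n^e(v)\quad\forall r_h\in R_h,$$ where $w_h^n=\frac{m_h^n}{a\rho_h^n}$ and $\eta_h^n=\frac{\varepsilon^2(m_h^n)^2}{2a^2(\rho_h^n)^2}+P'(\rho_h^n)$.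 A discrete solution is an admissible state solution if $2\underline\rho/3\le\rho_h^n\le3\bar\rho/2$ and $|w_h^n|\le3\bar w/2$ for all $0\le n\le N$. *)

theory Defs
  imports "HOL-Analysis.Analysis" "Graph_Theory.Digraph_Component"
begin

definition smooth_on :: "real set \<Rightarrow> (real \<Rightarrow> real) \<Rightarrow> bool" where
  "smooth_on S f \<longleftrightarrow> (\<forall>k. (deriv ^^ k) f differentiable_on S)"

definition strongly_convex_on :: "real set \<Rightarrow> (real \<Rightarrow> real) \<Rightarrow> bool" where
  "strongly_convex_on S f \<longleftrightarrow> convex S \<and> (\<exists>\<mu>>0. \<forall>x\<in>S. \<forall>y\<in>S. \<forall>t\<in>{0..1}.
     f (t * x + (1 - t) * y) \<le> t * f x + (1 - t) * f y - \<mu> / 2 * t * (1 - t) * (x - y)\<^sup>2)"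

definition pipe :: "real \<Rightarrow> real measure" where
  "pipe l = restrict_space lborel {0<..<l}"

definition Lp :: "real \<Rightarrow> real \<Rightarrow> (real \<Rightarrow> real) set" where
  "Lp p l = {u \<in> borel_measurable (pipe l). integrable (pipe l) (\<lambda>x. \<bar>u x\<bar> powr p)}"

definition test_function :: "real \<Rightarrow> (real \<Rightarrow> real) \<Rightarrow> bool" where
  "test_function l \<phi> \<longleftrightarrow> smooth_on UNIV \<phi> \<and>
     (\<exists>\<alpha> \<beta>. 0 < \<alpha> \<and> \<beta> < l \<and> (\<forall>x. x \<notin> {\<alpha>..\<beta>} \<longrightarrow> \<phi> x = 0))"

definition has_weak_deriv :: "real \<Rightarrow> (real \<Rightarrow> real) \<Rightarrow> (real \<Rightarrow> real) \<Rightarrow> bool" where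
  "has_weak_deriv l u g \<longleftrightarrow> u \<in> Lp 2 l \<and> g \<in> Lp 2 l \<and>
     (\<forall>\<phi>. test_function l \<phi> \<longrightarrow>
        (\<integral>x. u x * deriv \<phi> x \<partial>pipe l) = - (\<integral>x. g x * \<phi> x \<partial>pipe l))"

text \<open>An element of \<open>H\<^sup>1(0,l)\<close> is represented by its representative that is continuous on
  \<open>[0,l]\<close>; the values at \<open>0\<close> and \<open>l\<close> are then the traces.\<close>

definition H1 :: "real \<Rightarrow> (real \<Rightarrow> real) set" where
  "H1 l = {u. continuous_on {0..l} u \<and> (\<exists>g. has_weak_deriv l u g)}"

text \<open>The weak derivative is determined almost everywhere only; the following picks some
  representative and is meaningful for arguments in \<open>H1 l\<close>.\<close>

definition weak_deriv :: "real \<Rightarrow> (real \<Rightarrow> real) \<Rightarrow> real \<Rightarrow> real" where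
  "weak_deriv l u = (SOME g. has_weak_deriv l u g)"

text \<open>A network is a digraph \<open>G\<close> with pipe lengths \<open>\<l>\<close>. A function \<open>u\<close> on it is given by
  its restrictions \<open>u e\<close> to the pipes \<open>e\<close>, where the tail of \<open>e\<close> is at \<open>0\<close> and the head
  of \<open>e\<close> is at \<open>\<l> e\<close>.\<close>

type_synonym 'e netfun = "'e \<Rightarrow> real \<Rightarrow> real"

definition incident_arcs :: "('v,'e) pre_digraph \<Rightarrow> 'v \<Rightarrow> 'e set" where
  "incident_arcs G v = {e \<in> arcs G. tail G e = v \<or> head G e = v}"

definition boundary_verts :: "('v,'e) pre_digraph \<Rightarrow> 'v set" where
  "boundary_verts G = {v \<in> verts G. card (incident_arcs G v) = 1}"

definition inner_verts :: "('v,'e) pre_digraph \<Rightarrow> 'v set" where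
  "inner_verts G = verts G - boundary_verts G"

definition edge_sign :: "('v,'e) pre_digraph \<Rightarrow> 'e \<Rightarrow> 'v \<Rightarrow> real" where
  "edge_sign G e v = (if v = tail G e then -1 else if v = head G e then 1 else 0)"

text \<open>Intended for \<open>e \<in> incident_arcs G v\<close> in a graph without loops, as is \<open>edge_sign\<close> (for a loop
  the two prescribed signs at its vertex would contradict each other).\<close>

definition vertex_value :: "('v,'e) pre_digraph \<Rightarrow> ('e \<Rightarrow> real) \<Rightarrow> 'e netfun \<Rightarrow> 'e \<Rightarrow> 'v \<Rightarrow> real" where
  "vertex_value G \<l> u e v = (if v = tail G e then u e 0 else u e (\<l> e))"

definition LpE :: "('v,'e) pre_digraph \<Rightarrow> ('e \<Rightarrow> real) \<Rightarrow> real \<Rightarrow> 'e netfun set" where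
  "LpE G \<l> p = {u. \<forall>e\<in>arcs G. u e \<in> Lp p (\<l> e)}"

definition LpE_norm :: "('v,'e) pre_digraph \<Rightarrow> ('e \<Rightarrow> real) \<Rightarrow> real \<Rightarrow> 'e netfun \<Rightarrow> real" where
  "LpE_norm G \<l> p u = (\<Sum>e\<in>arcs G. \<integral>x. \<bar>u e x\<bar> powr p \<partial>pipe (\<l> e)) powr (1 / p)"

definition ipE :: "('v,'e) pre_digraph \<Rightarrow> ('e \<Rightarrow> real) \<Rightarrow> 'e netfun \<Rightarrow> 'e netfun \<Rightarrow> real" where
  "ipE G \<l> u v = (\<Sum>e\<in>arcs G. \<integral>x. u e x * v e x \<partial>pipe (\<l> e))"

definition dx :: "('e \<Rightarrow> real) \<Rightarrow> 'e netfun \<Rightarrow> 'e netfun" where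
  "dx \<l> u = (\<lambda>e. weak_deriv (\<l> e) (u e))"

definition H1pw :: "('v,'e) pre_digraph \<Rightarrow> ('e \<Rightarrow> real) \<Rightarrow> 'e netfun set" where
  "H1pw G \<l> = {u. \<forall>e\<in>arcs G. u e \<in> H1 (\<l> e)}"

definition H1pw_norm :: "('v,'e) pre_digraph \<Rightarrow> ('e \<Rightarrow> real) \<Rightarrow> 'e netfun \<Rightarrow> real" where
  "H1pw_norm G \<l> u = sqrt (\<Sum>e\<in>arcs G.
     (\<integral>x. (u e x)\<^sup>2 \<partial>pipe (\<l> e)) + (\<integral>x. (dx \<l> u e x)\<^sup>2 \<partial>pipe (\<l> e)))"

definition Hdiv :: "('v,'e) pre_digraph \<Rightarrow> ('e \<Rightarrow> real) \<Rightarrow> 'e netfun set" where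
  "Hdiv G \<l> = {u \<in> H1pw G \<l>.
     \<forall>v\<in>inner_verts G. (\<Sum>e\<in>incident_arcs G v. vertex_value G \<l> u e v * edge_sign G e v) = 0}"

text \<open>Here \<open>X\<close> is a space of functions on the network and \<open>N\<close> is its norm.\<close>

definition C0_time :: "'e netfun set \<Rightarrow> ('e netfun \<Rightarrow> real) \<Rightarrow> real \<Rightarrow> (real \<Rightarrow> 'e netfun) \<Rightarrow> bool" where
  "C0_time X N T u \<longleftrightarrow> (\<forall>t\<in>{0..T}. u t \<in> X \<and>
     ((\<lambda>s. N (\<lambda>e x. u s e x - u t e x)) \<longlongrightarrow> 0) (at t within {0..T}))"

definition C1_time_deriv ::
  "'e netfun set \<Rightarrow> ('e netfun \<Rightarrow> real) \<Rightarrow> real \<Rightarrow> (real \<Rightarrow> 'e netfun) \<Rightarrow> (real \<Rightarrow> 'e netfun) \<Rightarrow> bool"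
where
  "C1_time_deriv X N T u u' \<longleftrightarrow> C0_time X N T u \<and> C0_time X N T u' \<and>
     (\<forall>t\<in>{0..T}. ((\<lambda>s. N (\<lambda>e x. (u s e x - u t e x) / (s - t) - u' t e x)) \<longlongrightarrow> 0)
        (at t within {0..T}))"

text \<open>Elements of \<open>L\<^sup>\<infinity>(0,T;X)\<close> are represented by functions that are jointly measurable in
  time and space; for \<open>X\<close> either \<open>L\<^sup>2\<close> or \<open>H\<^sup>1\<close>, which are separable, this amounts to strong
  measurability, and the Bochner integrals below are computed pointwise in space.\<close>

definition Linf_time_le :: "('v,'e) pre_digraph \<Rightarrow> ('e \<Rightarrow> real) \<Rightarrow>
    'e netfun set \<Rightarrow> ('e netfun \<Rightarrow> real) \<Rightarrow> real \<Rightarrow> real \<Rightarrow> (real \<Rightarrow> 'e netfun) \<Rightarrow> bool" where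
  "Linf_time_le G \<l> X N T K u \<longleftrightarrow>
     (\<forall>e\<in>arcs G. (\<lambda>(t, x). u t e x) \<in> borel_measurable (pipe T \<Otimes>\<^sub>M pipe (\<l> e))) \<and>
     (AE t in pipe T. u t \<in> X \<and> N (u t) \<le> K)"

definition has_weak_time_deriv :: "('v,'e) pre_digraph \<Rightarrow> ('e \<Rightarrow> real) \<Rightarrow>
    real \<Rightarrow> (real \<Rightarrow> 'e netfun) \<Rightarrow> (real \<Rightarrow> 'e netfun) \<Rightarrow> bool" where
  "has_weak_time_deriv G \<l> T u g \<longleftrightarrow> (\<forall>\<phi>. test_function T \<phi> \<longrightarrow>
     (\<forall>e\<in>arcs G. AE x in pipe (\<l> e).
        (\<integral>t. u t e x * deriv \<phi> t \<partial>pipe T) = - (\<integral>t. g t e x * \<phi> t \<partial>pipe T)))"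

text \<open>The norm of \<open>W\<^sup>k\<^sup>,\<^sup>\<infinity>(0,T;X)\<close>, i.e. the maximum over \<open>j \<le> k\<close> of the \<open>L\<^sup>\<infinity>(0,T;X)\<close>-norms
  of the \<open>j\<close>-th weak time derivatives, is at most \<open>K\<close>.\<close>

definition Winf_time_le :: "('v,'e) pre_digraph \<Rightarrow> ('e \<Rightarrow> real) \<Rightarrow>
    'e netfun set \<Rightarrow> ('e netfun \<Rightarrow> real) \<Rightarrow> nat \<Rightarrow> real \<Rightarrow> real \<Rightarrow> (real \<Rightarrow> 'e netfun) \<Rightarrow> bool" where
  "Winf_time_le G \<l> X N k T K u \<longleftrightarrow> (\<exists>D. D 0 = u \<and>
     (\<forall>j\<le>k. Linf_time_le G \<l> X N T K (D j)) \<and>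
     (\<forall>j<k. has_weak_time_deriv G \<l> T (D j) (D (Suc j))))"

definition mass_flow :: "('e \<Rightarrow> real) \<Rightarrow> 'e netfun \<Rightarrow> 'e netfun \<Rightarrow> 'e netfun" where
  "mass_flow a \<rho> w = (\<lambda>e x. a e * \<rho> e x * w e x)"

definition enthalpy :: "(real \<Rightarrow> real) \<Rightarrow> real \<Rightarrow> 'e netfun \<Rightarrow> 'e netfun \<Rightarrow> 'e netfun" where
  "enthalpy P \<epsilon> \<rho> w = (\<lambda>e x. 1 / 2 * \<epsilon>\<^sup>2 * (w e x)\<^sup>2 + deriv P (\<rho> e x))"

text \<open>Since \<open>\<partial>\<^sub>\<tau>\<rho>\<close>, \<open>\<partial>\<^sub>\<tau>w\<close>, \<open>\<partial>\<^sub>xm\<close> and \<open>\<partial>\<^sub>x\<eta>\<close> are elements of \<open>L\<^sup>2\<close>, the differential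
  equations hold at every time and almost every point of a pipe.\<close>

definition classical_solution ::
  "('v,'e) pre_digraph \<Rightarrow> ('e \<Rightarrow> real) \<Rightarrow> (real \<Rightarrow> real) \<Rightarrow> real \<Rightarrow> ('e \<Rightarrow> real) \<Rightarrow> ('e \<Rightarrow> real) \<Rightarrow>
   real \<Rightarrow> ('v \<Rightarrow> real \<Rightarrow> real) \<Rightarrow> (real \<Rightarrow> 'e netfun) \<Rightarrow> (real \<Rightarrow> 'e netfun) \<Rightarrow> bool" where
  "classical_solution G \<l> P \<epsilon> a \<gamma> T \<eta>b \<rho> w \<longleftrightarrow>
     C0_time (H1pw G \<l>) (H1pw_norm G \<l>) T \<rho> \<and>
     C0_time (H1pw G \<l>) (H1pw_norm G \<l>) T w \<and>
     (\<forall>\<tau>\<in>{0..T}. \<forall>e\<in>arcs G. \<forall>x\<in>{0..\<l> e}. 0 < \<rho> \<tau> e x) \<and>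
     (\<exists>\<rho>' w'.
        C1_time_deriv (LpE G \<l> 2) (LpE_norm G \<l> 2) T \<rho> \<rho>' \<and>
        C1_time_deriv (LpE G \<l> 2) (LpE_norm G \<l> 2) T w w' \<and>
        (\<forall>\<tau>\<in>{0<..T}. \<forall>e\<in>arcs G. AE x in pipe (\<l> e).
           a e * \<rho>' \<tau> e x + dx \<l> (mass_flow a (\<rho> \<tau>) (w \<tau>)) e x = 0 \<and>
           \<epsilon>\<^sup>2 * w' \<tau> e x + dx \<l> (enthalpy P \<epsilon> (\<rho> \<tau>) (w \<tau>)) e x
             = - \<gamma> e * \<bar>w \<tau> e x\<bar> * w \<tau> e x)) \<and>
     (\<forall>\<tau>\<in>{0<..T}. \<forall>v\<in>inner_verts G.
        (\<Sum>e\<in>incident_arcs G v. vertex_value G \<l> (mass_flow a (\<rho> \<tau>) (w \<tau>)) e v * edge_sign G e v) = 0 \<and>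
        (\<exists>\<eta>v. \<forall>e\<in>incident_arcs G v. vertex_value G \<l> (enthalpy P \<epsilon> (\<rho> \<tau>) (w \<tau>)) e v = \<eta>v)) \<and>
     (\<forall>\<tau>\<in>{0<..T}. \<forall>v\<in>boundary_verts G. \<forall>e\<in>incident_arcs G v.
        vertex_value G \<l> (enthalpy P \<epsilon> (\<rho> \<tau>) (w \<tau>)) e v = \<eta>b v \<tau>)"

definition mesh_size :: "('e \<Rightarrow> real) \<Rightarrow> ('e \<Rightarrow> nat) \<Rightarrow> 'e \<Rightarrow> real" where
  "mesh_size \<l> M e = \<l> e / real (M e)"

definition max_mesh_size :: "('v,'e) pre_digraph \<Rightarrow> ('e \<Rightarrow> real) \<Rightarrow> ('e \<Rightarrow> nat) \<Rightarrow> real" where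
  "max_mesh_size G \<l> M = Max (mesh_size \<l> M ` arcs G)"

definition cell :: "('e \<Rightarrow> real) \<Rightarrow> ('e \<Rightarrow> nat) \<Rightarrow> 'e \<Rightarrow> nat \<Rightarrow> real set" where
  "cell \<l> M e i = {real i * mesh_size \<l> M e <..< real (Suc i) * mesh_size \<l> M e}"

text \<open>Elements of \<open>Qh\<close> are \<open>L\<^sup>2\<close>-functions, their values at the mesh points are irrelevant.
  Elements of \<open>Rh\<close> are continuous on each pipe, as they belong to \<open>Hdiv\<close>.\<close>

definition Qh :: "('v,'e) pre_digraph \<Rightarrow> ('e \<Rightarrow> real) \<Rightarrow> ('e \<Rightarrow> nat) \<Rightarrow> 'e netfun set" where
  "Qh G \<l> M = {q. \<forall>e\<in>arcs G. \<forall>i<M e. \<exists>c. \<forall>x\<in>cell \<l> M e i. q e x = c}"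

definition Rh :: "('v,'e) pre_digraph \<Rightarrow> ('e \<Rightarrow> real) \<Rightarrow> ('e \<Rightarrow> nat) \<Rightarrow> 'e netfun set" where
  "Rh G \<l> M = {r \<in> Hdiv G \<l>. \<forall>e\<in>arcs G. \<forall>i<M e. \<exists>c d. \<forall>x\<in>cell \<l> M e i. r e x = c + d * x}"

definition is_L2_projection ::
  "('v,'e) pre_digraph \<Rightarrow> ('e \<Rightarrow> real) \<Rightarrow> ('e \<Rightarrow> nat) \<Rightarrow> 'e netfun \<Rightarrow> 'e netfun \<Rightarrow> bool" where
  "is_L2_projection G \<l> M u p \<longleftrightarrow> p \<in> Qh G \<l> M \<and> (\<forall>q\<in>Qh G \<l> M. ipE G \<l> p q = ipE G \<l> u q)"

definition is_nodal_interpolation ::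
  "('v,'e) pre_digraph \<Rightarrow> ('e \<Rightarrow> real) \<Rightarrow> ('e \<Rightarrow> nat) \<Rightarrow> 'e netfun \<Rightarrow> 'e netfun \<Rightarrow> bool" where
  "is_nodal_interpolation G \<l> M u r \<longleftrightarrow> r \<in> Rh G \<l> M \<and>
     (\<forall>e\<in>arcs G. \<forall>i\<le>M e. r e (real i * mesh_size \<l> M e) = u e (real i * mesh_size \<l> M e))"

definition discrete_velocity :: "('e \<Rightarrow> real) \<Rightarrow> 'e netfun \<Rightarrow> 'e netfun \<Rightarrow> 'e netfun" where
  "discrete_velocity a \<rho> m = (\<lambda>e x. m e x / (a e * \<rho> e x))"

definition discrete_enthalpy ::
  "(real \<Rightarrow> real) \<Rightarrow> real \<Rightarrow> ('e \<Rightarrow> real) \<Rightarrow> 'e netfun \<Rightarrow> 'e netfun \<Rightarrow> 'e netfun" where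
  "discrete_enthalpy P \<epsilon> a \<rho> m =
     (\<lambda>e x. \<epsilon>\<^sup>2 * (m e x)\<^sup>2 / (2 * (a e)\<^sup>2 * (\<rho> e x)\<^sup>2) + deriv P (\<rho> e x))"

definition backward_diff :: "real \<Rightarrow> (nat \<Rightarrow> 'e netfun) \<Rightarrow> nat \<Rightarrow> 'e netfun" where
  "backward_diff dt u n = (\<lambda>e x. (u n e x - u (n - 1) e x) / dt)"

definition discrete_solution ::
  "('v,'e) pre_digraph \<Rightarrow> ('e \<Rightarrow> real) \<Rightarrow> (real \<Rightarrow> real) \<Rightarrow> real \<Rightarrow> ('e \<Rightarrow> real) \<Rightarrow> ('e \<Rightarrow> real) \<Rightarrow>
   ('v \<Rightarrow> real \<Rightarrow> real) \<Rightarrow> 'e netfun \<Rightarrow> 'e netfun \<Rightarrow> ('e \<Rightarrow> nat) \<Rightarrow> real \<Rightarrow> nat \<Rightarrow>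
   (nat \<Rightarrow> 'e netfun) \<Rightarrow> (nat \<Rightarrow> 'e netfun) \<Rightarrow> bool" where
  "discrete_solution G \<l> P \<epsilon> a \<gamma> \<eta>b \<rho>0 m0 M dt N \<rho>h mh \<longleftrightarrow>
     is_L2_projection G \<l> M \<rho>0 (\<rho>h 0) \<and>
     is_nodal_interpolation G \<l> M m0 (mh 0) \<and>
     (\<forall>n\<in>{1..N}. \<rho>h n \<in> Qh G \<l> M \<and> mh n \<in> Rh G \<l> M \<and>
        (\<forall>q\<in>Qh G \<l> M.
           ipE G \<l> (\<lambda>e x. a e * backward_diff dt \<rho>h n e x) q + ipE G \<l> (dx \<l> (mh n)) q = 0) \<and>
        (let wh = (\<lambda>k. discrete_velocity a (\<rho>h k) (mh k));
             \<eta>h = discrete_enthalpy P \<epsilon> a (\<rho>h n) (mh n)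
         in \<forall>r\<in>Rh G \<l> M.
           ipE G \<l> (\<lambda>e x. \<epsilon>\<^sup>2 * backward_diff dt wh n e x) r - ipE G \<l> \<eta>h (dx \<l> r)
             + ipE G \<l> (\<lambda>e x. \<gamma> e * \<bar>wh n e x\<bar> * wh n e x) r
           = - (\<Sum>v\<in>boundary_verts G. \<Sum>e\<in>incident_arcs G v.
                  \<eta>b v (real n * dt) * vertex_value G \<l> r e v * edge_sign G e v)))"

definition admissible_state :: "('v,'e) pre_digraph \<Rightarrow> ('e \<Rightarrow> real) \<Rightarrow> ('e \<Rightarrow> real) \<Rightarrow>
   real \<Rightarrow> real \<Rightarrow> real \<Rightarrow> nat \<Rightarrow> (nat \<Rightarrow> 'e netfun) \<Rightarrow> (nat \<Rightarrow> 'e netfun) \<Rightarrow> bool" where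
  "admissible_state G \<l> a \<rho>lo \<rho>hi wbar N \<rho>h mh \<longleftrightarrow>
     (\<forall>n\<le>N. \<forall>e\<in>arcs G. AE x in pipe (\<l> e).
        2 * \<rho>lo / 3 \<le> \<rho>h n e x \<and> \<rho>h n e x \<le> 3 * \<rho>hi / 2 \<and>
        \<bar>discrete_velocity a (\<rho>h n) (mh n) e x\<bar> \<le> 3 * wbar / 2)"

end

theory Submission
  imports Defs
begin

text \<open>The error is measured by the relative energy of the discrete state \<open>(\<rho>\<^sub>h, w\<^sub>h)\<close> with respect to
  the exact state \<open>(\<rho>, w)\<close> at the same time, that is, by the energy \<open>\<epsilon>\<^sup>2 \<rho> w\<^sup>2 / 2 + P(\<rho>)\<close> minus its first
  order Taylor polynomial. The subsonic condition \<open>\<rho> P''(\<rho>) \<ge> 4 \<epsilon>\<^sup>2 w\<^sup>2\<close> makes this energy uniformly convex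
  in the norm \<open>(\<delta>\<rho>)\<^sup>2 + \<epsilon>\<^sup>2 (\<delta>w)\<^sup>2\<close>, so the implicit Euler step decreases the relative energy up to
  consistency terms. Testing the difference of the momentum balances with \<open>m\<^sub>h - I\<^sub>h m\<close>, whose derivative is
  determined by the mass balances, cancels the pressure terms; the friction term controls, by
  the strong monotonicity of \<open>w \<mapsto> |w| w\<close>, \<open>|m - m\<^sub>h|\<^sup>3\<close> and the remaining residuals are of order \<open>\<Delta>\<tau>\<close> or
  \<open>h\<close> in \<open>L\<^sup>2\<close>. A discrete Gronwall argument finishes the proof. Since no constant is divided by \<open>\<epsilon>\<close>,
  the estimate is uniform in \<open>\<epsilon>\<close>.\<close>

section \<open>Square-integrable functions on an interval\<close>

text \<open>The difficulty is that both arguments of the relative energy move during a time step.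
  The increment is routed through an intermediate state: the old discrete state translated by the
  exact increment. From there to the new discrete state, convexity yields the implicit Euler
  inequality. Along the translation the error vector is constant, so only the change of base point
  matters, which costs \<open>dt\<close> times the squared error. This needs exact increments of
  size \<open>dt\<close> that are bounded pointwise, available because H1 functions on a pipe are
  bounded by their norm, and convexity slightly outside the admissible set, since the translated
  state may leave it; the margin \<open>\<kappa>\<close> provides the latter. Second time
  derivatives are controlled in L2 only, so the residuals are compared in L2, at every time level,
  although the regularity bounds hold only for almost every time. The constants are to be chosen
  before \<open>\<epsilon>\<close>, the coefficients, the solution and the mesh; hence they are
  explicit functions of the graph and of the given bounds.\<close>

lemma space_pipe [simp]: "space (pipe l) = {0<..<l}"
  by (simp add: pipe_def space_restrict_space)

lemma measurable_pipe_cong: "measurable (pipe l) M = measurable (restrict_space borel {0<..<l}) M"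
  by (rule measurable_cong_sets) (simp_all add: pipe_def sets_restrict_space)

lemma borel_measurable_pipe: "f \<in> borel_measurable borel \<Longrightarrow> f \<in> borel_measurable (pipe l)"
  by (simp add: measurable_pipe_cong measurable_restrict_space1)

lemma borel_measurable_pipe_continuous_on:
  fixes f :: "real \<Rightarrow> real"
  assumes "continuous_on {0..l} f" shows "f \<in> borel_measurable (pipe l)"
  unfolding measurable_pipe_cong
  by (rule borel_measurable_continuous_on_restrict) (rule continuous_on_subset[OF assms], auto)

lemma interval_sets_pipe [measurable]: "{x<..<y} \<inter> {0<..<l} \<in> sets (pipe l)"
  by (auto simp: pipe_def sets_restrict_space)

lemma interval_sets_pipe' [simp]: "0 \<le> x \<Longrightarrow> y \<le> l \<Longrightarrow> {x<..<y} \<in> sets (pipe l)"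
  using interval_sets_pipe[of x y l] by (simp add: Int_absorb2 greaterThanLessThan_subseteq_greaterThanLessThan)

lemma indicator_measurable_pipe [measurable, simp]:
  "(indicator {x<..<y} :: real \<Rightarrow> real) \<in> borel_measurable (pipe l)"
  by (rule borel_measurable_pipe) simp

lemma integrable_indicator_pipe:
  fixes g :: "real \<Rightarrow> real"
  assumes "integrable (pipe l) g"
  shows "integrable (pipe l) (\<lambda>t. indicator {x<..<y} t * g t)"
proof (rule Bochner_Integration.integrable_bound[OF assms])
  show "(\<lambda>t. indicator {x<..<y} t * g t) \<in> borel_measurable (pipe l)"
    using borel_measurable_integrable[OF assms] by (intro borel_measurable_times) simp_all
qed (auto simp: indicator_def)

lemma emeasure_pipe: "0 \<le> x \<Longrightarrow> x \<le> y \<Longrightarrow> y \<le> l \<Longrightarrow> emeasure (pipe l) {x<..<y} = ennreal (y - x)"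
  unfolding pipe_def by (subst emeasure_restrict_space) auto

lemma measure_pipe: "0 \<le> x \<Longrightarrow> x \<le> y \<Longrightarrow> y \<le> l \<Longrightarrow> measure (pipe l) {x<..<y} = y - x"
  by (simp add: measure_def emeasure_pipe)

lemma finite_measure_pipe: "finite_measure (pipe l)"
proof
  show "emeasure (pipe l) (space (pipe l)) \<noteq> \<infinity>"
    unfolding space_pipe unfolding pipe_def
    by (cases "0 \<le> l") (auto simp: emeasure_restrict_space)
qed

interpretation pipe: finite_measure "pipe l" by (rule finite_measure_pipe)

lemma AE_pipe_I: "AE x in lborel. P x \<Longrightarrow> AE x in pipe l. P x"
  unfolding pipe_def by (subst AE_restrict_space_iff) auto

lemma AE_pipe_finite: "finite F \<Longrightarrow> AE x in pipe l. x \<notin> F"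
  by (rule AE_pipe_I, rule AE_not_in)
    (auto simp: null_sets_def emeasure_lborel_countable countable_finite borel_closed finite_imp_closed)

section \<open>The space L2 on a pipe and the Cauchy-Schwarz inequality\<close>

lemma Lp2_iff: "u \<in> Lp 2 l \<longleftrightarrow> u \<in> borel_measurable (pipe l) \<and> integrable (pipe l) (\<lambda>x. (u x)\<^sup>2)"
  by (simp add: Lp_def)

text \<open>Evaluation at the vertex \<open>t = b / c\<close> gives the claim once \<open>c\<close>
  is positive. The sign of \<open>c\<close> has to be derived: a quadratic with negative leading
  coefficient is negative for large \<open>t\<close>, and a nonconstant linear function takes
  negative values.\<close>

lemma quadratic_discriminant:
  fixes a b c :: real
  assumes "\<And>t. 0 \<le> a - 2 * t * b + t\<^sup>2 * c"
  shows "b\<^sup>2 \<le> a * c"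
proof (cases "c = 0")
  case True
  have "b = 0"
  proof (rule ccontr)
    assume "b \<noteq> 0"
    then show False using assms[of "(a + 1) / (2 * b)"] True by simp
  qed
  then show ?thesis using True by simp
next
  case False
  have "0 \<le> c"
  proof (rule ccontr)
    assume "\<not> 0 \<le> c"
    then have c: "c < 0" by simp
    \<comment> \<open>Large enough for the quadratic term to outweigh both lower-order terms;
      \<open>1 \<le> s\<close> allows the constant term to be bounded by
      \<open>\<bar>a\<bar> * s\<close>.\<close>
    define s where "s = max 1 (((\<bar>a\<bar> + 2 * \<bar>b\<bar>)) / (-c) + 1)"
    have s1: "1 \<le> s" by (simp add: s_def)
    have "(\<bar>a\<bar> + 2 * \<bar>b\<bar>) / (-c) < s" by (simp add: s_def)
    then have "\<bar>a\<bar> + 2 * \<bar>b\<bar> < - c * s" using c by (simp add: field_simps)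
    then have "(\<bar>a\<bar> + 2 * \<bar>b\<bar>) * s < - c * s * s" using s1 by (intro mult_strict_right_mono) auto
    moreover have "a \<le> \<bar>a\<bar> * s" "- 2 * s * b \<le> 2 * \<bar>b\<bar> * s"
      using s1 mult_left_mono[of 1 s "\<bar>a\<bar>"] mult_right_mono[of "-b" "\<bar>b\<bar>" "2 * s"] by auto
    ultimately have "a - 2 * s * b + s\<^sup>2 * c < 0" by (simp add: algebra_simps power2_eq_square)
    then show False using assms[of s] by simp
  qed
  with False have "0 < c" by simp
  then show ?thesis using assms[of "b / c"] by (simp add: field_simps power2_eq_square)
qed

lemma integrable_mult_square:
  fixes u v :: "'a \<Rightarrow> real"
  assumes [measurable]: "u \<in> borel_measurable M" "v \<in> borel_measurable M"
    and "integrable M (\<lambda>x. (u x)\<^sup>2)" "integrable M (\<lambda>x. (v x)\<^sup>2)"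
  shows "integrable M (\<lambda>x. u x * v x)"
proof (rule Bochner_Integration.integrable_bound)
  show "integrable M (\<lambda>x. (u x)\<^sup>2 + (v x)\<^sup>2)" using assms by simp
  show "AE x in M. norm (u x * v x) \<le> norm ((u x)\<^sup>2 + (v x)\<^sup>2)"
  proof (rule AE_I2)
    fix x
    have "2 * \<bar>u x\<bar> * \<bar>v x\<bar> \<le> (u x)\<^sup>2 + (v x)\<^sup>2" using sum_squares_bound[of "\<bar>u x\<bar>" "\<bar>v x\<bar>"] by simp
    moreover have "0 \<le> \<bar>u x\<bar> * \<bar>v x\<bar>" by simp
    ultimately have "\<bar>u x\<bar> * \<bar>v x\<bar> \<le> (u x)\<^sup>2 + (v x)\<^sup>2" by linarith
    then show "norm (u x * v x) \<le> norm ((u x)\<^sup>2 + (v x)\<^sup>2)" by (simp add: abs_mult)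
  qed
qed simp

text \<open>Discriminant of the nonnegative quadratic that maps \<open>t\<close> to the integral of
  \<open>(u - t * v)\<^sup>2\<close>.\<close>

lemma integral_Cauchy_Schwarz:
  fixes u v :: "'a \<Rightarrow> real"
  assumes "u \<in> borel_measurable M" "v \<in> borel_measurable M"
    and "integrable M (\<lambda>x. (u x)\<^sup>2)" "integrable M (\<lambda>x. (v x)\<^sup>2)"
  shows "(\<integral>x. u x * v x \<partial>M)\<^sup>2 \<le> (\<integral>x. (u x)\<^sup>2 \<partial>M) * (\<integral>x. (v x)\<^sup>2 \<partial>M)"
proof (rule quadratic_discriminant)
  fix t :: real
  note i = integrable_mult_square[OF assms]
  have "0 \<le> (\<integral>x. (u x - t * v x)\<^sup>2 \<partial>M)" by simp
  also have "\<dots> = (\<integral>x. (u x)\<^sup>2 - 2 * t * (u x * v x) + t\<^sup>2 * (v x)\<^sup>2 \<partial>M)"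
    by (rule Bochner_Integration.integral_cong) (auto simp: power2_eq_square algebra_simps)
  also have "\<dots> = (\<integral>x. (u x)\<^sup>2 \<partial>M) - 2 * t * (\<integral>x. u x * v x \<partial>M) + t\<^sup>2 * (\<integral>x. (v x)\<^sup>2 \<partial>M)"
    using i assms by simp
  finally show "0 \<le> \<dots>" .
qed

lemma Lp2_mult: "u \<in> Lp 2 l \<Longrightarrow> v \<in> Lp 2 l \<Longrightarrow> integrable (pipe l) (\<lambda>x. u x * v x)"
  by (auto simp: Lp2_iff intro: integrable_mult_square)

lemma Lp2_square: "u \<in> Lp 2 l \<Longrightarrow> integrable (pipe l) (\<lambda>x. (u x)\<^sup>2)"
  by (simp add: Lp2_iff)

lemma Lp2_measurable: "u \<in> Lp 2 l \<Longrightarrow> u \<in> borel_measurable (pipe l)"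
  by (simp add: Lp2_iff)

lemma Lp2_bounded_mult:
  assumes "u \<in> borel_measurable (pipe l)" "AE x in pipe l. \<bar>u x\<bar> \<le> B" "v \<in> Lp 2 l"
  shows "(\<lambda>x. u x * v x) \<in> Lp 2 l"
  unfolding Lp2_iff
proof
  show m: "(\<lambda>x. u x * v x) \<in> borel_measurable (pipe l)"
    using assms Lp2_measurable by (intro borel_measurable_times) auto
  show "integrable (pipe l) (\<lambda>x. (u x * v x)\<^sup>2)"
  proof (rule Bochner_Integration.integrable_bound[of _ "\<lambda>x. B\<^sup>2 * (v x)\<^sup>2"])
    show "AE x in pipe l. norm ((u x * v x)\<^sup>2) \<le> norm (B\<^sup>2 * (v x)\<^sup>2)"
      using assms(2)
    proof (eventually_elim)
      fix x assume "\<bar>u x\<bar> \<le> B"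
      then have "(u x)\<^sup>2 \<le> B\<^sup>2" by (simp add: abs_le_square_iff[symmetric])
      then show "norm ((u x * v x)\<^sup>2) \<le> norm (B\<^sup>2 * (v x)\<^sup>2)"
        by (simp add: power_mult_distrib mult_right_mono)
    qed
  qed (use assms m in \<open>auto intro: Lp2_square borel_measurable_power\<close>)
qed

lemma Lp2_const [simp]: "(\<lambda>x. c) \<in> Lp 2 l"
  by (simp add: Lp2_iff)

lemma Lp2_bounded:
  assumes "u \<in> borel_measurable (pipe l)" "AE x in pipe l. \<bar>u x\<bar> \<le> B" shows "u \<in> Lp 2 l"
  using Lp2_bounded_mult[OF assms Lp2_const[of 1]] by simp

lemma Lp2_integrable: "u \<in> Lp 2 l \<Longrightarrow> integrable (pipe l) u"
  using Lp2_mult[OF _ Lp2_const[of 1]] by simp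

lemma Lp2_add: "u \<in> Lp 2 l \<Longrightarrow> v \<in> Lp 2 l \<Longrightarrow> (\<lambda>x. u x + v x) \<in> Lp 2 l"
  using Lp2_mult[of u l v] unfolding Lp2_iff power2_sum by (auto simp: mult.assoc)

lemma Lp2_cmult: "u \<in> Lp 2 l \<Longrightarrow> (\<lambda>x. c * u x) \<in> Lp 2 l"
  by (rule Lp2_bounded_mult[of _ _ "\<bar>c\<bar>"]) auto

lemma Lp2_divide: "u \<in> Lp 2 l \<Longrightarrow> (\<lambda>x. u x / c) \<in> Lp 2 l"
  using Lp2_cmult[of u l "1/c"] by simp

lemma Lp2_uminus: "u \<in> Lp 2 l \<Longrightarrow> (\<lambda>x. - u x) \<in> Lp 2 l"
  using Lp2_cmult[of u l "-1"] by simp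

lemma Lp2_diff: "u \<in> Lp 2 l \<Longrightarrow> v \<in> Lp 2 l \<Longrightarrow> (\<lambda>x. u x - v x) \<in> Lp 2 l"
  using Lp2_add[OF _ Lp2_uminus, of u l v] by simp

lemma Lp2_continuous: "continuous_on {0..l} u \<Longrightarrow> u \<in> Lp 2 l"
proof -
  assume c: "continuous_on {0..l} u"
  have "bounded (u ` {0..l})" using c compact_Icc compact_continuous_image compact_imp_bounded by blast
  then obtain B where "\<forall>x\<in>{0..l}. \<bar>u x\<bar> \<le> B" by (auto simp: bounded_iff)
  then show ?thesis
    by (intro Lp2_bounded[of _ _ B] borel_measurable_pipe_continuous_on c AE_I2) auto
qed

lemma Lp2_Cauchy_Schwarz:
  "u \<in> Lp 2 l \<Longrightarrow> v \<in> Lp 2 l \<Longrightarrow>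
    (\<integral>x. u x * v x \<partial>pipe l)\<^sup>2 \<le> (\<integral>x. (u x)\<^sup>2 \<partial>pipe l) * (\<integral>x. (v x)\<^sup>2 \<partial>pipe l)"
  by (rule integral_Cauchy_Schwarz) (auto simp: Lp2_iff)

section \<open>Integrals over subintervals of a pipe\<close>

lemma set_integrable_pipe:
  fixes g :: "real \<Rightarrow> real"
  assumes "integrable (pipe l) g" "A \<in> sets (pipe l)" shows "set_integrable (pipe l) A g"
  unfolding set_integrable_def using integrable_mult_indicator[OF assms(2,1)] .

lemma set_integral_split:
  fixes g :: "real \<Rightarrow> real"
  assumes "integrable (pipe l) g" "0 \<le> x" "x \<le> y" "y \<le> z" "z \<le> l"
  shows "(LINT t:{x<..<z}|pipe l. g t) = (LINT t:{x<..<y}|pipe l. g t) + (LINT t:{y<..<z}|pipe l. g t)"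
proof -
  have 1: "(LINT t:{x<..<y}|pipe l. g t) + (LINT t:{y<..<z}|pipe l. g t)
      = (LINT t:{x<..<y} \<union> {y<..<z}|pipe l. g t)"
    using assms by (subst set_integral_Un) (auto intro!: set_integrable_pipe)
  have "AE t in pipe l. t \<notin> {y}" by (rule AE_pipe_finite) simp
  then have "AE t in pipe l. (t \<in> {x<..<z}) = (t \<in> {x<..<y} \<union> {y<..<z})"
    by (rule eventually_mono) (use assms in auto)
  then have "(LINT t:{x<..<z}|pipe l. g t) = (LINT t:{x<..<y} \<union> {y<..<z}|pipe l. g t)"
    using assms set_integrable_pipe[OF assms(1), of "{x<..<y} \<union> {y<..<z}"] sets.Un[of "{x<..<y}" "pipe l" "{y<..<z}"]
    by (intro set_integral_cong_set)
      (auto simp: set_borel_measurable_def set_integrable_def integrable_indicator_pipe intro: borel_measurable_integrable)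
  with 1 show ?thesis by simp
qed

lemma set_integral_whole_pipe: "(LINT t:{0<..<l}|pipe l. g t) = (\<integral>t. g t \<partial>pipe l)" for g :: "real \<Rightarrow> real"
  unfolding set_lebesgue_integral_def by (rule Bochner_Integration.integral_cong) auto

lemma set_integral_const_pipe:
  "0 \<le> x \<Longrightarrow> x \<le> y \<Longrightarrow> y \<le> l \<Longrightarrow> (LINT t:{x<..<y}|pipe l. (c::real)) = (y - x) * c"
  by (subst set_integral_const) (auto simp: measure_pipe emeasure_pipe)

text \<open>Cauchy-Schwarz against the indicator of the interval. The factor \<open>y - x\<close> is
  the source of Hoelder continuity of H1 functions and of one power of the mesh size in the
  approximation estimates.\<close>

lemma set_integral_square_bound:
  assumes g: "g \<in> Lp 2 l" and xy: "0 \<le> x" "x \<le> y" "y \<le> l"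
  shows "(LINT t:{x<..<y}|pipe l. \<bar>g t\<bar>)\<^sup>2 \<le> (y - x) * (LINT t:{x<..<y}|pipe l. (g t)\<^sup>2)"
proof -
  define i where "i = (indicator {x<..<y} :: real \<Rightarrow> real)"
  have [measurable]: "i \<in> borel_measurable (pipe l)" "g \<in> borel_measurable (pipe l)"
    using xy Lp2_measurable[OF g] by (simp_all add: i_def)
  have i: "i \<in> Lp 2 l" by (rule Lp2_bounded[of _ _ 1]) (simp, auto simp: i_def indicator_def)
  have ig: "(\<lambda>t. i t * \<bar>g t\<bar>) \<in> Lp 2 l"
    by (rule Lp2_bounded_mult[of _ _ 1]) (simp, use g in \<open>auto simp: i_def indicator_def Lp2_iff\<close>)
  have ii: "i t * i t = i t" for t by (auto simp: i_def indicator_def)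
  have "(LINT t:{x<..<y}|pipe l. \<bar>g t\<bar>)\<^sup>2 = (\<integral>t. i t * (i t * \<bar>g t\<bar>) \<partial>pipe l)\<^sup>2"
    unfolding set_lebesgue_integral_def i_def[symmetric] by (simp add: mult.assoc[symmetric] ii)
  also have "\<dots> \<le> (\<integral>t. (i t)\<^sup>2 \<partial>pipe l) * (\<integral>t. (i t * \<bar>g t\<bar>)\<^sup>2 \<partial>pipe l)"
    by (rule Lp2_Cauchy_Schwarz[OF i ig])
  also have "(\<integral>t. (i t)\<^sup>2 \<partial>pipe l) = (LINT t:{x<..<y}|pipe l. 1)"
    unfolding set_lebesgue_integral_def i_def[symmetric] by (simp add: power2_eq_square ii)
  also have "\<dots> = y - x" using set_integral_const_pipe[OF xy, of 1] by simp
  also have "(\<integral>t. (i t * \<bar>g t\<bar>)\<^sup>2 \<partial>pipe l) = (LINT t:{x<..<y}|pipe l. (g t)\<^sup>2)"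
    unfolding set_lebesgue_integral_def i_def[symmetric]
    by (simp add: power_mult_distrib) (simp add: power2_eq_square ii)
  finally show ?thesis .
qed

lemma set_integral_abs_bound:
  fixes g :: "real \<Rightarrow> real"
  assumes "integrable (pipe l) g" "0 \<le> x" "y \<le> l"
  shows "\<bar>LINT t:{x<..<y}|pipe l. g t\<bar> \<le> (LINT t:{x<..<y}|pipe l. \<bar>g t\<bar>)"
  using set_integral_norm_bound[OF set_integrable_pipe[OF assms(1), of "{x<..<y}"]] assms by simp

lemma set_integral_mono_pipe:
  fixes f g :: "real \<Rightarrow> real"
  assumes "integrable (pipe l) f" "integrable (pipe l) g" "0 \<le> x" "y \<le> l"
    "AE t in pipe l. t \<in> {x<..<y} \<longrightarrow> f t \<le> g t"
  shows "(LINT t:{x<..<y}|pipe l. f t) \<le> (LINT t:{x<..<y}|pipe l. g t)"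
  unfolding set_lebesgue_integral_def
proof (rule integral_mono_AE)
  show "AE t in pipe l. indicator {x<..<y} t *\<^sub>R f t \<le> indicator {x<..<y} t *\<^sub>R g t"
    using assms(5) by (rule eventually_mono) (auto simp: indicator_def)
qed (use assms in \<open>simp_all add: integrable_indicator_pipe\<close>)

lemma set_integral_pipe_lborel:
  fixes g :: "real \<Rightarrow> real"
  assumes "0 \<le> x" "y \<le> l"
  shows "(LINT t:{x<..<y}|pipe l. g t) = (LINT t:{x<..<y}|lborel. g t)"
proof -
  have *: "indicator {0<..<l} t * (indicator {x<..<y} t * g t) = indicator {x<..<y} t * g t" for t
    using assms by (auto simp: indicator_def)
  show ?thesis
    unfolding set_lebesgue_integral_def unfolding pipe_def
    by (subst integral_restrict_space) (simp_all add: *)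
qed

lemma set_integral_Icc_Ioo:
  fixes g :: "real \<Rightarrow> real"
  assumes "g \<in> borel_measurable borel"
  shows "(LINT t:{x..y}|lborel. g t) = (LINT t:{x<..<y}|lborel. g t)"
proof (rule set_integral_cong_set)
  have "AE t in lborel. t \<notin> {x, y}"
    by (rule AE_not_in) (auto simp: null_sets_def emeasure_lborel_countable)
  then show "AE t in lborel. (t \<in> {x<..<y}) = (t \<in> {x..y})"
    by (rule eventually_mono) auto
qed (use assms in \<open>auto simp: set_borel_measurable_def\<close>)

lemma FTC_pipe:
  fixes f F :: "real \<Rightarrow> real"
  assumes xy: "0 \<le> x" "x \<le> y" "y \<le> l"
    and F: "\<And>t. x \<le> t \<Longrightarrow> t \<le> y \<Longrightarrow> (F has_real_derivative f t) (at t within {x..y})"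
    and f: "continuous_on {x..y} f"
  shows "(LINT t:{x<..<y}|pipe l. f t) = F y - F x"
proof -
  \<comment> \<open>Extension by zero makes the integrand Borel measurable on the whole line; only
    the values on \<open>{x..y}\<close> matter.\<close>
  define g where "g t = indicator {x..y} t * f t" for t
  have g: "g \<in> borel_measurable borel"
    using borel_measurable_continuous_on_indicator[OF _ f] by (simp add: g_def[abs_def])
  have "(LINT t:{x<..<y}|pipe l. f t) = (LINT t:{x<..<y}|lborel. g t)"
    using xy by (subst set_integral_pipe_lborel)
      (auto intro!: set_lebesgue_integral_cong simp: g_def)
  also have "\<dots> = (LINT t:{x..y}|lborel. g t)" using set_integral_Icc_Ioo[OF g] by simp
  also have "\<dots> = (\<integral>t. indicator {x..y} t *\<^sub>R f t \<partial>lborel)"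
    unfolding set_lebesgue_integral_def by (rule Bochner_Integration.integral_cong) (auto simp: g_def indicator_def)
  also have "\<dots> = F y - F x"
    using F by (intro integral_FTC_Icc[OF xy(2) _ f]) (simp add: has_real_derivative_iff_has_vector_derivative)
  finally show ?thesis .
qed

text \<open>Open intervals form an intersection-stable generator of the Borel sets, and the Borel
  sets over which \<open>f\<close> integrates to 0 are closed under complements and countable
  disjoint unions. Hence the integral of \<open>f\<close> over every measurable set vanishes, which
  forces \<open>f\<close> to vanish almost everywhere.\<close>

lemma AE_eq_0_if_interval_integrals_0:
  fixes f :: "real \<Rightarrow> real"
  assumes f: "integrable (pipe l) f" and l: "0 \<le> l"
    and 0: "\<And>x y. 0 \<le> x \<Longrightarrow> x \<le> y \<Longrightarrow> y \<le> l \<Longrightarrow> (LINT t:{x<..<y}|pipe l. f t) = 0"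
  shows "AE t in pipe l. f t = 0"
proof (rule density_unique_real[OF f])
  fix A assume "A \<in> sets (pipe l)"
  then obtain B where B: "B \<in> sets borel" "A = B \<inter> {0<..<l}"
    by (auto simp: pipe_def sets_restrict_space)
  have total: "(\<integral>t. f t \<partial>pipe l) = 0" using 0[of 0 l] l by (simp add: set_integral_whole_pipe)
  have int: "integrable (pipe l) (\<lambda>t. indicator B t * f t)" if "B \<in> sets borel" for B
  proof (rule Bochner_Integration.integrable_bound[OF f])
    show "(\<lambda>t. indicator B t * f t) \<in> borel_measurable (pipe l)"
      using borel_measurable_integrable[OF f] that
      by (intro borel_measurable_times) (auto intro!: borel_measurable_pipe)
  qed (auto simp: indicator_def)
  have "Int_stable (range (\<lambda>(a, b). box a (b::real)))"
    by (auto simp: Int_stable_def box_Int_box)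
  moreover have "range (\<lambda>(a, b). box a (b::real)) \<subseteq> Pow UNIV" by auto
  moreover have "B \<in> sigma_sets UNIV (range (\<lambda>(a, b). box a (b::real)))"
    using B(1) unfolding borel_eq_box by (subst (asm) sets_measure_of) (auto simp del: box_real)
  ultimately have "(\<integral>t. indicator B t * f t \<partial>pipe l) = 0"
  proof (induction rule: sigma_sets_induct_disjoint)
    case (basic A)
    then obtain a b where A: "A = {a<..<b}" by auto
    \<comment> \<open>The box is clipped to \<open>[0,l]\<close>; the outer \<open>max x\<close>
      keeps the end points ordered when the box is empty or misses the pipe.\<close>
    define x y where "x = max 0 (min a l)" and "y = max x (min b l)"
    have "(\<integral>t. indicator A t * f t \<partial>pipe l) = (LINT t:{x<..<y}|pipe l. f t)"
      unfolding set_lebesgue_integral_def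
      by (rule Bochner_Integration.integral_cong) (auto simp: A x_def y_def indicator_def)
    also have "\<dots> = 0" by (rule 0) (use l in \<open>auto simp: x_def y_def\<close>)
    finally show ?case .
  next
    case empty then show ?case by simp
  next
    case (compl A)
    then have A: "A \<in> sets borel" by (simp add: borel_eq_box)
    have "(\<integral>t. indicator (UNIV - A) t * f t \<partial>pipe l) = (\<integral>t. f t - indicator A t * f t \<partial>pipe l)"
      by (rule Bochner_Integration.integral_cong) (auto simp: indicator_def)
    also have "\<dots> = 0" using compl total f int[OF A] by simp
    finally show ?case .
  next
    case (union A)
    then have A: "A i \<in> sets borel" for i by (auto simp: borel_eq_box)
    have eq: "indicator (A i \<inter> {0<..<l}) t *\<^sub>R f t = indicator (A i) t * f t" if "t \<in> space (pipe l)" for i t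
      using that by (auto simp: indicator_def)
    have "(LINT t:(\<Union>i. A i \<inter> {0<..<l})|pipe l. f t) = (\<Sum>i. (LINT t:(A i \<inter> {0<..<l})|pipe l. f t))"
    proof (rule lebesgue_integral_countable_add)
      show "A i \<inter> {0<..<l} \<in> sets (pipe l)" for i
        using A[of i] by (auto simp: pipe_def sets_restrict_space)
      then have "(\<Union>i. A i \<inter> {0<..<l}) \<in> sets (pipe l)" by (rule sets.countable_UN[OF image_subsetI])
      then show "set_integrable (pipe l) (\<Union>i. A i \<inter> {0<..<l}) f" by (rule set_integrable_pipe[OF f])
    qed (use union in \<open>auto simp: disjoint_family_on_def\<close>)
    also have "\<dots> = (\<Sum>i. 0)"
      unfolding set_lebesgue_integral_def
      using union by (subst Bochner_Integration.integral_cong[OF refl eq]) simp_all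
    finally have "(LINT t:(\<Union>i. A i \<inter> {0<..<l})|pipe l. f t) = 0" by simp
    moreover have "(LINT t:(\<Union>i. A i \<inter> {0<..<l})|pipe l. f t) = (\<integral>t. indicator (\<Union>i. A i) t * f t \<partial>pipe l)"
      unfolding set_lebesgue_integral_def
      by (rule Bochner_Integration.integral_cong) (auto simp: indicator_def)
    ultimately show ?case by simp
  qed
  also have "(\<integral>t. indicator B t * f t \<partial>pipe l) = (LINT t:A|pipe l. f t)"
    unfolding set_lebesgue_integral_def B(2)
    by (rule Bochner_Integration.integral_cong) (auto simp: indicator_def)
  finally show "(LINT t:A|pipe l. f t) = (LINT t:A|pipe l. 0)" by simp
qed simp

section \<open>Absolutely continuous functions with square-integrable derivative\<close>

text \<open>The integral form of H1: absolute continuity with an explicit square-integrable density.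
  It determines \<open>u\<close> pointwise on \<open>[0,l]\<close> up to a constant, so traces make
  sense and no test functions enter the calculus. Its agreement with the weak derivative for
  continuous functions is \<open>has_weak_deriv_imp_has_L2_deriv\<close> below.\<close>

definition has_L2_deriv :: "real \<Rightarrow> (real \<Rightarrow> real) \<Rightarrow> (real \<Rightarrow> real) \<Rightarrow> bool" where
  "has_L2_deriv l u g \<longleftrightarrow> g \<in> Lp 2 l \<and>
     (\<forall>x y. 0 \<le> x \<longrightarrow> x \<le> y \<longrightarrow> y \<le> l \<longrightarrow> u y - u x = (LINT t:{x<..<y}|pipe l. g t))"

lemma has_L2_derivD:
  "has_L2_deriv l u g \<Longrightarrow> 0 \<le> x \<Longrightarrow> x \<le> y \<Longrightarrow> y \<le> l \<Longrightarrow> u y - u x = (LINT t:{x<..<y}|pipe l. g t)"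
  "has_L2_deriv l u g \<Longrightarrow> g \<in> Lp 2 l"
  by (auto simp: has_L2_deriv_def)

lemma increment_le_integral_abs:
  assumes "has_L2_deriv l u g" "0 \<le> x" "x \<le> y" "y \<le> l"
  shows "\<bar>u y - u x\<bar> \<le> (LINT t:{x<..<y}|pipe l. \<bar>g t\<bar>)"
  using has_L2_derivD[OF assms(1)] assms
  by (simp add: set_integral_abs_bound Lp2_integrable)

lemma abs_integral_mono_interval:
  fixes g :: "real \<Rightarrow> real"
  assumes g: "integrable (pipe l) g" and "{x<..<y} \<subseteq> {x'<..<y'}"
  shows "(LINT t:{x<..<y}|pipe l. \<bar>g t\<bar>) \<le> (LINT t:{x'<..<y'}|pipe l. \<bar>g t\<bar>)"
  unfolding set_lebesgue_integral_def
proof (rule integral_mono)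
  show "indicator {x<..<y} t *\<^sub>R \<bar>g t\<bar> \<le> indicator {x'<..<y'} t *\<^sub>R \<bar>g t\<bar>" for t
    using assms(2) by (auto simp: indicator_def)
qed (use g in \<open>simp_all add: integrable_indicator_pipe\<close>)

lemma increment_square_bound:
  assumes u: "has_L2_deriv l u g" and xy: "0 \<le> x" "x \<le> y" "y \<le> l"
  shows "(u y - u x)\<^sup>2 \<le> (y - x) * (LINT t:{x<..<y}|pipe l. (g t)\<^sup>2)"
proof -
  have "(u y - u x)\<^sup>2 \<le> (LINT t:{x<..<y}|pipe l. \<bar>g t\<bar>)\<^sup>2"
    using increment_le_integral_abs[OF assms] power_mono[of "\<bar>u y - u x\<bar>" _ 2] by simp
  also have "\<dots> \<le> (y - x) * (LINT t:{x<..<y}|pipe l. (g t)\<^sup>2)"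
    by (rule set_integral_square_bound[OF has_L2_derivD(2)[OF u] xy])
  finally show ?thesis .
qed

lemma set_integral_square_le:
  assumes "g \<in> Lp 2 l"
  shows "(LINT t:{x<..<y}|pipe l. (g t)\<^sup>2) \<le> (\<integral>t. (g t)\<^sup>2 \<partial>pipe l)"
  unfolding set_lebesgue_integral_def
  using Lp2_square[OF assms] integrable_indicator_pipe[OF Lp2_square[OF assms], of x y]
  by (intro integral_mono) (auto simp: indicator_def)

lemma has_L2_deriv_imp_continuous_on:
  assumes u: "has_L2_deriv l u g"
  shows "continuous_on {0..l} u"
proof -
  define K where "K = (\<integral>t. (g t)\<^sup>2 \<partial>pipe l)"
  have K: "0 \<le> K" by (simp add: K_def)
  have le: "(u y - u x)\<^sup>2 \<le> \<bar>y - x\<bar> * K" if "x \<in> {0..l}" "y \<in> {0..l}" for x y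
  proof -
    have *: "(u y - u x)\<^sup>2 \<le> \<bar>y - x\<bar> * K" if "0 \<le> x" "x \<le> y" "y \<le> l" for x y
    proof -
      have "(u y - u x)\<^sup>2 \<le> (y - x) * (LINT t:{x<..<y}|pipe l. (g t)\<^sup>2)"
        by (rule increment_square_bound[OF u that])
      also have "\<dots> \<le> (y - x) * K"
        unfolding K_def using that has_L2_derivD(2)[OF u]
        by (intro mult_left_mono set_integral_square_le) auto
      finally show ?thesis using that by simp
    qed
    show ?thesis using *[of x y] *[of y x] that
      by (cases "x \<le> y") (auto simp: abs_minus_commute power2_commute)
  qed
  show ?thesis
  proof (rule continuous_on_iff[THEN iffD2], intro ballI allI impI)
    fix x e :: real assume x: "x \<in> {0..l}" and e: "0 < e"
    \<comment> \<open>If \<open>g\<close> vanishes then \<open>K = 0\<close>; \<open>K + 1\<close>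
      keeps the radius below well defined.\<close>
    show "\<exists>d>0. \<forall>x'\<in>{0..l}. dist x' x < d \<longrightarrow> dist (u x') (u x) < e"
    proof (intro exI[of _ "e\<^sup>2 / (K + 1)"] conjI ballI impI)
      show "0 < e\<^sup>2 / (K + 1)" using e K by simp
      fix y assume y: "y \<in> {0..l}" and d: "dist y x < e\<^sup>2 / (K + 1)"
      have "(u y - u x)\<^sup>2 \<le> \<bar>y - x\<bar> * K" by (rule le[OF x y])
      also have "\<dots> \<le> \<bar>y - x\<bar> * (K + 1)" by (intro mult_left_mono) auto
      also have "\<dots> < e\<^sup>2" using d K by (simp add: dist_real_def field_simps)
      finally have "\<bar>u y - u x\<bar> < e" using e by (metis abs_le_square_iff abs_of_pos not_le)
      then show "dist (u y) (u x) < e" by (simp add: dist_real_def)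
    qed
  qed
qed

text \<open>Over \<open>n\<close> equal subintervals the bounds telescope in \<open>\<mu>\<close>
  and sum to \<open>(y - x) * (\<mu> y - \<mu> x) / n\<close>, which tends to 0. This replaces an
  argument by differentiation almost everywhere.\<close>

lemma superadditive_increment_const:
  fixes \<Psi> \<mu> :: "real \<Rightarrow> real"
  assumes le: "\<And>s t. x \<le> s \<Longrightarrow> s \<le> t \<Longrightarrow> t \<le> y \<Longrightarrow> \<bar>\<Psi> t - \<Psi> s\<bar> \<le> (t - s) * (\<mu> t - \<mu> s)"
    and xy: "x \<le> y"
  shows "\<Psi> y = \<Psi> x"
proof -
  define K where "K = (y - x) * (\<mu> y - \<mu> x)"
  have "\<bar>\<Psi> y - \<Psi> x\<bar> \<le> K / real (Suc n)" for n
  proof -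
    define \<delta> where "\<delta> = (y - x) / real (Suc n)"
    define p where "p i = x + real i * \<delta>" for i
    have \<delta>: "0 \<le> \<delta>" using xy by (simp add: \<delta>_def)
    have p: "p 0 = x" "p (Suc n) = y" by (simp_all add: p_def \<delta>_def del: of_nat_Suc)
    have step: "p (Suc i) - p i = (y - x) / real (Suc n)" for i
      unfolding \<delta>_def[symmetric] by (simp add: p_def algebra_simps)
    have mono: "p i \<le> p j" if "i \<le> j" for i j
      using that \<delta> by (auto simp: p_def intro!: mult_right_mono)
    have "\<bar>\<Psi> y - \<Psi> x\<bar> = \<bar>\<Sum>i<Suc n. \<Psi> (p (Suc i)) - \<Psi> (p i)\<bar>"
      by (subst sum_lessThan_telescope) (simp add: p)
    also have "\<dots> \<le> (\<Sum>i<Suc n. \<bar>\<Psi> (p (Suc i)) - \<Psi> (p i)\<bar>)" by (rule sum_abs)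
    also have "\<dots> \<le> (\<Sum>i<Suc n. (y - x) / real (Suc n) * (\<mu> (p (Suc i)) - \<mu> (p i)))"
    proof (rule sum_mono)
      fix i assume i: "i \<in> {..<Suc n}"
      have "\<bar>\<Psi> (p (Suc i)) - \<Psi> (p i)\<bar> \<le> (p (Suc i) - p i) * (\<mu> (p (Suc i)) - \<mu> (p i))"
        using mono[of 0 i] mono[of i "Suc i"] mono[of "Suc i" "Suc n"] i p by (intro le) auto
      then show "\<bar>\<Psi> (p (Suc i)) - \<Psi> (p i)\<bar> \<le> (y - x) / real (Suc n) * (\<mu> (p (Suc i)) - \<mu> (p i))"
        by (simp add: step)
    qed
    also have "\<dots> = (y - x) / real (Suc n) * (\<mu> y - \<mu> x)"
      by (subst sum_distrib_left[symmetric], subst sum_lessThan_telescope) (simp add: p)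
    finally show ?thesis by (simp add: K_def)
  qed
  moreover have "(\<lambda>n. K / real (Suc n)) \<longlonglongrightarrow> 0"
    by (rule LIMSEQ_Suc) (rule lim_const_over_n)
  ultimately have "\<bar>\<Psi> y - \<Psi> x\<bar> \<le> 0"
    by (intro LIMSEQ_le_const) auto
  then show ?thesis by simp
qed

text \<open>The chain rule, without almost everywhere differentiability of \<open>u\<close>. The
  defect \<open>\<Psi>\<close> between \<open>F (u t)\<close> and the candidate primitive has
  increments quadratic in the local variation of \<open>u\<close>, which Cauchy-Schwarz turns into
  interval length times an additive set function; such a defect is constant.\<close>

lemma has_L2_deriv_compose:
  assumes u: "has_L2_deriv l u g" and S: "convex S" "\<And>x. 0 \<le> x \<Longrightarrow> x \<le> l \<Longrightarrow> u x \<in> S"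
    and F: "\<And>r. r \<in> S \<Longrightarrow> (F has_real_derivative F' r) (at r)"
    and L: "\<And>r s. r \<in> S \<Longrightarrow> s \<in> S \<Longrightarrow> \<bar>F' r - F' s\<bar> \<le> L * \<bar>r - s\<bar>"
  shows "has_L2_deriv l (\<lambda>x. F (u x)) (\<lambda>x. F' (u x) * g x)"
proof -
  have g: "g \<in> Lp 2 l" by (rule has_L2_derivD[OF u])
  have contF': "continuous_on S F'"
  proof (rule continuous_on_iff[THEN iffD2], intro ballI allI impI)
    fix r e :: real assume r: "r \<in> S" and e: "0 < e"
    show "\<exists>d>0. \<forall>s\<in>S. dist s r < d \<longrightarrow> dist (F' s) (F' r) < e"
    proof (intro exI[of _ "e / (\<bar>L\<bar> + 1)"] conjI ballI impI)
      show "0 < e / (\<bar>L\<bar> + 1)" using e by (simp add: add_nonneg_pos)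
      fix s assume s: "s \<in> S" "dist s r < e / (\<bar>L\<bar> + 1)"
      have "\<bar>F' s - F' r\<bar> \<le> L * \<bar>s - r\<bar>" by (rule L[OF s(1) r])
      also have "\<dots> \<le> (\<bar>L\<bar> + 1) * \<bar>s - r\<bar>" by (intro mult_right_mono) auto
      also have "\<dots> < e" using s(2) by (simp add: dist_real_def field_simps add_nonneg_pos)
      finally show "dist (F' s) (F' r) < e" by (simp add: dist_real_def)
    qed
  qed
  have cont: "continuous_on {0..l} (\<lambda>x. F' (u x))"
    by (rule continuous_on_compose2[OF contF' has_L2_deriv_imp_continuous_on[OF u]]) (use S in auto)
  then obtain B where "\<forall>x\<in>{0..l}. \<bar>F' (u x)\<bar> \<le> B"
    using compact_imp_bounded[OF compact_continuous_image[OF cont compact_Icc]] by (auto simp: bounded_iff)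
  then have B: "\<And>x. x \<in> {0..l} \<Longrightarrow> \<bar>F' (u x)\<bar> \<le> B" by blast
  have FL: "(\<lambda>x. F' (u x) * g x) \<in> Lp 2 l"
    by (rule Lp2_bounded_mult[of _ _ B, OF borel_measurable_pipe_continuous_on[OF cont] _ g])
      (rule AE_I2, auto intro: B)
  show ?thesis
    unfolding has_L2_deriv_def
  proof (intro conjI allI impI FL)
    fix x y assume xy: "0 \<le> x" "x \<le> y" "y \<le> l"
    define \<Psi> where "\<Psi> t = F (u t) - (LINT t:{x<..<t}|pipe l. F' (u t) * g t)" for t
    \<comment> \<open>By Cauchy-Schwarz \<open>V\<^sup>2\<close> is at most \<open>t - s\<close>
      times the integral of \<open>g\<^sup>2\<close> over the interval, so this \<open>\<mu>\<close>
      dominates the defect \<open>2 * \<bar>L\<bar> * V\<^sup>2\<close>.\<close>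
    define \<mu> where "\<mu> t = 2 * \<bar>L\<bar> * (LINT t:{x<..<t}|pipe l. (g t)\<^sup>2)" for t
    have "\<Psi> y = \<Psi> x"
    proof (rule superadditive_increment_const[of x y \<Psi> \<mu>])
      fix s t assume st: "x \<le> s" "s \<le> t" "t \<le> y"
      define V where "V = (LINT t:{s<..<t}|pipe l. \<bar>g t\<bar>)"
      have gi: "integrable (pipe l) g" by (rule Lp2_integrable[OF g])
      have Fi: "integrable (pipe l) (\<lambda>t. F' (u t) * g t)" by (rule Lp2_integrable[OF FL])
      have near: "\<bar>u r - u s\<bar> \<le> V" if "r \<in> {s..t}" for r
      proof -
        have "\<bar>u r - u s\<bar> \<le> (LINT t:{s<..<r}|pipe l. \<bar>g t\<bar>)"
          using that st xy by (intro increment_le_integral_abs[OF u]) auto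
        also have "\<dots> \<le> V" unfolding V_def using that by (intro abs_integral_mono_interval gi) auto
        finally show ?thesis .
      qed
      have uS: "u r \<in> S" if "r \<in> {s..t}" for r using that st xy by (intro S) auto
      \<comment> \<open>Mean value theorem on the range of \<open>u\<close>. Both
        \<open>\<xi>\<close> and every \<open>u r\<close> on the interval lie within
        \<open>V\<close> of \<open>u s\<close>, hence within \<open>2 * V\<close> of each other;
        this is the factor 2 below.\<close>
      have "\<exists>\<xi>\<in>S. \<bar>\<xi> - u s\<bar> \<le> V \<and> F (u t) - F (u s) = F' \<xi> * (u t - u s)"
      proof (cases "u s = u t")
        case True
        then show ?thesis using uS[of s] near[of s] st by (intro bexI[of _ "u s"]) auto
      next
        case False
        define p q where "p = min (u s) (u t)" and "q = max (u s) (u t)"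
        have pq: "p < q" using False by (auto simp: p_def q_def)
        have sub: "{p..q} \<subseteq> S"
          using S(1) uS[of s] uS[of t] st unfolding p_def q_def
          by (metis atLeastAtMost_iff closed_segment_eq_real_ivl closed_segment_subset linorder_linear max.absorb1 max.absorb2 min.absorb1 min.absorb2 order_refl)
        obtain z where z: "p < z" "z < q" "F q - F p = (q - p) * F' z"
          using MVT2[OF pq, of F F'] F sub by (auto simp: subset_iff)
        have "\<bar>z - u s\<bar> \<le> \<bar>u t - u s\<bar>" using z(1,2) by (auto simp: p_def q_def)
        also have "\<dots> \<le> V" using st by (intro near) auto
        finally show ?thesis
          using z sub by (intro bexI[of _ z]) (auto simp: p_def q_def min_def max_def algebra_simps split: if_splits)
      qed
      then obtain \<xi> where \<xi>: "\<xi> \<in> S" "\<bar>\<xi> - u s\<bar> \<le> V" "F (u t) - F (u s) = F' \<xi> * (u t - u s)" by auto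
      have st': "0 \<le> s" "s \<le> t" "t \<le> l" using st xy by auto
      have "\<Psi> t - \<Psi> s = F (u t) - F (u s) - (LINT t:{s<..<t}|pipe l. F' (u t) * g t)"
        using set_integral_split[OF Fi xy(1) st(1,2)] st' by (simp add: \<Psi>_def)
      also have "\<dots> = (LINT r:{s<..<t}|pipe l. F' \<xi> * g r) - (LINT t:{s<..<t}|pipe l. F' (u t) * g t)"
        using \<xi>(3) has_L2_derivD(1)[OF u st'] by simp
      also have "\<dots> = (LINT r:{s<..<t}|pipe l. (F' \<xi> * g r - F' (u r) * g r))"
        using st' Fi gi by (intro set_integral_diff(2)[symmetric] set_integrable_pipe) auto
      finally have "\<bar>\<Psi> t - \<Psi> s\<bar> \<le> (LINT r:{s<..<t}|pipe l. \<bar>F' \<xi> * g r - F' (u r) * g r\<bar>)"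
        using st' gi Fi by (simp add: set_integral_abs_bound)
      also have "\<dots> \<le> (LINT r:{s<..<t}|pipe l. 2 * \<bar>L\<bar> * V * \<bar>g r\<bar>)"
      proof (rule set_integral_mono_pipe)
        have "\<bar>F' \<xi> * g r - F' (u r) * g r\<bar> \<le> 2 * \<bar>L\<bar> * V * \<bar>g r\<bar>" if r: "r \<in> {s<..<t}" for r
        proof -
          have "\<bar>F' \<xi> - F' (u r)\<bar> \<le> L * \<bar>\<xi> - u r\<bar>" using \<xi>(1) uS[of r] r by (intro L) auto
          also have "\<dots> \<le> \<bar>L\<bar> * (2 * V)"
            using near[of r] \<xi>(2) r by (intro mult_mono) auto
          finally have "\<bar>F' \<xi> - F' (u r)\<bar> * \<bar>g r\<bar> \<le> \<bar>L\<bar> * (2 * V) * \<bar>g r\<bar>" by (intro mult_right_mono) auto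
          then show ?thesis by (simp add: abs_mult[symmetric] algebra_simps)
        qed
        then show "AE r in pipe l. r \<in> {s<..<t} \<longrightarrow> \<bar>F' \<xi> * g r - F' (u r) * g r\<bar> \<le> 2 * \<bar>L\<bar> * V * \<bar>g r\<bar>"
          by simp
      qed (use gi Fi st' in auto)
      also have "\<dots> = 2 * \<bar>L\<bar> * V\<^sup>2" by (simp add: V_def power2_eq_square)
      also have "\<dots> \<le> 2 * \<bar>L\<bar> * ((t - s) * (LINT t:{s<..<t}|pipe l. (g t)\<^sup>2))"
        unfolding V_def using set_integral_square_bound[OF g st'] by (intro mult_left_mono) auto
      also have "\<dots> = (t - s) * (\<mu> t - \<mu> s)"
        using set_integral_split[OF Lp2_square[OF g] xy(1) st(1,2)] st' by (simp add: \<mu>_def algebra_simps)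
      finally show "\<bar>\<Psi> t - \<Psi> s\<bar> \<le> (t - s) * (\<mu> t - \<mu> s)" .
    qed (rule xy)
    then show "F (u y) - F (u x) = (LINT t:{x<..<y}|pipe l. F' (u t) * g t)"
      by (simp add: \<Psi>_def set_lebesgue_integral_def)
  qed
qed

section \<open>Linearity, product rule and integration by parts\<close>

lemma has_L2_deriv_add:
  assumes "has_L2_deriv l u g" "has_L2_deriv l v k"
  shows "has_L2_deriv l (\<lambda>x. u x + v x) (\<lambda>x. g x + k x)"
  unfolding has_L2_deriv_def
proof (intro conjI allI impI)
  show "(\<lambda>x. g x + k x) \<in> Lp 2 l" using assms has_L2_derivD(2) by (intro Lp2_add) auto
  fix x y assume xy: "0 \<le> x" "x \<le> y" "y \<le> l"
  have "(LINT t:{x<..<y}|pipe l. g t + k t) = (LINT t:{x<..<y}|pipe l. g t) + (LINT t:{x<..<y}|pipe l. k t)"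
    using assms xy by (intro set_integral_add set_integrable_pipe Lp2_integrable) (auto intro: has_L2_derivD)
  then show "u y + v y - (u x + v x) = (LINT t:{x<..<y}|pipe l. g t + k t)"
    using has_L2_derivD(1)[OF assms(1) xy] has_L2_derivD(1)[OF assms(2) xy] by simp
qed

lemma has_L2_deriv_cmult:
  assumes "has_L2_deriv l u g" shows "has_L2_deriv l (\<lambda>x. c * u x) (\<lambda>x. c * g x)"
  unfolding has_L2_deriv_def
  using has_L2_derivD[OF assms] by (auto intro: Lp2_cmult simp: right_diff_distrib[symmetric])

lemma has_L2_deriv_diff:
  assumes "has_L2_deriv l u g" "has_L2_deriv l v k"
  shows "has_L2_deriv l (\<lambda>x. u x - v x) (\<lambda>x. g x - k x)"
  using has_L2_deriv_add[OF assms(1) has_L2_deriv_cmult[OF assms(2), of "-1"]] by simp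

lemma has_L2_deriv_square:
  assumes u: "has_L2_deriv l u g"
  shows "has_L2_deriv l (\<lambda>x. (u x)\<^sup>2) (\<lambda>x. 2 * u x * g x)"
proof -
  have "((\<lambda>r. r\<^sup>2) has_real_derivative 2 * r) (at r)" for r :: real
    by (auto intro!: derivative_eq_intros)
  moreover have "\<bar>2 * r - 2 * s\<bar> \<le> 2 * \<bar>r - s\<bar>" for r s :: real
  proof -
    have "2 * r - 2 * s = 2 * (r - s)" by simp
    then show ?thesis by (simp only: abs_mult abs_numeral order_refl)
  qed
  ultimately show ?thesis by (intro has_L2_deriv_compose[OF u convex_UNIV]) auto
qed

lemma has_L2_deriv_mult:
  assumes "has_L2_deriv l u g" "has_L2_deriv l v k"
  shows "has_L2_deriv l (\<lambda>x. u x * v x) (\<lambda>x. g x * v x + u x * k x)"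
proof -
  \<comment> \<open>polarisation\<close>
  have "has_L2_deriv l (\<lambda>x. 1/4 * ((u x + v x)\<^sup>2 - (u x - v x)\<^sup>2))
     (\<lambda>x. 1/4 * (2 * (u x + v x) * (g x + k x) - 2 * (u x - v x) * (g x - k x)))"
    using assms by (intro has_L2_deriv_cmult has_L2_deriv_diff has_L2_deriv_square has_L2_deriv_add)
  then show ?thesis by (simp add: power2_eq_square algebra_simps)
qed

lemma integral_by_parts_pipe:
  assumes "has_L2_deriv l u g" "has_L2_deriv l v k" "0 \<le> l"
  shows "(\<integral>x. g x * v x \<partial>pipe l) + (\<integral>x. u x * k x \<partial>pipe l) = u l * v l - u 0 * v 0"
proof -
  have "u l * v l - u 0 * v 0 = (\<integral>x. g x * v x + u x * k x \<partial>pipe l)"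
    using has_L2_derivD(1)[OF has_L2_deriv_mult[OF assms(1,2)], of 0 l] assms(3)
    by (simp add: set_integral_whole_pipe)
  also have "\<dots> = (\<integral>x. g x * v x \<partial>pipe l) + (\<integral>x. u x * k x \<partial>pipe l)"
    using assms by (intro Bochner_Integration.integral_add Lp2_mult)
      (auto intro: has_L2_derivD Lp2_continuous has_L2_deriv_imp_continuous_on)
  finally show ?thesis by simp
qed

lemma has_L2_deriv_C1:
  assumes F: "\<And>x. 0 \<le> x \<Longrightarrow> x \<le> l \<Longrightarrow> (F has_real_derivative f x) (at x within {0..l})"
    and f: "continuous_on {0..l} f"
  shows "has_L2_deriv l F f"
  unfolding has_L2_deriv_def
proof (intro conjI allI impI Lp2_continuous f)
  fix x y assume xy: "0 \<le> x" "x \<le> y" "y \<le> l"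
  show "F y - F x = (LINT t:{x<..<y}|pipe l. f t)"
    using xy by (intro FTC_pipe[symmetric] DERIV_subset[OF F] continuous_on_subset[OF f]) auto
qed

lemma has_L2_deriv_indefinite_integral:
  assumes "g \<in> Lp 2 l"
  shows "has_L2_deriv l (\<lambda>x. LINT t:{0<..<x}|pipe l. g t) g"
  unfolding has_L2_deriv_def
proof (intro conjI allI impI assms)
  fix x y assume xy: "0 \<le> x" "x \<le> y" "y \<le> l"
  show "(LINT t:{0<..<y}|pipe l. g t) - (LINT t:{0<..<x}|pipe l. g t) = (LINT t:{x<..<y}|pipe l. g t)"
    using set_integral_split[OF Lp2_integrable[OF assms] order_refl xy] by simp
qed

section \<open>Smoothness and test functions\<close>

lemma smooth_on_UNIV_I:
  assumes "D 0 = f" "\<And>k x. (D k has_real_derivative D (Suc k) x) (at x)"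
  shows "smooth_on UNIV f"
proof -
  have "(deriv ^^ k) f = D k" for k
    by (induction k) (auto simp: assms(1) intro!: DERIV_imp_deriv assms(2))
  then show ?thesis
    unfolding smooth_on_def differentiable_on_def
    using assms(2) real_differentiable_def by (auto intro: differentiable_at_withinI)
qed

lemma smooth_on_UNIV_D:
  assumes "smooth_on UNIV f"
  shows "((deriv ^^ k) f has_real_derivative (deriv ^^ Suc k) f x) (at x)"
  using assms DERIV_deriv_iff_real_differentiable[of "(deriv ^^ k) f" x]
  unfolding smooth_on_def differentiable_on_def by simp

lemma test_function_has_L2_deriv:
  assumes "test_function l \<phi>"
  shows "has_L2_deriv l \<phi> (deriv \<phi>)"
proof (rule has_L2_deriv_C1)
  have s: "smooth_on UNIV \<phi>" using assms by (simp add: test_function_def)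
  show "(\<phi> has_real_derivative deriv \<phi> x) (at x within {0..l})" for x
    using smooth_on_UNIV_D[OF s, of 0 x] by (simp add: has_field_derivative_at_within)
  show "continuous_on {0..l} (deriv \<phi>)"
    using smooth_on_UNIV_D[OF s, of 1] by (intro DERIV_continuous_on[of _ _ "deriv (deriv \<phi>)"]) (simp add: has_field_derivative_at_within)
qed

lemma test_function_deriv:
  assumes t: "test_function l \<phi>"
  shows "test_function l (deriv \<phi>)"
proof -
  obtain \<alpha> \<beta> where ab: "0 < \<alpha>" "\<beta> < l" "\<And>x. x \<notin> {\<alpha>..\<beta>} \<Longrightarrow> \<phi> x = 0"
    and s: "smooth_on UNIV \<phi>"
    using t by (auto simp: test_function_def)
  have "deriv \<phi> x = 0" if "x \<notin> {\<alpha>..\<beta>}" for x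
  proof (rule DERIV_imp_deriv)
    have "open (- {\<alpha>..\<beta>})" by (rule open_Compl[OF closed_atLeastAtMost])
    then have "eventually (\<lambda>y. \<phi> y = 0) (nhds x)"
      using that ab(3) unfolding eventually_nhds by blast
    then show "(\<phi> has_real_derivative 0) (at x)"
      by (subst DERIV_cong_ev[OF refl _ refl, of _ "\<lambda>_. 0"]) auto
  qed
  moreover have "smooth_on UNIV (deriv \<phi>)"
  proof (rule smooth_on_UNIV_I[of "\<lambda>k. (deriv ^^ Suc k) \<phi>"])
    show "((deriv ^^ Suc k) \<phi> has_real_derivative (deriv ^^ Suc (Suc k)) \<phi> x) (at x)" for k x
      by (rule smooth_on_UNIV_D[OF s])
  qed simp
  ultimately show ?thesis using ab unfolding test_function_def by blast
qed

lemma test_function_ends: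
  assumes "test_function l \<phi>" shows "\<phi> 0 = 0" "\<phi> l = 0"
proof -
  obtain \<alpha> \<beta> where ab: "0 < \<alpha>" "\<beta> < l" "\<forall>x. x \<notin> {\<alpha>..\<beta>} \<longrightarrow> \<phi> x = 0"
    using assms unfolding test_function_def by blast
  show "\<phi> 0 = 0" using ab(1) by (intro ab(3)[rule_format]) simp
  show "\<phi> l = 0" using ab(2) by (intro ab(3)[rule_format]) simp
qed

lemma has_L2_deriv_imp_has_weak_deriv:
  assumes u: "has_L2_deriv l u g" and l: "0 \<le> l"
  shows "has_weak_deriv l u g"
  unfolding has_weak_deriv_def
proof (intro conjI allI impI)
  show "u \<in> Lp 2 l" "g \<in> Lp 2 l"
    using u by (auto intro: has_L2_derivD Lp2_continuous has_L2_deriv_imp_continuous_on)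
  fix \<phi> assume \<phi>: "test_function l \<phi>"
  show "(\<integral>x. u x * deriv \<phi> x \<partial>pipe l) = - (\<integral>x. g x * \<phi> x \<partial>pipe l)"
    using integral_by_parts_pipe[OF u test_function_has_L2_deriv[OF \<phi>] l] test_function_ends[OF \<phi>]
    by simp
qed

subsection \<open>A smooth bump function\<close>

text \<open>The class of functions \<open>p(x) s(x)\<^sup>-\<^sup>k exp(-1/s(x))\<close> on \<open>(0,1)\<close>, extended by \<open>0\<close>, with
  \<open>s(x) = x (1 - x)\<close> and a polynomial \<open>p\<close>, is closed under differentiation.\<close>

definition bump_class :: "real poly \<Rightarrow> nat \<Rightarrow> real \<Rightarrow> real" where
  "bump_class p k x =
     (if 0 < x \<and> x < 1 then poly p x * (1 / (x * (1 - x))) ^ k * exp (- (1 / (x * (1 - x)))) else 0)"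

text \<open>One term of the exponential series is at most the whole sum.\<close>

lemma power_exp_bounded:
  fixes y :: real assumes "0 \<le> y" shows "y ^ k * exp (- y) \<le> fact k"
proof -
  have "y ^ k / fact k \<le> exp y"
  proof -
    have "(\<Sum>n\<in>{k}. y ^ n /\<^sub>R fact n) \<le> (\<Sum>n. y ^ n /\<^sub>R fact n)"
      by (rule sum_le_suminf) (use assms summable_exp_generic[of y] in auto)
    then show ?thesis by (simp add: exp_def divide_inverse mult.commute)
  qed
  then show ?thesis by (simp add: exp_minus field_simps)
qed

text \<open>With \<open>v = 1 / (x * (1 - x))\<close>, the exponential dominates not only
  \<open>v ^ k\<close> but \<open>v ^ (k + 2)\<close>; the two extra powers give a bound by
  \<open>(x * (1 - x))\<^sup>2\<close>, hence by the squared distance to either end point. A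
  function of quadratic size has derivative 0 there.\<close>

lemma bump_class_deriv_at_end:
  assumes x0: "x0 \<in> {0, 1}"
  shows "(bump_class p k has_real_derivative 0) (at x0)"
proof -
  have "continuous_on {0..1} (poly p)" by (intro continuous_intros)
  then obtain B where B: "\<forall>x\<in>{0..1}. \<bar>poly p x\<bar> \<le> B"
    using compact_imp_bounded[OF compact_continuous_image[OF _ compact_Icc]] by (fastforce simp: bounded_iff)
  have B0: "0 \<le> B" using B by (meson abs_ge_zero atLeastAtMost_iff order_trans zero_le_one order_refl)
  define K where "K = B * fact (k + 2)"
  have K0: "0 \<le> K" using B0 by (simp add: K_def)
  have bound: "\<bar>bump_class p k x\<bar> \<le> K * (x - x0)\<^sup>2" for x
  proof (cases "0 < x \<and> x < 1")
    case True
    define v where "v = 1 / (x * (1 - x))"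
    have v: "0 < v" using True by (simp add: v_def)
    have vs: "v * (x * (1 - x)) = 1" using True by (simp add: v_def)
    have "\<bar>bump_class p k x\<bar> = \<bar>poly p x\<bar> * (v ^ k * exp (- v))"
      using True v by (simp add: bump_class_def v_def[symmetric] abs_mult)
    also have "\<dots> \<le> B * (v ^ k * exp (- v))"
      using B True v by (intro mult_right_mono) auto
    also have "v ^ k * exp (- v) = v ^ (k + 2) * exp (- v) * (x * (1 - x))\<^sup>2"
    proof -
      have "v ^ (k + 2) * exp (- v) * (x * (1 - x))\<^sup>2 = v ^ k * exp (- v) * (v * (x * (1 - x)))\<^sup>2"
        by (simp only: power_add power_mult_distrib mult_ac)
      then show ?thesis using vs by simp
    qed
    also have "B * (v ^ (k + 2) * exp (- v) * (x * (1 - x))\<^sup>2) \<le> B * (fact (k + 2) * (x - x0)\<^sup>2)"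
    proof (intro mult_left_mono mult_mono power_exp_bounded B0)
      show "(x * (1 - x))\<^sup>2 \<le> (x - x0)\<^sup>2"
        unfolding abs_le_square_iff[symmetric] using x0 True
        by (auto simp: abs_mult mult_le_cancel_left1 mult_left_le_one_le mult_right_le_one_le)
    qed (use v in auto)
    finally show ?thesis by (simp add: K_def)
  qed (auto simp: bump_class_def K0)
  have z: "bump_class p k x0 = 0" using x0 by (auto simp: bump_class_def)
  have "((\<lambda>y. (bump_class p k y - bump_class p k x0) / (y - x0)) \<longlongrightarrow> 0) (at x0)"
  proof (rule Lim_null_comparison)
    show "\<forall>\<^sub>F y in at x0. norm ((bump_class p k y - bump_class p k x0) / (y - x0)) \<le> K * \<bar>y - x0\<bar>"
    proof (rule eventually_at_filter[THEN iffD2], rule always_eventually, intro allI impI)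
      fix y assume y: "y \<noteq> x0"
      have "(y - x0)\<^sup>2 = \<bar>y - x0\<bar> * \<bar>y - x0\<bar>" by (simp add: power2_eq_square)
      then have "\<bar>bump_class p k y\<bar> \<le> K * \<bar>y - x0\<bar> * \<bar>y - x0\<bar>"
        using bound[of y] by (simp only: mult.assoc)
      then show "norm ((bump_class p k y - bump_class p k x0) / (y - x0)) \<le> K * \<bar>y - x0\<bar>"
        using y by (simp add: z pos_divide_le_eq)
    qed
    show "((\<lambda>y. K * \<bar>y - x0\<bar>) \<longlongrightarrow> 0) (at x0)"
      by (auto intro!: tendsto_eq_intros)
  qed
  then show ?thesis by (simp add: has_field_derivative_iff)
qed

lemma bump_class_deriv:
  "\<exists>q j. \<forall>x. (bump_class p k has_real_derivative bump_class q j x) (at x)"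
proof (intro exI allI)
  fix x :: real
  define s where "s = [:0, 1, -1::real:]"
  \<comment> \<open>Here \<open>s\<close> is \<open>x * (1 - x)\<close> and \<open>[:1, -2:]\<close>
    its derivative. The product rule produces the powers \<open>k\<close>, \<open>k + 1\<close> and
    \<open>k + 2\<close> of \<open>1 / s\<close>; factors of \<open>s\<close> raise them all to
    \<open>k + 2\<close>.\<close>
  define q where "q = pderiv p * s\<^sup>2 - smult (real k) (p * [:1, -2:] * s) + p * [:1, -2:]"
  show "(bump_class p k has_real_derivative bump_class q (k + 2) x) (at x)"
  proof (cases "0 < x \<and> x < 1")
    case True
    define v where "v x = 1 / (x * (1 - x))" for x :: real
    have xx: "x * (1 - x) \<noteq> 0" using True by simp
    have dv: "(v has_real_derivative - ((1 - 2 * x) * (v x)\<^sup>2)) (at x)"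
      unfolding v_def[abs_def] using xx
      by (auto intro!: derivative_eq_intros simp: power2_eq_square divide_simps)
    have vs: "v x * poly s x = 1" using True by (simp add: v_def s_def algebra_simps)
    have dvk: "((\<lambda>x. v x ^ k) has_real_derivative real k * v x ^ (k - 1) * - ((1 - 2 * x) * (v x)\<^sup>2)) (at x)"
      using DERIV_power[OF dv, of k] by (simp add: mult_ac)
    have kk: "real k * v x ^ (k - 1) * (v x)\<^sup>2 = real k * v x ^ (k + 2) * poly s x"
    proof (cases k)
      case (Suc n)
      have "v x ^ (k + 2) * poly s x = v x ^ (k - 1) * (v x)\<^sup>2 * (v x * poly s x)"
        by (simp add: Suc power_add power2_eq_square mult_ac)
      then have e: "v x ^ (k + 2) * poly s x = v x ^ (k - 1) * (v x)\<^sup>2"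
        unfolding vs by (simp only: mult_1_right)
      show ?thesis by (simp only: mult.assoc e)
    next
      case 0
      then show ?thesis by simp
    qed
    have k2: "v x ^ k = v x ^ (k + 2) * (poly s x)\<^sup>2"
    proof -
      have "v x ^ (k + 2) * (poly s x)\<^sup>2 = v x ^ k * (v x * poly s x)\<^sup>2"
        by (simp add: power_add power2_eq_square mult_ac)
      then show ?thesis unfolding vs by (simp only: power_one mult_1_right)
    qed
    have ed: "((\<lambda>x. exp (- v x)) has_real_derivative exp (- v x) * ((1 - 2 * x) * (v x)\<^sup>2)) (at x)"
      using DERIV_fun_exp[OF DERIV_minus[OF dv]] by simp
    have d: "((\<lambda>x. poly p x * v x ^ k * exp (- v x)) has_real_derivative
        (poly (pderiv p) x * v x ^ k + poly p x * (real k * v x ^ (k - 1) * - ((1 - 2 * x) * (v x)\<^sup>2))) * exp (- v x)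
        + poly p x * v x ^ k * (exp (- v x) * ((1 - 2 * x) * (v x)\<^sup>2))) (at x)"
      by (rule DERIV_cong[OF DERIV_mult[OF DERIV_mult[OF poly_DERIV dvk] ed]]) (simp add: algebra_simps)
    have "(poly (pderiv p) x * v x ^ k + poly p x * (real k * v x ^ (k - 1) * - ((1 - 2 * x) * (v x)\<^sup>2))) * exp (- v x)
        + poly p x * v x ^ k * (exp (- v x) * ((1 - 2 * x) * (v x)\<^sup>2))
      = (poly (pderiv p) x * v x ^ k - poly p x * (1 - 2 * x) * (real k * v x ^ (k - 1) * (v x)\<^sup>2)
         + poly p x * (1 - 2 * x) * (v x ^ (k + 2))) * exp (- v x)"
      by (simp add: algebra_simps power_add power2_eq_square)
    also have "\<dots> = bump_class q (k + 2) x"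
    proof -
      have qx: "poly q x = poly (pderiv p) x * (poly s x)\<^sup>2 - real k * (poly p x * (1 - 2 * x) * poly s x) + poly p x * (1 - 2 * x)"
        by (simp add: q_def algebra_simps)
      have bq: "bump_class q (k + 2) x = poly q x * v x ^ (k + 2) * exp (- v x)"
        using True by (simp add: bump_class_def v_def)
      have id: "(A * (V * S\<^sup>2) - B * D * (K * V * S) + B * D * V) * E
          = (A * S\<^sup>2 - K * (B * D * S) + B * D) * V * E" for A B D E K S V :: real
        by (simp add: algebra_simps)
      show ?thesis unfolding kk by (subst k2) (simp only: qx bq id)
    qed
    finally have eq: "(poly (pderiv p) x * v x ^ k + poly p x * (real k * v x ^ (k - 1) * - ((1 - 2 * x) * (v x)\<^sup>2))) * exp (- v x)
        + poly p x * v x ^ k * (exp (- v x) * ((1 - 2 * x) * (v x)\<^sup>2)) = bump_class q (k + 2) x" .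
    show ?thesis
    proof (rule has_field_derivative_transform_within_open[OF DERIV_cong[OF d eq], of "{0<..<1}"])
      show "poly p x * v x ^ k * exp (- v x) = bump_class p k x" if "x \<in> {0<..<1}" for x
        using that by (simp add: bump_class_def v_def)
    qed (use True in auto)
  next
    case False
    show ?thesis
    proof (cases "x \<in> {0, 1}")
      case True
      then show ?thesis using bump_class_deriv_at_end[OF True, of p k] by (auto simp: bump_class_def)
    next
      case nonend: False
      have "x \<in> - {0..1}" using False nonend by auto
      moreover have "open (- {0..1::real})" by (rule open_Compl[OF closed_atLeastAtMost])
      moreover have "\<forall>y\<in>- {0..1}. bump_class p k y = 0" by (auto simp: bump_class_def)
      ultimately have "eventually (\<lambda>y. bump_class p k y = 0) (nhds x)"
        unfolding eventually_nhds by blast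
      then have "(bump_class p k has_real_derivative 0) (at x)"
        by (subst DERIV_cong_ev[OF refl _ refl, of _ "\<lambda>_. 0"]) auto
      then show ?thesis using False by (auto simp: bump_class_def)
    qed
  qed
qed

definition bump :: "real \<Rightarrow> real" where "bump = bump_class 1 0"

lemma smooth_on_bump: "smooth_on UNIV bump"
proof -
  have "\<exists>p j. (deriv ^^ k) bump = bump_class p j" for k
  proof (induction k)
    case 0 then show ?case by (auto simp: bump_def)
  next
    case (Suc k)
    then obtain p j where pj: "(deriv ^^ k) bump = bump_class p j" by auto
    obtain q i where "\<forall>x. (bump_class p j has_real_derivative bump_class q i x) (at x)"
      using bump_class_deriv[of p j] by (elim exE)
    then have "deriv (bump_class p j) = bump_class q i"
      by (intro ext DERIV_imp_deriv) blast
    then have "(deriv ^^ Suc k) bump = bump_class q i" using pj by simp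
    then show ?case by blast
  qed
  then have *: "\<exists>p j. (deriv ^^ k) bump = bump_class p j" for k .
  have "(deriv ^^ k) bump differentiable at x within UNIV" for k x
  proof -
    obtain p j where pj: "(deriv ^^ k) bump = bump_class p j" using * by blast
    obtain q i where "\<forall>x. (bump_class p j has_real_derivative bump_class q i x) (at x)"
      using bump_class_deriv[of p j] by (elim exE)
    then show ?thesis unfolding pj real_differentiable_def by blast
  qed
  then show ?thesis unfolding smooth_on_def differentiable_on_def by blast
qed

lemma bump_pos: "0 < x \<Longrightarrow> x < 1 \<Longrightarrow> 0 < bump x"
  by (simp add: bump_def bump_class_def)

lemma bump_eq_0: "x \<notin> {0<..<1} \<Longrightarrow> bump x = 0"
  by (simp add: bump_def bump_class_def)

lemma bump_nonneg: "0 \<le> bump x"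
  using bump_pos[of x] bump_eq_0[of x] by (cases "x \<in> {0<..<1}") auto

text \<open>An antiderivative of \<open>bump\<close>, constant on both sides of the unit interval.
  Its total rise \<open>c\<close> is left unnormalised; positivity suffices, as it can be divided
  out.\<close>

lemma smooth_step_ex:
  obtains B c where "\<And>x. (B has_real_derivative bump x) (at x)" "0 < c"
    "\<And>x. x \<le> 0 \<Longrightarrow> B x = B 0" "\<And>x. 1 \<le> x \<Longrightarrow> B x = B 0 + c"
proof -
  have cont: "isCont bump x" for x
    using smooth_on_UNIV_D[OF smooth_on_bump, of 0 x] by (simp add: DERIV_isCont)
  have "\<exists>F. \<forall>x::real. - \<infinity> < ereal x \<longrightarrow> ereal x < \<infinity> \<longrightarrow> (F has_vector_derivative bump x) (at x)"
    by (rule einterval_antiderivative) (simp_all add: cont)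
  then obtain B where B: "\<And>x. (B has_real_derivative bump x) (at x)"
    by (auto simp: has_real_derivative_iff_has_vector_derivative)
  have contB: "continuous_on S B" for S
    using B by (meson DERIV_isCont continuous_at_imp_continuous_on)
  have "B 0 < B 1"
    by (rule DERIV_pos_imp_increasing_open[OF zero_less_one]) (use B bump_pos contB in blast)+
  have const: "B x = B y" if "x < y" "\<And>z. x < z \<Longrightarrow> z < y \<Longrightarrow> bump z = 0" for x y
  proof (rule DERIV_isconst_end[OF that(1) contB, symmetric])
    show "(B has_real_derivative 0) (at z)" if "x < z" "z < y" for z
      using B[of z] \<open>\<And>z. x < z \<Longrightarrow> z < y \<Longrightarrow> bump z = 0\<close>[OF that] by simp
  qed
  have c0: "B x = B 0" if "x \<le> 0" for x
    using that const[of x 0] bump_eq_0 by (cases "x = 0") auto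
  have c1: "B x = B 0 + (B 1 - B 0)" if "1 \<le> x" for x
    using that const[of 1 x] bump_eq_0 by (cases "x = 1") auto
  show ?thesis
    by (rule that[OF B _ c0 c1]) (use \<open>B 0 < B 1\<close> in simp_all)
qed

text \<open>The lemma of du Bois-Reymond for continuous functions. The test function is a plateau: a
  smooth step up near \<open>x\<close> minus a smooth step up near \<open>y\<close>. Its derivative
  is a unit mass near \<open>x\<close> minus a unit mass near \<open>y\<close>, so testing equates
  two local averages of \<open>v\<close>, each of which is close to the corresponding value.\<close>

lemma weak_deriv_0_imp_const:
  fixes v :: "real \<Rightarrow> real"
  assumes cont: "continuous_on {0..l} v"
    and weak: "\<And>\<phi>. test_function l \<phi> \<Longrightarrow> (\<integral>x. v x * deriv \<phi> x \<partial>pipe l) = 0"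
    and xy: "0 < x" "x < y" "y < l"
  shows "v x = v y"
proof (rule ccontr)
  assume neq: "v x \<noteq> v y"
  define e where "e = \<bar>v x - v y\<bar> / 3"
  have e: "0 < e" using neq by (simp add: e_def)
  obtain B c where B: "\<And>x. (B has_real_derivative bump x) (at x)" "0 < c"
    "\<And>x. x \<le> 0 \<Longrightarrow> B x = B 0" "\<And>x. 1 \<le> x \<Longrightarrow> B x = B 0 + c"
    by (rule smooth_step_ex) blast
  obtain d1 where d1: "0 < d1" "\<And>t. t \<in> {0..l} \<Longrightarrow> \<bar>t - x\<bar> < d1 \<Longrightarrow> \<bar>v t - v x\<bar> < e"
    using cont[unfolded continuous_on_iff, rule_format, of x e] e xy by (auto simp: dist_real_def)
  obtain d2 where d2: "0 < d2" "\<And>t. t \<in> {0..l} \<Longrightarrow> \<bar>t - y\<bar> < d2 \<Longrightarrow> \<bar>v t - v y\<bar> < e"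
    using cont[unfolded continuous_on_iff, rule_format, of y e] e xy by (auto simp: dist_real_def)
  \<comment> \<open>The width keeps the support inside the pipe and both averages within the
    continuity radii \<open>d1\<close> and \<open>d2\<close>.\<close>
  define d where "d = min (min d1 d2) (min (l - y) (y - x)) / 2"
  have d: "0 < d" "d < d1" "d < d2" "d < l - y" using d1(1) d2(1) xy by (auto simp: d_def)
  define \<beta> where "\<beta> z t = bump ((t - z) / d) / (c * d)" for z t
  define \<phi> where "\<phi> t = (B ((t - x) / d) - B ((t - y) / d)) / c" for t
  have DB: "((\<lambda>t. B ((t - z) / d) / c) has_real_derivative \<beta> z t) (at t)" for z t
    unfolding \<beta>_def using B(2) d(1)
    by (auto intro!: derivative_eq_intros DERIV_chain2[OF B(1)] simp: field_simps)
  have D\<phi>: "(\<phi> has_real_derivative (\<beta> x t - \<beta> y t)) (at t)" for t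
    using DERIV_diff[OF DB[of x t] DB[of y t]] by (simp add: \<phi>_def[abs_def] diff_divide_distrib)
  have test: "test_function l \<phi>"
    unfolding test_function_def
  proof (intro conjI exI allI impI)
    \<comment> \<open>The tower of derivatives of \<open>\<phi>\<close>: from order 1 on the
      constant of the antiderivative drops out and only rescaled derivatives of \<open>bump\<close>
      remain.\<close>
    define D where "D k = (case k of 0 \<Rightarrow> \<phi> | Suc j \<Rightarrow>
      (\<lambda>t. ((deriv ^^ j) bump ((t - x) / d) - (deriv ^^ j) bump ((t - y) / d)) / (c * d ^ Suc j)))" for k
    show "smooth_on UNIV \<phi>"
    proof (rule smooth_on_UNIV_I[of D])
      show "D 0 = \<phi>" by (simp add: D_def)
      show "(D k has_real_derivative D (Suc k) t) (at t)" for k t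
      proof (cases k)
        case 0
        then show ?thesis using D\<phi>[of t] by (simp add: D_def \<beta>_def diff_divide_distrib)
      next
        case (Suc j)
        have "((\<lambda>t. (deriv ^^ j) bump ((t - z) / d)) has_real_derivative (deriv ^^ Suc j) bump ((t - z) / d) * (1 / d)) (at t)" for z
          by (rule DERIV_chain2[OF smooth_on_UNIV_D[OF smooth_on_bump]])
            (use d in \<open>auto intro!: derivative_eq_intros\<close>)
        from DERIV_cdivide[OF DERIV_diff[OF this[of x] this[of y]], of "c * d ^ Suc j"]
        show ?thesis by (simp add: Suc D_def diff_divide_distrib mult_ac)
      qed
    qed
    show "0 < x" "y + d < l" using xy d by auto
    fix t assume "t \<notin> {x..y + d}"
    then have "t \<le> x \<and> t \<le> y \<or> x + d \<le> t \<and> y + d \<le> t" using xy d by auto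
    then show "\<phi> t = 0"
    proof
      assume "t \<le> x \<and> t \<le> y"
      then show ?thesis
        using d B(3)[of "(t - x) / d"] B(3)[of "(t - y) / d"] by (simp add: \<phi>_def divide_nonpos_pos)
    next
      assume "x + d \<le> t \<and> y + d \<le> t"
      then show ?thesis
        using d B(4)[of "(t - x) / d"] B(4)[of "(t - y) / d"] by (simp add: \<phi>_def le_divide_eq)
    qed
  qed
  have cont\<beta>: "continuous_on {0..l} (\<beta> z)" for z
  proof -
    have "continuous_on UNIV bump"
      using smooth_on_UNIV_D[OF smooth_on_bump, of 0]
      by (intro continuous_at_imp_continuous_on ballI DERIV_isCont) simp
    then have "continuous_on {0..l} (\<lambda>t. bump ((t - z) / d))"
      by (rule continuous_on_compose2) (use d in \<open>auto intro!: continuous_intros\<close>)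
    then show ?thesis unfolding \<beta>_def
      by (rule continuous_on_divide) (use d B(2) in auto)
  qed
  have \<beta>0: "0 \<le> \<beta> z t" for z t using d B(2) by (simp add: \<beta>_def bump_nonneg)
  have near: "\<bar>(\<integral>t. v t * \<beta> z t \<partial>pipe l) - v z\<bar> \<le> e"
    if z: "0 \<le> z" "z + d \<le> l" "\<And>t. t \<in> {0..l} \<Longrightarrow> \<bar>t - z\<bar> < d \<Longrightarrow> \<bar>v t - v z\<bar> \<le> e" for z
  proof -
    have "(LINT t:{0<..<l}|pipe l. \<beta> z t) = B ((l - z) / d) / c - B ((0 - z) / d) / c"
      by (rule FTC_pipe[of 0 l l "\<lambda>t. B ((t - z) / d) / c"])
        (use xy in \<open>simp_all add: cont\<beta> has_field_derivative_at_within[OF DB]\<close>)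
    also have "\<dots> = 1"
      using z d B(2) B(3)[of "(0 - z) / d"] B(4)[of "(l - z) / d"]
      by (simp add: divide_nonpos_pos le_divide_eq add_divide_distrib)
    finally have int1: "(\<integral>t. \<beta> z t \<partial>pipe l) = 1" by (simp add: set_integral_whole_pipe)
    have i: "integrable (pipe l) (\<beta> z)" "integrable (pipe l) (\<lambda>t. v t * \<beta> z t)"
      using cont cont\<beta> by (simp_all add: Lp2_integrable Lp2_mult Lp2_continuous)
    have "(\<integral>t. v t * \<beta> z t \<partial>pipe l) - v z = (\<integral>t. v t * \<beta> z t \<partial>pipe l) - (\<integral>t. v z * \<beta> z t \<partial>pipe l)"
      by (simp add: int1)
    also have "\<dots> = (\<integral>t. v t * \<beta> z t - v z * \<beta> z t \<partial>pipe l)" using i by simp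
    also have "\<bar>\<dots>\<bar> \<le> (\<integral>t. \<bar>v t * \<beta> z t - v z * \<beta> z t\<bar> \<partial>pipe l)" by (rule integral_abs_bound)
    also have "\<dots> \<le> (\<integral>t. e * \<beta> z t \<partial>pipe l)"
    proof (rule integral_mono)
      fix t assume t: "t \<in> space (pipe l)"
      have "\<bar>v t * \<beta> z t - v z * \<beta> z t\<bar> = \<bar>v t - v z\<bar> * \<beta> z t"
        using \<beta>0[of z t] by (simp add: left_diff_distrib[symmetric] abs_mult)
      also have "\<dots> \<le> e * \<beta> z t"
      proof (cases "\<bar>t - z\<bar> < d")
        case True
        then show ?thesis using z(3)[of t] t \<beta>0[of z t] by (intro mult_right_mono) auto
      next
        case False
        then have "(t - z) / d \<notin> {0<..<1}" using d by (auto simp: field_simps abs_if split: if_splits)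
        then have "\<beta> z t = 0" by (simp add: \<beta>_def bump_eq_0)
        then show ?thesis by simp
      qed
      finally show "\<bar>v t * \<beta> z t - v z * \<beta> z t\<bar> \<le> e * \<beta> z t" .
    qed (use i in auto)
    finally show ?thesis by (simp add: int1)
  qed
  have "0 = (\<integral>t. v t * deriv \<phi> t \<partial>pipe l)" using weak[OF test] by simp
  also have "\<dots> = (\<integral>t. v t * \<beta> x t - v t * \<beta> y t \<partial>pipe l)"
    using DERIV_imp_deriv[OF D\<phi>] by (simp add: right_diff_distrib)
  also have "\<dots> = (\<integral>t. v t * \<beta> x t \<partial>pipe l) - (\<integral>t. v t * \<beta> y t \<partial>pipe l)"
    using cont cont\<beta> by (intro Bochner_Integration.integral_diff Lp2_mult Lp2_continuous) auto
  finally have "(\<integral>t. v t * \<beta> x t \<partial>pipe l) = (\<integral>t. v t * \<beta> y t \<partial>pipe l)" by simp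
  moreover have "\<bar>(\<integral>t. v t * \<beta> x t \<partial>pipe l) - v x\<bar> \<le> e"
    using xy d d1(2) by (intro near) (auto intro!: less_imp_le)
  moreover have "\<bar>(\<integral>t. v t * \<beta> y t \<partial>pipe l) - v y\<bar> \<le> e"
    using xy d d2(2) by (intro near) (auto intro!: less_imp_le)
  ultimately have "\<bar>v x - v y\<bar> \<le> 2 * e" by linarith
  then show False using e by (simp add: e_def)
qed

text \<open>Subtracting the primitive of \<open>g\<close> leaves a continuous function with weak
  derivative 0, constant on the open pipe and, by continuity, up to its end points.\<close>

theorem has_weak_deriv_imp_has_L2_deriv:
  assumes cont: "continuous_on {0..l} u" and weak: "has_weak_deriv l u g" and l: "0 < l"
  shows "has_L2_deriv l u g"
proof -
  have g: "g \<in> Lp 2 l" and u: "u \<in> Lp 2 l" using weak by (auto simp: has_weak_deriv_def)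
  define G where "G x = (LINT t:{0<..<x}|pipe l. g t)" for x
  have G: "has_L2_deriv l G g" unfolding G_def by (rule has_L2_deriv_indefinite_integral[OF g])
  define v where "v x = u x - G x" for x
  have contv: "continuous_on {0..l} v"
    unfolding v_def by (intro continuous_intros cont has_L2_deriv_imp_continuous_on[OF G])
  have weakv: "(\<integral>x. v x * deriv \<phi> x \<partial>pipe l) = 0" if \<phi>: "test_function l \<phi>" for \<phi>
  proof -
    have Gw: "has_weak_deriv l G g" using has_L2_deriv_imp_has_weak_deriv[OF G] l by simp
    have d: "deriv \<phi> \<in> Lp 2 l" by (rule has_L2_derivD(2)[OF test_function_has_L2_deriv[OF \<phi>]])
    have "(\<integral>x. v x * deriv \<phi> x \<partial>pipe l) = (\<integral>x. u x * deriv \<phi> x - G x * deriv \<phi> x \<partial>pipe l)"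
      by (simp add: v_def left_diff_distrib)
    also have "\<dots> = (\<integral>x. u x * deriv \<phi> x \<partial>pipe l) - (\<integral>x. G x * deriv \<phi> x \<partial>pipe l)"
      using u d Gw by (intro Bochner_Integration.integral_diff Lp2_mult) (auto simp: has_weak_deriv_def)
    also have "\<dots> = 0" using weak Gw \<phi> by (simp add: has_weak_deriv_def)
    finally show ?thesis .
  qed
  define c where "c = v (l / 2)"
  have const: "v x = c" if "x \<in> {0<..<l}" for x
  proof (cases x "l / 2" rule: linorder_cases)
    case less
    then show ?thesis
      unfolding c_def using that l by (intro weak_deriv_0_imp_const[OF contv weakv]) simp_all
  next
    case greater
    then show ?thesis
      unfolding c_def using that l by (intro weak_deriv_0_imp_const[OF contv weakv, symmetric]) simp_all
  next
    case equal
    show ?thesis unfolding c_def by (simp only: equal)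
  qed
  have const': "v x = c" if "x \<in> {0..l}" for x
  proof -
    have "continuous_on (closure {0<..<l}) v" using contv l by simp
    then show ?thesis using continuous_constant_on_closure[of "{0<..<l}" v c x] const that l by auto
  qed
  show ?thesis
    unfolding has_L2_deriv_def
  proof (intro conjI allI impI g)
    fix x y assume xy: "0 \<le> x" "x \<le> y" "y \<le> l"
    then show "u y - u x = (LINT t:{x<..<y}|pipe l. g t)"
      using const'[of x] const'[of y] has_L2_derivD(1)[OF G xy] by (simp add: v_def)
  qed
qed

section \<open>Consequences for H1: representation, uniqueness and the sup bound\<close>

lemma H1_has_L2_deriv:
  assumes "u \<in> H1 l" "0 < l" shows "has_L2_deriv l u (weak_deriv l u)"
proof -
  have "\<exists>g. has_weak_deriv l u g" and c: "continuous_on {0..l} u" using assms(1) by (auto simp: H1_def)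
  then have "has_weak_deriv l u (weak_deriv l u)" unfolding weak_deriv_def by (metis someI_ex)
  then show ?thesis by (rule has_weak_deriv_imp_has_L2_deriv[OF c _ assms(2)])
qed

lemma has_L2_deriv_imp_H1: "has_L2_deriv l u g \<Longrightarrow> 0 \<le> l \<Longrightarrow> u \<in> H1 l"
  unfolding H1_def using has_L2_deriv_imp_continuous_on has_L2_deriv_imp_has_weak_deriv by blast

lemma has_L2_deriv_unique:
  assumes "has_L2_deriv l u g" "has_L2_deriv l u k" "0 \<le> l"
  shows "AE x in pipe l. g x = k x"
proof -
  have "AE x in pipe l. g x - k x = 0"
  proof (rule AE_eq_0_if_interval_integrals_0[OF _ assms(3)])
    show "integrable (pipe l) (\<lambda>x. g x - k x)"
      using assms has_L2_derivD(2) by (intro Lp2_integrable Lp2_diff) auto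
    fix x y assume xy: "0 \<le> x" "x \<le> y" "y \<le> l"
    have "(LINT t:{x<..<y}|pipe l. g t - k t) = (LINT t:{x<..<y}|pipe l. g t) - (LINT t:{x<..<y}|pipe l. k t)"
      using assms xy by (intro set_integral_diff set_integrable_pipe Lp2_integrable) (auto intro: has_L2_derivD)
    then show "(LINT t:{x<..<y}|pipe l. g t - k t) = 0"
      using has_L2_derivD(1)[OF assms(1) xy] has_L2_derivD(1)[OF assms(2) xy] by simp
  qed
  then show ?thesis by simp
qed

text \<open>The Sobolev embedding in one dimension: \<open>u x\<close> differs from
  \<open>u y\<close> by a Hoelder bound, and averaging over \<open>y\<close> replaces the value at
  \<open>y\<close> by the L2 norm. The explicit constant reappears in the bound of the pointwise
  time increments.\<close>

lemma H1_sup_bound: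
  assumes u: "has_L2_deriv l u g" and x: "0 \<le> x" "x \<le> l" and l: "0 < l"
  shows "(u x)\<^sup>2 \<le> (2 / l + 2 * l) * ((\<integral>t. (u t)\<^sup>2 \<partial>pipe l) + (\<integral>t. (g t)\<^sup>2 \<partial>pipe l))"
proof -
  have u2: "u \<in> Lp 2 l" by (rule Lp2_continuous[OF has_L2_deriv_imp_continuous_on[OF u]])
  define K where "K = (\<integral>t. (g t)\<^sup>2 \<partial>pipe l)"
  have le: "(u x)\<^sup>2 \<le> 2 * (u y)\<^sup>2 + 2 * l * K" if y: "y \<in> {0<..<l}" for y
  proof -
    have *: "(u q - u p)\<^sup>2 \<le> l * K" if "0 \<le> p" "p \<le> q" "q \<le> l" for p q
    proof -
      have "(u q - u p)\<^sup>2 \<le> (q - p) * (LINT t:{p<..<q}|pipe l. (g t)\<^sup>2)"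
        by (rule increment_square_bound[OF u that])
      also have "\<dots> \<le> l * K" unfolding K_def using that has_L2_derivD(2)[OF u]
        by (intro mult_mono set_integral_square_le) (auto simp: set_lebesgue_integral_def intro!: integral_nonneg_AE)
      finally show ?thesis .
    qed
    have d: "(u x - u y)\<^sup>2 \<le> l * K"
      using *[of x y] *[of y x] x y by (cases "x \<le> y") (auto simp: power2_commute)
    have "(u x)\<^sup>2 \<le> 2 * (u y)\<^sup>2 + 2 * (u x - u y)\<^sup>2"
      using zero_le_power2[of "u x - 2 * u y"] by (simp add: power2_eq_square algebra_simps)
    then show ?thesis using d by simp
  qed
  have "l * (u x)\<^sup>2 = (\<integral>y. (u x)\<^sup>2 \<partial>pipe l)"
    using measure_pipe[of 0 l l] l by simp
  also have "\<dots> \<le> (\<integral>y. 2 * (u y)\<^sup>2 + 2 * l * K \<partial>pipe l)"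
    using le Lp2_square[OF u2] by (intro integral_mono) auto
  also have "\<dots> = 2 * (\<integral>y. (u y)\<^sup>2 \<partial>pipe l) + 2 * l * K * l"
    using Lp2_square[OF u2] measure_pipe[of 0 l l] l by simp
  finally have "(u x)\<^sup>2 \<le> (2 / l) * (\<integral>y. (u y)\<^sup>2 \<partial>pipe l) + 2 * l * K"
    using l by (simp add: field_simps)
  also have "\<dots> \<le> (2 / l + 2 * l) * (\<integral>y. (u y)\<^sup>2 \<partial>pipe l) + (2 / l + 2 * l) * K"
    using l by (intro add_mono mult_right_mono) (auto simp: K_def)
  finally show ?thesis by (simp add: K_def distrib_left)
qed

section \<open>Time regularity by duality\<close>

text \<open>Pairing with a fixed \<open>v \<in> L\<^sup>2(0,l)\<close> turns weak derivatives of \<open>L\<^sup>2(0,l)\<close>-valued functions into weak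
  derivatives of scalar functions of time; norm bounds are recovered by choosing for \<open>v\<close> the quantity
  to be estimated. This replaces the theory of Bochner spaces.\<close>

definition L2_time_bounded :: "real \<Rightarrow> real \<Rightarrow> real \<Rightarrow> (real \<Rightarrow> real \<Rightarrow> real) \<Rightarrow> bool" where
  "L2_time_bounded T l K u \<longleftrightarrow> (\<lambda>(t, x). u t x) \<in> borel_measurable (pipe T \<Otimes>\<^sub>M pipe l) \<and>
     (AE t in pipe T. u t \<in> Lp 2 l \<and> (\<integral>x. (u t x)\<^sup>2 \<partial>pipe l) \<le> K\<^sup>2)"

definition weak_time_deriv :: "real \<Rightarrow> real \<Rightarrow> (real \<Rightarrow> real \<Rightarrow> real) \<Rightarrow> (real \<Rightarrow> real \<Rightarrow> real) \<Rightarrow> bool" where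
  "weak_time_deriv T l u g \<longleftrightarrow> (\<forall>\<phi>. test_function T \<phi> \<longrightarrow>
     (AE x in pipe l. (\<integral>t. u t x * deriv \<phi> t \<partial>pipe T) = - (\<integral>t. g t x * \<phi> t \<partial>pipe T)))"

definition L2_continuous :: "real \<Rightarrow> real \<Rightarrow> (real \<Rightarrow> real \<Rightarrow> real) \<Rightarrow> bool" where
  "L2_continuous T l u \<longleftrightarrow> (\<forall>t\<in>{0..T}. u t \<in> Lp 2 l \<and>
     ((\<lambda>s. \<integral>x. (u s x - u t x)\<^sup>2 \<partial>pipe l) \<longlongrightarrow> 0) (at t within {0..T}))"

abbreviation pairing :: "real \<Rightarrow> (real \<Rightarrow> real \<Rightarrow> real) \<Rightarrow> (real \<Rightarrow> real) \<Rightarrow> real \<Rightarrow> real" where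
  "pairing l u \<psi> t \<equiv> \<integral>x. u t x * \<psi> x \<partial>pipe l"

section \<open>Scalar pairings as functions of time\<close>

lemma pair_sigma_finite_pipe: "pair_sigma_finite (pipe T) (pipe l)"
  by (simp add: pair_sigma_finite_def finite_measure_pipe finite_measure.axioms(1))

lemma Lp2_pairing_bound:
  assumes "u \<in> Lp 2 l" "\<psi> \<in> Lp 2 l" "(\<integral>x. (u x)\<^sup>2 \<partial>pipe l) \<le> K\<^sup>2" "0 \<le> K"
  shows "\<bar>\<integral>x. u x * \<psi> x \<partial>pipe l\<bar> \<le> K * sqrt (\<integral>x. (\<psi> x)\<^sup>2 \<partial>pipe l)"
proof -
  have "(\<integral>x. u x * \<psi> x \<partial>pipe l)\<^sup>2 \<le> (\<integral>x. (u x)\<^sup>2 \<partial>pipe l) * (\<integral>x. (\<psi> x)\<^sup>2 \<partial>pipe l)"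
    by (rule Lp2_Cauchy_Schwarz[OF assms(1,2)])
  also have "\<dots> \<le> K\<^sup>2 * (\<integral>x. (\<psi> x)\<^sup>2 \<partial>pipe l)" using assms(3) by (intro mult_right_mono) auto
  also have "\<dots> = (K * sqrt (\<integral>x. (\<psi> x)\<^sup>2 \<partial>pipe l))\<^sup>2" by (simp add: power_mult_distrib)
  finally show ?thesis
    using assms(4) by (simp add: abs_le_square_iff[symmetric] abs_mult)
qed

lemma pairing_measurable:
  assumes u: "L2_time_bounded T l K u" and \<psi>: "\<psi> \<in> Lp 2 l"
  shows "pairing l u \<psi> \<in> borel_measurable (pipe T)"
proof -
  interpret pair_sigma_finite "pipe T" "pipe l" by (rule pair_sigma_finite_pipe)
  have [measurable]: "(\<lambda>(t, x). u t x) \<in> borel_measurable (pipe T \<Otimes>\<^sub>M pipe l)"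
    "\<psi> \<in> borel_measurable (pipe l)"
    using u \<psi> by (auto simp: L2_time_bounded_def Lp2_measurable)
  show ?thesis by (rule pipe.borel_measurable_lebesgue_integral) measurable
qed

lemma pairing_bound:
  assumes u: "L2_time_bounded T l K u" and \<psi>: "\<psi> \<in> Lp 2 l" and K: "0 \<le> K"
  shows "AE t in pipe T. \<bar>pairing l u \<psi> t\<bar> \<le> K * sqrt (\<integral>x. (\<psi> x)\<^sup>2 \<partial>pipe l)"
proof -
  have "AE t in pipe T. u t \<in> Lp 2 l \<and> (\<integral>x. (u t x)\<^sup>2 \<partial>pipe l) \<le> K\<^sup>2"
    using u by (simp add: L2_time_bounded_def)
  then show ?thesis by (rule eventually_mono) (use \<psi> K in \<open>auto intro: Lp2_pairing_bound\<close>)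
qed

lemma pairing_Lp2:
  assumes "L2_time_bounded T l K u" "\<psi> \<in> Lp 2 l" "0 \<le> K"
  shows "pairing l u \<psi> \<in> Lp 2 T"
  by (rule Lp2_bounded[OF pairing_measurable[OF assms(1,2)] pairing_bound[OF assms]])

text \<open>For almost every time, Cauchy-Schwarz in space bounds the integral of the absolute
  value, uniformly in time; together with joint measurability this makes the integrand integrable on
  the product.\<close>

lemma pairing_Fubini:
  assumes u: "L2_time_bounded T l K u" and \<psi>: "\<psi> \<in> Lp 2 l" and K: "0 \<le> K"
    and \<theta>: "continuous_on {0..T} \<theta>"
  shows "(\<integral>t. pairing l u \<psi> t * \<theta> t \<partial>pipe T) = (\<integral>x. (\<integral>t. u t x * \<theta> t \<partial>pipe T) * \<psi> x \<partial>pipe l)"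
proof -
  interpret pair_sigma_finite "pipe T" "pipe l" by (rule pair_sigma_finite_pipe)
  have [measurable]: "(\<lambda>(t, x). u t x) \<in> borel_measurable (pipe T \<Otimes>\<^sub>M pipe l)"
    "\<psi> \<in> borel_measurable (pipe l)" "\<theta> \<in> borel_measurable (pipe T)"
    using u \<psi> \<theta> by (auto simp: L2_time_bounded_def Lp2_measurable borel_measurable_pipe_continuous_on)
  obtain B where B: "\<forall>t\<in>{0..T}. \<bar>\<theta> t\<bar> \<le> B"
    using compact_imp_bounded[OF compact_continuous_image[OF \<theta> compact_Icc]] by (auto simp: bounded_iff)
  have ub: "AE t in pipe T. u t \<in> Lp 2 l \<and> (\<integral>x. (u t x)\<^sup>2 \<partial>pipe l) \<le> K\<^sup>2"
    using u by (simp add: L2_time_bounded_def)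
  have abs\<psi>: "(\<lambda>x. \<bar>\<psi> x\<bar>) \<in> Lp 2 l" using \<psi> by (simp add: Lp2_iff)
  have int: "integrable (pipe T \<Otimes>\<^sub>M pipe l) (\<lambda>(t, x). u t x * \<theta> t * \<psi> x)"
  proof (rule Fubini_integrable)
    show "integrable (pipe T) (\<lambda>t. \<integral>x. norm (case (t, x) of (t, x) \<Rightarrow> u t x * \<theta> t * \<psi> x) \<partial>pipe l)"
    proof (rule pipe.integrable_const_bound)
      show "AE t in pipe T. norm (\<integral>x. norm (case (t, x) of (t, x) \<Rightarrow> u t x * \<theta> t * \<psi> x) \<partial>pipe l)
          \<le> B * (K * sqrt (\<integral>x. (\<psi> x)\<^sup>2 \<partial>pipe l))"
        using ub AE_space
      proof eventually_elim
        case (elim t)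
        then have "(\<lambda>x. \<bar>u t x\<bar>) \<in> Lp 2 l" by (simp add: Lp2_iff)
        then have "\<bar>\<integral>x. \<bar>u t x\<bar> * \<bar>\<psi> x\<bar> \<partial>pipe l\<bar> \<le> K * sqrt (\<integral>x. (\<bar>\<psi> x\<bar>)\<^sup>2 \<partial>pipe l)"
          by (rule Lp2_pairing_bound[OF _ abs\<psi> _ K]) (use elim in auto)
        moreover have "\<bar>\<theta> t\<bar> \<le> B" using elim(2) B by auto
        moreover have "(\<integral>x. norm (u t x * \<theta> t * \<psi> x) \<partial>pipe l) = \<bar>\<theta> t\<bar> * (\<integral>x. \<bar>u t x\<bar> * \<bar>\<psi> x\<bar> \<partial>pipe l)"
          by (subst integral_mult_right_zero[symmetric])
            (rule Bochner_Integration.integral_cong, auto simp: abs_mult mult_ac)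
        ultimately show ?case by (auto simp: abs_mult intro!: mult_mono)
      qed
    qed measurable
    show "AE t in pipe T. integrable (pipe l) (\<lambda>x. case (t, x) of (t, x) \<Rightarrow> u t x * \<theta> t * \<psi> x)"
      using ub
    proof eventually_elim
      case (elim t)
      then have "integrable (pipe l) (\<lambda>x. \<theta> t * (u t x * \<psi> x))"
        using \<psi> by (intro integrable_mult_right Lp2_mult) auto
      then show ?case by (simp add: mult_ac)
    qed
  qed measurable
  have "(\<integral>t. pairing l u \<psi> t * \<theta> t \<partial>pipe T) = (\<integral>t. (\<integral>x. u t x * \<theta> t * \<psi> x \<partial>pipe l) \<partial>pipe T)"
    by (intro Bochner_Integration.integral_cong refl, subst integral_mult_left_zero[symmetric])
      (intro Bochner_Integration.integral_cong refl, simp)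
  also have "\<dots> = (\<integral>x. (\<integral>t. u t x * \<theta> t * \<psi> x \<partial>pipe T) \<partial>pipe l)"
    using Fubini_integral[OF int] by simp
  finally show ?thesis by simp
qed

text \<open>The identity defining the weak time derivative holds off a null set of points that
  depends on the test function. After Fubini the identity stands under the space integral, where
  that null set disappears.\<close>

lemma pairing_has_weak_deriv:
  assumes u: "L2_time_bounded T l K u" and g: "L2_time_bounded T l K g"
    and w: "weak_time_deriv T l u g" and \<psi>: "\<psi> \<in> Lp 2 l" and K: "0 \<le> K"
  shows "has_weak_deriv T (pairing l u \<psi>) (pairing l g \<psi>)"
  unfolding has_weak_deriv_def
proof (intro conjI allI impI pairing_Lp2[OF u \<psi> K] pairing_Lp2[OF g \<psi> K])
  fix \<phi> assume \<phi>: "test_function T \<phi>"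
  interpret pair_sigma_finite "pipe T" "pipe l" by (rule pair_sigma_finite_pipe)
  have c: "continuous_on {0..T} \<phi>" "continuous_on {0..T} (deriv \<phi>)"
    using test_function_has_L2_deriv[OF \<phi>] test_function_has_L2_deriv[OF test_function_deriv[OF \<phi>]]
    by (auto intro: has_L2_deriv_imp_continuous_on)
  have [measurable]: "(\<lambda>(t, x). u t x) \<in> borel_measurable (pipe T \<Otimes>\<^sub>M pipe l)"
    "(\<lambda>(t, x). g t x) \<in> borel_measurable (pipe T \<Otimes>\<^sub>M pipe l)"
    "\<psi> \<in> borel_measurable (pipe l)" "\<phi> \<in> borel_measurable (pipe T)" "deriv \<phi> \<in> borel_measurable (pipe T)"
    using u g \<psi> c by (auto simp: L2_time_bounded_def Lp2_measurable borel_measurable_pipe_continuous_on)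
  have [measurable]: "(\<lambda>(x, t). u t x) \<in> borel_measurable (pipe l \<Otimes>\<^sub>M pipe T)"
    "(\<lambda>(x, t). g t x) \<in> borel_measurable (pipe l \<Otimes>\<^sub>M pipe T)"
    using u[unfolded L2_time_bounded_def, THEN conjunct1, THEN measurable_pair_swap]
      g[unfolded L2_time_bounded_def, THEN conjunct1, THEN measurable_pair_swap] by simp_all
  have m1: "(\<lambda>x. \<integral>t. u t x * deriv \<phi> t \<partial>pipe T) \<in> borel_measurable (pipe l)"
    by (rule pipe.borel_measurable_lebesgue_integral) measurable
  have m2: "(\<lambda>x. \<integral>t. g t x * \<phi> t \<partial>pipe T) \<in> borel_measurable (pipe l)"
    by (rule pipe.borel_measurable_lebesgue_integral) measurable
  have ae: "AE x in pipe l. (\<integral>t. u t x * deriv \<phi> t \<partial>pipe T) * \<psi> x = - ((\<integral>t. g t x * \<phi> t \<partial>pipe T) * \<psi> x)"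
    using w[unfolded weak_time_deriv_def, rule_format, OF \<phi>] by (rule eventually_mono) simp
  have "(\<integral>t. pairing l u \<psi> t * deriv \<phi> t \<partial>pipe T) = (\<integral>x. (\<integral>t. u t x * deriv \<phi> t \<partial>pipe T) * \<psi> x \<partial>pipe l)"
    by (rule pairing_Fubini[OF u \<psi> K c(2)])
  also have "\<dots> = (\<integral>x. - ((\<integral>t. g t x * \<phi> t \<partial>pipe T) * \<psi> x) \<partial>pipe l)"
    using m1 m2 by (intro integral_cong_AE ae) measurable
  also have "\<dots> = - (\<integral>t. pairing l g \<psi> t * \<phi> t \<partial>pipe T)"
    by (simp add: pairing_Fubini[OF g \<psi> K c(1)])
  finally show "(\<integral>t. pairing l u \<psi> t * deriv \<phi> t \<partial>pipe T) = - (\<integral>t. pairing l g \<psi> t * \<phi> t \<partial>pipe T)" .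
qed

lemma tendsto_0_sqrt_bound:
  fixes f q :: "real \<Rightarrow> real"
  assumes q: "(q \<longlongrightarrow> 0) F" and le: "\<forall>\<^sub>F s in F. (f s)\<^sup>2 \<le> q s * c"
  shows "(f \<longlongrightarrow> 0) F"
proof -
  have "((\<lambda>s. q s * c) \<longlongrightarrow> 0 * c) F" by (intro tendsto_mult q tendsto_const)
  then have "((\<lambda>s. (f s)\<^sup>2) \<longlongrightarrow> 0) F"
    by (intro tendsto_sandwich[OF _ le tendsto_const]) auto
  then show ?thesis by simp
qed

lemma pairing_continuous:
  assumes u: "L2_continuous T l u" and \<psi>: "\<psi> \<in> Lp 2 l"
  shows "continuous_on {0..T} (pairing l u \<psi>)"
  unfolding continuous_on_def
proof
  fix t assume t: "t \<in> {0..T}"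
  have "((\<lambda>s. pairing l u \<psi> s - pairing l u \<psi> t) \<longlongrightarrow> 0) (at t within {0..T})"
  proof (rule tendsto_0_sqrt_bound)
    show "((\<lambda>s. \<integral>x. (u s x - u t x)\<^sup>2 \<partial>pipe l) \<longlongrightarrow> 0) (at t within {0..T})"
      using u t by (simp add: L2_continuous_def)
    show "\<forall>\<^sub>F s in at t within {0..T}. (pairing l u \<psi> s - pairing l u \<psi> t)\<^sup>2
      \<le> (\<integral>x. (u s x - u t x)\<^sup>2 \<partial>pipe l) * (\<integral>x. (\<psi> x)\<^sup>2 \<partial>pipe l)"
      unfolding eventually_at_filter
    proof (rule always_eventually, intro allI impI)
      fix s assume "s \<in> {0..T}"
      then have L: "u s \<in> Lp 2 l" "u t \<in> Lp 2 l" using u t by (auto simp: L2_continuous_def)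
      have "pairing l u \<psi> s - pairing l u \<psi> t = (\<integral>x. (u s x - u t x) * \<psi> x \<partial>pipe l)"
        using Lp2_mult[OF L(1) \<psi>] Lp2_mult[OF L(2) \<psi>] by (simp add: left_diff_distrib)
      then show "(pairing l u \<psi> s - pairing l u \<psi> t)\<^sup>2
          \<le> (\<integral>x. (u s x - u t x)\<^sup>2 \<partial>pipe l) * (\<integral>x. (\<psi> x)\<^sup>2 \<partial>pipe l)"
        using Lp2_Cauchy_Schwarz[OF Lp2_diff[OF L] \<psi>] by simp
    qed
  qed
  then show "(pairing l u \<psi> \<longlongrightarrow> pairing l u \<psi> t) (at t within {0..T})" by (rule LIM_zero_cancel)
qed

text \<open>Continuity in L2 makes the pairing continuous in time, so the weak scalar derivative
  yields increments between any two times, not just almost all.\<close>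

lemma pairing_has_L2_deriv:
  assumes "L2_continuous T l u" "L2_time_bounded T l K u" "L2_time_bounded T l K g"
    "weak_time_deriv T l u g" "\<psi> \<in> Lp 2 l" "0 \<le> K" "0 < T"
  shows "has_L2_deriv T (pairing l u \<psi>) (pairing l g \<psi>)"
  using assms by (intro has_weak_deriv_imp_has_L2_deriv pairing_continuous pairing_has_weak_deriv) auto

definition L2_time_deriv :: "real \<Rightarrow> real \<Rightarrow> (real \<Rightarrow> real \<Rightarrow> real) \<Rightarrow> (real \<Rightarrow> real \<Rightarrow> real) \<Rightarrow> bool" where
  "L2_time_deriv T l u u' \<longleftrightarrow> L2_continuous T l u \<and> L2_continuous T l u' \<and>
     (\<forall>t\<in>{0..T}. ((\<lambda>s. \<integral>x. ((u s x - u t x) / (s - t) - u' t x)\<^sup>2 \<partial>pipe l) \<longlongrightarrow> 0) (at t within {0..T}))"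

lemma pairing_C1:
  assumes u: "L2_time_deriv T l u u'" and \<psi>: "\<psi> \<in> Lp 2 l"
  shows "has_L2_deriv T (pairing l u \<psi>) (pairing l u' \<psi>)"
proof (rule has_L2_deriv_C1)
  have uc: "L2_continuous T l u" "L2_continuous T l u'" using u by (auto simp: L2_time_deriv_def)
  show "continuous_on {0..T} (pairing l u' \<psi>)" by (rule pairing_continuous[OF uc(2) \<psi>])
  fix t assume "0 \<le> t" "t \<le> T"
  then have t: "t \<in> {0..T}" by simp
  have "((\<lambda>s. (pairing l u \<psi> s - pairing l u \<psi> t) / (s - t) - pairing l u' \<psi> t) \<longlongrightarrow> 0) (at t within {0..T})"
  proof (rule tendsto_0_sqrt_bound)
    show "((\<lambda>s. \<integral>x. ((u s x - u t x) / (s - t) - u' t x)\<^sup>2 \<partial>pipe l) \<longlongrightarrow> 0) (at t within {0..T})"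
      using u t by (simp add: L2_time_deriv_def)
    show "\<forall>\<^sub>F s in at t within {0..T}. ((pairing l u \<psi> s - pairing l u \<psi> t) / (s - t) - pairing l u' \<psi> t)\<^sup>2
      \<le> (\<integral>x. ((u s x - u t x) / (s - t) - u' t x)\<^sup>2 \<partial>pipe l) * (\<integral>x. (\<psi> x)\<^sup>2 \<partial>pipe l)"
      unfolding eventually_at_filter
    proof (rule always_eventually, intro allI impI)
      fix s assume "s \<in> {0..T}"
      then have L: "u s \<in> Lp 2 l" "u t \<in> Lp 2 l" "u' t \<in> Lp 2 l" using uc t by (auto simp: L2_continuous_def)
      have "(pairing l u \<psi> s - pairing l u \<psi> t) / (s - t) - pairing l u' \<psi> t
          = (\<integral>x. ((u s x - u t x) / (s - t) - u' t x) * \<psi> x \<partial>pipe l)"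
        using L[THEN Lp2_mult[OF _ \<psi>]] by (simp add: left_diff_distrib diff_divide_distrib)
      then show "((pairing l u \<psi> s - pairing l u \<psi> t) / (s - t) - pairing l u' \<psi> t)\<^sup>2
          \<le> (\<integral>x. ((u s x - u t x) / (s - t) - u' t x)\<^sup>2 \<partial>pipe l) * (\<integral>x. (\<psi> x)\<^sup>2 \<partial>pipe l)"
        using Lp2_Cauchy_Schwarz[OF Lp2_diff[OF Lp2_divide[OF Lp2_diff[OF L(1,2)]] L(3)] \<psi>] by simp
    qed
  qed
  then show "(pairing l u \<psi> has_real_derivative pairing l u' \<psi> t) (at t within {0..T})"
    unfolding has_field_derivative_iff by (rule LIM_zero_cancel)
qed

text \<open>This connects the two notions of time derivative. The pairing of \<open>u\<close> has
  both the strong and the weak derivative as density, so they agree for almost every time; thus the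
  pairing of \<open>u'\<close> is the continuous representative of that of \<open>g\<close> and
  inherits its weak derivative.\<close>

lemma pairing_deriv_has_L2_deriv:
  assumes u: "L2_time_deriv T l u u'" and b: "L2_time_bounded T l K u" "L2_time_bounded T l K g" "L2_time_bounded T l K k"
    and w: "weak_time_deriv T l u g" "weak_time_deriv T l g k" and \<psi>: "\<psi> \<in> Lp 2 l" and K: "0 \<le> K" and T: "0 < T"
  shows "has_L2_deriv T (pairing l u' \<psi>) (pairing l k \<psi>)"
proof -
  have uc: "L2_continuous T l u" "L2_continuous T l u'" using u by (auto simp: L2_time_deriv_def)
  note c' = pairing_continuous[OF uc(2) \<psi>]
  have d1: "has_L2_deriv T (pairing l u \<psi>) (pairing l u' \<psi>)" by (rule pairing_C1[OF u \<psi>])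
  have d2: "has_L2_deriv T (pairing l u \<psi>) (pairing l g \<psi>)"
    by (rule pairing_has_L2_deriv[OF uc(1) b(1,2) w(1) \<psi> K T])
  have ae: "AE t in pipe T. pairing l u' \<psi> t = pairing l g \<psi> t"
    using has_L2_deriv_unique[OF d1 d2] T by simp
  have wd: "has_weak_deriv T (pairing l g \<psi>) (pairing l k \<psi>)"
    by (rule pairing_has_weak_deriv[OF b(2,3) w(2) \<psi> K])
  have "has_weak_deriv T (pairing l u' \<psi>) (pairing l k \<psi>)"
    unfolding has_weak_deriv_def
  proof (intro conjI allI impI Lp2_continuous[OF c'] pairing_Lp2[OF b(3) \<psi> K])
    fix \<phi> assume \<phi>: "test_function T \<phi>"
    have d: "deriv \<phi> \<in> borel_measurable (pipe T)"
      by (rule Lp2_measurable[OF has_L2_derivD(2)[OF test_function_has_L2_deriv[OF \<phi>]]])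
    have "(\<integral>t. pairing l u' \<psi> t * deriv \<phi> t \<partial>pipe T) = (\<integral>t. pairing l g \<psi> t * deriv \<phi> t \<partial>pipe T)"
    proof (rule integral_cong_AE)
      show "AE t in pipe T. pairing l u' \<psi> t * deriv \<phi> t = pairing l g \<psi> t * deriv \<phi> t"
        using ae by (rule eventually_mono) simp
    qed (use d borel_measurable_pipe_continuous_on[OF c'] pairing_measurable[OF b(2) \<psi>] in
        \<open>auto intro: borel_measurable_times\<close>)
    then show "(\<integral>t. pairing l u' \<psi> t * deriv \<phi> t \<partial>pipe T) = - (\<integral>t. pairing l k \<psi> t * \<phi> t \<partial>pipe T)"
      using wd \<phi> by (simp add: has_weak_deriv_def)
  qed
  then show ?thesis by (rule has_weak_deriv_imp_has_L2_deriv[OF c' _ T])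
qed

section \<open>Estimates in time recovered from the pairings\<close>

lemma has_L2_deriv_Lipschitz:
  assumes F: "has_L2_deriv T F H" and H: "AE t in pipe T. \<bar>H t\<bar> \<le> \<kappa>"
    and st: "s \<in> {0..T}" "t \<in> {0..T}"
  shows "\<bar>F t - F s\<bar> \<le> \<kappa> * \<bar>t - s\<bar>"
proof -
  have *: "\<bar>F t - F s\<bar> \<le> \<kappa> * (t - s)" if st: "0 \<le> s" "s \<le> t" "t \<le> T" for s t
  proof -
    have i: "integrable (pipe T) H" by (rule Lp2_integrable[OF has_L2_derivD(2)[OF F]])
    have "\<bar>F t - F s\<bar> \<le> (LINT r:{s<..<t}|pipe T. \<bar>H r\<bar>)" by (rule increment_le_integral_abs[OF F st])
    also have "\<dots> \<le> (LINT r:{s<..<t}|pipe T. \<kappa>)"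
      using H i st by (intro set_integral_mono_pipe) (auto elim: eventually_mono)
    also have "\<dots> = \<kappa> * (t - s)" using set_integral_const_pipe[OF st] by simp
    finally show ?thesis .
  qed
  show ?thesis
    using *[of s t] *[of t s] st by (cases "s \<le> t") (auto simp: abs_minus_commute)
qed

text \<open>The shape in which duality estimates end when a function is paired with itself:
  \<open>q\<close> is its squared norm, and one factor \<open>sqrt q\<close> can be divided
  out.\<close>

lemma square_le_of_self_bound:
  fixes q c :: real
  assumes "q \<le> c * sqrt q" "0 \<le> q" "0 \<le> c"
  shows "q \<le> c\<^sup>2"
proof (cases "q = 0")
  case False
  then have p: "0 < sqrt q" using assms by simp
  have "sqrt q * sqrt q \<le> c * sqrt q" using assms by simp
  then have "sqrt q \<le> c" using p mult_le_cancel_right_pos by blast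
  then have "(sqrt q)\<^sup>2 \<le> c\<^sup>2" using p by (intro power_mono) auto
  then show ?thesis using assms by simp
qed simp

text \<open>The increment of \<open>u'\<close> is paired with itself: the scalar function of time
  obtained this way is Lipschitz because its derivative is the pairing of \<open>k\<close>.\<close>

lemma L2_time_deriv_Lipschitz:
  assumes u: "L2_time_deriv T l u u'" and b: "L2_time_bounded T l K u" "L2_time_bounded T l K g" "L2_time_bounded T l K k"
    and w: "weak_time_deriv T l u g" "weak_time_deriv T l g k" and K: "0 \<le> K" and T: "0 < T"
    and st: "s \<in> {0..T}" "t \<in> {0..T}"
  shows "(\<integral>x. (u' t x - u' s x)\<^sup>2 \<partial>pipe l) \<le> (K * \<bar>t - s\<bar>)\<^sup>2"
proof -
  define \<psi> where "\<psi> x = u' t x - u' s x" for x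
  have L: "u' t \<in> Lp 2 l" "u' s \<in> Lp 2 l" using u st by (auto simp: L2_time_deriv_def L2_continuous_def)
  then have \<psi>: "\<psi> \<in> Lp 2 l" unfolding \<psi>_def by (intro Lp2_diff)
  define q where "q = (\<integral>x. (\<psi> x)\<^sup>2 \<partial>pipe l)"
  have "q = pairing l u' \<psi> t - pairing l u' \<psi> s"
    using Lp2_mult[OF L(1) \<psi>] Lp2_mult[OF L(2) \<psi>]
    by (simp add: q_def power2_eq_square left_diff_distrib \<psi>_def[of x for x, THEN arg_cong, of "\<lambda>y. y * \<psi> x" for x])
  also have "\<dots> \<le> K * sqrt q * \<bar>t - s\<bar>"
    unfolding q_def
    using has_L2_deriv_Lipschitz[OF pairing_deriv_has_L2_deriv[OF u b w \<psi> K T] pairing_bound[OF b(3) \<psi> K] st] by simp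
  finally have "q \<le> (K * \<bar>t - s\<bar>)\<^sup>2"
    using K by (intro square_le_of_self_bound) (auto simp: mult_ac q_def)
  then show ?thesis by (simp add: q_def \<psi>_def)
qed

text \<open>First-order Taylor estimate for the scalar pairing with the consistency error itself.
  Its derivative is Lipschitz with constant \<open>K * sqrt q\<close>, which bounds the mean of the
  derivative over \<open>[s,t]\<close> against its value at \<open>t\<close>.\<close>

lemma L2_difference_quotient:
  assumes u: "L2_time_deriv T l u u'" and b: "L2_time_bounded T l K u" "L2_time_bounded T l K g" "L2_time_bounded T l K k"
    and w: "weak_time_deriv T l u g" "weak_time_deriv T l g k" and K: "0 \<le> K" and T: "0 < T"
    and st: "0 \<le> s" "s < t" "t \<le> T"
  shows "(\<integral>x. ((u t x - u s x) / (t - s) - u' t x)\<^sup>2 \<partial>pipe l) \<le> (K * (t - s))\<^sup>2"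
proof -
  define \<psi> where "\<psi> x = (u t x - u s x) / (t - s) - u' t x" for x
  have L: "u t \<in> Lp 2 l" "u s \<in> Lp 2 l" "u' t \<in> Lp 2 l"
    using u st by (auto simp: L2_time_deriv_def L2_continuous_def)
  then have \<psi>: "\<psi> \<in> Lp 2 l" unfolding \<psi>_def by (intro Lp2_diff Lp2_divide)
  define q where "q = (\<integral>x. (\<psi> x)\<^sup>2 \<partial>pipe l)"
  define F where "F = pairing l u \<psi>"
  define F1 where "F1 = pairing l u' \<psi>"
  have F: "has_L2_deriv T F F1" unfolding F_def F1_def by (rule pairing_C1[OF u \<psi>])
  have i: "integrable (pipe T) F1" by (rule Lp2_integrable[OF has_L2_derivD(2)[OF F]])
  have near: "F1 r \<le> F1 t + K * sqrt q * (t - s)" if "r \<in> {s<..<t}" for r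
  proof -
    have "\<bar>F1 t - F1 r\<bar> \<le> K * sqrt q * \<bar>t - r\<bar>"
      unfolding q_def F1_def
      using that st by (intro has_L2_deriv_Lipschitz[OF pairing_deriv_has_L2_deriv[OF u b w \<psi> K T] pairing_bound[OF b(3) \<psi> K]]) auto
    also have "\<dots> \<le> K * sqrt q * (t - s)" using that K by (intro mult_left_mono) (auto simp: q_def)
    finally show ?thesis by linarith
  qed
  have "F t - F s = (LINT r:{s<..<t}|pipe T. F1 r)" using has_L2_derivD(1)[OF F] st by simp
  also have "\<dots> \<le> (LINT r:{s<..<t}|pipe T. F1 t + K * sqrt q * (t - s))"
    using near i st by (intro set_integral_mono_pipe) auto
  also have "\<dots> = (t - s) * (F1 t + K * sqrt q * (t - s))"
    using set_integral_const_pipe[of s t T] st by simp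
  finally have "(F t - F s) / (t - s) - F1 t \<le> K * sqrt q * (t - s)"
    using st by (simp add: field_simps)
  also have "(F t - F s) / (t - s) - F1 t = (\<integral>x. ((u t x - u s x) / (t - s) - u' t x) * \<psi> x \<partial>pipe l)"
    unfolding F_def F1_def
    using L[THEN Lp2_mult[OF _ \<psi>]] by (simp add: left_diff_distrib diff_divide_distrib)
  also have "\<dots> = q" unfolding q_def by (simp add: \<psi>_def power2_eq_square)
  finally have "q \<le> (K * (t - s))\<^sup>2"
    using K st by (intro square_le_of_self_bound) (auto simp: mult_ac q_def)
  then show ?thesis by (simp add: q_def \<psi>_def)
qed

text \<open>Duality between integrable and bounded functions. The increment is paired with its sign
  on the set \<open>A\<close> where it exceeds the claimed bound; the pairing grows at rate at most
  \<open>B\<close> times the measure of \<open>A\<close>. Hence the total excess over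
  \<open>A\<close> is not positive, and \<open>A\<close> is null.\<close>

lemma sup_increment_bound:
  assumes u: "L2_continuous T l u" and b: "L2_time_bounded T l K u" "L2_time_bounded T l K g"
    and w: "weak_time_deriv T l u g" and K: "0 \<le> K" and T: "0 < T"
    and B: "AE t in pipe T. \<forall>x\<in>{0<..<l}. \<bar>g t x\<bar> \<le> B" and st: "0 \<le> s" "s \<le> t" "t \<le> T"
  shows "AE x in pipe l. \<bar>u t x - u s x\<bar> \<le> B * (t - s)"
proof -
  define \<delta> where "\<delta> x = u t x - u s x" for x
  have L: "u t \<in> Lp 2 l" "u s \<in> Lp 2 l" using u st by (auto simp: L2_continuous_def)
  then have \<delta>: "\<delta> \<in> Lp 2 l" unfolding \<delta>_def by (intro Lp2_diff)
  note [measurable] = Lp2_measurable[OF \<delta>]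
  define A where "A = {x \<in> space (pipe l). B * (t - s) < \<bar>\<delta> x\<bar>}"
  have [measurable]: "A \<in> sets (pipe l)" unfolding A_def by measurable
  define \<psi> where "\<psi> x = indicator A x * sgn (\<delta> x)" for x
  have \<psi>1: "\<bar>\<psi> x\<bar> \<le> indicator A x" for x by (auto simp: \<psi>_def indicator_def sgn_if)
  have \<psi>: "\<psi> \<in> Lp 2 l"
    by (rule Lp2_bounded[of _ _ 1]) (unfold \<psi>_def, measurable, auto simp: indicator_def sgn_if)
  have iA: "integrable (pipe l) (indicator A :: real \<Rightarrow> real)"
    by (rule pipe.integrable_const_bound[of _ 1]) auto
  have AI: "A \<inter> {0<..<l} = A" by (auto simp: A_def)
  have gb: "AE r in pipe T. \<bar>pairing l g \<psi> r\<bar> \<le> B * measure (pipe l) A"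
    using B b(2)[unfolded L2_time_bounded_def, THEN conjunct2]
  proof eventually_elim
    case (elim r)
    have gi: "integrable (pipe l) (\<lambda>x. g r x * \<psi> x)" using elim \<psi> by (intro Lp2_mult) auto
    have "\<bar>pairing l g \<psi> r\<bar> \<le> (\<integral>x. \<bar>g r x * \<psi> x\<bar> \<partial>pipe l)" by (rule integral_abs_bound)
    also have "\<dots> \<le> (\<integral>x. B * indicator A x \<partial>pipe l)"
    proof (rule integral_mono)
      fix x assume x: "x \<in> space (pipe l)"
      then have gB: "\<bar>g r x\<bar> \<le> B" using elim by auto
      then have "0 \<le> B" using abs_ge_zero order_trans by blast
      then show "\<bar>g r x * \<psi> x\<bar> \<le> B * indicator A x"
        using gB \<psi>1[of x] unfolding abs_mult by (intro mult_mono) auto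
    qed (use gi iA in auto)
    also have "\<dots> = B * measure (pipe l) A" using iA by (simp add: AI)
    finally show ?case .
  qed
  have int1: "integrable (pipe l) (\<lambda>x. \<delta> x * \<psi> x)" by (rule Lp2_mult[OF \<delta> \<psi>])
  have "(\<integral>x. \<delta> x * \<psi> x \<partial>pipe l) = pairing l u \<psi> t - pairing l u \<psi> s"
    using Lp2_mult[OF L(1) \<psi>] Lp2_mult[OF L(2) \<psi>] by (simp add: \<delta>_def left_diff_distrib)
  also have "\<dots> \<le> B * measure (pipe l) A * (t - s)"
    using has_L2_deriv_Lipschitz[OF pairing_has_L2_deriv[OF u b w \<psi> K T] gb, of s t] st by simp
  finally have le: "(\<integral>x. \<delta> x * \<psi> x \<partial>pipe l) \<le> B * measure (pipe l) A * (t - s)" .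
  have eq: "\<delta> x * \<psi> x - B * (t - s) * indicator A x = indicator A x * (\<bar>\<delta> x\<bar> - B * (t - s))" for x
    by (auto simp: \<psi>_def indicator_def sgn_if abs_if)
  have int2: "integrable (pipe l) (\<lambda>x. indicator A x * (\<bar>\<delta> x\<bar> - B * (t - s)))"
    unfolding eq[symmetric] using int1 iA by (intro Bochner_Integration.integrable_diff integrable_mult_right)
  have nn: "0 \<le> indicator A x * (\<bar>\<delta> x\<bar> - B * (t - s))" for x by (auto simp: A_def indicator_def)
  have "(\<integral>x. indicator A x * (\<bar>\<delta> x\<bar> - B * (t - s)) \<partial>pipe l) = (\<integral>x. \<delta> x * \<psi> x \<partial>pipe l) - B * (t - s) * measure (pipe l) A"
    unfolding eq[symmetric] using int1 iA by (simp add: AI)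
  then have "(\<integral>x. indicator A x * (\<bar>\<delta> x\<bar> - B * (t - s)) \<partial>pipe l) \<le> 0" using le by (simp add: mult_ac)
  then have "(\<integral>x. indicator A x * (\<bar>\<delta> x\<bar> - B * (t - s)) \<partial>pipe l) = 0"
    by (intro antisym integral_nonneg_AE) (simp_all add: nn)
  then have "AE x in pipe l. indicator A x * (\<bar>\<delta> x\<bar> - B * (t - s)) = 0"
    using integral_nonneg_eq_0_iff_AE[OF int2] nn by simp
  with AE_space show ?thesis
    by eventually_elim (auto simp: A_def indicator_def \<delta>_def split: if_splits)
qed

section \<open>Projection and interpolation on a uniform mesh\<close>

locale uniform_mesh =
  fixes l :: real and k :: nat
  assumes l_pos: "0 < l" and k_pos: "1 \<le> k"
begin

definition h :: real where "h = l / real k"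

definition node :: "nat \<Rightarrow> real" where "node i = real i * h"

text \<open>The cell index is read off by the floor function, which gives a Borel function on the
  whole line without cases; the values at the nodes are immaterial.\<close>

definition step :: "(nat \<Rightarrow> real) \<Rightarrow> real \<Rightarrow> real" where "step c x = c (nat \<lfloor>x / h\<rfloor>)"

definition avg :: "(real \<Rightarrow> real) \<Rightarrow> nat \<Rightarrow> real" where
  "avg f i = (LINT t:{node i<..<node (Suc i)}|pipe l. f t) / h"

definition proj :: "(real \<Rightarrow> real) \<Rightarrow> real \<Rightarrow> real" where "proj f = step (avg f)"

section \<open>Geometry of the mesh and cellwise functions\<close>

lemma h_pos: "0 < h" using l_pos k_pos by (simp add: h_def)

lemma node_0 [simp]: "node 0 = 0" by (simp add: node_def)

lemma node_k [simp]: "node k = l" using k_pos by (simp add: node_def h_def)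

lemma node_Suc: "node (Suc i) = node i + h" by (simp add: node_def algebra_simps)

lemma node_mono: "i \<le> j \<Longrightarrow> node i \<le> node j" using h_pos by (simp add: node_def mult_right_mono)

lemma node_range: "i \<le> k \<Longrightarrow> 0 \<le> node i \<and> node i \<le> l"
  using node_mono[of 0 i] node_mono[of i k] by simp

lemma cell_range:
  assumes "i < k"
  shows "0 \<le> node i" "node i \<le> node (Suc i)" "node (Suc i) \<le> l" "node i < node (Suc i)"
  using assms node_range[of i] node_range[of "Suc i"] h_pos by (auto simp: node_Suc)

lemma step_cell: "x \<in> {node i<..<node (Suc i)} \<Longrightarrow> step c x = c i"
proof -
  assume "x \<in> {node i<..<node (Suc i)}"
  then have "real i \<le> x / h" "x / h < real i + 1"
    using h_pos by (auto simp: node_def field_simps)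
  then have "\<lfloor>x / h\<rfloor> = int i" by (intro floor_unique) auto
  then show ?thesis by (simp add: step_def)
qed

lemma ex_cell:
  assumes "x \<in> {0<..<l}" "x \<notin> node ` {..k}"
  shows "\<exists>i<k. x \<in> {node i<..<node (Suc i)}"
proof -
  have "\<exists>i<n. x \<in> {node i<..<node (Suc i)}" if "n \<le> k" "x < node n" for n
    using that
  proof (induction n)
    case 0
    then show ?case using assms(1) by simp
  next
    case (Suc n)
    have "x \<noteq> node n" using assms(2) Suc.prems by auto
    then show ?case using Suc by (cases "x < node n") (fastforce simp: less_Suc_eq)+
  qed
  from this[of k] show ?thesis using assms(1) by simp
qed

lemma AE_cell: "AE x in pipe l. \<exists>i<k. x \<in> {node i<..<node (Suc i)}"
proof -
  have "AE x in pipe l. x \<notin> node ` {..k}" by (rule AE_pipe_finite) simp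
  with AE_space show ?thesis by eventually_elim (auto intro: ex_cell simp del: greaterThanLessThan_iff)
qed

lemma AE_by_cells:
  assumes "\<And>i x. i < k \<Longrightarrow> x \<in> {node i<..<node (Suc i)} \<Longrightarrow> P x"
  shows "AE x in pipe l. P x"
  using AE_cell by (rule eventually_mono) (use assms in blast)

lemma measurable_by_cells:
  assumes f: "f \<in> borel_measurable (pipe l)"
    and eq: "\<And>i x. i < k \<Longrightarrow> x \<in> {node i<..<node (Suc i)} \<Longrightarrow> f x = (g x :: real)"
  shows "g \<in> borel_measurable (pipe l)"
proof (rule measurable_discrete_difference[OF f, of "{0<..<l} \<inter> node ` {..k}"])
  show "f x = g x" if "x \<in> space (pipe l)" "x \<notin> {0<..<l} \<inter> node ` {..k}" for x
    using ex_cell[of x] that eq by auto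
qed (auto simp: countable_finite pipe_def sets_restrict_space)

lemma step_borel: "step c \<in> borel_measurable borel"
  unfolding step_def[abs_def] by measurable

lemma step_measurable: "step c \<in> borel_measurable (pipe l)"
  by (rule borel_measurable_pipe[OF step_borel])

lemma step_Lp2: "step c \<in> Lp 2 l"
proof (rule Lp2_bounded[OF step_measurable])
  show "AE x in pipe l. \<bar>step c x\<bar> \<le> (\<Sum>i<k. \<bar>c i\<bar>)"
  proof (rule AE_by_cells)
    fix i x assume "i < k" "x \<in> {node i<..<node (Suc i)}"
    then show "\<bar>step c x\<bar> \<le> (\<Sum>i<k. \<bar>c i\<bar>)"
      using member_le_sum[of i "{..<k}" "\<lambda>i. \<bar>c i\<bar>"] by (simp add: step_cell)
  qed
qed

lemma integral_cells:
  fixes f :: "real \<Rightarrow> real"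
  assumes f: "integrable (pipe l) f"
  shows "(\<integral>x. f x \<partial>pipe l) = (\<Sum>i<k. LINT t:{node i<..<node (Suc i)}|pipe l. f t)"
proof -
  have "(LINT t:{0<..<node n}|pipe l. f t) = (\<Sum>i<n. LINT t:{node i<..<node (Suc i)}|pipe l. f t)" if "n \<le> k" for n
    using that
  proof (induction n)
    case 0
    then show ?case by (simp add: set_lebesgue_integral_def)
  next
    case (Suc n)
    then have "(LINT t:{0<..<node (Suc n)}|pipe l. f t)
       = (LINT t:{0<..<node n}|pipe l. f t) + (LINT t:{node n<..<node (Suc n)}|pipe l. f t)"
      using cell_range[of n] by (intro set_integral_split[OF f]) auto
    then show ?case using Suc by simp
  qed
  from this[of k] show ?thesis by (simp add: set_integral_whole_pipe)
qed

lemma set_integral_cell_cong: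
  assumes "\<And>t. t \<in> {x<..<y} \<Longrightarrow> f t = (g t :: real)"
  shows "(LINT t:{x<..<y}|pipe l. f t) = (LINT t:{x<..<y}|pipe l. g t)"
  unfolding set_lebesgue_integral_def
  using assms by (intro Bochner_Integration.integral_cong refl) (simp add: indicator_def)

lemma set_integral_cell_const: "i < k \<Longrightarrow> (LINT t:{node i<..<node (Suc i)}|pipe l. (c::real)) = h * c"
  using cell_range[of i] by (subst set_integral_const_pipe) (auto simp: node_Suc)

lemma integral_step_mult:
  fixes f :: "real \<Rightarrow> real"
  assumes "integrable (pipe l) f" "integrable (pipe l) (\<lambda>x. f x * step c x)"
  shows "(\<integral>x. f x * step c x \<partial>pipe l) = (\<Sum>i<k. (LINT t:{node i<..<node (Suc i)}|pipe l. f t) * c i)"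
  unfolding integral_cells[OF assms(2)]
proof (rule sum.cong[OF refl])
  fix i
  have "(LINT t:{node i<..<node (Suc i)}|pipe l. f t * step c t) = (LINT t:{node i<..<node (Suc i)}|pipe l. f t * c i)"
    by (rule set_integral_cell_cong) (simp add: step_cell)
  then show "(LINT t:{node i<..<node (Suc i)}|pipe l. f t * step c t) = (LINT t:{node i<..<node (Suc i)}|pipe l. f t) * c i"
    by simp
qed

section \<open>The L2 projection onto cellwise constants\<close>

lemma proj_Lp2: "proj f \<in> Lp 2 l" unfolding proj_def by (rule step_Lp2)

lemma set_integral_proj_cell:
  assumes i: "i < k"
  shows "(LINT t:{node i<..<node (Suc i)}|pipe l. proj f t) = (LINT t:{node i<..<node (Suc i)}|pipe l. f t)"
proof -
  have "(LINT t:{node i<..<node (Suc i)}|pipe l. proj f t) = (LINT t:{node i<..<node (Suc i)}|pipe l. avg f i)"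
    by (rule set_integral_cell_cong) (simp add: proj_def step_cell)
  then show ?thesis using h_pos by (simp add: set_integral_cell_const[OF i] avg_def)
qed

lemma proj_orthogonal:
  assumes f: "f \<in> Lp 2 l"
  shows "(\<integral>x. proj f x * step c x \<partial>pipe l) = (\<integral>x. f x * step c x \<partial>pipe l)"
  using f proj_Lp2[of f] step_Lp2[of c]
  by (subst (1 2) integral_step_mult) (auto simp: set_integral_proj_cell intro: Lp2_integrable Lp2_mult)

text \<open>By orthogonality the squared norm of \<open>f - proj f\<close> is the difference of the
  two sides.\<close>

lemma proj_contraction:
  assumes f: "f \<in> Lp 2 l"
  shows "(\<integral>x. (proj f x)\<^sup>2 \<partial>pipe l) \<le> (\<integral>x. (f x)\<^sup>2 \<partial>pipe l)"
proof -
  have i: "integrable (pipe l) (\<lambda>x. (f x)\<^sup>2)" "integrable (pipe l) (\<lambda>x. (proj f x)\<^sup>2)"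
    "integrable (pipe l) (\<lambda>x. f x * proj f x)"
    using f proj_Lp2 by (auto intro: Lp2_square Lp2_mult)
  have eq: "(\<integral>x. (proj f x)\<^sup>2 \<partial>pipe l) = (\<integral>x. f x * proj f x \<partial>pipe l)"
    using proj_orthogonal[OF f, of "avg f"] by (simp add: proj_def power2_eq_square)
  have "0 \<le> (\<integral>x. (f x - proj f x)\<^sup>2 \<partial>pipe l)" by simp
  also have "\<dots> = (\<integral>x. (f x)\<^sup>2 - 2 * (f x * proj f x) + (proj f x)\<^sup>2 \<partial>pipe l)"
    by (rule Bochner_Integration.integral_cong) (auto simp: power2_eq_square algebra_simps)
  also have "\<dots> = (\<integral>x. (f x)\<^sup>2 \<partial>pipe l) - (\<integral>x. (proj f x)\<^sup>2 \<partial>pipe l)" using i by (simp add: eq)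
  finally show ?thesis by simp
qed

lemma avg_linear:
  assumes "integrable (pipe l) f" "integrable (pipe l) g"
  shows "avg (\<lambda>x. a * f x + b * g x) i = a * avg f i + b * avg g i"
  using integrable_indicator_pipe[OF assms(1)] integrable_indicator_pipe[OF assms(2)]
  by (simp add: avg_def set_lebesgue_integral_def distrib_left mult.left_commute add_divide_distrib)

lemma proj_linear:
  assumes "integrable (pipe l) f" "integrable (pipe l) g"
  shows "proj (\<lambda>x. a * f x + b * g x) x = a * proj f x + b * proj g x"
  using avg_linear[OF assms] by (simp add: proj_def step_def)

text \<open>The common core of the approximation estimates: Cauchy-Schwarz on a cell gives one
  factor \<open>h\<close>, and integration of the resulting constant over the cell gives the
  second.\<close>

lemma cellwise_square_bound:
  assumes d: "d \<in> Lp 2 l" and g: "g \<in> Lp 2 l"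
    and le: "\<And>i x. i < k \<Longrightarrow> x \<in> {node i<..<node (Suc i)} \<Longrightarrow>
      \<bar>d x\<bar> \<le> (LINT t:{node i<..<node (Suc i)}|pipe l. \<bar>g t\<bar>)"
  shows "(\<integral>x. (d x)\<^sup>2 \<partial>pipe l) \<le> h\<^sup>2 * (\<integral>x. (g x)\<^sup>2 \<partial>pipe l)"
proof -
  have "(\<integral>x. (d x)\<^sup>2 \<partial>pipe l) = (\<Sum>i<k. LINT t:{node i<..<node (Suc i)}|pipe l. (d t)\<^sup>2)"
    by (rule integral_cells[OF Lp2_square[OF d]])
  also have "\<dots> \<le> (\<Sum>i<k. h\<^sup>2 * (LINT t:{node i<..<node (Suc i)}|pipe l. (g t)\<^sup>2))"
  proof (rule sum_mono)
    fix i assume "i \<in> {..<k}"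
    then have i: "i < k" by simp
    define V where "V = (LINT t:{node i<..<node (Suc i)}|pipe l. \<bar>g t\<bar>)"
    define W where "W = (LINT t:{node i<..<node (Suc i)}|pipe l. (g t)\<^sup>2)"
    have V: "V\<^sup>2 \<le> h * W"
      unfolding V_def W_def using set_integral_square_bound[OF g cell_range(1-3)[OF i]] by (simp add: node_Suc)
    have "(LINT t:{node i<..<node (Suc i)}|pipe l. (d t)\<^sup>2) \<le> (LINT t:{node i<..<node (Suc i)}|pipe l. h * W)"
    proof (rule set_integral_mono_pipe)
      show "AE t in pipe l. t \<in> {node i<..<node (Suc i)} \<longrightarrow> (d t)\<^sup>2 \<le> h * W"
      proof (intro AE_I2 impI)
        fix t assume "t \<in> {node i<..<node (Suc i)}"
        then have "(d t)\<^sup>2 \<le> V\<^sup>2" using power_mono[OF le[OF i], of t 2] by (simp add: V_def)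
        then show "(d t)\<^sup>2 \<le> h * W" using V by simp
      qed
    qed (use Lp2_square[OF d] cell_range[OF i] in auto)
    also have "\<dots> = h\<^sup>2 * W" using set_integral_cell_const[OF i] by (simp add: power2_eq_square)
    finally show "(LINT t:{node i<..<node (Suc i)}|pipe l. (d t)\<^sup>2) \<le> h\<^sup>2 * (LINT t:{node i<..<node (Suc i)}|pipe l. (g t)\<^sup>2)"
      by (simp add: W_def)
  qed
  also have "\<dots> = h\<^sup>2 * (\<integral>x. (g x)\<^sup>2 \<partial>pipe l)"
    by (simp add: integral_cells[OF Lp2_square[OF g]] sum_distrib_left)
  finally show ?thesis .
qed

lemma cell_oscillation:
  assumes u: "has_L2_deriv l u g" and i: "i < k"
    and xy: "x \<in> {node i..node (Suc i)}" "y \<in> {node i..node (Suc i)}"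
  shows "\<bar>u x - u y\<bar> \<le> (LINT t:{node i<..<node (Suc i)}|pipe l. \<bar>g t\<bar>)"
proof -
  have *: "\<bar>u y - u x\<bar> \<le> (LINT t:{node i<..<node (Suc i)}|pipe l. \<bar>g t\<bar>)"
    if "x \<le> y" "x \<in> {node i..node (Suc i)}" "y \<in> {node i..node (Suc i)}" for x y
  proof -
    have "\<bar>u y - u x\<bar> \<le> (LINT t:{x<..<y}|pipe l. \<bar>g t\<bar>)"
      using that cell_range[OF i] by (intro increment_le_integral_abs[OF u]) auto
    also have "\<dots> \<le> (LINT t:{node i<..<node (Suc i)}|pipe l. \<bar>g t\<bar>)"
      using that by (intro abs_integral_mono_interval Lp2_integrable[OF has_L2_derivD(2)[OF u]]) auto
    finally show ?thesis .
  qed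
  show ?thesis using *[of x y] *[of y x] xy by (cases "x \<le> y") (auto simp: abs_minus_commute)
qed

text \<open>A cell mean differs from any value in the cell by at most the oscillation of
  \<open>u\<close> there.\<close>

lemma proj_error:
  assumes u: "has_L2_deriv l u g"
  shows "(\<integral>x. (u x - proj u x)\<^sup>2 \<partial>pipe l) \<le> h\<^sup>2 * (\<integral>x. (g x)\<^sup>2 \<partial>pipe l)"
proof (rule cellwise_square_bound)
  have u2: "u \<in> Lp 2 l" by (rule Lp2_continuous[OF has_L2_deriv_imp_continuous_on[OF u]])
  show "(\<lambda>x. u x - proj u x) \<in> Lp 2 l" by (rule Lp2_diff[OF u2 proj_Lp2])
  show "g \<in> Lp 2 l" by (rule has_L2_derivD(2)[OF u])
  fix i x assume i: "i < k" and x: "x \<in> {node i<..<node (Suc i)}"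
  define V where "V = (LINT t:{node i<..<node (Suc i)}|pipe l. \<bar>g t\<bar>)"
  have ui: "integrable (pipe l) u" by (rule Lp2_integrable[OF u2])
  have m: "proj u x = (LINT t:{node i<..<node (Suc i)}|pipe l. u t) / h"
    using x by (simp add: proj_def step_cell avg_def)
  have osc: "\<bar>u x - u t\<bar> \<le> V" if "t \<in> {node i<..<node (Suc i)}" for t
    unfolding V_def using that x by (intro cell_oscillation[OF u i]) auto
  have osc': "u t \<le> u x + V" "u x - V \<le> u t" if "t \<in> {node i<..<node (Suc i)}" for t
    using osc[OF that] by linarith+
  have "(LINT t:{node i<..<node (Suc i)}|pipe l. u t) \<le> (LINT t:{node i<..<node (Suc i)}|pipe l. u x + V)"
    using ui cell_range[OF i] by (intro set_integral_mono_pipe AE_I2 impI osc') simp_all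
  moreover have "(LINT t:{node i<..<node (Suc i)}|pipe l. u x - V) \<le> (LINT t:{node i<..<node (Suc i)}|pipe l. u t)"
    using ui cell_range[OF i] by (intro set_integral_mono_pipe AE_I2 impI osc') simp_all
  ultimately have "h * (u x - V) \<le> proj u x * h" "proj u x * h \<le> h * (u x + V)"
    using h_pos by (simp_all add: set_integral_cell_const[OF i] m)
  then have "u x - V \<le> proj u x" "proj u x \<le> u x + V"
    using h_pos by (simp_all add: mult.commute[of _ h])
  then show "\<bar>u x - proj u x\<bar> \<le> V" by (simp add: abs_le_iff)
qed

text \<open>If \<open>g\<close> is the weak derivative of \<open>u\<close>, the primitive of the projection of \<open>g\<close> with initial value
  \<open>u 0\<close> is the nodal interpolant of \<open>u\<close>.\<close>

definition interp :: "(real \<Rightarrow> real) \<Rightarrow> (real \<Rightarrow> real) \<Rightarrow> real \<Rightarrow> real" where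
  "interp u g x = u 0 + (LINT t:{0<..<x}|pipe l. proj g t)"

section \<open>Nodal interpolation\<close>

lemma interp_has_L2_deriv: "has_L2_deriv l (interp u g) (proj g)"
  using has_L2_deriv_indefinite_integral[OF proj_Lp2[of g]] by (simp add: has_L2_deriv_def interp_def)

lemma interp_node:
  assumes u: "has_L2_deriv l u g" and "i \<le> k"
  shows "interp u g (node i) = u (node i)"
  using \<open>i \<le> k\<close>
proof (induction i)
  case 0
  then show ?case by (simp add: interp_def set_lebesgue_integral_def)
next
  case (Suc i)
  then have i: "i < k" by simp
  have "interp u g (node (Suc i)) - interp u g (node i) = (LINT t:{node i<..<node (Suc i)}|pipe l. g t)"
    using has_L2_derivD(1)[OF interp_has_L2_deriv cell_range(1-3)[OF i], of u g] by (simp add: set_integral_proj_cell i)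
  also have "\<dots> = u (node (Suc i)) - u (node i)"
    using has_L2_derivD(1)[OF u cell_range(1-3)[OF i]] by simp
  finally show ?case using Suc by simp
qed

lemma L2_deriv_step_affine:
  assumes v: "has_L2_deriv l v (step c)" and i: "i < k" and x: "x \<in> {node i..node (Suc i)}"
  shows "v x = v (node i) + c i * (x - node i)"
proof -
  have "v x - v (node i) = (LINT t:{node i<..<x}|pipe l. step c t)"
    using x cell_range[OF i] by (intro has_L2_derivD(1)[OF v]) auto
  also have "\<dots> = (LINT t:{node i<..<x}|pipe l. c i)"
    using x by (intro set_integral_cell_cong step_cell) auto
  also have "\<dots> = (x - node i) * c i"
    using x cell_range[OF i] by (intro set_integral_const_pipe) auto
  finally show ?thesis by (simp add: algebra_simps)
qed

text \<open>On a cell, \<open>v\<close> is a convex combination of the two nodal values of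
  \<open>u\<close>, each within the oscillation of \<open>u x\<close>. Any \<open>v\<close> with
  cellwise constant derivative and the right nodal values is allowed, so the bound covers
  \<open>interp\<close>, differences of interpolants, and the discrete initial flux.\<close>

lemma interp_error:
  assumes u: "has_L2_deriv l u g"
    and v: "has_L2_deriv l v (step c)" "\<And>i. i \<le> k \<Longrightarrow> v (node i) = u (node i)"
  shows "(\<integral>x. (u x - v x)\<^sup>2 \<partial>pipe l) \<le> h\<^sup>2 * (\<integral>x. (g x)\<^sup>2 \<partial>pipe l)"
proof (rule cellwise_square_bound)
  show "(\<lambda>x. u x - v x) \<in> Lp 2 l"
    using u v by (intro Lp2_diff Lp2_continuous has_L2_deriv_imp_continuous_on)
  show "g \<in> Lp 2 l" by (rule has_L2_derivD(2)[OF u])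
  fix i x assume i: "i < k" and x: "x \<in> {node i<..<node (Suc i)}"
  define V where "V = (LINT t:{node i<..<node (Suc i)}|pipe l. \<bar>g t\<bar>)"
  define s where "s = (x - node i) / h"
  have s: "0 \<le> s" "s \<le> 1" using x h_pos by (auto simp: s_def node_Suc)
  have osc: "\<bar>u x - u (node i)\<bar> \<le> V" "\<bar>u x - u (node (Suc i))\<bar> \<le> V"
    unfolding V_def using x by (intro cell_oscillation[OF u i]; auto simp: node_Suc h_pos less_imp_le)+
  have "u (node (Suc i)) = u (node i) + c i * h"
    using L2_deriv_step_affine[OF v(1) i, of "node (Suc i)"] v(2)[of i] v(2)[of "Suc i"] i cell_range(2)[OF i]
    by (simp add: node_Suc)
  then have ci: "c i = (u (node (Suc i)) - u (node i)) / h" using h_pos by (simp add: field_simps)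
  have "v x = u (node i) + (u (node (Suc i)) - u (node i)) * s"
    using L2_deriv_step_affine[OF v(1) i, of x] x v(2)[of i] i by (simp add: ci s_def)
  then have "u x - v x = (1 - s) * (u x - u (node i)) + s * (u x - u (node (Suc i)))"
    by (simp add: algebra_simps)
  also have "\<bar>\<dots>\<bar> \<le> (1 - s) * \<bar>u x - u (node i)\<bar> + s * \<bar>u x - u (node (Suc i))\<bar>"
    using s by (intro order_trans[OF abs_triangle_ineq]) (simp add: abs_mult)
  also have "\<dots> \<le> (1 - s) * V + s * V" using s osc by (intro add_mono mult_left_mono) auto
  finally show "\<bar>u x - v x\<bar> \<le> V" by (simp add: algebra_simps)
qed

text \<open>A gain of \<open>h\<close> and of \<open>t - s\<close> at once. The projection error
  \<open>\<psi>\<close> of the increment is orthogonal to all step functions; therefore its pairing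
  with \<open>g r\<close> sees only \<open>g r - proj (g r)\<close>, which is of order
  \<open>h\<close> because \<open>g r\<close> lies in H1. No exchange of time and space derivatives
  is required.\<close>

lemma projection_increment_bound:
  assumes u: "L2_continuous T l u" and b: "L2_time_bounded T l K u" "L2_time_bounded T l K g"
    and w: "weak_time_deriv T l u g" and K: "0 \<le> K" and T: "0 < T"
    and H: "AE t in pipe T. \<exists>q. has_L2_deriv l (g t) q \<and> (\<integral>x. (q x)\<^sup>2 \<partial>pipe l) \<le> K\<^sup>2"
    and st: "0 \<le> s" "s \<le> t" "t \<le> T"
  shows "(\<integral>x. ((u t x - u s x) - proj (\<lambda>x. u t x - u s x) x)\<^sup>2 \<partial>pipe l) \<le> (h * K * (t - s))\<^sup>2"
proof -
  define \<delta> where "\<delta> x = u t x - u s x" for x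
  have L: "u t \<in> Lp 2 l" "u s \<in> Lp 2 l" using u st by (auto simp: L2_continuous_def)
  then have \<delta>: "\<delta> \<in> Lp 2 l" unfolding \<delta>_def by (intro Lp2_diff)
  define \<psi> where "\<psi> x = \<delta> x - proj \<delta> x" for x
  have \<psi>: "\<psi> \<in> Lp 2 l" unfolding \<psi>_def by (rule Lp2_diff[OF \<delta> proj_Lp2])
  have orth: "(\<integral>x. proj f x * \<psi> x \<partial>pipe l) = 0" for f
  proof -
    have "(\<integral>x. proj f x * \<psi> x \<partial>pipe l) = (\<integral>x. \<delta> x * proj f x - proj \<delta> x * proj f x \<partial>pipe l)"
      by (rule Bochner_Integration.integral_cong) (auto simp: \<psi>_def algebra_simps)
    also have "\<dots> = (\<integral>x. \<delta> x * proj f x \<partial>pipe l) - (\<integral>x. proj \<delta> x * proj f x \<partial>pipe l)"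
      by (intro Bochner_Integration.integral_diff Lp2_mult \<delta> proj_Lp2)
    also have "\<dots> = 0" using proj_orthogonal[OF \<delta>, of "avg f"] by (simp add: proj_def)
    finally show ?thesis .
  qed
  define q where "q = (\<integral>x. (\<psi> x)\<^sup>2 \<partial>pipe l)"
  have "AE r in pipe T. \<bar>pairing l g \<psi> r\<bar> \<le> h * K * sqrt q"
    using H
  proof eventually_elim
    case (elim r)
    then obtain p where p: "has_L2_deriv l (g r) p" "(\<integral>x. (p x)\<^sup>2 \<partial>pipe l) \<le> K\<^sup>2" by auto
    have gL: "g r \<in> Lp 2 l" by (rule Lp2_continuous[OF has_L2_deriv_imp_continuous_on[OF p(1)]])
    have d: "(\<lambda>x. g r x - proj (g r) x) \<in> Lp 2 l" by (rule Lp2_diff[OF gL proj_Lp2])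
    have "(\<integral>x. (g r x - proj (g r) x)\<^sup>2 \<partial>pipe l) \<le> h\<^sup>2 * (\<integral>x. (p x)\<^sup>2 \<partial>pipe l)" by (rule proj_error[OF p(1)])
    also have "\<dots> \<le> (h * K)\<^sup>2" using p(2) by (simp add: power_mult_distrib mult_left_mono)
    finally have "\<bar>\<integral>x. (g r x - proj (g r) x) * \<psi> x \<partial>pipe l\<bar> \<le> h * K * sqrt q"
      unfolding q_def using K h_pos by (intro Lp2_pairing_bound[OF d \<psi>]) auto
    moreover have "(\<integral>x. (g r x - proj (g r) x) * \<psi> x \<partial>pipe l) = pairing l g \<psi> r"
      using orth[of "g r"] Lp2_mult[OF gL \<psi>] Lp2_mult[OF proj_Lp2 \<psi>, of "g r"] by (simp add: left_diff_distrib)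
    ultimately show ?case by simp
  qed
  from has_L2_deriv_Lipschitz[OF pairing_has_L2_deriv[OF u b w \<psi> K T] this, of s t]
  have le: "pairing l u \<psi> t - pairing l u \<psi> s \<le> h * K * sqrt q * (t - s)" using st by simp
  have eq: "q = pairing l u \<psi> t - pairing l u \<psi> s"
  proof -
    have "q = (\<integral>x. \<delta> x * \<psi> x - proj \<delta> x * \<psi> x \<partial>pipe l)"
      by (simp add: q_def power2_eq_square) (simp add: \<psi>_def algebra_simps)
    also have "\<dots> = (\<integral>x. \<delta> x * \<psi> x \<partial>pipe l) - (\<integral>x. proj \<delta> x * \<psi> x \<partial>pipe l)"
      by (intro Bochner_Integration.integral_diff Lp2_mult \<delta> proj_Lp2 \<psi>)
    also have "\<dots> = (\<integral>x. \<delta> x * \<psi> x \<partial>pipe l)" by (simp add: orth)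
    also have "\<dots> = pairing l u \<psi> t - pairing l u \<psi> s"
      using Lp2_mult[OF L(1) \<psi>] Lp2_mult[OF L(2) \<psi>] by (simp add: \<delta>_def left_diff_distrib)
    finally show ?thesis .
  qed
  have "q \<le> h * K * (t - s) * sqrt q" using le unfolding eq[symmetric] by (simp add: mult_ac)
  then have "q \<le> (h * K * (t - s))\<^sup>2"
    using K st h_pos by (intro square_le_of_self_bound) (simp_all add: q_def)
  then show ?thesis unfolding q_def \<psi>_def \<delta>_def[abs_def] .
qed

end

section \<open>The relative energy density\<close>

text \<open>\<open>L\<close> is both a bound and a Lipschitz constant for \<open>P2\<close>, on a
  range strictly larger than the admissible densities. The room between the two ranges accommodates
  densities translated by an exact time increment.\<close>

locale gas_law =
  fixes P P1 P2 :: "real \<Rightarrow> real" and \<rho>lo \<rho>hi wbar \<epsilon>bar L :: real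
  assumes dP: "\<And>r. 0 < r \<Longrightarrow> (P has_real_derivative P1 r) (at r)"
    and dP1: "\<And>r. 0 < r \<Longrightarrow> (P1 has_real_derivative P2 r) (at r)"
    and pos: "0 < \<rho>lo" "\<rho>lo \<le> \<rho>hi" "0 < wbar" "0 < \<epsilon>bar" "0 < L"
    and P2_bound: "\<And>r. r \<in> {\<rho>lo / 2..2 * \<rho>hi} \<Longrightarrow> \<bar>P2 r\<bar> \<le> L"
    and P2_Lipschitz: "\<And>r s. r \<in> {\<rho>lo / 2..2 * \<rho>hi} \<Longrightarrow> s \<in> {\<rho>lo / 2..2 * \<rho>hi} \<Longrightarrow> \<bar>P2 r - P2 s\<bar> \<le> L * \<bar>r - s\<bar>"
    and subsonic: "\<And>r. r \<in> {2 * \<rho>lo / 3..3 * \<rho>hi / 2} \<Longrightarrow> 4 * \<epsilon>bar\<^sup>2 * wbar\<^sup>2 \<le> r * P2 r"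
begin

text \<open>The enlargement of the admissible set of states by \<open>\<kappa>\<close> in both variables uses up only a part of the
  factor 4 in \<open>subsonic\<close>, so that the energy stays convex there.\<close>

definition \<kappa> :: real where
  "\<kappa> = min (min (wbar / 4) (\<rho>lo / 6)) (\<epsilon>bar\<^sup>2 * wbar\<^sup>2 / (2 * L * (1 + 2 * \<rho>hi)))"

lemma \<kappa>: "0 < \<kappa>" "\<kappa> \<le> wbar / 4" "\<kappa> \<le> \<rho>lo / 6" "\<kappa> * L * (1 + 2 * \<rho>hi) \<le> \<epsilon>bar\<^sup>2 * wbar\<^sup>2 / 2"
proof -
  have p: "0 < 2 * L * (1 + 2 * \<rho>hi)" using pos by simp
  then show "0 < \<kappa>" using pos by (simp add: \<kappa>_def)
  show "\<kappa> \<le> wbar / 4" "\<kappa> \<le> \<rho>lo / 6" by (auto simp: \<kappa>_def min_def)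
  have "\<kappa> \<le> \<epsilon>bar\<^sup>2 * wbar\<^sup>2 / (2 * L * (1 + 2 * \<rho>hi))" by (simp add: \<kappa>_def)
  then have "\<kappa> * (2 * L * (1 + 2 * \<rho>hi)) \<le> \<epsilon>bar\<^sup>2 * wbar\<^sup>2" using p by (simp only: pos_le_divide_eq)
  then show "\<kappa> * L * (1 + 2 * \<rho>hi) \<le> \<epsilon>bar\<^sup>2 * wbar\<^sup>2 / 2" by (simp add: algebra_simps)
qed

definition U :: "real \<Rightarrow> real \<Rightarrow> real \<Rightarrow> real" where "U \<epsilon> r w = \<epsilon>\<^sup>2 / 2 * r * w\<^sup>2 + P r"

text \<open>The derivative of \<open>U\<close> with respect to the density, that is, the specific
  enthalpy; the derivative with respect to the velocity is
  \<open>\<epsilon>\<^sup>2 * r * w\<close>, proportional to the mass flux. Below,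
  \<open>(r, w)\<close> is the base point and \<open>(R, W)\<close> the other state.\<close>

definition enth :: "real \<Rightarrow> real \<Rightarrow> real \<Rightarrow> real" where "enth \<epsilon> r w = \<epsilon>\<^sup>2 / 2 * w\<^sup>2 + P1 r"

definition rel_energy :: "real \<Rightarrow> real \<Rightarrow> real \<Rightarrow> real \<Rightarrow> real \<Rightarrow> real" where
  "rel_energy \<epsilon> r w R W = U \<epsilon> R W - U \<epsilon> r w - enth \<epsilon> r w * (R - r) - \<epsilon>\<^sup>2 * r * w * (W - w)"

text \<open>Taylor's theorem with Lagrange remainder for \<open>U\<close> on the segment between the
  two states; the bracket is the Hessian of \<open>U\<close> at an intermediate state, applied to
  the difference.\<close>

lemma rel_energy_Taylor:
  assumes "0 < r" "0 < R"
  shows "\<exists>s. 0 < s \<and> s < 1 \<and> rel_energy \<epsilon> r w R W =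
    (P2 (r + s * (R - r)) * (R - r)\<^sup>2
      + \<epsilon>\<^sup>2 * (2 * (w + s * (W - w)) * (R - r) * (W - w) + (r + s * (R - r)) * (W - w)\<^sup>2)) / 2"
proof -
  define dr dw where "dr = R - r" and "dw = W - w"
  define f where "f s = U \<epsilon> (r + s * dr) (w + s * dw)" for s
  define f1 where "f1 s = \<epsilon>\<^sup>2 / 2 * (dr * (w + s * dw)\<^sup>2 + 2 * (r + s * dr) * (w + s * dw) * dw) + P1 (r + s * dr) * dr" for s
  define f2 where "f2 s = P2 (r + s * dr) * dr\<^sup>2 + \<epsilon>\<^sup>2 * (2 * (w + s * dw) * dr * dw + (r + s * dr) * dw\<^sup>2)" for s
  have p: "0 < r + s * dr" if "0 \<le> s" "s \<le> 1" for s
  proof -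
    have "r + s * dr = (1 - s) * r + s * R" by (simp add: dr_def algebra_simps)
    moreover have "0 < (1 - s) * r + s * R"
      using that assms by (cases "s = 0") (auto intro!: add_nonneg_pos)
    ultimately show ?thesis by simp
  qed
  have dPs: "((\<lambda>s. P (r + s * dr)) has_real_derivative P1 (r + s * dr) * dr) (at s)"
    "((\<lambda>s. P1 (r + s * dr)) has_real_derivative P2 (r + s * dr) * dr) (at s)" if "0 \<le> s" "s \<le> 1" for s
    using p[OF that]
    by (auto intro!: DERIV_chain2[where f = P and g = "\<lambda>s. r + s * dr", OF dP]
        DERIV_chain2[where f = P1 and g = "\<lambda>s. r + s * dr", OF dP1] derivative_eq_intros)
  have d0: "(f has_real_derivative f1 s) (at s)" if "0 \<le> s" "s \<le> 1" for s
    unfolding f_def[abs_def] U_def f1_def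
    by (auto intro!: derivative_eq_intros dPs[OF that] simp: power2_eq_square algebra_simps)
  have d1: "(f1 has_real_derivative f2 s) (at s)" if "0 \<le> s" "s \<le> 1" for s
    unfolding f1_def[abs_def] f2_def
    by (auto intro!: derivative_eq_intros dPs[OF that] simp: power2_eq_square algebra_simps)
  define diff where "diff m = (if m = 0 then f else if m = 1 then f1 else f2)" for m :: nat
  have "\<exists>t>0. t < 1 \<and> f 1 = (\<Sum>m<2. diff m 0 / fact m * 1 ^ m) + diff 2 t / fact 2 * 1 ^ 2"
  proof (rule Maclaurin)
    show "\<forall>m t. m < 2 \<and> 0 \<le> t \<and> t \<le> 1 \<longrightarrow> (diff m has_real_derivative diff (Suc m) t) (at t)"
    proof (intro allI impI)
      fix m :: nat and t :: real assume a: "m < 2 \<and> 0 \<le> t \<and> t \<le> 1"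
      then have "m = 0 \<or> m = 1" by auto
      then show "(diff m has_real_derivative diff (Suc m) t) (at t)"
        using a d0[of t] d1[of t] by (auto simp: diff_def)
    qed
  qed (auto simp: diff_def)
  then obtain t where t: "0 < t" "t < 1" "f 1 = f 0 + f1 0 + f2 t / 2"
    by (auto simp: diff_def numeral_2_eq_2)
  have "rel_energy \<epsilon> r w R W = f 1 - f 0 - f1 0"
    by (simp add: rel_energy_def f_def f1_def dr_def dw_def enth_def field_simps power2_eq_square)
  then show ?thesis using t by (auto simp: f2_def dr_def dw_def)
qed

text \<open>After multiplication by \<open>r\<close> the square
  \<open>\<epsilon>\<^sup>2 * (w * x + r * y)\<^sup>2\<close> can be completed;
  \<open>\<epsilon>\<close> remains a common factor and is never divided out.\<close>

lemma energy_form_nonneg: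
  assumes "0 < (r::real)" "\<epsilon>\<^sup>2 * w\<^sup>2 \<le> r * p"
  shows "0 \<le> p * x\<^sup>2 + \<epsilon>\<^sup>2 * (2 * w * x * y + r * y\<^sup>2)"
proof -
  have "0 \<le> \<epsilon>\<^sup>2 * (w * x + r * y)\<^sup>2" by simp
  also have "\<dots> = (\<epsilon>\<^sup>2 * w\<^sup>2) * x\<^sup>2 + r * (\<epsilon>\<^sup>2 * (2 * w * x * y + r * y\<^sup>2))"
    by (simp add: power2_eq_square algebra_simps)
  also have "\<dots> \<le> (r * p) * x\<^sup>2 + r * (\<epsilon>\<^sup>2 * (2 * w * x * y + r * y\<^sup>2))"
    using assms(2) by (intro add_right_mono mult_right_mono) auto
  also have "\<dots> = r * (p * x\<^sup>2 + \<epsilon>\<^sup>2 * (2 * w * x * y + r * y\<^sup>2))" by (simp add: algebra_simps)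
  finally show ?thesis using assms(1) by (simp add: zero_le_mult_iff)
qed

text \<open>A quarter of the diagonal is kept and the remaining three quarters dominate the mixed
  term; the discriminant condition for this is the factor \<open>16 / 9\<close>.\<close>

lemma energy_form_coercive:
  assumes r: "0 < (r::real)" and "16 / 9 * (\<epsilon>\<^sup>2 * w\<^sup>2) \<le> r * p"
  shows "(p * x\<^sup>2 + \<epsilon>\<^sup>2 * r * y\<^sup>2) / 4 \<le> p * x\<^sup>2 + \<epsilon>\<^sup>2 * (2 * w * x * y + r * y\<^sup>2)"
proof -
  define D where "D = 3 / 4 * p * x\<^sup>2 + 2 * \<epsilon>\<^sup>2 * w * x * y + 3 / 4 * \<epsilon>\<^sup>2 * r * y\<^sup>2"
  have "0 \<le> \<epsilon>\<^sup>2 * (4 * w * x + 3 * r * y)\<^sup>2 / 12" by simp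
  also have "\<dots> = 3 / 4 * (16 / 9 * (\<epsilon>\<^sup>2 * w\<^sup>2)) * x\<^sup>2 + r * (2 * \<epsilon>\<^sup>2 * w * x * y + 3 / 4 * \<epsilon>\<^sup>2 * r * y\<^sup>2)"
    by (simp add: power2_eq_square algebra_simps)
  also have "\<dots> \<le> 3 / 4 * (r * p) * x\<^sup>2 + r * (2 * \<epsilon>\<^sup>2 * w * x * y + 3 / 4 * \<epsilon>\<^sup>2 * r * y\<^sup>2)"
    using assms(2) by (intro add_right_mono mult_right_mono mult_left_mono) auto
  also have "\<dots> = r * D" by (simp add: D_def algebra_simps)
  finally have "0 \<le> D" using r by (simp add: zero_le_mult_iff)
  then show ?thesis by (simp add: D_def algebra_simps)
qed

lemma segment_bounds:
  fixes a b :: real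
  assumes "0 \<le> s" "s \<le> 1" "lo \<le> a" "a \<le> hi" "lo \<le> b" "b \<le> hi"
  shows "lo \<le> a + s * (b - a)" "a + s * (b - a) \<le> hi"
proof -
  have eq: "a + s * (b - a) = (1 - s) * a + s * b" by (simp add: algebra_simps)
  have "(1 - s) * lo + s * lo \<le> (1 - s) * a + s * b"
    using assms by (intro add_mono mult_left_mono) auto
  then show "lo \<le> a + s * (b - a)" unfolding eq by (simp add: algebra_simps)
  have "(1 - s) * a + s * b \<le> (1 - s) * hi + s * hi"
    using assms by (intro add_mono mult_left_mono) auto
  then show "a + s * (b - a) \<le> hi" unfolding eq by (simp add: algebra_simps)
qed

text \<open>Replacing \<open>r\<close> by the nearest admissible density changes
  \<open>r * P2 r\<close> by at most \<open>\<kappa> * L * (1 + 2 * \<rho>hi)\<close>, which by the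
  choice of \<open>\<kappa>\<close> lowers the factor 4 to \<open>7 / 2\<close>. Speeds up to
  \<open>7 / 4 * wbar\<close> need only \<open>49 / 16\<close>.\<close>

lemma subsonic_enlarged:
  assumes r: "2 * \<rho>lo / 3 - \<kappa> \<le> r" "r \<le> 3 * \<rho>hi / 2 + \<kappa>" and w: "\<bar>w\<bar> \<le> 3 * wbar / 2 + \<kappa>"
    and \<epsilon>: "0 \<le> \<epsilon>" "\<epsilon> \<le> \<epsilon>bar"
  shows "\<epsilon>\<^sup>2 * w\<^sup>2 \<le> r * P2 r"
proof -
  define r' where "r' = max (2 * \<rho>lo / 3) (min r (3 * \<rho>hi / 2))"
  have r': "r' \<in> {2 * \<rho>lo / 3..3 * \<rho>hi / 2}" using pos by (auto simp: r'_def)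
  have d: "\<bar>r - r'\<bar> \<le> \<kappa>" using r \<kappa>(1) pos by (auto simp: r'_def max_def min_def)
  have I: "r \<in> {\<rho>lo / 2..2 * \<rho>hi}" "r' \<in> {\<rho>lo / 2..2 * \<rho>hi}"
    using r r' \<kappa> pos by auto
  have r'0: "0 \<le> r'" "r' \<le> 2 * \<rho>hi" using I pos by auto
  have "\<bar>(r - r') * P2 r\<bar> \<le> \<kappa> * L"
    unfolding abs_mult using d P2_bound[OF I(1)] \<kappa>(1) by (intro mult_mono) auto
  moreover have "\<bar>r' * (P2 r - P2 r')\<bar> \<le> 2 * \<rho>hi * (L * \<kappa>)"
  proof -
    have "\<bar>P2 r - P2 r'\<bar> \<le> L * \<bar>r - r'\<bar>" by (rule P2_Lipschitz[OF I])
    also have "\<dots> \<le> L * \<kappa>" using d pos by (intro mult_left_mono) auto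
    finally show ?thesis unfolding abs_mult using r'0 pos \<kappa>(1) by (intro mult_mono) auto
  qed
  moreover have "r * P2 r = r' * P2 r' + (r - r') * P2 r + r' * (P2 r - P2 r')" by (simp add: algebra_simps)
  moreover have "4 * \<epsilon>bar\<^sup>2 * wbar\<^sup>2 \<le> r' * P2 r'" by (rule subsonic[OF r'])
  moreover have "\<kappa> * L + 2 * \<rho>hi * (L * \<kappa>) \<le> \<epsilon>bar\<^sup>2 * wbar\<^sup>2 / 2" using \<kappa>(4) by (simp add: algebra_simps)
  ultimately have 1: "4 * \<epsilon>bar\<^sup>2 * wbar\<^sup>2 - \<epsilon>bar\<^sup>2 * wbar\<^sup>2 / 2 \<le> r * P2 r" by (simp add: abs_le_iff)
  have "\<bar>w\<bar> \<le> 7 / 4 * wbar" using w \<kappa>(2) by simp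
  then have "w\<^sup>2 \<le> (7 / 4 * wbar)\<^sup>2" using pos by (simp add: abs_le_square_iff[symmetric])
  moreover have "\<epsilon>\<^sup>2 \<le> \<epsilon>bar\<^sup>2" using \<epsilon> by (intro power_mono) auto
  ultimately have "\<epsilon>\<^sup>2 * w\<^sup>2 \<le> \<epsilon>bar\<^sup>2 * (7 / 4 * wbar)\<^sup>2" by (intro mult_mono) auto
  also have "\<dots> = 49 / 16 * (\<epsilon>bar\<^sup>2 * wbar\<^sup>2)" by (simp add: power2_eq_square)
  also have "\<dots> \<le> 4 * \<epsilon>bar\<^sup>2 * wbar\<^sup>2 - \<epsilon>bar\<^sup>2 * wbar\<^sup>2 / 2"
  proof -
    have "0 \<le> \<epsilon>bar\<^sup>2 * wbar\<^sup>2" by simp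
    then show ?thesis by linarith
  qed
  finally show ?thesis using 1 by simp
qed

lemma rel_energy_nonneg:
  assumes "r \<in> {2 * \<rho>lo / 3 - \<kappa>..3 * \<rho>hi / 2 + \<kappa>}" "R \<in> {2 * \<rho>lo / 3 - \<kappa>..3 * \<rho>hi / 2 + \<kappa>}"
    and "\<bar>w\<bar> \<le> 3 * wbar / 2 + \<kappa>" "\<bar>W\<bar> \<le> 3 * wbar / 2 + \<kappa>" and \<epsilon>: "0 \<le> \<epsilon>" "\<epsilon> \<le> \<epsilon>bar"
  shows "0 \<le> rel_energy \<epsilon> r w R W"
proof -
  have p: "0 < 2 * \<rho>lo / 3 - \<kappa>" using \<kappa>(3) pos by simp
  then have "0 < r" "0 < R" using assms by auto
  from rel_energy_Taylor[OF this, of \<epsilon> w W] obtain s where s: "0 < s" "s < 1" and eq: "rel_energy \<epsilon> r w R W =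
    (P2 (r + s * (R - r)) * (R - r)\<^sup>2
      + \<epsilon>\<^sup>2 * (2 * (w + s * (W - w)) * (R - r) * (W - w) + (r + s * (R - r)) * (W - w)\<^sup>2)) / 2" by blast
  have rs: "2 * \<rho>lo / 3 - \<kappa> \<le> r + s * (R - r)" "r + s * (R - r) \<le> 3 * \<rho>hi / 2 + \<kappa>"
    using segment_bounds[of s "2 * \<rho>lo / 3 - \<kappa>" r "3 * \<rho>hi / 2 + \<kappa>" R] assms s by simp_all
  have ws: "\<bar>w + s * (W - w)\<bar> \<le> 3 * wbar / 2 + \<kappa>"
    using segment_bounds[of s "- (3 * wbar / 2 + \<kappa>)" w "3 * wbar / 2 + \<kappa>" W] assms s by (simp add: abs_le_iff)
  have "0 \<le> P2 (r + s * (R - r)) * (R - r)\<^sup>2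
      + \<epsilon>\<^sup>2 * (2 * (w + s * (W - w)) * (R - r) * (W - w) + (r + s * (R - r)) * (W - w)\<^sup>2)"
    by (rule energy_form_nonneg[OF _ subsonic_enlarged[OF rs ws \<epsilon>]]) (use rs p in simp)
  then show ?thesis using eq by simp
qed

text \<open>The two entries are lower bounds of \<open>P2\<close> and of the density on the
  admissible range. The 8 is the product of 4 from the coercive form and 2 from the Taylor
  remainder.\<close>

definition c0 :: real where "c0 = min (8 / 3 * \<epsilon>bar\<^sup>2 * wbar\<^sup>2 / \<rho>hi) (2 * \<rho>lo / 3) / 8"

lemma c0_pos: "0 < c0" using pos by (simp add: c0_def)

definition C0 :: real where "C0 = L + \<epsilon>bar\<^sup>2 * (2 * wbar)\<^sup>2 + 1 + 2 * \<rho>hi"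

lemma C0_pos: "0 < C0" using pos by (auto simp: C0_def intro!: add_pos_nonneg add_pos_pos)

text \<open>For admissible speeds up to \<open>3 / 2 * wbar\<close> the coercivity condition reads
  \<open>16 / 9 * 9 / 4 = 4\<close>, so the factor 4 in the subsonic condition is used up exactly.
  Admissible states form a convex set, so the intermediate state of the Taylor formula is admissible
  too.\<close>

lemma rel_energy_bounds:
  assumes "r \<in> {2 * \<rho>lo / 3..3 * \<rho>hi / 2}" "R \<in> {2 * \<rho>lo / 3..3 * \<rho>hi / 2}"
    and "\<bar>w\<bar> \<le> 3 * wbar / 2" "\<bar>W\<bar> \<le> 3 * wbar / 2" and \<epsilon>: "0 \<le> \<epsilon>" "\<epsilon> \<le> \<epsilon>bar"
  shows "c0 * ((R - r)\<^sup>2 + \<epsilon>\<^sup>2 * (W - w)\<^sup>2) \<le> rel_energy \<epsilon> r w R W"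
    and "rel_energy \<epsilon> r w R W \<le> C0 * ((R - r)\<^sup>2 + \<epsilon>\<^sup>2 * (W - w)\<^sup>2)"
proof -
  have "0 < r" "0 < R" using assms pos by auto
  from rel_energy_Taylor[OF this, of \<epsilon> w W] obtain s where s: "0 < s" "s < 1" and eq: "rel_energy \<epsilon> r w R W =
    (P2 (r + s * (R - r)) * (R - r)\<^sup>2
      + \<epsilon>\<^sup>2 * (2 * (w + s * (W - w)) * (R - r) * (W - w) + (r + s * (R - r)) * (W - w)\<^sup>2)) / 2" by blast
  define q v x y where "q = r + s * (R - r)" and "v = w + s * (W - w)" and "x = R - r" and "y = W - w"
  have q: "2 * \<rho>lo / 3 \<le> q" "q \<le> 3 * \<rho>hi / 2"
    unfolding q_def using segment_bounds[of s "2 * \<rho>lo / 3" r "3 * \<rho>hi / 2" R] assms s by simp_all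
  have v: "\<bar>v\<bar> \<le> 3 * wbar / 2"
  proof -
    have "- (3 * wbar / 2) \<le> w" "w \<le> 3 * wbar / 2" "- (3 * wbar / 2) \<le> W" "W \<le> 3 * wbar / 2"
      using assms by (auto simp only: abs_le_iff)
    then show ?thesis
      unfolding v_def using segment_bounds[of s "- (3 * wbar / 2)" w "3 * wbar / 2" W] s
      by (intro abs_leI) linarith+
  qed
  have q0: "0 < q" using q pos by simp
  have eq': "rel_energy \<epsilon> r w R W = (P2 q * x\<^sup>2 + \<epsilon>\<^sup>2 * (2 * v * x * y + q * y\<^sup>2)) / 2"
    using eq by (simp add: q_def v_def x_def y_def)
  have \<epsilon>2: "\<epsilon>\<^sup>2 \<le> \<epsilon>bar\<^sup>2" using \<epsilon> by (intro power_mono) auto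
  have sub: "4 * \<epsilon>bar\<^sup>2 * wbar\<^sup>2 \<le> q * P2 q" using q by (intro subsonic) auto
  have v2: "v\<^sup>2 \<le> (3 * wbar / 2)\<^sup>2" using v pos by (simp add: abs_le_square_iff[symmetric])
  have "\<epsilon>\<^sup>2 * v\<^sup>2 \<le> \<epsilon>bar\<^sup>2 * (3 * wbar / 2)\<^sup>2" using \<epsilon>2 v2 by (intro mult_mono) auto
  then have "16 / 9 * (\<epsilon>\<^sup>2 * v\<^sup>2) \<le> q * P2 q" using sub by (simp add: power2_eq_square)
  from energy_form_coercive[OF q0 this, of x y]
  have 1: "(P2 q * x\<^sup>2 + \<epsilon>\<^sup>2 * q * y\<^sup>2) / 4 \<le> 2 * rel_energy \<epsilon> r w R W" by (simp add: eq')
  have "8 / 3 * \<epsilon>bar\<^sup>2 * wbar\<^sup>2 / \<rho>hi \<le> P2 q"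
  proof -
    have "0 \<le> P2 q"
      using sub q0 zero_le_mult_iff[of q "P2 q"] order_trans[of 0 "4 * \<epsilon>bar\<^sup>2 * wbar\<^sup>2" "q * P2 q"] by auto
    then have "q * P2 q \<le> 3 * \<rho>hi / 2 * P2 q" using q by (intro mult_right_mono) auto
    with sub have "4 * \<epsilon>bar\<^sup>2 * wbar\<^sup>2 \<le> 3 * \<rho>hi / 2 * P2 q" by simp
    then show ?thesis using pos by (simp add: field_simps)
  qed
  then have c1: "8 * c0 \<le> P2 q" and c2: "8 * c0 \<le> q" using q by (auto simp: c0_def)
  have "8 * c0 * x\<^sup>2 + 8 * c0 * (\<epsilon>\<^sup>2 * y\<^sup>2) \<le> P2 q * x\<^sup>2 + q * (\<epsilon>\<^sup>2 * y\<^sup>2)"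
    using c1 c2 by (intro add_mono mult_right_mono) auto
  then show "c0 * ((R - r)\<^sup>2 + \<epsilon>\<^sup>2 * (W - w)\<^sup>2) \<le> rel_energy \<epsilon> r w R W"
    using 1 by (simp add: x_def[symmetric] y_def[symmetric] algebra_simps)
  have "P2 q * x\<^sup>2 \<le> L * x\<^sup>2" using P2_bound[of q] q pos by (intro mult_right_mono) auto
  moreover have "\<epsilon>\<^sup>2 * (2 * v * x * y) \<le> \<epsilon>bar\<^sup>2 * (2 * wbar)\<^sup>2 * x\<^sup>2 + \<epsilon>\<^sup>2 * y\<^sup>2"
  proof -
    have "2 * v * x * y \<le> v\<^sup>2 * x\<^sup>2 + y\<^sup>2" using zero_le_power2[of "v * x - y"] by (simp add: power2_eq_square algebra_simps)
    then have "\<epsilon>\<^sup>2 * (2 * v * x * y) \<le> \<epsilon>\<^sup>2 * (v\<^sup>2 * x\<^sup>2 + y\<^sup>2)" by (intro mult_left_mono) auto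
    moreover have "\<epsilon>\<^sup>2 * v\<^sup>2 \<le> \<epsilon>bar\<^sup>2 * (2 * wbar)\<^sup>2"
    proof (intro mult_mono \<epsilon>2)
      have "\<bar>v\<bar> \<le> \<bar>2 * wbar\<bar>" using v pos by simp
      then show "v\<^sup>2 \<le> (2 * wbar)\<^sup>2" by (simp only: abs_le_square_iff)
    qed auto
    then have "\<epsilon>\<^sup>2 * v\<^sup>2 * x\<^sup>2 \<le> \<epsilon>bar\<^sup>2 * (2 * wbar)\<^sup>2 * x\<^sup>2" by (intro mult_right_mono) auto
    ultimately show ?thesis by (simp add: distrib_left mult.assoc)
  qed
  moreover have "q * (\<epsilon>\<^sup>2 * y\<^sup>2) \<le> 2 * \<rho>hi * (\<epsilon>\<^sup>2 * y\<^sup>2)" using q pos by (intro mult_right_mono) auto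
  ultimately have "2 * rel_energy \<epsilon> r w R W \<le> (L + \<epsilon>bar\<^sup>2 * (2 * wbar)\<^sup>2) * x\<^sup>2 + (1 + 2 * \<rho>hi) * (\<epsilon>\<^sup>2 * y\<^sup>2)"
    by (simp add: eq' algebra_simps)
  also have "\<dots> \<le> C0 * x\<^sup>2 + C0 * (\<epsilon>\<^sup>2 * y\<^sup>2)"
    using pos by (intro add_mono mult_right_mono) (auto simp: C0_def)
  also have "\<dots> = C0 * (x\<^sup>2 + \<epsilon>\<^sup>2 * y\<^sup>2)" by (simp add: distrib_left)
  finally have "2 * rel_energy \<epsilon> r w R W \<le> C0 * (x\<^sup>2 + \<epsilon>\<^sup>2 * y\<^sup>2)" .
  moreover have "0 \<le> C0 * (x\<^sup>2 + \<epsilon>\<^sup>2 * y\<^sup>2)" using C0_pos by simp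
  ultimately show "rel_energy \<epsilon> r w R W \<le> C0 * ((R - r)\<^sup>2 + \<epsilon>\<^sup>2 * (W - w)\<^sup>2)" by (simp add: x_def y_def)
qed

text \<open>Both states are translated by the same vector, so their difference \<open>(x, y)\<close>
  is unchanged. What varies is the relative pressure potential \<open>Q\<close> at fixed
  displacement, and in the kinetic part only
  \<open>(r1 - r0) * y\<^sup>2 / 2 + (w1 - w0) * x * y\<close>. Each is at most \<open>b\<close>
  times a quadratic error; the factor \<open>\<epsilon>\<^sup>2\<close> on \<open>x\<^sup>2\<close>
  is absorbed in \<open>\<epsilon>bar\<^sup>2\<close>.\<close>

lemma rel_energy_shift:
  assumes r: "r0 \<in> {\<rho>lo..\<rho>hi}" "r1 \<in> {\<rho>lo..\<rho>hi}" and R: "R \<in> {2 * \<rho>lo / 3..3 * \<rho>hi / 2}"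
    and B: "\<bar>r1 - r0\<bar> \<le> b" "\<bar>w1 - w0\<bar> \<le> b" and b: "b \<le> \<kappa>" and \<epsilon>: "0 \<le> \<epsilon>" "\<epsilon> \<le> \<epsilon>bar"
  shows "rel_energy \<epsilon> r1 w1 (R + (r1 - r0)) (W + (w1 - w0)) - rel_energy \<epsilon> r0 w0 R W
    \<le> (L + \<epsilon>bar\<^sup>2 + 1) * b * ((R - r0)\<^sup>2 + \<epsilon>\<^sup>2 * (W - w0)\<^sup>2)"
proof -
  define x y where "x = R - r0" and "y = W - w0"
  define Q where "Q r = P (r + x) - P r - P1 r * x" for r
  have b0: "0 \<le> b" using B(1) by linarith
  \<comment> \<open>The bound \<open>\<kappa> \<le> \<rho>lo / 6\<close> is just what keeps the
    translated density above \<open>\<rho>lo / 2\<close>, inside the range where \<open>P2\<close>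
    is controlled.\<close>
  have in_I: "r \<in> {\<rho>lo / 2..2 * \<rho>hi} \<and> r + x \<in> {\<rho>lo / 2..2 * \<rho>hi}"
    if "min r0 r1 \<le> r" "r \<le> max r0 r1" for r
  proof -
    have "\<bar>r - r0\<bar> \<le> b" using that B(1) by (auto simp: min_def max_def split: if_splits)
    moreover have "r + x = R + (r - r0)" by (simp add: x_def)
    moreover have "\<rho>lo \<le> r" "r \<le> \<rho>hi" using that r by (auto simp: min_def max_def split: if_splits)
    ultimately show ?thesis using R b \<kappa>(3) pos by (auto simp: abs_le_iff)
  qed
  \<comment> \<open>The derivative of \<open>Q\<close> is a first-order Taylor remainder of
    \<open>P1\<close>; the Lipschitz bound on \<open>P2\<close> makes it quadratic in
    \<open>x\<close>.\<close>
  have Q': "\<bar>P1 (r + x) - P1 r - P2 r * x\<bar> \<le> L * x\<^sup>2"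
    if I: "r \<in> {\<rho>lo / 2..2 * \<rho>hi}" "r + x \<in> {\<rho>lo / 2..2 * \<rho>hi}" for r
  proof -
    have "\<exists>\<xi>. \<xi> \<in> {\<rho>lo / 2..2 * \<rho>hi} \<and> \<bar>\<xi> - r\<bar> \<le> \<bar>x\<bar> \<and> P1 (r + x) - P1 r = P2 \<xi> * x"
    proof (cases x "0 :: real" rule: linorder_cases)
      case less
      have "\<exists>z>r + x. z < r \<and> P1 r - P1 (r + x) = (r - (r + x)) * P2 z"
        using less I pos by (intro MVT2) (auto intro!: dP1)
      then obtain z where "r + x < z" "z < r" "P1 r - P1 (r + x) = (r - (r + x)) * P2 z" by blast
      then show ?thesis using I less by (intro exI[of _ z]) (auto simp: algebra_simps)
    next
      case equal
      then show ?thesis using I by (intro exI[of _ r]) auto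
    next
      case greater
      have "\<exists>z>r. z < r + x \<and> P1 (r + x) - P1 r = (r + x - r) * P2 z"
        using greater I pos by (intro MVT2) (auto intro!: dP1)
      then obtain z where "r < z" "z < r + x" "P1 (r + x) - P1 r = (r + x - r) * P2 z" by blast
      then show ?thesis using I greater by (intro exI[of _ z]) (auto simp: algebra_simps)
    qed
    then obtain \<xi> where \<xi>: "\<xi> \<in> {\<rho>lo / 2..2 * \<rho>hi}" "\<bar>\<xi> - r\<bar> \<le> \<bar>x\<bar>" "P1 (r + x) - P1 r = P2 \<xi> * x" by blast
    have "\<bar>P1 (r + x) - P1 r - P2 r * x\<bar> = \<bar>P2 \<xi> - P2 r\<bar> * \<bar>x\<bar>"
      by (simp add: \<xi>(3) left_diff_distrib[symmetric] abs_mult)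
    also have "\<dots> \<le> (L * \<bar>x\<bar>) * \<bar>x\<bar>"
    proof (intro mult_right_mono)
      have "\<bar>P2 \<xi> - P2 r\<bar> \<le> L * \<bar>\<xi> - r\<bar>" by (rule P2_Lipschitz[OF \<xi>(1) I(1)])
      also have "\<dots> \<le> L * \<bar>x\<bar>" using \<xi>(2) pos by (intro mult_left_mono) auto
      finally show "\<bar>P2 \<xi> - P2 r\<bar> \<le> L * \<bar>x\<bar>" .
    qed simp
    also have "\<dots> = L * x\<^sup>2" by (simp add: power2_eq_square)
    finally show ?thesis .
  qed
  have dQ: "(Q has_real_derivative (P1 (r + x) - P1 r - P2 r * x)) (at r)"
    if "r \<in> {\<rho>lo / 2..2 * \<rho>hi}" "r + x \<in> {\<rho>lo / 2..2 * \<rho>hi}" for r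
    unfolding Q_def[abs_def] using that pos
    by (auto intro!: derivative_eq_intros DERIV_chain2[OF dP] dP dP1)
  have Qdiff: "\<bar>Q q - Q p\<bar> \<le> L * x\<^sup>2 * (q - p)" if pq: "p < q" "min r0 r1 \<le> p" "q \<le> max r0 r1" for p q
  proof -
    have "\<exists>z>p. z < q \<and> Q q - Q p = (q - p) * (P1 (z + x) - P1 z - P2 z * x)"
      using pq in_I by (intro MVT2 dQ) auto
    then obtain z where z: "p < z" "z < q" "Q q - Q p = (q - p) * (P1 (z + x) - P1 z - P2 z * x)" by blast
    have "\<bar>P1 (z + x) - P1 z - P2 z * x\<bar> \<le> L * x\<^sup>2" using z pq in_I[of z] by (intro Q') auto
    then show ?thesis using pq by (simp add: z(3) abs_mult mult.commute mult_left_mono)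
  qed
  have "\<bar>Q r1 - Q r0\<bar> \<le> L * x\<^sup>2 * \<bar>r1 - r0\<bar>"
    using Qdiff[of r0 r1] Qdiff[of r1 r0] by (cases r0 r1 rule: linorder_cases) (auto simp: abs_minus_commute)
  also have "\<dots> \<le> L * x\<^sup>2 * b" using B pos by (intro mult_left_mono) auto
  finally have q: "Q r1 - Q r0 \<le> L * x\<^sup>2 * b" by simp
  have "(r1 - r0) * y\<^sup>2 \<le> b * y\<^sup>2" using B by (intro mult_right_mono) auto
  moreover have "(w1 - w0) * x * y \<le> b * ((x\<^sup>2 + y\<^sup>2) / 2)"
  proof -
    have "\<bar>x\<bar> * \<bar>y\<bar> \<le> (x\<^sup>2 + y\<^sup>2) / 2" using sum_squares_bound[of "\<bar>x\<bar>" "\<bar>y\<bar>"] by simp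
    then have "\<bar>w1 - w0\<bar> * (\<bar>x\<bar> * \<bar>y\<bar>) \<le> b * ((x\<^sup>2 + y\<^sup>2) / 2)" using B b0 by (intro mult_mono) auto
    then have "\<bar>(w1 - w0) * x * y\<bar> \<le> b * ((x\<^sup>2 + y\<^sup>2) / 2)" by (simp add: abs_mult mult.assoc)
    then show ?thesis by simp
  qed
  ultimately have "(r1 - r0) * y\<^sup>2 / 2 + (w1 - w0) * x * y \<le> b * y\<^sup>2 / 2 + b * ((x\<^sup>2 + y\<^sup>2) / 2)"
    by linarith
  also have "\<dots> = b * y\<^sup>2 + b * x\<^sup>2 / 2" by (simp add: field_simps)
  also have "\<dots> \<le> b * (x\<^sup>2 + y\<^sup>2)"
    using mult_nonneg_nonneg[OF b0 zero_le_power2[of x]] unfolding distrib_left by linarith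
  finally have "(r1 - r0) * y\<^sup>2 / 2 + (w1 - w0) * x * y \<le> b * (x\<^sup>2 + y\<^sup>2)" .
  then have k: "\<epsilon>\<^sup>2 * ((r1 - r0) * y\<^sup>2 / 2 + (w1 - w0) * x * y) \<le> \<epsilon>\<^sup>2 * (b * (x\<^sup>2 + y\<^sup>2))"
    by (intro mult_left_mono) auto
  have "rel_energy \<epsilon> r1 w1 (R + (r1 - r0)) (W + (w1 - w0)) - rel_energy \<epsilon> r0 w0 R W
      = Q r1 - Q r0 + \<epsilon>\<^sup>2 * ((r1 - r0) * y\<^sup>2 / 2 + (w1 - w0) * x * y)"
  proof -
    have RW: "R = r0 + x" "W = w0 + y" by (auto simp: x_def y_def)
    show ?thesis unfolding RW by (simp add: rel_energy_def U_def enth_def Q_def power2_eq_square field_simps)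
  qed
  also have "\<dots> \<le> L * x\<^sup>2 * b + \<epsilon>\<^sup>2 * (b * (x\<^sup>2 + y\<^sup>2))" using q k by simp
  also have "\<dots> \<le> (L + \<epsilon>bar\<^sup>2 + 1) * b * (x\<^sup>2 + \<epsilon>\<^sup>2 * y\<^sup>2)"
  proof -
    have "\<epsilon>\<^sup>2 \<le> \<epsilon>bar\<^sup>2" using \<epsilon> by (intro power_mono) auto
    then have "\<epsilon>\<^sup>2 * (b * x\<^sup>2) \<le> \<epsilon>bar\<^sup>2 * (b * x\<^sup>2)" using b0 by (intro mult_right_mono) auto
    moreover have "0 \<le> b * x\<^sup>2" "0 \<le> L * (b * (\<epsilon>\<^sup>2 * y\<^sup>2))" "0 \<le> \<epsilon>bar\<^sup>2 * (b * (\<epsilon>\<^sup>2 * y\<^sup>2))" using b0 pos by auto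
    ultimately show ?thesis by (simp add: algebra_simps)
  qed
  finally show ?thesis by (simp add: x_def y_def)
qed

text \<open>The three-point identity for relative energies (Bregman distances), applied to the exact
  state, the new discrete state and the translated old discrete state. The term that is dropped is
  the relative energy of the last two, nonnegative on the enlarged set. As in implicit Euler, the
  derivatives of \<open>U\<close> are taken at the new time.\<close>

lemma rel_energy_increment:
  assumes r: "r0 \<in> {\<rho>lo..\<rho>hi}" "r1 \<in> {\<rho>lo..\<rho>hi}"
    and R: "R0 \<in> {2 * \<rho>lo / 3..3 * \<rho>hi / 2}" "R1 \<in> {2 * \<rho>lo / 3..3 * \<rho>hi / 2}"
    and W: "\<bar>W0\<bar> \<le> 3 * wbar / 2" "\<bar>W1\<bar> \<le> 3 * wbar / 2"
    and B: "\<bar>r1 - r0\<bar> \<le> b" "\<bar>w1 - w0\<bar> \<le> b" and b: "b \<le> \<kappa>" and \<epsilon>: "0 \<le> \<epsilon>" "\<epsilon> \<le> \<epsilon>bar"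
  shows "rel_energy \<epsilon> r1 w1 R1 W1 - rel_energy \<epsilon> r0 w0 R0 W0
    \<le> (enth \<epsilon> R1 W1 - enth \<epsilon> r1 w1) * ((R1 - R0) - (r1 - r0))
      + \<epsilon>\<^sup>2 * (R1 * W1 - r1 * w1) * ((W1 - W0) - (w1 - w0))
      + (L + \<epsilon>bar\<^sup>2 + 1) * b * ((R0 - r0)\<^sup>2 + \<epsilon>\<^sup>2 * (W0 - w0)\<^sup>2)"
proof -
  define R' W' where "R' = R0 + (r1 - r0)" and "W' = W0 + (w1 - w0)"
  have "0 \<le> rel_energy \<epsilon> R1 W1 R' W'"
    using R W B b \<kappa>(1) by (intro rel_energy_nonneg \<epsilon>) (auto simp: R'_def W'_def abs_le_iff)
  also have "\<dots> = rel_energy \<epsilon> r1 w1 R' W' - rel_energy \<epsilon> r1 w1 R1 W1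
      + (enth \<epsilon> R1 W1 - enth \<epsilon> r1 w1) * (R1 - R') + \<epsilon>\<^sup>2 * (R1 * W1 - r1 * w1) * (W1 - W')"
    by (simp add: rel_energy_def algebra_simps)
  finally have main: "rel_energy \<epsilon> r1 w1 R1 W1 \<le> rel_energy \<epsilon> r1 w1 R' W'
      + (enth \<epsilon> R1 W1 - enth \<epsilon> r1 w1) * (R1 - R') + \<epsilon>\<^sup>2 * (R1 * W1 - r1 * w1) * (W1 - W')" by simp
  have e: "R1 - R' = (R1 - R0) - (r1 - r0)" "W1 - W' = (W1 - W0) - (w1 - w0)"
    by (auto simp: R'_def W'_def)
  have "rel_energy \<epsilon> r1 w1 R' W' - rel_energy \<epsilon> r0 w0 R0 W0 \<le> (L + \<epsilon>bar\<^sup>2 + 1) * b * ((R0 - r0)\<^sup>2 + \<epsilon>\<^sup>2 * (W0 - w0)\<^sup>2)"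
    unfolding R'_def W'_def by (rule rel_energy_shift[OF r R(1) B b \<epsilon>])
  with main[unfolded e] show ?thesis by linarith
qed

end

text \<open>For equal signs the difference is one of squares, for opposite signs a sum of squares.
  The same weight \<open>\<bar>W\<bar> + \<bar>w\<bar>\<close> occurs in the lower and the upper
  bound, so a perturbation of the test function can be absorbed although the weight may degenerate
  at zero velocity.\<close>

lemma friction_monotone:
  fixes W w :: real
  shows "(\<bar>W\<bar> + \<bar>w\<bar>) * (W - w)\<^sup>2 / 2 \<le> (\<bar>W\<bar> * W - \<bar>w\<bar> * w) * (W - w)"
    and "\<bar>\<bar>W\<bar> * W - \<bar>w\<bar> * w\<bar> \<le> (\<bar>W\<bar> + \<bar>w\<bar>) * \<bar>W - w\<bar>"
proof -
  have opp: "(p + q) * (p + q)\<^sup>2 / 2 \<le> (p\<^sup>2 + q\<^sup>2) * (p + q)" "p\<^sup>2 + q\<^sup>2 \<le> (p + q) * (p + q)"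
    if "0 \<le> p" "0 \<le> q" for p q :: real
  proof -
    have "(p + q)\<^sup>2 / 2 \<le> p\<^sup>2 + q\<^sup>2"
      using zero_le_power2[of "p - q"] by (simp add: power2_eq_square algebra_simps)
    then have "(p + q) * ((p + q)\<^sup>2 / 2) \<le> (p + q) * (p\<^sup>2 + q\<^sup>2)" using that by (intro mult_left_mono) auto
    then show "(p + q) * (p + q)\<^sup>2 / 2 \<le> (p\<^sup>2 + q\<^sup>2) * (p + q)" by (simp add: mult.commute)
    show "p\<^sup>2 + q\<^sup>2 \<le> (p + q) * (p + q)" using that by (simp add: power2_eq_square algebra_simps)
  qed
  have same: "(p + q) * (p - q)\<^sup>2 / 2 \<le> (p * p - q * q) * (p - q)" "\<bar>p * p - q * q\<bar> \<le> (p + q) * \<bar>p - q\<bar>"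
    if "0 \<le> p" "0 \<le> q" for p q :: real
  proof -
    have e: "p * p - q * q = (p + q) * (p - q)" by (simp add: algebra_simps)
    have n: "0 \<le> (p + q) * (p - q)\<^sup>2" using that by simp
    have e2: "(p * p - q * q) * (p - q) = (p + q) * (p - q)\<^sup>2" unfolding e by (simp add: power2_eq_square)
    show "(p + q) * (p - q)\<^sup>2 / 2 \<le> (p * p - q * q) * (p - q)"
      unfolding e2 using n by linarith
    show "\<bar>p * p - q * q\<bar> \<le> (p + q) * \<bar>p - q\<bar>" unfolding e abs_mult using that by simp
  qed
  consider "0 \<le> W" "0 \<le> w" | "W \<le> 0" "w \<le> 0" | "0 \<le> W" "w \<le> 0" | "W \<le> 0" "0 \<le> w" by linarith
  then have "(\<bar>W\<bar> + \<bar>w\<bar>) * (W - w)\<^sup>2 / 2 \<le> (\<bar>W\<bar> * W - \<bar>w\<bar> * w) * (W - w)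
    \<and> \<bar>\<bar>W\<bar> * W - \<bar>w\<bar> * w\<bar> \<le> (\<bar>W\<bar> + \<bar>w\<bar>) * \<bar>W - w\<bar>"
  proof cases
    case 1
    then show ?thesis using same[of W w] by simp
  next
    case 2
    then have e: "\<bar>W\<bar> = - W" "\<bar>w\<bar> = - w" by auto
    \<comment> \<open>Both velocities nonpositive: the reflection of both signs reduces this case to
      the nonnegative one.\<close>
    have f: "((- W) * W - (- w) * w) * (W - w) = ((- W) * (- W) - (- w) * (- w)) * (- W - - w)"
      "(W - w)\<^sup>2 = (- W - - w)\<^sup>2"
      "\<bar>(- W) * W - (- w) * w\<bar> = \<bar>(- W) * (- W) - (- w) * (- w)\<bar>" "\<bar>W - w\<bar> = \<bar>- W - - w\<bar>"
      by (simp_all add: power2_eq_square algebra_simps abs_minus_commute)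
    have "0 \<le> - W" "0 \<le> - w" using 2 by auto
    from same[OF this] show ?thesis unfolding e f by blast
  next
    case 3
    then have e: "\<bar>W\<bar> = W" "\<bar>w\<bar> = - w" "\<bar>W - w\<bar> = W + - w" by auto
    have f: "W * W - (- w) * w = W\<^sup>2 + (- w)\<^sup>2" by (simp add: power2_eq_square)
    show ?thesis using opp[of W "- w"] 3 unfolding e f by simp
  next
    case 4
    then have e: "\<bar>W\<bar> = - W" "\<bar>w\<bar> = w" "\<bar>W - w\<bar> = - W + w" by auto
    have f0: "(- W) * W - w * w = - ((- W)\<^sup>2 + w\<^sup>2)" by (simp add: power2_eq_square)
    have f: "((- W) * W - w * w) * (W - w) = ((- W)\<^sup>2 + w\<^sup>2) * (- W + w)"
      "(W - w)\<^sup>2 = (- W + w)\<^sup>2" "\<bar>(- W) * W - w * w\<bar> = (- W)\<^sup>2 + w\<^sup>2"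
      unfolding f0 by (simp_all add: power2_eq_square algebra_simps)
    have "0 \<le> - W" using 4 by simp
    from opp[OF this 4(2)] show ?thesis unfolding e f by blast
  qed
  then show "(\<bar>W\<bar> + \<bar>w\<bar>) * (W - w)\<^sup>2 / 2 \<le> (\<bar>W\<bar> * W - \<bar>w\<bar> * w) * (W - w)"
    "\<bar>\<bar>W\<bar> * W - \<bar>w\<bar> * w\<bar> \<le> (\<bar>W\<bar> + \<bar>w\<bar>) * \<bar>W - w\<bar>" by auto
qed

lemma Young: fixes x y :: real assumes "0 < \<delta>" shows "\<bar>x\<bar> * \<bar>y\<bar> \<le> \<delta> * x\<^sup>2 + y\<^sup>2 / (4 * \<delta>)"
proof -
  have "0 \<le> (2 * \<delta> * \<bar>x\<bar> - \<bar>y\<bar>)\<^sup>2" by simp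
  also have "\<dots> = 4 * \<delta> * (\<delta> * x\<^sup>2 - \<bar>x\<bar> * \<bar>y\<bar>) + y\<^sup>2" by (simp add: power2_eq_square algebra_simps abs_mult_self_eq)
  finally show ?thesis using assms by (simp add: field_simps)
qed

lemma cube_add_le:
  fixes x y :: real assumes "0 \<le> x" "0 \<le> y" shows "(x + y) ^ 3 \<le> 4 * (x ^ 3 + y ^ 3)"
proof -
  have "0 \<le> 3 * (x + y) * (x - y)\<^sup>2" using assms by simp
  also have "\<dots> = 4 * (x ^ 3 + y ^ 3) - (x + y) ^ 3" by (simp add: power2_eq_square power3_eq_cube algebra_simps)
  finally show ?thesis by simp
qed

lemma square_sum_le:
  fixes x y z :: real
  shows "(x + y)\<^sup>2 \<le> 2 * x\<^sup>2 + 2 * y\<^sup>2" "(x + y + z)\<^sup>2 \<le> 3 * x\<^sup>2 + 3 * y\<^sup>2 + 3 * z\<^sup>2"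
proof -
  show "(x + y)\<^sup>2 \<le> 2 * x\<^sup>2 + 2 * y\<^sup>2"
    using zero_le_power2[of "x - y"] by (simp add: power2_eq_square algebra_simps)
  show "(x + y + z)\<^sup>2 \<le> 3 * x\<^sup>2 + 3 * y\<^sup>2 + 3 * z\<^sup>2"
    using zero_le_power2[of "x - y"] zero_le_power2[of "y - z"] zero_le_power2[of "x - z"]
    by (simp add: power2_eq_square algebra_simps)
qed

section \<open>Pointwise estimates for one time step\<close>

context gas_law
begin

text \<open>The difference of the squared velocities carries \<open>\<epsilon>\<^sup>2\<close>; one
  \<open>\<epsilon>\<close> goes into the constant and the other stays with \<open>W - w\<close>, so
  that squaring gives exactly the terms controlled by the relative energy.\<close>

lemma enth_difference:
  assumes r: "r \<in> {\<rho>lo..\<rho>hi}" and R: "R \<in> {2 * \<rho>lo / 3..3 * \<rho>hi / 2}"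
    and w: "\<bar>w\<bar> \<le> wbar" and W: "\<bar>W\<bar> \<le> 3 * wbar / 2" and \<epsilon>: "0 \<le> \<epsilon>" "\<epsilon> \<le> \<epsilon>bar"
  shows "\<bar>enth \<epsilon> R W - enth \<epsilon> r w\<bar> \<le> (L + 2 * \<epsilon>bar * wbar) * (\<bar>R - r\<bar> + \<epsilon> * \<bar>W - w\<bar>)"
proof -
  have lip: "\<bar>P1 q - P1 p\<bar> \<le> L * \<bar>q - p\<bar>"
    if "p < q" "p \<in> {\<rho>lo / 2..2 * \<rho>hi}" "q \<in> {\<rho>lo / 2..2 * \<rho>hi}" for p q
  proof -
    have "\<exists>z>p. z < q \<and> P1 q - P1 p = (q - p) * P2 z"
      using that pos by (intro MVT2) (auto intro!: dP1)
    then obtain z where z: "p < z" "z < q" "P1 q - P1 p = (q - p) * P2 z" by blast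
    then have "\<bar>P2 z\<bar> \<le> L" using that by (intro P2_bound) auto
    then show ?thesis using that z by (simp add: abs_mult mult.commute mult_right_mono)
  qed
  have I: "r \<in> {\<rho>lo / 2..2 * \<rho>hi}" "R \<in> {\<rho>lo / 2..2 * \<rho>hi}" using r R pos by auto
  have 1: "\<bar>P1 R - P1 r\<bar> \<le> L * \<bar>R - r\<bar>"
    using lip[OF _ I] lip[OF _ I(2,1)] by (cases r R rule: linorder_cases) (auto simp: abs_minus_commute)
  have "W\<^sup>2 - w\<^sup>2 = (W + w) * (W - w)" by (simp add: power2_eq_square algebra_simps)
  then have "\<bar>\<epsilon>\<^sup>2 / 2 * (W\<^sup>2 - w\<^sup>2)\<bar> = \<epsilon> * \<bar>W + w\<bar> / 2 * (\<epsilon> * \<bar>W - w\<bar>)"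
    using \<epsilon> by (simp add: abs_mult power2_eq_square)
  also have "\<dots> \<le> 2 * \<epsilon>bar * wbar * (\<epsilon> * \<bar>W - w\<bar>)"
  proof (intro mult_right_mono)
    have "\<bar>W + w\<bar> \<le> 4 * wbar" using w W pos by linarith
    then have "\<epsilon> * \<bar>W + w\<bar> \<le> \<epsilon>bar * (4 * wbar)" using \<epsilon> by (intro mult_mono) auto
    then show "\<epsilon> * \<bar>W + w\<bar> / 2 \<le> 2 * \<epsilon>bar * wbar" by simp
  qed (use \<epsilon> in auto)
  finally have 2: "\<bar>\<epsilon>\<^sup>2 / 2 * (W\<^sup>2 - w\<^sup>2)\<bar> \<le> 2 * \<epsilon>bar * wbar * (\<epsilon> * \<bar>W - w\<bar>)" .
  have "enth \<epsilon> R W - enth \<epsilon> r w = \<epsilon>\<^sup>2 / 2 * (W\<^sup>2 - w\<^sup>2) + (P1 R - P1 r)" by (simp add: enth_def algebra_simps)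
  then have "\<bar>enth \<epsilon> R W - enth \<epsilon> r w\<bar> \<le> 2 * \<epsilon>bar * wbar * (\<epsilon> * \<bar>W - w\<bar>) + L * \<bar>R - r\<bar>"
    using 1 2 abs_triangle_ineq[of "\<epsilon>\<^sup>2 / 2 * (W\<^sup>2 - w\<^sup>2)" "P1 R - P1 r"] by linarith
  moreover have "0 \<le> 2 * \<epsilon>bar * wbar * \<bar>R - r\<bar>" "0 \<le> L * (\<epsilon> * \<bar>W - w\<bar>)" using pos \<epsilon> by auto
  ultimately show ?thesis by (simp add: algebra_simps)
qed

text \<open>The test function splits into \<open>a * R * (W - w)\<close>, which friction dissipates,
  and the perturbation \<open>y\<close> from the density error and the interpolation error.
  Monotonicity gives the weight \<open>2 * \<delta> * s\<close>, Young's inequality with the same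
  weight \<open>s\<close> spends half of it, and \<open>\<bar>W - w\<bar> \<le> s\<close> turns the
  rest into a cube.\<close>

lemma friction_bound:
  assumes r: "r \<in> {\<rho>lo..\<rho>hi}" and R: "R \<in> {2 * \<rho>lo / 3..3 * \<rho>hi / 2}"
    and w: "\<bar>w\<bar> \<le> wbar" and W: "\<bar>W\<bar> \<le> 3 * wbar / 2"
    and a: "0 < alo" "alo \<le> a" "a \<le> ahi" and \<gamma>: "0 < \<gamma>lo" "\<gamma>lo \<le> \<gamma>" "\<gamma> \<le> \<gamma>hi"
  shows "- \<gamma> * (\<bar>W\<bar> * W - \<bar>w\<bar> * w) * (a * R * W - a * r * w - \<phi>)
    \<le> - \<gamma>lo * (alo * \<rho>lo / 6) * \<bar>W - w\<bar> ^ 3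
      + \<gamma>hi * (3 * wbar) / (2 * alo * \<rho>lo / 3) * (2 * (ahi * wbar)\<^sup>2 * (R - r)\<^sup>2 + 2 * \<phi>\<^sup>2)"
proof -
  define D s x y \<delta> where "D = \<bar>W\<bar> * W - \<bar>w\<bar> * w" and "s = \<bar>W\<bar> + \<bar>w\<bar>" and "x = W - w"
    and "y = a * w * (R - r) - \<phi>" and "\<delta> = alo * \<rho>lo / 6"
  have \<delta>: "0 < \<delta>" using a pos by (simp add: \<delta>_def)
  have s: "0 \<le> s" "s \<le> 3 * wbar" using w W pos by (auto simp: s_def)
  have g: "0 < \<gamma>" using \<gamma> by simp
  have z: "a * R * W - a * r * w - \<phi> = a * R * x + y" by (simp add: x_def y_def algebra_simps)
  \<comment> \<open>The admissible density is at least \<open>2 * \<rho>lo / 3\<close>, which fixes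
    the choice of \<open>\<delta>\<close>.\<close>
  have aR: "2 * \<delta> \<le> a * R / 2"
  proof -
    have "alo * (2 * \<rho>lo / 3) \<le> a * R" using a R pos by (intro mult_mono) auto
    then show ?thesis by (simp add: \<delta>_def mult_ac)
  qed
  have Dx: "s * x\<^sup>2 / 2 \<le> D * x" and Dabs: "\<bar>D\<bar> \<le> s * \<bar>x\<bar>"
    using friction_monotone[where W = W and w = w] by (auto simp: D_def s_def x_def)
  have "(2 * \<delta>) * (s * x\<^sup>2) \<le> (a * R / 2) * (s * x\<^sup>2)" using aR s by (intro mult_right_mono) auto
  also have "\<dots> = (a * R) * (s * x\<^sup>2 / 2)" by simp
  also have "\<dots> \<le> (a * R) * (D * x)" using Dx aR \<delta> by (intro mult_left_mono) auto
  finally have 1: "2 * \<delta> * (s * x\<^sup>2) \<le> a * R * (D * x)" .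
  have "\<bar>D * y\<bar> \<le> s * (\<bar>x\<bar> * \<bar>y\<bar>)" unfolding abs_mult using mult_right_mono[OF Dabs, of "\<bar>y\<bar>"] by (simp add: mult_ac)
  also have "\<dots> \<le> s * (\<delta> * x\<^sup>2 + y\<^sup>2 / (4 * \<delta>))" using s Young[OF \<delta>] by (intro mult_left_mono) auto
  finally have 2: "- (D * y) \<le> \<delta> * (s * x\<^sup>2) + s * (y\<^sup>2 / (4 * \<delta>))" by (simp add: algebra_simps abs_le_iff)
  have "- (D * (a * R * x + y)) \<le> - \<delta> * (s * x\<^sup>2) + s * (y\<^sup>2 / (4 * \<delta>))"
    using 1 2 by (simp add: algebra_simps)
  then have "\<gamma> * - (D * (a * R * x + y)) \<le> \<gamma> * (- \<delta> * (s * x\<^sup>2) + s * (y\<^sup>2 / (4 * \<delta>)))"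
    using g by (intro mult_left_mono) auto
  then have A: "- \<gamma> * D * (a * R * x + y) \<le> - (\<gamma> * \<delta> * (s * x\<^sup>2)) + \<gamma> * (s * (y\<^sup>2 / (4 * \<delta>)))"
    by (simp add: algebra_simps)
  have "\<bar>x\<bar> ^ 3 \<le> s * x\<^sup>2"
  proof -
    have "\<bar>x\<bar> \<le> s" by (simp add: x_def s_def)
    then have "\<bar>x\<bar> * x\<^sup>2 \<le> s * x\<^sup>2" by (intro mult_right_mono) auto
    then show ?thesis by (simp add: power3_eq_cube power2_eq_square abs_mult_self_eq mult.assoc)
  qed
  then have B: "\<gamma>lo * \<delta> * \<bar>x\<bar> ^ 3 \<le> \<gamma> * \<delta> * (s * x\<^sup>2)"
    using \<gamma> \<delta> by (intro mult_mono) auto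
  have y2: "y\<^sup>2 \<le> 2 * (ahi * wbar)\<^sup>2 * (R - r)\<^sup>2 + 2 * \<phi>\<^sup>2"
  proof -
    have "y\<^sup>2 \<le> 2 * (a * w * (R - r))\<^sup>2 + 2 * \<phi>\<^sup>2"
      using square_sum_le(1)[of "a * w * (R - r)" "- \<phi>"] by (simp add: y_def)
    moreover have "\<bar>a * w\<bar> \<le> ahi * wbar" unfolding abs_mult using a w by (intro mult_mono) auto
    then have "(a * w)\<^sup>2 \<le> (ahi * wbar)\<^sup>2" by (metis abs_ge_zero power2_abs power_mono)
    then have "(a * w * (R - r))\<^sup>2 \<le> (ahi * wbar)\<^sup>2 * (R - r)\<^sup>2"
      unfolding power_mult_distrib[of "a * w"] by (intro mult_right_mono) auto
    ultimately show ?thesis by simp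
  qed
  have "\<gamma> * (s * (y\<^sup>2 / (4 * \<delta>))) \<le> \<gamma>hi * (3 * wbar * ((2 * (ahi * wbar)\<^sup>2 * (R - r)\<^sup>2 + 2 * \<phi>\<^sup>2) / (4 * \<delta>)))"
    using \<gamma> g s y2 \<delta> by (intro mult_mono divide_right_mono) auto
  also have "\<dots> = \<gamma>hi * (3 * wbar) / (2 * alo * \<rho>lo / 3) * (2 * (ahi * wbar)\<^sup>2 * (R - r)\<^sup>2 + 2 * \<phi>\<^sup>2)"
  proof -
    have d: "2 * alo * \<rho>lo / 3 = 4 * \<delta>" by (simp add: \<delta>_def)
    show ?thesis unfolding d by simp
  qed
  finally show ?thesis using A B unfolding z by (simp add: D_def[symmetric] \<delta>_def x_def)
qed

text \<open>The flux error is split into a velocity and a density error. The cube of the latter is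
  lowered to a square, since \<open>\<bar>R - r\<bar>\<close> is bounded by
  \<open>2 * \<rho>hi\<close>; it then belongs to the relative energy.\<close>

lemma flux_cube_bound:
  assumes r: "r \<in> {\<rho>lo..\<rho>hi}" and R: "R \<in> {2 * \<rho>lo / 3..3 * \<rho>hi / 2}" and w: "\<bar>w\<bar> \<le> wbar"
    and a: "0 < alo" "alo \<le> a" "a \<le> ahi"
  shows "\<bar>a * R * W - a * r * w\<bar> ^ 3
    \<le> 4 * (2 * ahi * \<rho>hi) ^ 3 * \<bar>W - w\<bar> ^ 3 + 4 * (ahi * wbar) ^ 3 * (2 * \<rho>hi) * (R - r)\<^sup>2"
proof -
  have a0: "0 \<le> a" "0 \<le> ahi" using a by auto
  have R0: "0 \<le> R" "R \<le> 2 * \<rho>hi" using R pos by auto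
  have "a * R * W - a * r * w = (a * R) * (W - w) + (a * w) * (R - r)" by (simp add: algebra_simps)
  then have "\<bar>a * R * W - a * r * w\<bar> \<le> \<bar>a * R\<bar> * \<bar>W - w\<bar> + \<bar>a * w\<bar> * \<bar>R - r\<bar>"
    by (metis abs_mult abs_triangle_ineq)
  also have "\<dots> \<le> (2 * ahi * \<rho>hi) * \<bar>W - w\<bar> + (ahi * wbar) * \<bar>R - r\<bar>"
  proof (intro add_mono mult_right_mono)
    have "a * R \<le> ahi * (2 * \<rho>hi)" using a a0 R0 by (intro mult_mono) auto
    then show "\<bar>a * R\<bar> \<le> 2 * ahi * \<rho>hi" using a0 R0 by simp
    show "\<bar>a * w\<bar> \<le> ahi * wbar" unfolding abs_mult using a a0 w by (intro mult_mono) auto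
  qed auto
  finally have "\<bar>a * R * W - a * r * w\<bar> ^ 3 \<le> ((2 * ahi * \<rho>hi) * \<bar>W - w\<bar> + (ahi * wbar) * \<bar>R - r\<bar>) ^ 3"
    by (intro power_mono) auto
  also have "\<dots> \<le> 4 * (((2 * ahi * \<rho>hi) * \<bar>W - w\<bar>) ^ 3 + ((ahi * wbar) * \<bar>R - r\<bar>) ^ 3)"
    using a0 pos by (intro cube_add_le) auto
  also have "\<dots> = 4 * (2 * ahi * \<rho>hi) ^ 3 * \<bar>W - w\<bar> ^ 3 + 4 * (ahi * wbar) ^ 3 * (\<bar>R - r\<bar> ^ 3)"
    by (simp add: power_mult_distrib)
  also have "\<dots> \<le> 4 * (2 * ahi * \<rho>hi) ^ 3 * \<bar>W - w\<bar> ^ 3 + 4 * (ahi * wbar) ^ 3 * (2 * \<rho>hi * (R - r)\<^sup>2)"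
  proof (intro add_left_mono mult_left_mono)
    have "\<bar>R - r\<bar> \<le> 2 * \<rho>hi" using r R pos by auto
    then have "\<bar>R - r\<bar> * (R - r)\<^sup>2 \<le> 2 * \<rho>hi * (R - r)\<^sup>2" by (intro mult_right_mono) auto
    moreover have "\<bar>R - r\<bar> ^ 3 = \<bar>R - r\<bar> * (R - r)\<^sup>2"
      by (simp only: power3_eq_cube power2_eq_square mult.assoc abs_mult_self_eq)
    ultimately show "\<bar>R - r\<bar> ^ 3 \<le> 2 * \<rho>hi * (R - r)\<^sup>2" by simp
  qed (use a0 pos in auto)
  finally show ?thesis by (simp add: mult.assoc)
qed

text \<open>All nonlinear terms of one time step at one point. In the application
  \<open>\<zeta>\<close> and \<open>\<theta>\<close> are the residuals of the mass and momentum
  equations, \<open>\<phi>\<close> is the interpolation error, \<open>\<psi>\<close> its difference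
  quotient in time and \<open>e\<close> the old velocity error. The order of quantifiers makes
  \<open>C\<close> and \<open>c\<close> uniform in \<open>\<epsilon>\<close> and in the
  coefficients.\<close>

lemma step_bound:
  assumes "0 < alo" "0 < ahi" "0 < \<gamma>lo" "0 < \<gamma>hi"
  shows "\<exists>C>0. \<exists>c>0. \<forall>\<epsilon> a \<gamma> r w R W \<phi> \<psi> \<zeta> \<theta> e.
    0 \<le> \<epsilon> \<longrightarrow> \<epsilon> \<le> \<epsilon>bar \<longrightarrow> alo \<le> a \<longrightarrow> a \<le> ahi \<longrightarrow> \<gamma>lo \<le> \<gamma> \<longrightarrow> \<gamma> \<le> \<gamma>hi \<longrightarrow>
    r \<in> {\<rho>lo..\<rho>hi} \<longrightarrow> \<bar>w\<bar> \<le> wbar \<longrightarrow> R \<in> {2 * \<rho>lo / 3..3 * \<rho>hi / 2} \<longrightarrow> \<bar>W\<bar> \<le> 3 * wbar / 2 \<longrightarrow>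
    a * (enth \<epsilon> R W - enth \<epsilon> r w) * \<zeta> + \<epsilon>\<^sup>2 * \<theta> * (a * R * W - a * r * w - \<phi>)
      - \<gamma> * (\<bar>W\<bar> * W - \<bar>w\<bar> * w) * (a * R * W - a * r * w - \<phi>) - \<epsilon>\<^sup>2 * \<psi> * e
    \<le> C * ((R - r)\<^sup>2 + \<epsilon>\<^sup>2 * (W - w)\<^sup>2 + \<epsilon>\<^sup>2 * e\<^sup>2 + \<phi>\<^sup>2 + \<psi>\<^sup>2 + \<zeta>\<^sup>2 + \<theta>\<^sup>2)
      - c * \<bar>a * R * W - a * r * w\<bar> ^ 3"
proof -
  define K1 where "K1 = ahi * (L + 2 * \<epsilon>bar * wbar)"
  define K2 where "K2 = \<epsilon>bar\<^sup>2 + 3 / 2 * ((2 * ahi * \<rho>hi)\<^sup>2 + \<epsilon>bar\<^sup>2 * (ahi * wbar)\<^sup>2 + \<epsilon>bar\<^sup>2)"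
  \<comment> \<open>\<open>q\<close> is the cubic friction constant, \<open>p\<close> below the
    factor of the cubic velocity error in the flux bound. With \<open>c = q / p\<close> the entire
    friction dissipation is spent on the flux error.\<close>
  define q where "q = \<gamma>lo * (alo * \<rho>lo / 6)"
  define k where "k = \<gamma>hi * (3 * wbar) / (2 * alo * \<rho>lo / 3)"
  define K3 where "K3 = k * (2 * (ahi * wbar)\<^sup>2) + k * 2"
  define p where "p = 4 * (2 * ahi * \<rho>hi) ^ 3"
  define K5 where "K5 = q / p * (4 * (ahi * wbar) ^ 3 * (2 * \<rho>hi))"
  define K4 where "K4 = \<epsilon>bar\<^sup>2 + 1"
  have pp: "0 < p" "0 < q" "0 < k" using assms pos by (auto simp: p_def q_def k_def)
  have Kpos: "0 < K1" "0 \<le> K2" "0 \<le> K3" "0 \<le> K5" "0 \<le> K4"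
    using assms pos pp by (auto simp: K1_def K2_def K3_def K5_def K4_def intro!: add_pos_pos mult_pos_pos)
  show ?thesis
  proof (rule exI[of _ "K1 + K2 + K3 + K5 + K4"], rule conjI[rotated], rule exI[of _ "q / p"],
      rule conjI[rotated], intro allI impI)
    show "0 < K1 + K2 + K3 + K5 + K4" "0 < q / p" using Kpos pp by auto
    fix \<epsilon> a \<gamma> r w R W \<phi> \<psi> \<zeta> \<theta> e :: real
    assume \<epsilon>: "0 \<le> \<epsilon>" "\<epsilon> \<le> \<epsilon>bar" and a: "alo \<le> a" "a \<le> ahi" and \<gamma>: "\<gamma>lo \<le> \<gamma>" "\<gamma> \<le> \<gamma>hi"
      and r: "r \<in> {\<rho>lo..\<rho>hi}" and w: "\<bar>w\<bar> \<le> wbar" and R: "R \<in> {2 * \<rho>lo / 3..3 * \<rho>hi / 2}" and W: "\<bar>W\<bar> \<le> 3 * wbar / 2"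
    define X Y E F G Z H where "X = (R - r)\<^sup>2" and "Y = \<epsilon>\<^sup>2 * (W - w)\<^sup>2" and "E = \<epsilon>\<^sup>2 * e\<^sup>2" and "F = \<phi>\<^sup>2"
      and "G = \<psi>\<^sup>2" and "Z = \<zeta>\<^sup>2" and "H = \<theta>\<^sup>2"
    define S where "S = X + Y + E + F + G + Z + H"
    have nn: "0 \<le> X" "0 \<le> Y" "0 \<le> E" "0 \<le> F" "0 \<le> G" "0 \<le> Z" "0 \<le> H"
      by (auto simp: X_def Y_def E_def F_def G_def Z_def H_def)
    define z where "z = a * R * W - a * r * w - \<phi>"
    have a0: "0 < a" using a assms by simp
    have \<epsilon>2: "\<epsilon>\<^sup>2 \<le> \<epsilon>bar\<^sup>2" using \<epsilon> by (intro power_mono) auto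
    have T1: "a * (enth \<epsilon> R W - enth \<epsilon> r w) * \<zeta> \<le> K1 * S"
    proof -
      have "a * (enth \<epsilon> R W - enth \<epsilon> r w) * \<zeta> \<le> \<bar>a * (enth \<epsilon> R W - enth \<epsilon> r w) * \<zeta>\<bar>" by simp
      also have "\<dots> = a * \<bar>enth \<epsilon> R W - enth \<epsilon> r w\<bar> * \<bar>\<zeta>\<bar>" using a0 by (simp add: abs_mult)
      also have "\<dots> \<le> ahi * ((L + 2 * \<epsilon>bar * wbar) * (\<bar>R - r\<bar> + \<epsilon> * \<bar>W - w\<bar>)) * \<bar>\<zeta>\<bar>"
        using a a0 \<epsilon> assms pos enth_difference[OF r R w W \<epsilon>] by (intro mult_mono) auto
      also have "\<dots> = K1 * (\<bar>R - r\<bar> * \<bar>\<zeta>\<bar> + \<bar>\<epsilon> * (W - w)\<bar> * \<bar>\<zeta>\<bar>)"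
      proof -
        have "\<bar>\<epsilon> * (W - w)\<bar> = \<epsilon> * \<bar>W - w\<bar>" using \<epsilon> by (simp add: abs_mult)
        then show ?thesis unfolding K1_def by (simp only: distrib_left distrib_right mult_ac)
      qed
      also have "\<dots> \<le> K1 * S"
      proof (intro mult_left_mono)
        have "\<bar>R - r\<bar> * \<bar>\<zeta>\<bar> \<le> 1 / 2 * X + Z / 2" using Young[of "1/2" "R - r" \<zeta>] by (simp add: X_def Z_def)
        moreover have "\<bar>\<epsilon> * (W - w)\<bar> * \<bar>\<zeta>\<bar> \<le> 1 / 2 * Y + Z / 2"
          using Young[of "1/2" "\<epsilon> * (W - w)" \<zeta>] by (simp add: Y_def Z_def power_mult_distrib)
        ultimately show "\<bar>R - r\<bar> * \<bar>\<zeta>\<bar> + \<bar>\<epsilon> * (W - w)\<bar> * \<bar>\<zeta>\<bar> \<le> S" using nn unfolding S_def by linarith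
      qed (use Kpos in simp)
      finally show ?thesis .
    qed
    have T2: "\<epsilon>\<^sup>2 * \<theta> * z \<le> K2 * S"
    proof -
      have "z = (a * R) * (W - w) + (a * w) * (R - r) + - \<phi>" by (simp add: z_def algebra_simps)
      then have "z\<^sup>2 \<le> 3 * ((a * R) * (W - w))\<^sup>2 + 3 * ((a * w) * (R - r))\<^sup>2 + 3 * \<phi>\<^sup>2"
        using square_sum_le(2)[of "(a * R) * (W - w)" "(a * w) * (R - r)" "- \<phi>"] by simp
      then have "\<epsilon>\<^sup>2 * z\<^sup>2 \<le> \<epsilon>\<^sup>2 * (3 * ((a * R) * (W - w))\<^sup>2 + 3 * ((a * w) * (R - r))\<^sup>2 + 3 * \<phi>\<^sup>2)"
        by (intro mult_left_mono) auto
      also have "\<dots> = 3 * ((a * R)\<^sup>2 * Y) + 3 * (\<epsilon>\<^sup>2 * (a * w)\<^sup>2 * X) + 3 * (\<epsilon>\<^sup>2 * F)"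
        by (simp only: X_def Y_def F_def power_mult_distrib distrib_left mult_ac)
      also have "\<dots> \<le> 3 * ((2 * ahi * \<rho>hi)\<^sup>2 * Y) + 3 * (\<epsilon>bar\<^sup>2 * (ahi * wbar)\<^sup>2 * X) + 3 * (\<epsilon>bar\<^sup>2 * F)"
      proof -
        have "a * R \<le> ahi * (2 * \<rho>hi)" using a a0 R pos by (intro mult_mono) auto
        then have 1: "(a * R)\<^sup>2 \<le> (2 * ahi * \<rho>hi)\<^sup>2" using a0 R pos by (intro power_mono) auto
        have "\<bar>a * w\<bar> \<le> ahi * wbar" unfolding abs_mult using a a0 w by (intro mult_mono) auto
        then have 2: "(a * w)\<^sup>2 \<le> (ahi * wbar)\<^sup>2" by (metis abs_ge_zero power2_abs power_mono)
        show ?thesis using 1 2 \<epsilon>2 nn by (intro add_mono mult_left_mono mult_mono) auto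
      qed
      finally have z2: "\<epsilon>\<^sup>2 * z\<^sup>2 \<le> 3 * ((2 * ahi * \<rho>hi)\<^sup>2 * Y) + 3 * (\<epsilon>bar\<^sup>2 * (ahi * wbar)\<^sup>2 * X) + 3 * (\<epsilon>bar\<^sup>2 * F)" .
      have "\<theta> * z \<le> \<theta>\<^sup>2 / 2 + z\<^sup>2 / 2" using sum_squares_bound[of \<theta> z] by simp
      then have "\<epsilon>\<^sup>2 * (\<theta> * z) \<le> \<epsilon>\<^sup>2 * (\<theta>\<^sup>2 / 2 + z\<^sup>2 / 2)" by (intro mult_left_mono) auto
      also have "\<dots> = \<epsilon>\<^sup>2 * H / 2 + \<epsilon>\<^sup>2 * z\<^sup>2 / 2" by (simp add: H_def algebra_simps)
      also have "\<dots> \<le> \<epsilon>bar\<^sup>2 * H / 2 + \<epsilon>\<^sup>2 * z\<^sup>2 / 2" using \<epsilon>2 nn by (intro add_right_mono divide_right_mono mult_right_mono) auto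
      finally have "\<epsilon>\<^sup>2 * \<theta> * z \<le> \<epsilon>bar\<^sup>2 * H + 3 / 2 * ((2 * ahi * \<rho>hi)\<^sup>2 * Y + \<epsilon>bar\<^sup>2 * (ahi * wbar)\<^sup>2 * X + \<epsilon>bar\<^sup>2 * F)"
      proof -
        have gen: "p \<le> h + 3 / 2 * (u + v + t)" if "p \<le> h / 2 + b / 2" "b \<le> 3 * u + 3 * v + 3 * t" "0 \<le> h"
          for p h b u v t :: real using that by (simp add: field_simps)
        show "\<epsilon>\<^sup>2 * (\<theta> * z) \<le> \<epsilon>bar\<^sup>2 * H / 2 + \<epsilon>\<^sup>2 * z\<^sup>2 / 2 \<Longrightarrow> ?thesis"
          unfolding mult.assoc[of "\<epsilon>\<^sup>2" \<theta> z]
          by (rule gen[OF _ z2]) (use nn in auto)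
      qed
      also have "\<dots> \<le> \<epsilon>bar\<^sup>2 * S + 3 / 2 * ((2 * ahi * \<rho>hi)\<^sup>2 * S + \<epsilon>bar\<^sup>2 * (ahi * wbar)\<^sup>2 * S + \<epsilon>bar\<^sup>2 * S)"
        using nn by (intro add_mono mult_left_mono) (auto simp: S_def)
      also have "\<dots> = K2 * S" by (simp add: K2_def algebra_simps)
      finally show ?thesis .
    qed
    have T3: "- \<gamma> * (\<bar>W\<bar> * W - \<bar>w\<bar> * w) * z \<le> - q * \<bar>W - w\<bar> ^ 3 + K3 * S"
    proof -
      have "- \<gamma> * (\<bar>W\<bar> * W - \<bar>w\<bar> * w) * z \<le> - q * \<bar>W - w\<bar> ^ 3 + k * (2 * (ahi * wbar)\<^sup>2 * X + 2 * F)"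
        using friction_bound[OF r R w W assms(1) a assms(3) \<gamma>, of \<phi>] by (simp add: z_def q_def k_def X_def F_def)
      also have "\<dots> = - q * \<bar>W - w\<bar> ^ 3 + (k * (2 * (ahi * wbar)\<^sup>2) * X + k * 2 * F)" by (simp add: distrib_left)
      also have "\<dots> \<le> - q * \<bar>W - w\<bar> ^ 3 + (k * (2 * (ahi * wbar)\<^sup>2) * S + k * 2 * S)"
        using pp nn by (intro add_left_mono add_mono mult_left_mono) (auto simp: S_def)
      finally show ?thesis by (simp add: K3_def distrib_right)
    qed
    have T4: "- \<epsilon>\<^sup>2 * \<psi> * e \<le> K4 * S"
    proof -
      have "- (\<psi> * e) \<le> \<psi>\<^sup>2 / 2 + e\<^sup>2 / 2" using sum_squares_bound[of \<psi> "- e"] by simp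
      then have "\<epsilon>\<^sup>2 * - (\<psi> * e) \<le> \<epsilon>\<^sup>2 * (\<psi>\<^sup>2 / 2 + e\<^sup>2 / 2)" by (intro mult_left_mono) auto
      also have "\<dots> = \<epsilon>\<^sup>2 * G / 2 + E / 2" by (simp add: G_def E_def algebra_simps)
      also have "\<dots> \<le> \<epsilon>bar\<^sup>2 * G + E"
        using \<epsilon>2 nn mult_right_mono[OF \<epsilon>2 nn(5)] mult_nonneg_nonneg[OF zero_le_power2[of \<epsilon>bar] nn(5)] by linarith
      also have "\<dots> \<le> \<epsilon>bar\<^sup>2 * S + S" using nn by (intro add_mono mult_left_mono) (auto simp: S_def)
      finally show ?thesis by (simp add: K4_def algebra_simps)
    qed
    have T5: "q / p * \<bar>a * R * W - a * r * w\<bar> ^ 3 \<le> q * \<bar>W - w\<bar> ^ 3 + K5 * S"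
    proof -
      have "q / p * \<bar>a * R * W - a * r * w\<bar> ^ 3 \<le> q / p * (p * \<bar>W - w\<bar> ^ 3 + 4 * (ahi * wbar) ^ 3 * (2 * \<rho>hi) * X)"
        using flux_cube_bound[OF r R w assms(1) a, of W] pp by (intro mult_left_mono) (auto simp: p_def X_def)
      also have "\<dots> = q * \<bar>W - w\<bar> ^ 3 + K5 * X" using pp by (simp add: K5_def field_simps)
      also have "\<dots> \<le> q * \<bar>W - w\<bar> ^ 3 + K5 * S" using Kpos nn by (intro add_left_mono mult_left_mono) (auto simp: S_def)
      finally show ?thesis .
    qed
    have "a * (enth \<epsilon> R W - enth \<epsilon> r w) * \<zeta> + \<epsilon>\<^sup>2 * \<theta> * z - \<gamma> * (\<bar>W\<bar> * W - \<bar>w\<bar> * w) * z - \<epsilon>\<^sup>2 * \<psi> * e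
      \<le> K1 * S + K2 * S + K3 * S + K5 * S + K4 * S - q / p * \<bar>a * R * W - a * r * w\<bar> ^ 3"
      using T1 T2 T3 T4 T5 by simp
    also have "K1 * S + K2 * S + K3 * S + K5 * S + K4 * S = (K1 + K2 + K3 + K5 + K4) * S" by (simp add: algebra_simps)
    finally show "a * (enth \<epsilon> R W - enth \<epsilon> r w) * \<zeta> + \<epsilon>\<^sup>2 * \<theta> * (a * R * W - a * r * w - \<phi>)
        - \<gamma> * (\<bar>W\<bar> * W - \<bar>w\<bar> * w) * (a * R * W - a * r * w - \<phi>) - \<epsilon>\<^sup>2 * \<psi> * e
      \<le> (K1 + K2 + K3 + K5 + K4) * ((R - r)\<^sup>2 + \<epsilon>\<^sup>2 * (W - w)\<^sup>2 + \<epsilon>\<^sup>2 * e\<^sup>2 + \<phi>\<^sup>2 + \<psi>\<^sup>2 + \<zeta>\<^sup>2 + \<theta>\<^sup>2)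
        - q / p * \<bar>a * R * W - a * r * w\<bar> ^ 3"
      unfolding z_def S_def X_def Y_def E_def F_def G_def Z_def H_def .
  qed
qed

end

section \<open>Essentially bounded functions, network norms and a discrete Gronwall lemma\<close>

text \<open>Unlike \<open>Lp 2 l\<close>, this class is closed under products, so that integrability
  of the energy densities follows structurally. The bound holds only almost everywhere because the
  admissibility of the discrete state does.\<close>

definition ess_bounded :: "real \<Rightarrow> (real \<Rightarrow> real) \<Rightarrow> bool" where
  "ess_bounded l f \<longleftrightarrow> f \<in> borel_measurable (pipe l) \<and> (\<exists>B. AE x in pipe l. \<bar>f x\<bar> \<le> B)"

lemma ess_boundedI: "f \<in> borel_measurable (pipe l) \<Longrightarrow> AE x in pipe l. \<bar>f x\<bar> \<le> B \<Longrightarrow> ess_bounded l f"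
  by (auto simp: ess_bounded_def)

lemma ess_bounded_measurable: "ess_bounded l f \<Longrightarrow> f \<in> borel_measurable (pipe l)"
  by (simp add: ess_bounded_def)

lemma ess_bounded_const [intro]: "ess_bounded l (\<lambda>x. c)"
  by (rule ess_boundedI[of _ _ "\<bar>c\<bar>"]) auto

lemma ess_bounded_add [intro]:
  assumes "ess_bounded l f" "ess_bounded l g" shows "ess_bounded l (\<lambda>x. f x + g x)"
proof -
  obtain B C where b: "AE x in pipe l. \<bar>f x\<bar> \<le> B" "AE x in pipe l. \<bar>g x\<bar> \<le> C"
    using assms by (auto simp: ess_bounded_def)
  show ?thesis
  proof (rule ess_boundedI[of _ _ "B + C"])
    show "AE x in pipe l. \<bar>f x + g x\<bar> \<le> B + C" using b by eventually_elim linarith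
  qed (use assms in \<open>auto simp: ess_bounded_def\<close>)
qed

lemma ess_bounded_mult [intro]:
  assumes "ess_bounded l f" "ess_bounded l g" shows "ess_bounded l (\<lambda>x. f x * g x)"
proof -
  obtain B C where b: "AE x in pipe l. \<bar>f x\<bar> \<le> B" "AE x in pipe l. \<bar>g x\<bar> \<le> C"
    using assms by (auto simp: ess_bounded_def)
  show ?thesis
  proof (rule ess_boundedI[of _ _ "\<bar>B\<bar> * \<bar>C\<bar>"])
    show "AE x in pipe l. \<bar>f x * g x\<bar> \<le> \<bar>B\<bar> * \<bar>C\<bar>"
      using b unfolding abs_mult by eventually_elim (auto intro!: mult_mono)
  qed (use assms in \<open>auto simp: ess_bounded_def\<close>)
qed

lemma ess_bounded_abs [intro]: "ess_bounded l f \<Longrightarrow> ess_bounded l (\<lambda>x. \<bar>f x\<bar>)"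
  by (auto simp: ess_bounded_def)

lemma ess_bounded_power [intro]: "ess_bounded l f \<Longrightarrow> ess_bounded l (\<lambda>x. f x ^ n)"
  by (induction n) auto

lemma ess_bounded_minus [intro]: "ess_bounded l f \<Longrightarrow> ess_bounded l (\<lambda>x. - f x)"
  by (auto simp: ess_bounded_def)

lemma ess_bounded_diff [intro]: "ess_bounded l f \<Longrightarrow> ess_bounded l g \<Longrightarrow> ess_bounded l (\<lambda>x. f x - g x)"
  using ess_bounded_add[OF _ ess_bounded_minus, of l f g] by simp

lemma ess_bounded_divide [intro]: "ess_bounded l f \<Longrightarrow> ess_bounded l (\<lambda>x. f x / c)"
  using ess_bounded_mult[OF _ ess_bounded_const, of l f "1 / c"] by simp

lemma ess_bounded_continuous: "continuous_on {0..l} f \<Longrightarrow> ess_bounded l f"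
proof -
  assume f: "continuous_on {0..l} f"
  obtain B where "\<forall>x\<in>{0..l}. \<bar>f x\<bar> \<le> B"
    using compact_imp_bounded[OF compact_continuous_image[OF f compact_Icc]] by (auto simp: bounded_iff)
  then show ?thesis
    by (intro ess_boundedI[of _ _ B] borel_measurable_pipe_continuous_on f AE_I2) auto
qed

lemma ess_bounded_Lp2: "ess_bounded l f \<Longrightarrow> f \<in> Lp 2 l"
  by (auto simp: ess_bounded_def intro: Lp2_bounded)

lemma ess_bounded_integrable: "ess_bounded l f \<Longrightarrow> integrable (pipe l) f"
  by (rule Lp2_integrable[OF ess_bounded_Lp2])

lemma ess_bounded_mult_Lp2: "ess_bounded l f \<Longrightarrow> g \<in> Lp 2 l \<Longrightarrow> (\<lambda>x. f x * g x) \<in> Lp 2 l"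
  by (auto simp: ess_bounded_def intro: Lp2_bounded_mult)

text \<open>A violation at an inner point persists on an interval of positive measure; the end
  points follow by continuity. It turns the almost everywhere bounds on the exact state into bounds
  at every point, as the chain rule and the traces require.\<close>

lemma continuous_on_AE_le:
  fixes u :: "real \<Rightarrow> real"
  assumes u: "continuous_on {0..l} u" and ae: "AE x in pipe l. u x \<le> c" and l: "0 < l" and x: "0 \<le> x" "x \<le> l"
  shows "u x \<le> c"
proof -
  have inner: "u x \<le> c" if x: "x \<in> {0<..<l}" for x
  proof (rule ccontr)
    assume "\<not> u x \<le> c"
    then have gt: "c < u x" by simp
    obtain d where d: "0 < d" "\<And>y. y \<in> {0..l} \<Longrightarrow> \<bar>y - x\<bar> < d \<Longrightarrow> \<bar>u y - u x\<bar> < u x - c"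
      using u[unfolded continuous_on_iff, rule_format, of x "u x - c"] gt x by (auto simp: dist_real_def)
    define p q where "p = max 0 (x - d)" and "q = min l (x + d)"
    have pq: "0 \<le> p" "p < q" "q \<le> l" using d x by (auto simp: p_def q_def)
    have "AE y in pipe l. y \<notin> {p<..<q}"
      using ae
    proof (rule eventually_mono)
      fix y assume le: "u y \<le> c"
      show "y \<notin> {p<..<q}"
      proof
        assume "y \<in> {p<..<q}"
        then have "y \<in> {0..l}" "\<bar>y - x\<bar> < d" by (auto simp: p_def q_def)
        from d(2)[OF this] le show False by linarith
      qed
    qed
    then have "emeasure (pipe l) {p<..<q} = 0"
      using pq by (subst (asm) AE_iff_measurable[where N = "{p<..<q}"]) auto
    then show False using pq emeasure_pipe[of p q l] by simp
  qed
  have "continuous_on (closure {0<..<l}) u" using u l by simp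
  then show ?thesis
    using continuous_le_on_closure[of "{0<..<l}" u x c] inner x l by simp
qed

section \<open>Network norms and sums over arcs and vertices\<close>

lemma LpE_norm_2: "LpE_norm G \<l> 2 u = sqrt (\<Sum>e\<in>arcs G. \<integral>x. (u e x)\<^sup>2 \<partial>pipe (\<l> e))"
  by (simp add: LpE_norm_def powr_half_sqrt sum_nonneg)

lemma LpE_norm_2_square: "(LpE_norm G \<l> 2 u)\<^sup>2 = (\<Sum>e\<in>arcs G. \<integral>x. (u e x)\<^sup>2 \<partial>pipe (\<l> e))"
  by (simp add: LpE_norm_2 sum_nonneg)

lemma LpE_norm_3_cube: "(LpE_norm G \<l> 3 u) ^ 3 = (\<Sum>e\<in>arcs G. \<integral>x. \<bar>u e x\<bar> ^ 3 \<partial>pipe (\<l> e))"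
proof -
  define S where "S = (\<Sum>e\<in>arcs G. \<integral>x. \<bar>u e x\<bar> ^ 3 \<partial>pipe (\<l> e))"
  have S: "0 \<le> S" by (simp add: S_def sum_nonneg)
  have "(S powr (1 / 3)) ^ 3 = S"
    using S by (simp add: powr_powr flip: powr_numeral)
  then show ?thesis by (simp add: LpE_norm_def S_def)
qed

lemma edge_le_network:
  assumes "finite (arcs G)" "e \<in> arcs G"
  shows "(\<integral>x. (u e x)\<^sup>2 \<partial>pipe (\<l> e)) \<le> (LpE_norm G \<l> 2 u)\<^sup>2"
  unfolding LpE_norm_2_square using assms by (intro member_le_sum) auto

lemma H1pw_norm_square:
  "(H1pw_norm G \<l> u)\<^sup>2 = (\<Sum>e\<in>arcs G.
     (\<integral>x. (u e x)\<^sup>2 \<partial>pipe (\<l> e)) + (\<integral>x. (dx \<l> u e x)\<^sup>2 \<partial>pipe (\<l> e)))"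
  by (simp add: H1pw_norm_def sum_nonneg)

lemma edge_le_network_H1:
  assumes "finite (arcs G)" "e \<in> arcs G"
  shows "(\<integral>x. (u e x)\<^sup>2 \<partial>pipe (\<l> e)) + (\<integral>x. (dx \<l> u e x)\<^sup>2 \<partial>pipe (\<l> e)) \<le> (H1pw_norm G \<l> u)\<^sup>2"
  unfolding H1pw_norm_square using assms
  by (intro member_le_sum[of e "arcs G" "\<lambda>e. (\<integral>x. (u e x)\<^sup>2 \<partial>pipe (\<l> e)) + (\<integral>x. (dx \<l> u e x)\<^sup>2 \<partial>pipe (\<l> e))"]) auto

lemma norm_nonneg_network: "0 \<le> LpE_norm G \<l> 2 u" "0 \<le> H1pw_norm G \<l> u"
  by (auto simp: LpE_norm_2 H1pw_norm_def intro!: real_sqrt_ge_zero sum_nonneg)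

text \<open>The divergence theorem on the graph, by interchanging the two sums. Absence of loops
  ensures that every arc has two distinct ends and enters once with each sign.\<close>

lemma sum_arcs_eq_sum_verts:
  assumes "fin_digraph G" "loopfree_digraph G"
  shows "(\<Sum>e\<in>arcs G. f e (\<l> e) - f e 0)
    = (\<Sum>v\<in>verts G. \<Sum>e\<in>incident_arcs G v. vertex_value G \<l> f e v * edge_sign G e v)"
proof -
  interpret fin_digraph G by fact
  interpret loopfree_digraph G by fact
  have "(\<Sum>v\<in>verts G. \<Sum>e\<in>incident_arcs G v. vertex_value G \<l> f e v * edge_sign G e v)
      = (\<Sum>e\<in>arcs G. \<Sum>v\<in>{v\<in>verts G. tail G e = v \<or> head G e = v}. vertex_value G \<l> f e v * edge_sign G e v)"
    unfolding incident_arcs_def by (rule sum.swap_restrict) auto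
  also have "\<dots> = (\<Sum>e\<in>arcs G. f e (\<l> e) - f e 0)"
  proof (rule sum.cong[OF refl])
    fix e assume e: "e \<in> arcs G"
    have ne: "tail G e \<noteq> head G e" by (rule no_loops[OF e])
    have "{v\<in>verts G. tail G e = v \<or> head G e = v} = {tail G e, head G e}" using e by auto
    then show "(\<Sum>v\<in>{v\<in>verts G. tail G e = v \<or> head G e = v}. vertex_value G \<l> f e v * edge_sign G e v) = f e (\<l> e) - f e 0"
      using ne by (simp add: vertex_value_def edge_sign_def)
  qed
  finally show ?thesis by simp
qed

text \<open>The implicit term \<open>S n\<close> on the right is absorbed thanks to
  \<open>C * dt \<le> 1 / 2\<close>; each step then costs at most a factor
  \<open>exp (4 * C * dt)\<close>. The accumulated dissipation and the source \<open>D\<close> are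
  carried along in the induction.\<close>

lemma discrete_Gronwall:
  fixes S Q :: "nat \<Rightarrow> real"
  assumes step: "\<And>n. 1 \<le> n \<Longrightarrow> n \<le> N \<Longrightarrow> S n + dt * Q n \<le> S (n - 1) + C * dt * (S n + S (n - 1) + D)"
    and nn: "\<And>n. n \<le> N \<Longrightarrow> 0 \<le> S n" "\<And>n. n \<le> N \<Longrightarrow> 0 \<le> Q n"
    and C: "0 \<le> C" "C * dt \<le> 1 / 2" and dt: "0 \<le> dt" and D: "0 \<le> D" and n: "n \<le> N"
  shows "S n + (\<Sum>k=1..n. dt * Q k) \<le> exp (4 * C * (real n * dt)) * (S 0 + D)"
proof -
  define c where "c = C * dt"
  have c: "0 \<le> c" "c \<le> 1 / 2" using C dt by (auto simp: c_def)
  \<comment> \<open>For \<open>c\<close> up to 1/2 the quotient is at most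
    \<open>1 + 4 * c\<close>.\<close>
  have ex: "(1 + c) / (1 - c) \<le> exp (4 * c)"
  proof -
    have "(1 + c) \<le> (1 + 4 * c) * (1 - c)"
    proof -
      have "c * c \<le> c * (1 / 2)" using c by (intro mult_left_mono) auto
      then show ?thesis by (simp add: algebra_simps)
    qed
    then have "(1 + c) / (1 - c) \<le> 1 + 4 * c" using c by (simp add: divide_le_eq)
    also have "\<dots> \<le> exp (4 * c)" by (rule exp_ge_add_one_self)
    finally show ?thesis .
  qed
  have "S n + (\<Sum>k=1..n. dt * Q k) + D \<le> exp (4 * c * real n) * (S 0 + D)" using n
  proof (induction n)
    case 0
    then show ?case by simp
  next
    case (Suc n)
    define q where "q = (\<Sum>k=1..n. dt * Q k)"
    have q: "0 \<le> q" unfolding q_def using nn(2) dt Suc.prems by (intro sum_nonneg mult_nonneg_nonneg) auto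
    have Q: "0 \<le> dt * Q (Suc n)" using nn(2)[of "Suc n"] dt Suc.prems by simp
    have s: "S (Suc n) + dt * Q (Suc n) \<le> S n + c * (S (Suc n) + S n + D)"
      using step[of "Suc n"] Suc.prems by (simp add: c_def)
    have "(1 - c) * (S (Suc n) + (q + dt * Q (Suc n)) + D)
        = (S (Suc n) + dt * Q (Suc n)) - c * S (Suc n) - c * (dt * Q (Suc n)) + (1 - c) * q + (1 - c) * D"
      by (simp add: algebra_simps)
    also have "\<dots> \<le> (1 + c) * S n + q + D"
      using s mult_nonneg_nonneg[OF c(1) Q] mult_nonneg_nonneg[OF c(1) q] by (simp add: algebra_simps)
    also have "\<dots> \<le> (1 + c) * (S n + q + D)" using mult_nonneg_nonneg[OF c(1) q] mult_nonneg_nonneg[OF c(1) D] by (simp add: algebra_simps)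
    finally have "S (Suc n) + (q + dt * Q (Suc n)) + D \<le> (1 + c) / (1 - c) * (S n + q + D)"
      using c by (simp add: field_simps)
    also have "\<dots> \<le> exp (4 * c) * (S n + q + D)"
      using ex nn(1)[of n] q D Suc.prems by (intro mult_right_mono) auto
    also have "\<dots> \<le> exp (4 * c) * (exp (4 * c * real n) * (S 0 + D))"
      using Suc by (intro mult_left_mono) (auto simp: q_def)
    also have "\<dots> = exp (4 * c * real (Suc n)) * (S 0 + D)"
    proof -
      have "4 * c * real (Suc n) = 4 * c + 4 * c * real n" by (simp add: algebra_simps)
      then show ?thesis by (simp only: exp_add mult.assoc)
    qed
    finally show ?case by (simp add: q_def)
  qed
  then show ?thesis using D by (simp add: c_def mult_ac)
qed

section \<open>The energy density corrected by the interpolation error\<close>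

context gas_law
begin

text \<open>The scheme can only be tested with \<open>m\<^sub>h - I\<^sub>h m = (m\<^sub>h - m) - \<phi>\<close>. The product of \<open>\<phi>\<close> with the
  difference quotient of \<open>\<epsilon>\<^sup>2 (W - w)\<close> is summed by parts in time, which leaves the last term below.\<close>

definition energy :: "real \<Rightarrow> real \<Rightarrow> (real \<Rightarrow> real) \<Rightarrow> (real \<Rightarrow> real) \<Rightarrow> (real \<Rightarrow> real) \<Rightarrow> (real \<Rightarrow> real) \<Rightarrow> (real \<Rightarrow> real) \<Rightarrow> real \<Rightarrow> real" where
  "energy \<epsilon> a r w R W \<phi> x = a * rel_energy \<epsilon> (r x) (w x) (R x) (W x) - \<epsilon>\<^sup>2 * \<phi> x * (W x - w x)"

text \<open>Young's inequality with \<open>\<delta> = alo * c0 / 2\<close> lets half of the coercive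
  part absorb the correction. The price is a multiple of \<open>(\<phi> x)\<^sup>2\<close>, whose
  integral is of the order of the squared mesh size.\<close>

lemma energy_bounds:
  assumes "r x \<in> {\<rho>lo..\<rho>hi}" "\<bar>w x\<bar> \<le> wbar" "R x \<in> {2 * \<rho>lo / 3..3 * \<rho>hi / 2}" "\<bar>W x\<bar> \<le> 3 * wbar / 2"
    and \<epsilon>: "0 \<le> \<epsilon>" "\<epsilon> \<le> \<epsilon>bar" and a: "0 < alo" "alo \<le> a" "a \<le> ahi"
  shows "alo * c0 / 2 * ((R x - r x)\<^sup>2 + \<epsilon>\<^sup>2 * (W x - w x)\<^sup>2) - \<epsilon>bar\<^sup>2 / (2 * alo * c0) * (\<phi> x)\<^sup>2 \<le> energy \<epsilon> a r w R W \<phi> x"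
    and "energy \<epsilon> a r w R W \<phi> x \<le> (ahi * C0 + 1) * ((R x - r x)\<^sup>2 + \<epsilon>\<^sup>2 * (W x - w x)\<^sup>2) + \<epsilon>bar\<^sup>2 * (\<phi> x)\<^sup>2"
proof -
  define X Y where "X = (R x - r x)\<^sup>2" and "Y = \<epsilon>\<^sup>2 * (W x - w x)\<^sup>2"
  have nn: "0 \<le> X" "0 \<le> Y" by (auto simp: X_def Y_def)
  have rl: "c0 * (X + Y) \<le> rel_energy \<epsilon> (r x) (w x) (R x) (W x)" "rel_energy \<epsilon> (r x) (w x) (R x) (W x) \<le> C0 * (X + Y)"
    unfolding X_def Y_def using assms pos by (intro rel_energy_bounds; auto)+
  have \<epsilon>2: "\<epsilon>\<^sup>2 \<le> \<epsilon>bar\<^sup>2" using \<epsilon> by (intro power_mono) auto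
  have yo: "\<bar>\<epsilon>\<^sup>2 * \<phi> x * (W x - w x)\<bar> \<le> \<delta> * Y + \<epsilon>bar\<^sup>2 * (\<phi> x)\<^sup>2 / (4 * \<delta>)" if "0 < \<delta>" for \<delta>
  proof -
    have "\<bar>\<epsilon>\<^sup>2 * \<phi> x * (W x - w x)\<bar> = \<bar>\<epsilon> * (W x - w x)\<bar> * \<bar>\<epsilon> * \<phi> x\<bar>" by (simp add: abs_mult power2_eq_square)
    also have "\<dots> \<le> \<delta> * (\<epsilon> * (W x - w x))\<^sup>2 + (\<epsilon> * \<phi> x)\<^sup>2 / (4 * \<delta>)" by (rule Young[OF that])
    also have "\<dots> \<le> \<delta> * Y + \<epsilon>bar\<^sup>2 * (\<phi> x)\<^sup>2 / (4 * \<delta>)"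
      using \<epsilon>2 that by (intro add_mono divide_right_mono) (auto simp: Y_def power_mult_distrib intro!: mult_right_mono)
    finally show ?thesis .
  qed
  have d: "0 < alo * c0 / 2" using a c0_pos by simp
  have "alo * (c0 * (X + Y)) \<le> a * rel_energy \<epsilon> (r x) (w x) (R x) (W x)"
    using rl(1) a c0_pos nn by (intro mult_mono) auto
  moreover have "\<bar>\<epsilon>\<^sup>2 * \<phi> x * (W x - w x)\<bar> \<le> alo * c0 / 2 * Y + \<epsilon>bar\<^sup>2 / (2 * alo * c0) * (\<phi> x)\<^sup>2"
    using yo[OF d] by (simp add: mult.assoc)
  moreover have "0 \<le> alo * c0 / 2 * X" using d nn by simp
  ultimately show "alo * c0 / 2 * ((R x - r x)\<^sup>2 + \<epsilon>\<^sup>2 * (W x - w x)\<^sup>2) - \<epsilon>bar\<^sup>2 / (2 * alo * c0) * (\<phi> x)\<^sup>2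
      \<le> energy \<epsilon> a r w R W \<phi> x"
  proof -
    have "alo * c0 / 2 * (X + Y) = alo * (c0 * (X + Y)) - alo * c0 / 2 * X - alo * c0 / 2 * Y" by (simp add: field_simps)
    then show ?thesis
      if "alo * (c0 * (X + Y)) \<le> a * rel_energy \<epsilon> (r x) (w x) (R x) (W x)"
        "\<bar>\<epsilon>\<^sup>2 * \<phi> x * (W x - w x)\<bar> \<le> alo * c0 / 2 * Y + \<epsilon>bar\<^sup>2 / (2 * alo * c0) * (\<phi> x)\<^sup>2" "0 \<le> alo * c0 / 2 * X"
      unfolding energy_def X_def[symmetric] Y_def[symmetric] using that abs_le_D1[OF that(2)] by linarith
  qed
  have "a * rel_energy \<epsilon> (r x) (w x) (R x) (W x) \<le> a * (C0 * (X + Y))" using rl(2) a by (intro mult_left_mono) auto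
  also have "\<dots> \<le> ahi * (C0 * (X + Y))" using a C0_pos nn by (intro mult_right_mono) auto
  finally have "a * rel_energy \<epsilon> (r x) (w x) (R x) (W x) \<le> ahi * (C0 * (X + Y))" .
  moreover have "\<bar>\<epsilon>\<^sup>2 * \<phi> x * (W x - w x)\<bar> \<le> Y + \<epsilon>bar\<^sup>2 * (\<phi> x)\<^sup>2 / 4" using yo[of 1] by simp
  then have "- (\<epsilon>\<^sup>2 * \<phi> x * (W x - w x)) \<le> Y + \<epsilon>bar\<^sup>2 * (\<phi> x)\<^sup>2 / 4" by (rule abs_le_D2)
  moreover have "0 \<le> \<epsilon>bar\<^sup>2 * (\<phi> x)\<^sup>2" by simp
  ultimately have "energy \<epsilon> a r w R W \<phi> x \<le> ahi * (C0 * (X + Y)) + (X + Y) + \<epsilon>bar\<^sup>2 * (\<phi> x)\<^sup>2"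
    unfolding energy_def using nn by linarith
  then show "energy \<epsilon> a r w R W \<phi> x \<le> (ahi * C0 + 1) * ((R x - r x)\<^sup>2 + \<epsilon>\<^sup>2 * (W x - w x)\<^sup>2) + \<epsilon>bar\<^sup>2 * (\<phi> x)\<^sup>2"
    unfolding X_def[symmetric] Y_def[symmetric] by (simp add: algebra_simps)
qed

text \<open>The increment is sorted into three parts: the terms matching the scheme tested with
  \<open>z\<close>, whose derivative is \<open>z'\<close>; the products with the residuals; and the
  cost of moving the base point. Here \<open>v\<close> stands for the exact time derivative of the
  velocity and \<open>q\<close> for the projected one of the density.\<close>

lemma energy_increment:
  assumes r: "r0 x \<in> {\<rho>lo..\<rho>hi}" "r1 x \<in> {\<rho>lo..\<rho>hi}"
    and R: "R0 x \<in> {2 * \<rho>lo / 3..3 * \<rho>hi / 2}" "R1 x \<in> {2 * \<rho>lo / 3..3 * \<rho>hi / 2}"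
    and W: "\<bar>W0 x\<bar> \<le> 3 * wbar / 2" "\<bar>W1 x\<bar> \<le> 3 * wbar / 2"
    and B: "\<bar>r1 x - r0 x\<bar> \<le> B * dt" "\<bar>w1 x - w0 x\<bar> \<le> B * dt" and b: "B * dt \<le> \<kappa>"
    and \<epsilon>: "0 \<le> \<epsilon>" "\<epsilon> \<le> \<epsilon>bar" and a: "0 < a" "a \<le> ahi" and dt: "0 < dt"
    and z: "z = a * R1 x * W1 x - a * r1 x * w1 x - \<phi>1 x"
    and z': "z' = - a * (R1 x - R0 x) / dt + a * q"
  shows "energy \<epsilon> a r1 w1 R1 W1 \<phi>1 x - energy \<epsilon> a r0 w0 R0 W0 \<phi>0 x
    \<le> dt * (\<epsilon>\<^sup>2 * ((W1 x - W0 x) / dt - v) * z - (enth \<epsilon> (R1 x) (W1 x) - enth \<epsilon> (r1 x) (w1 x)) * z')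
      + dt * (a * (enth \<epsilon> (R1 x) (W1 x) - enth \<epsilon> (r1 x) (w1 x)) * (q - (r1 x - r0 x) / dt)
        + \<epsilon>\<^sup>2 * (v - (w1 x - w0 x) / dt) * z - \<epsilon>\<^sup>2 * ((\<phi>1 x - \<phi>0 x) / dt) * (W0 x - w0 x))
      + dt * (ahi * (L + \<epsilon>bar\<^sup>2 + 1) * B * ((R0 x - r0 x)\<^sup>2 + \<epsilon>\<^sup>2 * (W0 x - w0 x)\<^sup>2))"
proof -
  define \<eta> where "\<eta> = enth \<epsilon> (R1 x) (W1 x) - enth \<epsilon> (r1 x) (w1 x)"
  define J where "J = (L + \<epsilon>bar\<^sup>2 + 1) * (B * dt) * ((R0 x - r0 x)\<^sup>2 + \<epsilon>\<^sup>2 * (W0 x - w0 x)\<^sup>2)"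
  have "0 \<le> B * dt" using B(1) by linarith
  then have J0: "0 \<le> J" unfolding J_def using pos by simp
  have "a * (rel_energy \<epsilon> (r1 x) (w1 x) (R1 x) (W1 x) - rel_energy \<epsilon> (r0 x) (w0 x) (R0 x) (W0 x))
    \<le> a * (\<eta> * ((R1 x - R0 x) - (r1 x - r0 x))
      + \<epsilon>\<^sup>2 * (R1 x * W1 x - r1 x * w1 x) * ((W1 x - W0 x) - (w1 x - w0 x)) + J)"
    unfolding \<eta>_def J_def using a by (intro mult_left_mono rel_energy_increment[OF r R W B b \<epsilon>]) auto
  also have "\<dots> \<le> a * (\<eta> * ((R1 x - R0 x) - (r1 x - r0 x)))
      + \<epsilon>\<^sup>2 * (z + \<phi>1 x) * ((W1 x - W0 x) - (w1 x - w0 x)) + ahi * J"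
    using mult_right_mono[OF a(2) J0] by (simp add: z algebra_simps)
  also have "\<dots> = dt * (\<epsilon>\<^sup>2 * ((W1 x - W0 x) / dt - v) * z - \<eta> * z')
      + dt * (a * \<eta> * (q - (r1 x - r0 x) / dt) + \<epsilon>\<^sup>2 * (v - (w1 x - w0 x) / dt) * z - \<epsilon>\<^sup>2 * ((\<phi>1 x - \<phi>0 x) / dt) * (W0 x - w0 x))
      + ahi * J + (\<epsilon>\<^sup>2 * \<phi>1 x * (W1 x - w1 x) - \<epsilon>\<^sup>2 * \<phi>0 x * (W0 x - w0 x))"
  \<comment> \<open>The difference of the last two terms is the increment of the correction:
    \<open>\<phi>1 * (W1 - w1) - \<phi>0 * (W0 - w0)\<close> equals \<open>\<phi>1\<close> times the
    increment of \<open>W - w\<close> plus the increment of \<open>\<phi>\<close> times the old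
    error. This is summation by parts in time.\<close>
  proof -
    have 1: "dt * (\<eta> * z') = - (a * (\<eta> * (R1 x - R0 x))) + dt * (a * \<eta> * q)" using dt by (simp add: z' field_simps)
    have 2: "dt * (\<epsilon>\<^sup>2 * ((W1 x - W0 x) / dt - v) * z) = \<epsilon>\<^sup>2 * (W1 x - W0 x) * z - dt * (\<epsilon>\<^sup>2 * v * z)" using dt by (simp add: field_simps)
    have 3: "dt * (a * \<eta> * (q - (r1 x - r0 x) / dt)) = dt * (a * \<eta> * q) - a * (\<eta> * (r1 x - r0 x))" using dt by (simp add: field_simps)
    have 4: "dt * (\<epsilon>\<^sup>2 * (v - (w1 x - w0 x) / dt) * z) = dt * (\<epsilon>\<^sup>2 * v * z) - \<epsilon>\<^sup>2 * (w1 x - w0 x) * z" using dt by (simp add: field_simps)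
    have 5: "dt * (\<epsilon>\<^sup>2 * ((\<phi>1 x - \<phi>0 x) / dt) * (W0 x - w0 x)) = \<epsilon>\<^sup>2 * (\<phi>1 x - \<phi>0 x) * (W0 x - w0 x)" using dt by (simp add: field_simps)
    show ?thesis
      unfolding right_diff_distrib[of dt] distrib_left[of dt] 1 2 3 4 5 by (simp add: algebra_simps)
  qed
  finally have "energy \<epsilon> a r1 w1 R1 W1 \<phi>1 x - energy \<epsilon> a r0 w0 R0 W0 \<phi>0 x
    \<le> dt * (\<epsilon>\<^sup>2 * ((W1 x - W0 x) / dt - v) * z - \<eta> * z')
      + dt * (a * \<eta> * (q - (r1 x - r0 x) / dt) + \<epsilon>\<^sup>2 * (v - (w1 x - w0 x) / dt) * z - \<epsilon>\<^sup>2 * ((\<phi>1 x - \<phi>0 x) / dt) * (W0 x - w0 x))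
      + ahi * J"
    unfolding energy_def right_diff_distrib[of a] by linarith
  moreover have "ahi * J = dt * (ahi * (L + \<epsilon>bar\<^sup>2 + 1) * B * ((R0 x - r0 x)\<^sup>2 + \<epsilon>\<^sup>2 * (W0 x - w0 x)\<^sup>2))"
    by (simp add: J_def mult_ac)
  ultimately show ?thesis unfolding \<eta>_def by linarith
qed

end

section \<open>Consequences of the regularity assumptions on a single pipe\<close>

lemma tendsto_0_if_le_square:
  fixes f q :: "'a \<Rightarrow> real"
  assumes q: "(q \<longlongrightarrow> 0) F" and f: "\<And>s. 0 \<le> f s" "\<And>s. f s \<le> (q s)\<^sup>2"
  shows "(f \<longlongrightarrow> 0) F"
proof (rule tendsto_sandwich[of "\<lambda>_. 0" f F "\<lambda>s. (q s)\<^sup>2" 0])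
  show "((\<lambda>s. (q s)\<^sup>2) \<longlongrightarrow> 0) F" using tendsto_power[OF q, of 2] by simp
  show "\<forall>\<^sub>F s in F. 0 \<le> f s" "\<forall>\<^sub>F s in F. f s \<le> (q s)\<^sup>2" using f by auto
qed simp

text \<open>One unknown on one pipe; density and velocity satisfy the same regularity assumptions
  and both instantiate it. Norms over the network bound those on the pipe, so the network constant
  \<open>K\<close> is kept.\<close>

locale regular_edge =
  fixes G :: "('v, 'e) pre_digraph" and \<l> :: "'e \<Rightarrow> real" and T K :: real
    and u u' :: "real \<Rightarrow> 'e netfun" and e :: 'e
  assumes fin: "finite (arcs G)" and e: "e \<in> arcs G" and l: "0 < \<l> e" and T: "0 < T" and K: "0 < K"
    and C0: "C0_time (H1pw G \<l>) (H1pw_norm G \<l>) T u"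
    and C1: "C1_time_deriv (LpE G \<l> 2) (LpE_norm G \<l> 2) T u u'"
    and W2: "Winf_time_le G \<l> (LpE G \<l> 2) (LpE_norm G \<l> 2) 2 T K u"
    and W1: "Winf_time_le G \<l> (H1pw G \<l>) (H1pw_norm G \<l>) 1 T K u"
begin

lemma H1_deriv: "t \<in> {0..T} \<Longrightarrow> has_L2_deriv (\<l> e) (u t e) (dx \<l> (u t) e)"
  using C0 e l unfolding C0_time_def H1pw_def dx_def by (auto intro!: H1_has_L2_deriv)

lemma L2_continuous_edge:
  assumes "C0_time (LpE G \<l> 2) (LpE_norm G \<l> 2) T v"
  shows "L2_continuous T (\<l> e) (\<lambda>t. v t e)"
  unfolding L2_continuous_def
proof (intro ballI conjI)
  fix t assume t: "t \<in> {0..T}"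
  show "v t e \<in> Lp 2 (\<l> e)" using assms t e by (auto simp: C0_time_def LpE_def)
  show "((\<lambda>s. \<integral>x. (v s e x - v t e x)\<^sup>2 \<partial>pipe (\<l> e)) \<longlongrightarrow> 0) (at t within {0..T})"
  proof (rule tendsto_0_if_le_square)
    show "((\<lambda>s. LpE_norm G \<l> 2 (\<lambda>e x. v s e x - v t e x)) \<longlongrightarrow> 0) (at t within {0..T})"
      using assms t by (auto simp: C0_time_def)
    show "(\<integral>x. (v s e x - v t e x)\<^sup>2 \<partial>pipe (\<l> e)) \<le> (LpE_norm G \<l> 2 (\<lambda>e x. v s e x - v t e x))\<^sup>2" for s
      by (rule edge_le_network[OF fin e])
  qed simp
qed

lemma L2_time_deriv_edge: "L2_time_deriv T (\<l> e) (\<lambda>t. u t e) (\<lambda>t. u' t e)"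
  unfolding L2_time_deriv_def
proof (intro conjI ballI)
  show "L2_continuous T (\<l> e) (\<lambda>t. u t e)" "L2_continuous T (\<l> e) (\<lambda>t. u' t e)"
    using C1 by (auto simp: C1_time_deriv_def intro: L2_continuous_edge)
  fix t assume t: "t \<in> {0..T}"
  show "((\<lambda>s. \<integral>x. ((u s e x - u t e x) / (s - t) - u' t e x)\<^sup>2 \<partial>pipe (\<l> e)) \<longlongrightarrow> 0) (at t within {0..T})"
  proof (rule tendsto_0_if_le_square)
    show "((\<lambda>s. LpE_norm G \<l> 2 (\<lambda>e x. (u s e x - u t e x) / (s - t) - u' t e x)) \<longlongrightarrow> 0) (at t within {0..T})"
      using C1 t by (auto simp: C1_time_deriv_def)
    show "(\<integral>x. ((u s e x - u t e x) / (s - t) - u' t e x)\<^sup>2 \<partial>pipe (\<l> e))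
        \<le> (LpE_norm G \<l> 2 (\<lambda>e x. (u s e x - u t e x) / (s - t) - u' t e x))\<^sup>2" for s
      by (rule edge_le_network[OF fin e])
  qed simp
qed

lemma L2_time_bounded_edge:
  assumes "Linf_time_le G \<l> (LpE G \<l> 2) (LpE_norm G \<l> 2) T K v"
  shows "L2_time_bounded T (\<l> e) K (\<lambda>t. v t e)"
  unfolding L2_time_bounded_def
proof
  show "(\<lambda>(t, x). v t e x) \<in> borel_measurable (pipe T \<Otimes>\<^sub>M pipe (\<l> e))"
    using assms e by (auto simp: Linf_time_le_def)
  have "AE t in pipe T. v t \<in> LpE G \<l> 2 \<and> LpE_norm G \<l> 2 (v t) \<le> K"
    using assms by (simp add: Linf_time_le_def)
  then show "AE t in pipe T. v t e \<in> Lp 2 (\<l> e) \<and> (\<integral>x. (v t e x)\<^sup>2 \<partial>pipe (\<l> e)) \<le> K\<^sup>2"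
  proof eventually_elim
    case (elim t)
    have "(LpE_norm G \<l> 2 (v t))\<^sup>2 \<le> K\<^sup>2" using elim by (intro power_mono norm_nonneg_network) auto
    then show ?case using edge_le_network[OF fin e, where u = "v t" and \<l> = \<l>] elim e by (auto simp: LpE_def)
  qed
qed

lemma H1_time_bounded_edge:
  assumes "Linf_time_le G \<l> (H1pw G \<l>) (H1pw_norm G \<l>) T K v"
  shows "L2_time_bounded T (\<l> e) K (\<lambda>t. v t e)"
    and "AE t in pipe T. \<exists>q. has_L2_deriv (\<l> e) (v t e) q \<and>
      (\<integral>x. (v t e x)\<^sup>2 \<partial>pipe (\<l> e)) + (\<integral>x. (q x)\<^sup>2 \<partial>pipe (\<l> e)) \<le> K\<^sup>2"
proof -
  have "AE t in pipe T. v t \<in> H1pw G \<l> \<and> H1pw_norm G \<l> (v t) \<le> K"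
    using assms by (simp add: Linf_time_le_def)
  then show ae: "AE t in pipe T. \<exists>q. has_L2_deriv (\<l> e) (v t e) q \<and>
      (\<integral>x. (v t e x)\<^sup>2 \<partial>pipe (\<l> e)) + (\<integral>x. (q x)\<^sup>2 \<partial>pipe (\<l> e)) \<le> K\<^sup>2"
  proof eventually_elim
    case (elim t)
    have "(H1pw_norm G \<l> (v t))\<^sup>2 \<le> K\<^sup>2" using elim by (intro power_mono norm_nonneg_network) auto
    then show ?case
      using edge_le_network_H1[OF fin e, where u = "v t" and \<l> = \<l>] elim e l
      by (intro exI[of _ "dx \<l> (v t) e"]) (auto simp: H1pw_def dx_def intro!: H1_has_L2_deriv)
  qed
  show "L2_time_bounded T (\<l> e) K (\<lambda>t. v t e)"
    unfolding L2_time_bounded_def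
  proof
    show "(\<lambda>(t, x). v t e x) \<in> borel_measurable (pipe T \<Otimes>\<^sub>M pipe (\<l> e))"
      using assms e by (auto simp: Linf_time_le_def)
    show "AE t in pipe T. v t e \<in> Lp 2 (\<l> e) \<and> (\<integral>x. (v t e x)\<^sup>2 \<partial>pipe (\<l> e)) \<le> K\<^sup>2"
      using ae
    proof eventually_elim
      case (elim t)
      then obtain q where q: "has_L2_deriv (\<l> e) (v t e) q"
        "(\<integral>x. (v t e x)\<^sup>2 \<partial>pipe (\<l> e)) + (\<integral>x. (q x)\<^sup>2 \<partial>pipe (\<l> e)) \<le> K\<^sup>2" by blast
      have "0 \<le> (\<integral>x. (q x)\<^sup>2 \<partial>pipe (\<l> e))" by simp
      then have "(\<integral>x. (v t e x)\<^sup>2 \<partial>pipe (\<l> e)) \<le> K\<^sup>2" using q(2) by linarith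
      then show ?case using Lp2_continuous[OF has_L2_deriv_imp_continuous_on[OF q(1)]] by blast
    qed
  qed
qed

lemma weak_time_deriv_edge: "has_weak_time_deriv G \<l> T v g \<Longrightarrow> weak_time_deriv T (\<l> e) (\<lambda>t. v t e) (\<lambda>t. g t e)"
  using e unfolding has_weak_time_deriv_def weak_time_deriv_def by blast

text \<open>The weak derivatives provided here and those in \<open>W1_edge\<close> are separate
  witnesses; they are never compared, as each estimate works with one family only.\<close>

lemma W2_edge:
  obtains g k where "L2_time_bounded T (\<l> e) K (\<lambda>t. u t e)" "L2_time_bounded T (\<l> e) K g" "L2_time_bounded T (\<l> e) K k"
    "weak_time_deriv T (\<l> e) (\<lambda>t. u t e) g" "weak_time_deriv T (\<l> e) g k"
proof -
  obtain D where D: "D 0 = u" "\<forall>j\<le>2. Linf_time_le G \<l> (LpE G \<l> 2) (LpE_norm G \<l> 2) T K (D j)"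
    "\<forall>j<2. has_weak_time_deriv G \<l> T (D j) (D (Suc j))"
    using W2 unfolding Winf_time_le_def by blast
  show ?thesis
  proof (rule that)
    show "L2_time_bounded T (\<l> e) K (\<lambda>t. u t e)" "L2_time_bounded T (\<l> e) K (\<lambda>t. D 1 t e)" "L2_time_bounded T (\<l> e) K (\<lambda>t. D 2 t e)"
      using D(2)[rule_format, of 0] D(2)[rule_format, of 1] D(2)[rule_format, of 2]
      by (auto simp: D(1) intro!: L2_time_bounded_edge)
    show "weak_time_deriv T (\<l> e) (\<lambda>t. u t e) (\<lambda>t. D 1 t e)" "weak_time_deriv T (\<l> e) (\<lambda>t. D 1 t e) (\<lambda>t. D 2 t e)"
      using D(3)[rule_format, of 0] D(3)[rule_format, of 1]
      by (auto simp: D(1) numeral_2_eq_2 intro!: weak_time_deriv_edge)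
  qed
qed

lemma W1_edge:
  obtains g where "L2_time_bounded T (\<l> e) K (\<lambda>t. u t e)" "L2_time_bounded T (\<l> e) K g"
    "weak_time_deriv T (\<l> e) (\<lambda>t. u t e) g"
    "AE t in pipe T. \<exists>q. has_L2_deriv (\<l> e) (g t) q \<and> (\<integral>x. (g t x)\<^sup>2 \<partial>pipe (\<l> e)) + (\<integral>x. (q x)\<^sup>2 \<partial>pipe (\<l> e)) \<le> K\<^sup>2"
    "AE t in pipe T. u t \<in> H1pw G \<l> \<and> H1pw_norm G \<l> (u t) \<le> K"
proof -
  obtain D where D: "D 0 = u" "\<forall>j\<le>1. Linf_time_le G \<l> (H1pw G \<l>) (H1pw_norm G \<l>) T K (D j)"
    "\<forall>j<1. has_weak_time_deriv G \<l> T (D j) (D (Suc j))"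
    using W1 unfolding Winf_time_le_def by blast
  note D1 = D(2)[rule_format, of 1, OF order_refl] and D0 = D(2)[rule_format, of 0, unfolded D(1)]
  show ?thesis
  proof (rule that)
    show "L2_time_bounded T (\<l> e) K (\<lambda>t. u t e)" using D0 by (intro H1_time_bounded_edge) simp
    show "L2_time_bounded T (\<l> e) K (\<lambda>t. D 1 t e)" by (rule H1_time_bounded_edge(1)[OF D1])
    show "weak_time_deriv T (\<l> e) (\<lambda>t. u t e) (\<lambda>t. D 1 t e)"
      using D(3)[rule_format, of 0] by (auto simp: D(1) intro!: weak_time_deriv_edge)
    show "AE t in pipe T. \<exists>q. has_L2_deriv (\<l> e) (D 1 t e) q \<and>
       (\<integral>x. (D 1 t e x)\<^sup>2 \<partial>pipe (\<l> e)) + (\<integral>x. (q x)\<^sup>2 \<partial>pipe (\<l> e)) \<le> K\<^sup>2"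
      by (rule H1_time_bounded_edge(2)[OF D1])
    show "AE t in pipe T. u t \<in> H1pw G \<l> \<and> H1pw_norm G \<l> (u t) \<le> K"
      using D0 by (simp add: Linf_time_le_def)
  qed
qed

lemma time_deriv_Lp2: "t \<in> {0..T} \<Longrightarrow> u' t e \<in> Lp 2 (\<l> e)"
  using L2_time_deriv_edge by (simp add: L2_time_deriv_def L2_continuous_def)

lemma time_deriv_Lipschitz:
  assumes "s \<in> {0..T}" "t \<in> {0..T}"
  shows "(\<integral>x. (u' t e x - u' s e x)\<^sup>2 \<partial>pipe (\<l> e)) \<le> (K * \<bar>t - s\<bar>)\<^sup>2"
proof -
  obtain g k where "L2_time_bounded T (\<l> e) K (\<lambda>t. u t e)" "L2_time_bounded T (\<l> e) K g" "L2_time_bounded T (\<l> e) K k"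
    "weak_time_deriv T (\<l> e) (\<lambda>t. u t e) g" "weak_time_deriv T (\<l> e) g k" by (rule W2_edge)
  from L2_time_deriv_Lipschitz[OF L2_time_deriv_edge this _ T assms] show ?thesis using K by simp
qed

lemma difference_quotient:
  assumes "0 \<le> s" "s < t" "t \<le> T"
  shows "(\<integral>x. ((u t e x - u s e x) / (t - s) - u' t e x)\<^sup>2 \<partial>pipe (\<l> e)) \<le> (K * (t - s))\<^sup>2"
proof -
  obtain g k where "L2_time_bounded T (\<l> e) K (\<lambda>t. u t e)" "L2_time_bounded T (\<l> e) K g" "L2_time_bounded T (\<l> e) K k"
    "weak_time_deriv T (\<l> e) (\<lambda>t. u t e) g" "weak_time_deriv T (\<l> e) g k" by (rule W2_edge)
  from L2_difference_quotient[OF L2_time_deriv_edge this _ T assms] show ?thesis using K by simp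
qed

definition sup_const :: real where "sup_const = sqrt (2 / \<l> e + 2 * \<l> e) * K"

lemma increment_bound:
  assumes st: "0 \<le> s" "s \<le> t" "t \<le> T"
  shows "AE x in pipe (\<l> e). \<bar>u t e x - u s e x\<bar> \<le> sup_const * (t - s)"
proof -
  obtain g where g: "L2_time_bounded T (\<l> e) K (\<lambda>t. u t e)" "L2_time_bounded T (\<l> e) K g"
    "weak_time_deriv T (\<l> e) (\<lambda>t. u t e) g"
    "AE t in pipe T. \<exists>q. has_L2_deriv (\<l> e) (g t) q \<and> (\<integral>x. (g t x)\<^sup>2 \<partial>pipe (\<l> e)) + (\<integral>x. (q x)\<^sup>2 \<partial>pipe (\<l> e)) \<le> K\<^sup>2"
    by (rule W1_edge)
  have c: "L2_continuous T (\<l> e) (\<lambda>t. u t e)" using L2_time_deriv_edge by (simp add: L2_time_deriv_def)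
  have "AE t in pipe T. \<forall>x\<in>{0<..<\<l> e}. \<bar>g t x\<bar> \<le> sup_const"
    using g(4)
  proof eventually_elim
    case (elim t)
    then obtain q where q: "has_L2_deriv (\<l> e) (g t) q"
      "(\<integral>x. (g t x)\<^sup>2 \<partial>pipe (\<l> e)) + (\<integral>x. (q x)\<^sup>2 \<partial>pipe (\<l> e)) \<le> K\<^sup>2" by blast
    show ?case
    proof
      fix x assume "x \<in> {0<..<\<l> e}"
      then have "(g t x)\<^sup>2 \<le> (2 / \<l> e + 2 * \<l> e) * ((\<integral>x. (g t x)\<^sup>2 \<partial>pipe (\<l> e)) + (\<integral>x. (q x)\<^sup>2 \<partial>pipe (\<l> e)))"
        by (intro H1_sup_bound[OF q(1)] l) auto
      also have "\<dots> \<le> (2 / \<l> e + 2 * \<l> e) * K\<^sup>2" using q(2) l by (intro mult_left_mono) auto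
      also have "\<dots> = sup_const\<^sup>2" using l by (simp add: sup_const_def power_mult_distrib)
      finally show "\<bar>g t x\<bar> \<le> sup_const"
        using K l by (simp add: abs_le_square_iff[symmetric] sup_const_def abs_mult)
    qed
  qed
  from sup_increment_bound[OF c g(1-3) _ T this st] show ?thesis using K by simp
qed

lemma projection_increment:
  assumes st: "0 \<le> s" "s \<le> t" "t \<le> T" and k: "1 \<le> k"
  shows "(\<integral>x. ((u t e x - u s e x) - uniform_mesh.proj (\<l> e) k (\<lambda>x. u t e x - u s e x) x)\<^sup>2 \<partial>pipe (\<l> e))
    \<le> (uniform_mesh.h (\<l> e) k * K * (t - s))\<^sup>2"
proof -
  interpret mesh: uniform_mesh "\<l> e" k by standard (use l k in auto)
  obtain g where g: "L2_time_bounded T (\<l> e) K (\<lambda>t. u t e)" "L2_time_bounded T (\<l> e) K g"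
    "weak_time_deriv T (\<l> e) (\<lambda>t. u t e) g"
    "AE t in pipe T. \<exists>q. has_L2_deriv (\<l> e) (g t) q \<and> (\<integral>x. (g t x)\<^sup>2 \<partial>pipe (\<l> e)) + (\<integral>x. (q x)\<^sup>2 \<partial>pipe (\<l> e)) \<le> K\<^sup>2"
    by (rule W1_edge)
  have c: "L2_continuous T (\<l> e) (\<lambda>t. u t e)" using L2_time_deriv_edge by (simp add: L2_time_deriv_def)
  have "AE t in pipe T. \<exists>q. has_L2_deriv (\<l> e) (g t) q \<and> (\<integral>x. (q x)\<^sup>2 \<partial>pipe (\<l> e)) \<le> K\<^sup>2"
    using g(4)
  proof eventually_elim
    case (elim t)
    then obtain q where q: "has_L2_deriv (\<l> e) (g t) q"
      "(\<integral>x. (g t x)\<^sup>2 \<partial>pipe (\<l> e)) + (\<integral>x. (q x)\<^sup>2 \<partial>pipe (\<l> e)) \<le> K\<^sup>2" by blast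
    have "0 \<le> (\<integral>x. (g t x)\<^sup>2 \<partial>pipe (\<l> e))" by simp
    then have "(\<integral>x. (q x)\<^sup>2 \<partial>pipe (\<l> e)) \<le> K\<^sup>2" using q(2) by linarith
    then show ?case using q(1) by blast
  qed
  from mesh.projection_increment_bound[OF c g(1-3) _ T this st] show ?thesis using K by simp
qed

text \<open>A bound at every time: \<open>u' t\<close> is compared with \<open>u' T\<close> by
  Lipschitz continuity, and \<open>u' T\<close> with the mean slope over the whole time interval,
  which the pointwise bounds on \<open>u\<close> control.\<close>

lemma time_deriv_bound:
  assumes b: "\<And>x. x \<in> {0..\<l> e} \<Longrightarrow> \<bar>u 0 e x\<bar> \<le> b" "\<And>x. x \<in> {0..\<l> e} \<Longrightarrow> \<bar>u T e x\<bar> \<le> b" and t: "t \<in> {0..T}"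
  shows "(\<integral>x. (u' t e x)\<^sup>2 \<partial>pipe (\<l> e)) \<le> 6 * (K * T)\<^sup>2 + 4 * \<l> e * (2 * b / T)\<^sup>2"
proof -
  define d where "d x = (u T e x - u 0 e x) / T" for x
  have T0: "0 \<in> {0..T}" "T \<in> {0..T}" using T by auto
  have Lp: "u T e \<in> Lp 2 (\<l> e)" "u 0 e \<in> Lp 2 (\<l> e)"
    using Lp2_continuous[OF has_L2_deriv_imp_continuous_on[OF H1_deriv]] T0 by auto
  then have d: "d \<in> Lp 2 (\<l> e)" unfolding d_def by (intro Lp2_divide Lp2_diff)
  note tT = time_deriv_Lp2[OF t] time_deriv_Lp2[OF T0(2)]
  have sq: "integrable (pipe (\<l> e)) (\<lambda>x. (f x - g x)\<^sup>2)" if "f \<in> Lp 2 (\<l> e)" "g \<in> Lp 2 (\<l> e)" for f g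
    using Lp2_square[OF Lp2_diff[OF that]] .
  have "(\<integral>x. (u' t e x)\<^sup>2 \<partial>pipe (\<l> e)) \<le> (\<integral>x. 2 * (u' t e x - u' T e x)\<^sup>2 + (4 * (d x - u' T e x)\<^sup>2 + 4 * (d x)\<^sup>2) \<partial>pipe (\<l> e))"
  proof (rule integral_mono)
    fix x
    have "(u' t e x)\<^sup>2 \<le> 2 * (u' t e x - u' T e x)\<^sup>2 + 2 * (u' T e x)\<^sup>2"
      using square_sum_le(1)[of "u' t e x - u' T e x" "u' T e x"] by simp
    moreover have "(u' T e x)\<^sup>2 \<le> 2 * (d x - u' T e x)\<^sup>2 + 2 * (d x)\<^sup>2"
      using square_sum_le(1)[of "u' T e x - d x" "d x"] by (simp add: power2_commute)
    ultimately show "(u' t e x)\<^sup>2 \<le> 2 * (u' t e x - u' T e x)\<^sup>2 + (4 * (d x - u' T e x)\<^sup>2 + 4 * (d x)\<^sup>2)" by simp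
  qed (use tT d sq Lp2_square in \<open>auto intro!: Bochner_Integration.integrable_add integrable_mult_right\<close>)
  also have "\<dots> = 2 * (\<integral>x. (u' t e x - u' T e x)\<^sup>2 \<partial>pipe (\<l> e))
      + (4 * (\<integral>x. (d x - u' T e x)\<^sup>2 \<partial>pipe (\<l> e)) + 4 * (\<integral>x. (d x)\<^sup>2 \<partial>pipe (\<l> e)))"
    using sq[OF tT] sq[OF d tT(2)] Lp2_square[OF d] by simp
  also have "(\<integral>x. (d x)\<^sup>2 \<partial>pipe (\<l> e)) \<le> (\<integral>x. (2 * b / T)\<^sup>2 \<partial>pipe (\<l> e))"
  proof (rule integral_mono)
    fix x assume "x \<in> space (pipe (\<l> e))"
    then have "\<bar>u T e x\<bar> \<le> b" "\<bar>u 0 e x\<bar> \<le> b" using b by auto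
    then have "\<bar>u T e x - u 0 e x\<bar> \<le> 2 * b" by linarith
    then have "\<bar>d x\<bar> \<le> 2 * b / T" using T by (simp add: d_def divide_right_mono)
    then show "(d x)\<^sup>2 \<le> (2 * b / T)\<^sup>2" using power_mono[of "\<bar>d x\<bar>" "2 * b / T" 2] by simp
  qed (use Lp2_square[OF d] in auto)
  also have "(\<integral>x. (2 * b / T)\<^sup>2 \<partial>pipe (\<l> e)) = \<l> e * (2 * b / T)\<^sup>2" using measure_pipe[of 0 "\<l> e" "\<l> e"] l by simp
  also have "(\<integral>x. (d x - u' T e x)\<^sup>2 \<partial>pipe (\<l> e)) \<le> (K * T)\<^sup>2"
    using difference_quotient[of 0 T] T by (simp add: d_def)
  also have "(\<integral>x. (u' t e x - u' T e x)\<^sup>2 \<partial>pipe (\<l> e)) \<le> (K * T)\<^sup>2"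
  proof -
    have "(\<integral>x. (u' t e x - u' T e x)\<^sup>2 \<partial>pipe (\<l> e)) \<le> (K * \<bar>t - T\<bar>)\<^sup>2" by (rule time_deriv_Lipschitz[OF T0(2) t])
    also have "\<dots> \<le> (K * T)\<^sup>2" using t K by (intro power_mono mult_left_mono) auto
    finally show ?thesis .
  qed
  finally show ?thesis by simp
qed

text \<open>The H1 bound holds for almost every time, hence at times arbitrarily close to 0; H1
  continuity transfers it to time 0 with an additional distance of at most 1. Squaring the sum gives
  \<open>2 * K\<^sup>2 + 2\<close>.\<close>

lemma initial_H1_bound:
  obtains q where "has_L2_deriv (\<l> e) (u 0 e) q" "(\<integral>x. (q x)\<^sup>2 \<partial>pipe (\<l> e)) \<le> 2 * K\<^sup>2 + 2"
proof -
  have "((\<lambda>s. H1pw_norm G \<l> (\<lambda>e x. u s e x - u 0 e x)) \<longlongrightarrow> 0) (at 0 within {0..T})"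
    using C0 T by (auto simp: C0_time_def)
  then have "\<forall>\<^sub>F s in at 0 within {0..T}. H1pw_norm G \<l> (\<lambda>e x. u s e x - u 0 e x) < 1"
    by (rule order_tendstoD) simp
  then obtain d where d: "0 < d" "\<And>s. s \<in> {0..T} \<Longrightarrow> s \<noteq> 0 \<Longrightarrow> dist s 0 < d \<Longrightarrow> H1pw_norm G \<l> (\<lambda>e x. u s e x - u 0 e x) < 1"
    unfolding eventually_at by blast
  obtain g where "AE t in pipe T. u t \<in> H1pw G \<l> \<and> H1pw_norm G \<l> (u t) \<le> K" by (rule W1_edge)
  \<comment> \<open>Otherwise a whole time interval after 0 would belong to the exceptional null
    set.\<close>
  have "\<exists>s. 0 < s \<and> s < min d T \<and> H1pw_norm G \<l> (u s) \<le> K"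
  proof (rule ccontr)
    assume "\<not> ?thesis"
    then have no: "\<not> H1pw_norm G \<l> (u s) \<le> K" if "s \<in> {0<..<min d T}" for s using that by auto
    have "AE t in pipe T. t \<notin> {0<..<min d T}"
      using \<open>AE t in pipe T. u t \<in> H1pw G \<l> \<and> H1pw_norm G \<l> (u t) \<le> K\<close>
      by (rule eventually_mono) (use no in blast)
    then have "emeasure (pipe T) {0<..<min d T} = 0"
      by (subst (asm) AE_iff_measurable[where N = "{0<..<min d T}"]) auto
    then show False using emeasure_pipe[of 0 "min d T" T] d T by simp
  qed
  then obtain s where s: "0 < s" "s < d" "s < T" "H1pw_norm G \<l> (u s) \<le> K" by auto
  define v where "v = (\<lambda>e x. u s e x - u 0 e x)"
  have us: "has_L2_deriv (\<l> e) (u s e) (dx \<l> (u s) e)" "has_L2_deriv (\<l> e) (u 0 e) (dx \<l> (u 0) e)"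
    using s T by (auto intro!: H1_deriv)
  have "v e \<in> H1 (\<l> e)" unfolding v_def using has_L2_deriv_imp_H1[OF has_L2_deriv_diff[OF us]] l by simp
  then have v: "has_L2_deriv (\<l> e) (v e) (dx \<l> v e)" unfolding dx_def by (rule H1_has_L2_deriv[OF _ l])
  have "(\<integral>x. (v e x)\<^sup>2 \<partial>pipe (\<l> e)) + (\<integral>x. (dx \<l> v e x)\<^sup>2 \<partial>pipe (\<l> e)) \<le> (H1pw_norm G \<l> v)\<^sup>2"
    by (rule edge_le_network_H1[OF fin e])
  also have "\<dots> \<le> 1\<^sup>2" using d(2)[of s] s by (intro power_mono norm_nonneg_network) (simp add: v_def)
  finally have "(\<integral>x. (v e x)\<^sup>2 \<partial>pipe (\<l> e)) + (\<integral>x. (dx \<l> v e x)\<^sup>2 \<partial>pipe (\<l> e)) \<le> 1" by simp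
  moreover have "0 \<le> (\<integral>x. (v e x)\<^sup>2 \<partial>pipe (\<l> e))" by simp
  ultimately have v1: "(\<integral>x. (dx \<l> v e x)\<^sup>2 \<partial>pipe (\<l> e)) \<le> 1" by linarith
  have "(\<integral>x. (u s e x)\<^sup>2 \<partial>pipe (\<l> e)) + (\<integral>x. (dx \<l> (u s) e x)\<^sup>2 \<partial>pipe (\<l> e)) \<le> (H1pw_norm G \<l> (u s))\<^sup>2"
    by (rule edge_le_network_H1[OF fin e])
  also have "\<dots> \<le> K\<^sup>2" by (intro power_mono s(4) norm_nonneg_network)
  finally have "(\<integral>x. (u s e x)\<^sup>2 \<partial>pipe (\<l> e)) + (\<integral>x. (dx \<l> (u s) e x)\<^sup>2 \<partial>pipe (\<l> e)) \<le> K\<^sup>2" .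
  moreover have "0 \<le> (\<integral>x. (u s e x)\<^sup>2 \<partial>pipe (\<l> e))" by simp
  ultimately have us1: "(\<integral>x. (dx \<l> (u s) e x)\<^sup>2 \<partial>pipe (\<l> e)) \<le> K\<^sup>2" by linarith
  define q where "q x = dx \<l> (u s) e x - dx \<l> v e x" for x
  have "has_L2_deriv (\<l> e) (u 0 e) q"
    using has_L2_deriv_diff[OF us(1) v] by (simp add: q_def[abs_def] v_def)
  moreover have "(\<integral>x. (q x)\<^sup>2 \<partial>pipe (\<l> e)) \<le> 2 * K\<^sup>2 + 2"
  proof -
    have i: "dx \<l> (u s) e \<in> Lp 2 (\<l> e)" "dx \<l> v e \<in> Lp 2 (\<l> e)" using us v has_L2_derivD(2) by auto
    have "(\<integral>x. (q x)\<^sup>2 \<partial>pipe (\<l> e)) \<le> (\<integral>x. 2 * (dx \<l> (u s) e x)\<^sup>2 + 2 * (dx \<l> v e x)\<^sup>2 \<partial>pipe (\<l> e))"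
    proof (rule integral_mono)
      show "(q x)\<^sup>2 \<le> 2 * (dx \<l> (u s) e x)\<^sup>2 + 2 * (dx \<l> v e x)\<^sup>2" for x
        using square_sum_le(1)[of "dx \<l> (u s) e x" "- dx \<l> v e x"] by (simp add: q_def)
      show "integrable (pipe (\<l> e)) (\<lambda>x. (q x)\<^sup>2)" unfolding q_def by (rule Lp2_square[OF Lp2_diff[OF i]])
    qed (use i Lp2_square in auto)
    also have "\<dots> = 2 * (\<integral>x. (dx \<l> (u s) e x)\<^sup>2 \<partial>pipe (\<l> e)) + 2 * (\<integral>x. (dx \<l> v e x)\<^sup>2 \<partial>pipe (\<l> e))"
      using i[THEN Lp2_square] by simp
    finally show ?thesis using us1 v1 by linarith
  qed
  ultimately show ?thesis by (rule that)
qed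

end

section \<open>Representatives, cellwise affine functions and continuity at a point\<close>

lemma has_L2_deriv_cong_AE:
  assumes u: "has_L2_deriv l u g" and k: "k \<in> Lp 2 l" and ae: "AE x in pipe l. g x = k x"
  shows "has_L2_deriv l u k"
  unfolding has_L2_deriv_def
proof (intro conjI allI impI k)
  fix x y assume xy: "0 \<le> x" "x \<le> y" "y \<le> l"
  have "(LINT t:{x<..<y}|pipe l. g t) = (LINT t:{x<..<y}|pipe l. k t)"
    unfolding set_lebesgue_integral_def
  proof (rule integral_cong_AE)
    show "AE t in pipe l. indicator {x<..<y} t *\<^sub>R g t = indicator {x<..<y} t *\<^sub>R k t"
      using ae by (rule eventually_mono) simp
  qed (use k has_L2_derivD(2)[OF u] Lp2_measurable in \<open>auto intro!: borel_measurable_times\<close>)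
  then show "u y - u x = (LINT t:{x<..<y}|pipe l. k t)" using has_L2_derivD(1)[OF u xy] by simp
qed

lemma (in uniform_mesh) step_ess_bounded: "ess_bounded l (step c)"
proof (rule ess_boundedI[OF step_measurable])
  show "AE x in pipe l. \<bar>step c x\<bar> \<le> (\<Sum>i<k. \<bar>c i\<bar>)"
  proof (rule AE_by_cells)
    fix i x assume "i < k" "x \<in> {node i<..<node (Suc i)}"
    then show "\<bar>step c x\<bar> \<le> (\<Sum>i<k. \<bar>c i\<bar>)"
      using member_le_sum[of i "{..<k}" "\<lambda>i. \<bar>c i\<bar>"] by (simp add: step_cell)
  qed
qed

lemma (in uniform_mesh) ess_bounded_by_cells:
  assumes "\<And>i x. i < k \<Longrightarrow> x \<in> {node i<..<node (Suc i)} \<Longrightarrow> g x = c i"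
  shows "ess_bounded l g"
proof -
  obtain B where B: "AE x in pipe l. \<bar>step c x\<bar> \<le> B" using step_ess_bounded[of c] by (auto simp: ess_bounded_def)
  have eq: "AE x in pipe l. step c x = g x" by (rule AE_by_cells) (simp add: assms step_cell)
  show ?thesis
  proof (rule ess_boundedI[of _ _ B])
    show "g \<in> borel_measurable (pipe l)"
      by (rule measurable_by_cells[OF step_measurable[of c]]) (simp add: assms step_cell)
    show "AE x in pipe l. \<bar>g x\<bar> \<le> B" using B eq by eventually_elim simp
  qed
qed

text \<open>Affinity is known on the open cells only; continuity extends it to the closed ones. Then
  \<open>u\<close> agrees with the primitive of its cell slopes at the nodes and in between, so the
  derivative can be taken as a step function.\<close>

lemma (in uniform_mesh) affine_cells_deriv:
  assumes u: "has_L2_deriv l u g"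
    and aff: "\<And>i. i < k \<Longrightarrow> \<exists>c d. \<forall>x\<in>{node i<..<node (Suc i)}. u x = c + d * x"
  obtains s where "has_L2_deriv l u (step s)"
proof -
  define s where "s i = (u (node (Suc i)) - u (node i)) / h" for i
  define v where "v x = u 0 + (LINT t:{0<..<x}|pipe l. step s t)" for x
  have v: "has_L2_deriv l v (step s)"
    using has_L2_deriv_indefinite_integral[OF step_Lp2[of s]] by (simp add: has_L2_deriv_def v_def)
  have cu: "continuous_on {0..l} u" by (rule has_L2_deriv_imp_continuous_on[OF u])
  have affc: "u x = u (node i) + s i * (x - node i)" if i: "i < k" and x: "x \<in> {node i..node (Suc i)}" for i x
  proof -
    obtain c d where cd: "\<And>x. x \<in> {node i<..<node (Suc i)} \<Longrightarrow> u x = c + d * x" using aff[OF i] by blast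
    have "u x - (c + d * x) = 0" if "x \<in> {node i..node (Suc i)}" for x
    proof (rule continuous_constant_on_closure[of "{node i<..<node (Suc i)}" "\<lambda>x. u x - (c + d * x)"])
      show "continuous_on (closure {node i<..<node (Suc i)}) (\<lambda>x. u x - (c + d * x))"
        using cell_range[OF i] by (auto intro!: continuous_intros continuous_on_subset[OF cu])
      show "x \<in> closure {node i<..<node (Suc i)}" using that cell_range[OF i] by simp
    qed (simp add: cd)
    then have e: "u x = c + d * x" if "x \<in> {node i..node (Suc i)}" for x using that by fastforce
    have "s i = d" using e[of "node i"] e[of "node (Suc i)"] cell_range[OF i] h_pos by (simp add: s_def node_Suc field_simps)
    then show ?thesis using e[of "node i"] e[OF x] cell_range[OF i] by (simp add: algebra_simps)
  qed
  have nodes: "v (node i) = u (node i)" if "i \<le> k" for i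
    using that
  proof (induction i)
    case 0
    then show ?case by (simp add: v_def set_lebesgue_integral_def)
  next
    case (Suc i)
    then have i: "i < k" by simp
    have "v (node (Suc i)) = v (node i) + s i * (node (Suc i) - node i)"
      using cell_range[OF i] by (intro L2_deriv_step_affine[OF v i]) auto
    then show ?case using Suc affc[OF i, of "node (Suc i)"] cell_range[OF i] by simp
  qed
  have uv: "u x = v x" if x: "0 \<le> x" "x \<le> l" for x
  proof (cases "x \<in> node ` {..k}")
    case True
    then show ?thesis using nodes by auto
  next
    case False
    then have "x \<noteq> node 0" "x \<noteq> node k" by blast+
    then have "x \<in> {0<..<l}" using x by auto
    then obtain i where i: "i < k" "x \<in> {node i<..<node (Suc i)}" using ex_cell False by blast
    then have x': "x \<in> {node i..node (Suc i)}" by auto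
    show ?thesis using affc[OF i(1) x'] L2_deriv_step_affine[OF v i(1) x'] nodes[of i] i(1) by simp
  qed
  have "has_L2_deriv l u (step s)"
    unfolding has_L2_deriv_def
  proof (intro conjI allI impI step_Lp2)
    fix x y assume xy: "0 \<le> x" "x \<le> y" "y \<le> l"
    then show "u y - u x = (LINT t:{x<..<y}|pipe l. step s t)"
      using has_L2_derivD(1)[OF v xy] uv[of x] uv[of y] by simp
  qed
  then show ?thesis by (rule that)
qed

text \<open>The sup bound for H1 functions, applied to \<open>u s - u t\<close>.\<close>

lemma (in regular_edge) point_continuous:
  assumes t: "t \<in> {0..T}" and x: "0 \<le> x" "x \<le> \<l> e"
  shows "((\<lambda>s. u s e x) \<longlongrightarrow> u t e x) (at t within {0..T})"
proof -
  have N: "((\<lambda>s. H1pw_norm G \<l> (\<lambda>e x. u s e x - u t e x)) \<longlongrightarrow> 0) (at t within {0..T})"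
    using C0 t by (auto simp: C0_time_def)
  have "((\<lambda>s. u s e x - u t e x) \<longlongrightarrow> 0) (at t within {0..T})"
  proof (rule tendsto_0_sqrt_bound)
    show "((\<lambda>s. (H1pw_norm G \<l> (\<lambda>e x. u s e x - u t e x))\<^sup>2) \<longlongrightarrow> 0) (at t within {0..T})"
      using tendsto_power[OF N, of 2] by simp
    show "\<forall>\<^sub>F s in at t within {0..T}. (u s e x - u t e x)\<^sup>2
        \<le> (H1pw_norm G \<l> (\<lambda>e x. u s e x - u t e x))\<^sup>2 * (2 / \<l> e + 2 * \<l> e)"
      unfolding eventually_at_filter
    proof (rule always_eventually, intro allI impI)
      fix s assume s: "s \<in> {0..T}"
      define v where "v = (\<lambda>e x. u s e x - u t e x)"
      have "v e \<in> H1 (\<l> e)"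
        unfolding v_def using has_L2_deriv_imp_H1[OF has_L2_deriv_diff[OF H1_deriv[OF s] H1_deriv[OF t]]] l by simp
      then have v: "has_L2_deriv (\<l> e) (v e) (dx \<l> v e)" unfolding dx_def by (rule H1_has_L2_deriv[OF _ l])
      have "(v e x)\<^sup>2 \<le> (2 / \<l> e + 2 * \<l> e) * ((\<integral>x. (v e x)\<^sup>2 \<partial>pipe (\<l> e)) + (\<integral>x. (dx \<l> v e x)\<^sup>2 \<partial>pipe (\<l> e)))"
        by (rule H1_sup_bound[OF v x l])
      also have "\<dots> \<le> (2 / \<l> e + 2 * \<l> e) * (H1pw_norm G \<l> v)\<^sup>2"
        using l by (intro mult_left_mono edge_le_network_H1[OF fin e]) auto
      finally show "(u s e x - u t e x)\<^sup>2 \<le> (H1pw_norm G \<l> (\<lambda>e x. u s e x - u t e x))\<^sup>2 * (2 / \<l> e + 2 * \<l> e)"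
        by (simp add: v_def mult.commute)
    qed
  qed
  then show ?thesis by (rule LIM_zero_cancel)
qed

section \<open>The exact solution\<close>

text \<open>The time derivatives \<open>\<rho>'\<close> and \<open>w'\<close>, existentially
  quantified in \<open>classical_solution\<close>, are fixed as parameters so that the residuals can
  refer to them. \<open>K\<close> is the regularity bound.\<close>

locale exact_solution = gas_law P "deriv P" "deriv (deriv P)" \<rho>lo \<rho>hi wbar \<epsilon>bar L
  for P :: "real \<Rightarrow> real" and \<rho>lo \<rho>hi wbar \<epsilon>bar L :: real +
  fixes G :: "('v, 'e) pre_digraph" and \<l> :: "'e \<Rightarrow> real" and \<epsilon> :: real and a \<gamma> :: "'e \<Rightarrow> real"
    and T K alo ahi \<gamma>lo \<gamma>hi :: real and \<eta>b :: "'v \<Rightarrow> real \<Rightarrow> real"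
    and \<rho> w \<rho>' w' :: "real \<Rightarrow> 'e netfun"
  assumes network: "fin_digraph G" "loopfree_digraph G" "\<And>e. e \<in> arcs G \<Longrightarrow> 0 < \<l> e"
    and params: "0 < T" "0 < K" "0 < alo" "0 < ahi" "0 < \<gamma>lo" "0 < \<gamma>hi" "0 \<le> \<epsilon>" "\<epsilon> \<le> \<epsilon>bar"
    and coeffs: "\<And>e. e \<in> arcs G \<Longrightarrow> alo \<le> a e \<and> a e \<le> ahi \<and> \<gamma>lo \<le> \<gamma> e \<and> \<gamma> e \<le> \<gamma>hi"
    and C0: "C0_time (H1pw G \<l>) (H1pw_norm G \<l>) T \<rho>" "C0_time (H1pw G \<l>) (H1pw_norm G \<l>) T w"
    and C1: "C1_time_deriv (LpE G \<l> 2) (LpE_norm G \<l> 2) T \<rho> \<rho>'" "C1_time_deriv (LpE G \<l> 2) (LpE_norm G \<l> 2) T w w'"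
    and W2: "Winf_time_le G \<l> (LpE G \<l> 2) (LpE_norm G \<l> 2) 2 T K \<rho>" "Winf_time_le G \<l> (LpE G \<l> 2) (LpE_norm G \<l> 2) 2 T K w"
    and W1: "Winf_time_le G \<l> (H1pw G \<l>) (H1pw_norm G \<l>) 1 T K \<rho>" "Winf_time_le G \<l> (H1pw G \<l>) (H1pw_norm G \<l>) 1 T K w"
    and range_AE: "\<And>t e. t \<in> {0..T} \<Longrightarrow> e \<in> arcs G \<Longrightarrow> AE x in pipe (\<l> e).
       \<rho>lo \<le> \<rho> t e x \<and> \<rho> t e x \<le> \<rho>hi \<and> - wbar \<le> w t e x \<and> w t e x \<le> wbar"
    and equations: "\<And>t e. t \<in> {0<..T} \<Longrightarrow> e \<in> arcs G \<Longrightarrow> AE x in pipe (\<l> e).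
       a e * \<rho>' t e x + dx \<l> (mass_flow a (\<rho> t) (w t)) e x = 0 \<and>
       \<epsilon>\<^sup>2 * w' t e x + dx \<l> (enthalpy P \<epsilon> (\<rho> t) (w t)) e x = - \<gamma> e * \<bar>w t e x\<bar> * w t e x"
    and inner: "\<And>t v. t \<in> {0<..T} \<Longrightarrow> v \<in> inner_verts G \<Longrightarrow>
       (\<Sum>e\<in>incident_arcs G v. vertex_value G \<l> (mass_flow a (\<rho> t) (w t)) e v * edge_sign G e v) = 0 \<and>
       (\<exists>\<eta>v. \<forall>e\<in>incident_arcs G v. vertex_value G \<l> (enthalpy P \<epsilon> (\<rho> t) (w t)) e v = \<eta>v)"
    and boundary: "\<And>t v e. t \<in> {0<..T} \<Longrightarrow> v \<in> boundary_verts G \<Longrightarrow> e \<in> incident_arcs G v \<Longrightarrow>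
       vertex_value G \<l> (enthalpy P \<epsilon> (\<rho> t) (w t)) e v = \<eta>b v t"
begin

section \<open>Everywhere bounds and the balance laws in integrated form\<close>

lemma fin_arcs: "finite (arcs G)" using network(1) by (simp add: fin_digraph.finite_arcs)

lemma fin_verts: "finite (verts G)" using network(1) by (simp add: fin_digraph.finite_verts)

lemma regular:
  assumes "e \<in> arcs G"
  shows "regular_edge G \<l> T K \<rho> \<rho>' e" "regular_edge G \<l> T K w w' e"
  by (unfold_locales; use assms fin_arcs network(3) params C0 C1 W2 W1 in simp)+

lemma H1_rho: "e \<in> arcs G \<Longrightarrow> t \<in> {0..T} \<Longrightarrow> has_L2_deriv (\<l> e) (\<rho> t e) (dx \<l> (\<rho> t) e)"
  by (rule regular_edge.H1_deriv[OF regular(1)])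

lemma H1_w: "e \<in> arcs G \<Longrightarrow> t \<in> {0..T} \<Longrightarrow> has_L2_deriv (\<l> e) (w t e) (dx \<l> (w t) e)"
  by (rule regular_edge.H1_deriv[OF regular(2)])

lemma cont_rho: "e \<in> arcs G \<Longrightarrow> t \<in> {0..T} \<Longrightarrow> continuous_on {0..\<l> e} (\<rho> t e)"
  by (rule has_L2_deriv_imp_continuous_on[OF H1_rho])

lemma cont_w: "e \<in> arcs G \<Longrightarrow> t \<in> {0..T} \<Longrightarrow> continuous_on {0..\<l> e} (w t e)"
  by (rule has_L2_deriv_imp_continuous_on[OF H1_w])

lemma range:
  assumes e: "e \<in> arcs G" and t: "t \<in> {0..T}" and x: "0 \<le> x" "x \<le> \<l> e"
  shows "\<rho> t e x \<in> {\<rho>lo..\<rho>hi}" "\<bar>w t e x\<bar> \<le> wbar"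
proof -
  note ae = range_AE[OF t e]
  have "AE x in pipe (\<l> e). \<rho> t e x \<le> \<rho>hi" "AE x in pipe (\<l> e). - \<rho> t e x \<le> - \<rho>lo"
    "AE x in pipe (\<l> e). w t e x \<le> wbar" "AE x in pipe (\<l> e). - w t e x \<le> wbar"
    by (rule eventually_mono[OF ae]; linarith)+
  from continuous_on_AE_le[OF cont_rho[OF e t] this(1) network(3)[OF e] x]
    continuous_on_AE_le[OF continuous_on_minus[OF cont_rho[OF e t]] this(2) network(3)[OF e] x]
    continuous_on_AE_le[OF cont_w[OF e t] this(3) network(3)[OF e] x]
    continuous_on_AE_le[OF continuous_on_minus[OF cont_w[OF e t]] this(4) network(3)[OF e] x]
  show "\<rho> t e x \<in> {\<rho>lo..\<rho>hi}" "\<bar>w t e x\<bar> \<le> wbar" by auto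
qed

definition m :: "real \<Rightarrow> 'e netfun" where "m t = mass_flow a (\<rho> t) (w t)"

definition \<eta> :: "real \<Rightarrow> 'e netfun" where "\<eta> t = enthalpy P \<epsilon> (\<rho> t) (w t)"

lemma m_eq: "m t e x = a e * \<rho> t e x * w t e x" by (simp add: m_def mass_flow_def)

lemma \<eta>_eq: "\<eta> t e x = enth \<epsilon> (\<rho> t e x) (w t e x)" by (simp add: \<eta>_def enthalpy_def enth_def)

lemma rho'_Lp2: "e \<in> arcs G \<Longrightarrow> t \<in> {0..T} \<Longrightarrow> \<rho>' t e \<in> Lp 2 (\<l> e)"
  by (rule regular_edge.time_deriv_Lp2[OF regular(1)])

lemma w'_Lp2: "e \<in> arcs G \<Longrightarrow> t \<in> {0..T} \<Longrightarrow> w' t e \<in> Lp 2 (\<l> e)"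
  by (rule regular_edge.time_deriv_Lp2[OF regular(2)])

text \<open>For positive time this is the mass balance. At time 0 no equation is given, yet the
  interpolation estimate is needed there for the initial energy; it is obtained by passing to the
  limit in the integrated balance.\<close>

lemma m_deriv:
  assumes e: "e \<in> arcs G" and t: "t \<in> {0..T}"
  shows "has_L2_deriv (\<l> e) (m t e) (\<lambda>x. - a e * \<rho>' t e x)"
proof -
  have pos: "has_L2_deriv (\<l> e) (m t e) (\<lambda>x. - a e * \<rho>' t e x)" if t: "t \<in> {0<..T}" for t
  proof -
    have t': "t \<in> {0..T}" using t by auto
    have "has_L2_deriv (\<l> e) (\<lambda>x. a e * (\<rho> t e x * w t e x))
      (\<lambda>x. a e * (dx \<l> (\<rho> t) e x * w t e x + \<rho> t e x * dx \<l> (w t) e x))"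
      by (intro has_L2_deriv_cmult has_L2_deriv_mult H1_rho H1_w e t')
    then have "m t e \<in> H1 (\<l> e)"
      using network(3)[OF e] has_L2_deriv_imp_H1 by (auto simp: m_eq[abs_def] mult.assoc)
    then have 1: "has_L2_deriv (\<l> e) (m t e) (dx \<l> (m t) e)"
      unfolding dx_def by (rule H1_has_L2_deriv[OF _ network(3)[OF e]])
    show ?thesis
    proof (rule has_L2_deriv_cong_AE[OF 1 Lp2_cmult[OF rho'_Lp2[OF e t']]])
      show "AE x in pipe (\<l> e). dx \<l> (m t) e x = - a e * \<rho>' t e x"
        using equations[OF t e] by (rule eventually_mono) (auto simp: m_def)
    qed
  qed
  show ?thesis
  proof (cases "t = 0")
    case False
    then show ?thesis using t by (intro pos) auto
  next
    case True
    show ?thesis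
      unfolding has_L2_deriv_def
    proof (intro conjI allI impI Lp2_cmult rho'_Lp2[OF e t])
      fix x y assume xy: "0 \<le> x" "x \<le> y" "y \<le> \<l> e"
      define \<psi> where "\<psi> = (indicator {x<..<y} :: real \<Rightarrow> real)"
      have \<psi>: "\<psi> \<in> Lp 2 (\<l> e)"
        by (rule Lp2_bounded[of _ _ 1]) (auto simp: \<psi>_def indicator_def[of _ x for x])
      have pair: "(LINT z:{x<..<y}|pipe (\<l> e). - a e * \<rho>' s e z) = - a e * pairing (\<l> e) (\<lambda>t. \<rho>' t e) \<psi> s" for s
        unfolding set_lebesgue_integral_def \<psi>_def[symmetric]
        by (subst integral_mult_right_zero[symmetric]) (simp add: mult_ac)
      \<comment> \<open>The defect of the integrated balance over \<open>(x,y)\<close>. It vanishes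
        for \<open>s > 0\<close> and is continuous at 0, by continuity of \<open>m\<close> at points
        and of the pairing of \<open>\<rho>'\<close> with the indicator of the interval.\<close>
      define f where "f s = (m s e y - m s e x) - - a e * pairing (\<l> e) (\<lambda>t. \<rho>' t e) \<psi> s" for s
      have "L2_continuous T (\<l> e) (\<lambda>t. \<rho>' t e)"
        using regular_edge.L2_time_deriv_edge[OF regular(1)[OF e]] by (simp add: L2_time_deriv_def)
      from pairing_continuous[OF this \<psi>]
      have "(pairing (\<l> e) (\<lambda>t. \<rho>' t e) \<psi> \<longlongrightarrow> pairing (\<l> e) (\<lambda>t. \<rho>' t e) \<psi> 0) (at 0 within {0..T})"
        using params by (auto simp: continuous_on_def)
      moreover have "((\<lambda>s. m s e z) \<longlongrightarrow> m 0 e z) (at 0 within {0..T})" if "0 \<le> z" "z \<le> \<l> e" for z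
        unfolding m_eq using that params
        by (intro tendsto_mult tendsto_const regular_edge.point_continuous[OF regular(1)[OF e]]
            regular_edge.point_continuous[OF regular(2)[OF e]]) auto
      ultimately have "(f \<longlongrightarrow> f 0) (at 0 within {0..T})"
        unfolding f_def[abs_def] using xy by (intro tendsto_diff tendsto_mult tendsto_const) auto
      moreover have "\<forall>\<^sub>F s in at 0 within {0..T}. f s = 0"
        unfolding eventually_at_filter
      proof (rule always_eventually, intro allI impI)
        fix s assume "s \<noteq> 0" "s \<in> {0..T}"
        then have "s \<in> {0<..T}" by auto
        from has_L2_derivD(1)[OF pos[OF this] xy] show "f s = 0" unfolding f_def pair by simp
      qed
      then have "(f \<longlongrightarrow> 0) (at 0 within {0..T})" by (rule tendsto_eventually)
      moreover have "at 0 within {0..T} \<noteq> bot"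
        using params(1) by (simp add: trivial_limit_within islimpt_Icc)
      ultimately have "f 0 = 0" using tendsto_unique by blast
      then show "m t e y - m t e x = (LINT z:{x<..<y}|pipe (\<l> e). - a e * \<rho>' t e z)"
        unfolding f_def pair True by simp
    qed
  qed
qed

text \<open>The chain rule is used only to see that the enthalpy lies in H1; the equation then
  identifies its derivative.\<close>

lemma \<eta>_deriv:
  assumes e: "e \<in> arcs G" and t: "t \<in> {0<..T}"
  shows "has_L2_deriv (\<l> e) (\<eta> t e) (\<lambda>x. - \<epsilon>\<^sup>2 * w' t e x - \<gamma> e * \<bar>w t e x\<bar> * w t e x)"
proof -
  have t': "t \<in> {0..T}" using t by auto
  have "has_L2_deriv (\<l> e) (\<lambda>x. deriv P (\<rho> t e x)) (\<lambda>x. deriv (deriv P) (\<rho> t e x) * dx \<l> (\<rho> t) e x)"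
  proof (rule has_L2_deriv_compose[OF H1_rho[OF e t'], of "{\<rho>lo..\<rho>hi}" _ _ L])
    show "(deriv P has_real_derivative deriv (deriv P) r) (at r)" if "r \<in> {\<rho>lo..\<rho>hi}" for r
      using that pos by (intro dP1) auto
    show "\<bar>deriv (deriv P) r - deriv (deriv P) s\<bar> \<le> L * \<bar>r - s\<bar>" if "r \<in> {\<rho>lo..\<rho>hi}" "s \<in> {\<rho>lo..\<rho>hi}" for r s
      using that pos by (intro P2_Lipschitz) auto
  qed (use range[OF e t'] in auto)
  from has_L2_deriv_add[OF has_L2_deriv_cmult[OF has_L2_deriv_square[OF H1_w[OF e t']], of "1 / 2 * \<epsilon>\<^sup>2"] this]
  have "\<eta> t e \<in> H1 (\<l> e)"
    using network(3)[OF e] has_L2_deriv_imp_H1 by (auto simp: \<eta>_def enthalpy_def)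
  then have 1: "has_L2_deriv (\<l> e) (\<eta> t e) (dx \<l> (\<eta> t) e)"
    unfolding dx_def by (rule H1_has_L2_deriv[OF _ network(3)[OF e]])
  have "ess_bounded (\<l> e) (\<lambda>x. \<gamma> e * \<bar>w t e x\<bar> * w t e x)"
    by (intro ess_bounded_mult ess_bounded_abs ess_bounded_const ess_bounded_continuous cont_w e t')
  then have k: "(\<lambda>x. - \<epsilon>\<^sup>2 * w' t e x - \<gamma> e * \<bar>w t e x\<bar> * w t e x) \<in> Lp 2 (\<l> e)"
    by (intro Lp2_diff Lp2_cmult w'_Lp2[OF e t'] ess_bounded_Lp2)
  show ?thesis
  proof (rule has_L2_deriv_cong_AE[OF 1 k])
    show "AE x in pipe (\<l> e). dx \<l> (\<eta> t) e x = - \<epsilon>\<^sup>2 * w' t e x - \<gamma> e * \<bar>w t e x\<bar> * w t e x"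
      using equations[OF t e] by (rule eventually_mono) (auto simp: \<eta>_def)
  qed
qed

text \<open>Integration by parts on each pipe, with the end terms collected by vertices. At an inner
  vertex the common enthalpy factors out of the vanishing Kirchhoff sum; at a boundary vertex it is
  the prescribed value. The right-hand side is that of the scheme for the same test
  function.\<close>

lemma weak_momentum_balance:
  assumes t: "t \<in> {0<..T}" and r: "\<And>e. e \<in> arcs G \<Longrightarrow> has_L2_deriv (\<l> e) (r e) (r' e)"
    and kirchhoff: "\<And>v. v \<in> inner_verts G \<Longrightarrow> (\<Sum>e\<in>incident_arcs G v. vertex_value G \<l> r e v * edge_sign G e v) = 0"
  shows "(\<Sum>e\<in>arcs G. (\<integral>x. \<epsilon>\<^sup>2 * w' t e x * r e x \<partial>pipe (\<l> e)) - (\<integral>x. \<eta> t e x * r' e x \<partial>pipe (\<l> e))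
      + (\<integral>x. \<gamma> e * \<bar>w t e x\<bar> * w t e x * r e x \<partial>pipe (\<l> e)))
    = - (\<Sum>v\<in>boundary_verts G. \<Sum>e\<in>incident_arcs G v. \<eta>b v t * vertex_value G \<l> r e v * edge_sign G e v)"
proof -
  have t': "t \<in> {0..T}" using t by auto
  have "(\<integral>x. \<epsilon>\<^sup>2 * w' t e x * r e x \<partial>pipe (\<l> e)) - (\<integral>x. \<eta> t e x * r' e x \<partial>pipe (\<l> e))
      + (\<integral>x. \<gamma> e * \<bar>w t e x\<bar> * w t e x * r e x \<partial>pipe (\<l> e)) = - (\<eta> t e (\<l> e) * r e (\<l> e) - \<eta> t e 0 * r e 0)"
    if e: "e \<in> arcs G" for e
  proof -
    have rL: "r e \<in> Lp 2 (\<l> e)" by (rule Lp2_continuous[OF has_L2_deriv_imp_continuous_on[OF r[OF e]]])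
    have i1: "integrable (pipe (\<l> e)) (\<lambda>x. \<epsilon>\<^sup>2 * w' t e x * r e x)"
      using rL by (intro Lp2_mult Lp2_cmult w'_Lp2[OF e t'])
    have "ess_bounded (\<l> e) (\<lambda>x. \<gamma> e * \<bar>w t e x\<bar> * w t e x)"
      by (intro ess_bounded_mult ess_bounded_abs ess_bounded_const ess_bounded_continuous cont_w e t')
    then have i2: "integrable (pipe (\<l> e)) (\<lambda>x. \<gamma> e * \<bar>w t e x\<bar> * w t e x * r e x)"
      using rL by (intro Lp2_integrable ess_bounded_mult_Lp2)
    have "(\<integral>x. (- \<epsilon>\<^sup>2 * w' t e x - \<gamma> e * \<bar>w t e x\<bar> * w t e x) * r e x \<partial>pipe (\<l> e)) + (\<integral>x. \<eta> t e x * r' e x \<partial>pipe (\<l> e))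
        = \<eta> t e (\<l> e) * r e (\<l> e) - \<eta> t e 0 * r e 0"
      using network(3)[OF e] by (intro integral_by_parts_pipe[OF \<eta>_deriv[OF e t] r[OF e]]) simp
    moreover have "(\<integral>x. (- \<epsilon>\<^sup>2 * w' t e x - \<gamma> e * \<bar>w t e x\<bar> * w t e x) * r e x \<partial>pipe (\<l> e))
        = (\<integral>x. - (\<epsilon>\<^sup>2 * w' t e x * r e x) - \<gamma> e * \<bar>w t e x\<bar> * w t e x * r e x \<partial>pipe (\<l> e))"
      by (rule Bochner_Integration.integral_cong) (auto simp: algebra_simps)
    moreover have "\<dots> = - (\<integral>x. \<epsilon>\<^sup>2 * w' t e x * r e x \<partial>pipe (\<l> e)) - (\<integral>x. \<gamma> e * \<bar>w t e x\<bar> * w t e x * r e x \<partial>pipe (\<l> e))"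
      using i1 i2 by simp
    ultimately show ?thesis by linarith
  qed
  then have "(\<Sum>e\<in>arcs G. (\<integral>x. \<epsilon>\<^sup>2 * w' t e x * r e x \<partial>pipe (\<l> e)) - (\<integral>x. \<eta> t e x * r' e x \<partial>pipe (\<l> e))
      + (\<integral>x. \<gamma> e * \<bar>w t e x\<bar> * w t e x * r e x \<partial>pipe (\<l> e)))
    = - (\<Sum>e\<in>arcs G. \<eta> t e (\<l> e) * r e (\<l> e) - \<eta> t e 0 * r e 0)" unfolding sum_negf[symmetric] by (intro sum.cong refl)
  also have "(\<Sum>e\<in>arcs G. \<eta> t e (\<l> e) * r e (\<l> e) - \<eta> t e 0 * r e 0)
    = (\<Sum>v\<in>verts G. \<Sum>e\<in>incident_arcs G v. vertex_value G \<l> (\<lambda>e x. \<eta> t e x * r e x) e v * edge_sign G e v)"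
    using sum_arcs_eq_sum_verts[OF network(1,2), of "\<lambda>e x. \<eta> t e x * r e x" \<l>] by simp
  also have "\<dots> = (\<Sum>v\<in>verts G. \<Sum>e\<in>incident_arcs G v. vertex_value G \<l> (\<eta> t) e v * (vertex_value G \<l> r e v * edge_sign G e v))"
    by (intro sum.cong refl) (simp add: vertex_value_def)
  also have "\<dots> = (\<Sum>v\<in>boundary_verts G. \<Sum>e\<in>incident_arcs G v. vertex_value G \<l> (\<eta> t) e v * (vertex_value G \<l> r e v * edge_sign G e v))"
  proof (rule sum.mono_neutral_right)
    show "\<forall>v\<in>verts G - boundary_verts G. (\<Sum>e\<in>incident_arcs G v. vertex_value G \<l> (\<eta> t) e v * (vertex_value G \<l> r e v * edge_sign G e v)) = 0"
    proof
      fix v assume "v \<in> verts G - boundary_verts G"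
      then have v: "v \<in> inner_verts G" by (simp add: inner_verts_def)
      obtain \<eta>v where "\<forall>e\<in>incident_arcs G v. vertex_value G \<l> (\<eta> t) e v = \<eta>v"
        using inner[OF t v] by (auto simp: \<eta>_def)
      then show "(\<Sum>e\<in>incident_arcs G v. vertex_value G \<l> (\<eta> t) e v * (vertex_value G \<l> r e v * edge_sign G e v)) = 0"
        using kirchhoff[OF v] by (simp add: sum_distrib_left[symmetric])
    qed
  qed (auto simp: fin_verts boundary_verts_def)
  also have "\<dots> = (\<Sum>v\<in>boundary_verts G. \<Sum>e\<in>incident_arcs G v. \<eta>b v t * vertex_value G \<l> r e v * edge_sign G e v)"
    by (intro sum.cong refl) (simp add: boundary[OF t] \<eta>_def mult.assoc)
  finally show ?thesis .
qed

end

section \<open>The discrete solution\<close>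

locale discretization = exact_solution P \<rho>lo \<rho>hi wbar \<epsilon>bar L G \<l> \<epsilon> a \<gamma> T K alo ahi \<gamma>lo \<gamma>hi \<eta>b \<rho> w \<rho>' w'
  for P :: "real \<Rightarrow> real" and \<rho>lo \<rho>hi wbar \<epsilon>bar L :: real
    and G :: "('v, 'e) pre_digraph" and \<l> :: "'e \<Rightarrow> real" and \<epsilon> :: real and a \<gamma> :: "'e \<Rightarrow> real"
    and T K alo ahi \<gamma>lo \<gamma>hi :: real and \<eta>b :: "'v \<Rightarrow> real \<Rightarrow> real"
    and \<rho> w \<rho>' w' :: "real \<Rightarrow> 'e netfun" +
  fixes N :: nat and M :: "'e \<Rightarrow> nat" and dt :: real and \<rho>h mh :: "nat \<Rightarrow> 'e netfun"
  assumes N: "1 \<le> N" and dt_def: "dt = T / real N" and M: "\<And>e. e \<in> arcs G \<Longrightarrow> 1 \<le> M e"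
    and discrete: "discrete_solution G \<l> P \<epsilon> a \<gamma> \<eta>b (\<rho> 0) (mass_flow a (\<rho> 0) (w 0)) M dt N \<rho>h mh"
    and admissible: "admissible_state G \<l> a \<rho>lo \<rho>hi wbar N \<rho>h mh"
begin

lemma dt_pos: "0 < dt" using N params by (simp add: dt_def)

definition \<tau> :: "nat \<Rightarrow> real" where "\<tau> n = real n * dt"

lemma \<tau>: "n \<le> N \<Longrightarrow> \<tau> n \<in> {0..T}" "1 \<le> n \<Longrightarrow> n \<le> N \<Longrightarrow> \<tau> n \<in> {0<..T}"
  "1 \<le> n \<Longrightarrow> \<tau> n - \<tau> (n - 1) = dt" "\<tau> 0 = 0"
proof -
  have *: "\<tau> n \<le> T" if "n \<le> N" for n
  proof -
    have "real n * T \<le> real N * T" using that params by (intro mult_right_mono) auto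
    then have "real n * dt \<le> T" using N by (simp add: dt_def divide_le_eq mult.commute)
    then show ?thesis by (simp add: \<tau>_def)
  qed
  then show "n \<le> N \<Longrightarrow> \<tau> n \<in> {0..T}" using dt_pos by (simp add: \<tau>_def)
  show "1 \<le> n \<Longrightarrow> n \<le> N \<Longrightarrow> \<tau> n \<in> {0<..T}" using * dt_pos by (simp add: \<tau>_def)
  show "1 \<le> n \<Longrightarrow> \<tau> n - \<tau> (n - 1) = dt" by (simp add: \<tau>_def of_nat_diff algebra_simps)
  show "\<tau> 0 = 0" by (simp add: \<tau>_def)
qed

section \<open>Structure of the discrete functions\<close>

lemma mesh: "e \<in> arcs G \<Longrightarrow> uniform_mesh (\<l> e) (M e)"
  using network(3) M by (simp add: uniform_mesh_def)

lemma cell_eq: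
  assumes "e \<in> arcs G"
  shows "cell \<l> M e i = {uniform_mesh.node (\<l> e) (M e) i<..<uniform_mesh.node (\<l> e) (M e) (Suc i)}"
  by (simp add: cell_def mesh_size_def uniform_mesh.node_def[OF mesh[OF assms]] uniform_mesh.h_def[OF mesh[OF assms]])

lemma rhoh_Qh: "n \<le> N \<Longrightarrow> \<rho>h n \<in> Qh G \<l> M"
  using discrete by (cases "n = 0") (auto simp: discrete_solution_def is_L2_projection_def)

lemma mh_Rh: "n \<le> N \<Longrightarrow> mh n \<in> Rh G \<l> M"
  using discrete by (cases "n = 0") (auto simp: discrete_solution_def is_nodal_interpolation_def)

lemma rhoh_cells:
  assumes "n \<le> N" "e \<in> arcs G"
  obtains c where "\<And>i x. i < M e \<Longrightarrow> x \<in> cell \<l> M e i \<Longrightarrow> \<rho>h n e x = c i"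
proof -
  have "\<forall>i. \<exists>c. i < M e \<longrightarrow> (\<forall>x\<in>cell \<l> M e i. \<rho>h n e x = c)"
    using rhoh_Qh[OF assms(1)] assms(2) unfolding Qh_def by blast
  then obtain c where "\<forall>i. i < M e \<longrightarrow> (\<forall>x\<in>cell \<l> M e i. \<rho>h n e x = c i)" by metis
  then show ?thesis by (intro that) blast
qed

text \<open>Off the nodes the discrete density takes finitely many values on a pipe, hence so does
  its image under any \<open>F\<close>. The cases used are the identity, \<open>P\<close> and
  \<open>deriv P\<close>.\<close>

lemma ess_bounded_rhoh:
  assumes n: "n \<le> N" and e: "e \<in> arcs G" shows "ess_bounded (\<l> e) (\<lambda>x. F (\<rho>h n e x))"
proof -
  interpret mesh: uniform_mesh "\<l> e" "M e" by (rule mesh[OF e])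
  obtain c where "\<And>i x. i < M e \<Longrightarrow> x \<in> cell \<l> M e i \<Longrightarrow> \<rho>h n e x = c i" by (rule rhoh_cells[OF n e]) blast
  then show ?thesis
    unfolding cell_eq[OF e] by (intro mesh.ess_bounded_by_cells[of "\<lambda>x. F (\<rho>h n e x)" "\<lambda>i. F (c i)"]) simp
qed

definition wh :: "nat \<Rightarrow> 'e netfun" where "wh n = discrete_velocity a (\<rho>h n) (mh n)"

lemma admissible_AE:
  assumes "n \<le> N" "e \<in> arcs G"
  shows "AE x in pipe (\<l> e). \<rho>h n e x \<in> {2 * \<rho>lo / 3..3 * \<rho>hi / 2} \<and> \<bar>wh n e x\<bar> \<le> 3 * wbar / 2
    \<and> mh n e x = a e * \<rho>h n e x * wh n e x"
proof -
  have a: "0 < a e" using coeffs[OF assms(2)] params by linarith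
  have "AE x in pipe (\<l> e). 2 * \<rho>lo / 3 \<le> \<rho>h n e x \<and> \<rho>h n e x \<le> 3 * \<rho>hi / 2 \<and>
      \<bar>discrete_velocity a (\<rho>h n) (mh n) e x\<bar> \<le> 3 * wbar / 2"
    using admissible assms unfolding admissible_state_def by blast
  then show ?thesis
  proof (rule eventually_mono)
    fix x assume *: "2 * \<rho>lo / 3 \<le> \<rho>h n e x \<and> \<rho>h n e x \<le> 3 * \<rho>hi / 2 \<and>
      \<bar>discrete_velocity a (\<rho>h n) (mh n) e x\<bar> \<le> 3 * wbar / 2"
    have "0 < \<rho>h n e x" using * pos by linarith
    then show "\<rho>h n e x \<in> {2 * \<rho>lo / 3..3 * \<rho>hi / 2} \<and> \<bar>wh n e x\<bar> \<le> 3 * wbar / 2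
      \<and> mh n e x = a e * \<rho>h n e x * wh n e x"
      using * a by (simp add: wh_def discrete_velocity_def)
  qed
qed

lemma mh_H1: "n \<le> N \<Longrightarrow> e \<in> arcs G \<Longrightarrow> has_L2_deriv (\<l> e) (mh n e) (dx \<l> (mh n) e)"
  using mh_Rh network(3) unfolding dx_def by (intro H1_has_L2_deriv) (auto simp: Rh_def Hdiv_def H1pw_def)

lemma cont_mh: "n \<le> N \<Longrightarrow> e \<in> arcs G \<Longrightarrow> continuous_on {0..\<l> e} (mh n e)"
  by (rule has_L2_deriv_imp_continuous_on[OF mh_H1])

lemma ess_bounded_wh:
  assumes n: "n \<le> N" and e: "e \<in> arcs G" shows "ess_bounded (\<l> e) (wh n e)"
proof (rule ess_boundedI)
  show "wh n e \<in> borel_measurable (pipe (\<l> e))"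
    unfolding wh_def discrete_velocity_def
    using ess_bounded_measurable[OF ess_bounded_rhoh[OF n e, of "\<lambda>r. r"]]
      borel_measurable_pipe_continuous_on[OF cont_mh[OF n e]]
    by (intro borel_measurable_divide borel_measurable_times) auto
  show "AE x in pipe (\<l> e). \<bar>wh n e x\<bar> \<le> 3 * wbar / 2"
    using admissible_AE[OF n e] by (rule eventually_mono) blast
qed

text \<open>The indicator, up to node values, of a single cell of a single pipe; testing with it
  localises the mass balance and the initial projection.\<close>

definition probe :: "'e \<Rightarrow> nat \<Rightarrow> 'e netfun" where
  "probe e i = (\<lambda>e' x. if e' = e then uniform_mesh.step (\<l> e) (M e) (\<lambda>j. if j = i then 1 else 0) x else 0)"

lemma probe_Qh:
  assumes e: "e \<in> arcs G" shows "probe e i \<in> Qh G \<l> M"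
  unfolding Qh_def
proof (intro CollectI ballI allI impI)
  interpret mesh: uniform_mesh "\<l> e" "M e" by (rule mesh[OF e])
  fix e' j assume "e' \<in> arcs G" "j < M e'"
  show "\<exists>c. \<forall>x\<in>cell \<l> M e' j. probe e i e' x = c"
  proof (cases "e' = e")
    case True
    then show ?thesis
      by (intro exI[of _ "if j = i then 1 else 0"]) (auto simp: probe_def cell_eq[OF e] mesh.step_cell)
  qed (simp add: probe_def)
qed

lemma ipE_probe:
  assumes e: "e \<in> arcs G" and i: "i < M e" and f: "f e \<in> Lp 2 (\<l> e)"
  shows "ipE G \<l> f (probe e i) = (LINT t:cell \<l> M e i|pipe (\<l> e). f e t)"
proof -
  interpret mesh: uniform_mesh "\<l> e" "M e" by (rule mesh[OF e])
  have "ipE G \<l> f (probe e i) = (\<Sum>e'\<in>arcs G. if e' = e then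
      (\<integral>x. f e x * mesh.step (\<lambda>j. if j = i then 1 else 0) x \<partial>pipe (\<l> e)) else 0)"
    unfolding ipE_def by (intro sum.cong refl) (auto simp: probe_def)
  also have "\<dots> = (\<integral>x. f e x * mesh.step (\<lambda>j. if j = i then 1 else 0) x \<partial>pipe (\<l> e))"
    using e fin_arcs by simp
  also have "\<dots> = (\<Sum>j<M e. (LINT t:{mesh.node j<..<mesh.node (Suc j)}|pipe (\<l> e). f e t) * (if j = i then 1 else 0))"
    by (intro mesh.integral_step_mult Lp2_integrable f Lp2_mult mesh.step_Lp2)
  also have "\<dots> = (\<Sum>j<M e. if j = i then (LINT t:{mesh.node j<..<mesh.node (Suc j)}|pipe (\<l> e). f e t) else 0)"
    by (intro sum.cong refl) auto
  also have "\<dots> = (LINT t:{mesh.node i<..<mesh.node (Suc i)}|pipe (\<l> e). f e t)" using i by simp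
  finally show ?thesis by (simp add: cell_eq[OF e])
qed

lemma mh_deriv_step:
  assumes n: "n \<le> N" and e: "e \<in> arcs G"
  obtains s where "has_L2_deriv (\<l> e) (mh n e) (uniform_mesh.step (\<l> e) (M e) s)"
proof -
  interpret mesh: uniform_mesh "\<l> e" "M e" by (rule mesh[OF e])
  have "\<exists>c d. \<forall>x\<in>{mesh.node i<..<mesh.node (Suc i)}. mh n e x = c + d * x" if "i < M e" for i
    using mh_Rh[OF n] e that unfolding Rh_def cell_eq[OF e, symmetric] by blast
  from mesh.affine_cells_deriv[OF mh_H1[OF n e] this] that show ?thesis by blast
qed

text \<open>Both terms of the discrete mass balance are constant on each cell, so testing with a
  single cell makes the balance hold pointwise there. This gives the derivative of the test function
  explicitly.\<close>

lemma discrete_mass: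
  assumes n: "1 \<le> n" "n \<le> N" and e: "e \<in> arcs G"
  shows "has_L2_deriv (\<l> e) (mh n e) (\<lambda>x. - a e * (\<rho>h n e x - \<rho>h (n - 1) e x) / dt)"
proof -
  interpret mesh: uniform_mesh "\<l> e" "M e" by (rule mesh[OF e])
  have n1: "n - 1 \<le> N" using n by simp
  obtain s where s: "has_L2_deriv (\<l> e) (mh n e) (mesh.step s)" by (rule mh_deriv_step[OF n(2) e])
  obtain c where c: "\<And>i x. i < M e \<Longrightarrow> x \<in> cell \<l> M e i \<Longrightarrow> \<rho>h n e x = c i" by (rule rhoh_cells[OF n(2) e]) blast
  obtain d where d: "\<And>i x. i < M e \<Longrightarrow> x \<in> cell \<l> M e i \<Longrightarrow> \<rho>h (n - 1) e x = d i" by (rule rhoh_cells[OF n1 e]) blast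
  have f: "(\<lambda>x. a e * backward_diff dt \<rho>h n e x) \<in> Lp 2 (\<l> e)"
    unfolding backward_diff_def
    by (intro ess_bounded_Lp2 ess_bounded_mult ess_bounded_divide ess_bounded_diff ess_bounded_const
        ess_bounded_rhoh[OF n(2) e, of "\<lambda>r. r"] ess_bounded_rhoh[OF n1 e, of "\<lambda>r. r"])
  have sc: "s i = - a e * (c i - d i) / dt" if i: "i < M e" for i
  proof -
    have "ipE G \<l> (\<lambda>e x. a e * backward_diff dt \<rho>h n e x) (probe e i) + ipE G \<l> (dx \<l> (mh n)) (probe e i) = 0"
      using discrete n probe_Qh[OF e, of i] by (auto simp: discrete_solution_def)
    then have "(LINT t:cell \<l> M e i|pipe (\<l> e). a e * backward_diff dt \<rho>h n e t) + (LINT t:cell \<l> M e i|pipe (\<l> e). dx \<l> (mh n) e t) = 0"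
      using ipE_probe[OF e i, of "\<lambda>e x. a e * backward_diff dt \<rho>h n e x", OF f]
        ipE_probe[OF e i, of "dx \<l> (mh n)", OF has_L2_derivD(2)[OF mh_H1[OF n(2) e]]] by simp
    moreover have "(LINT t:cell \<l> M e i|pipe (\<l> e). a e * backward_diff dt \<rho>h n e t) = mesh.h * (a e * ((c i - d i) / dt))"
    proof -
      have "(LINT t:cell \<l> M e i|pipe (\<l> e). a e * backward_diff dt \<rho>h n e t) = (LINT t:cell \<l> M e i|pipe (\<l> e). a e * ((c i - d i) / dt))"
        unfolding cell_eq[OF e]
        by (rule mesh.set_integral_cell_cong) (use c[OF i] d[OF i] in \<open>simp add: backward_diff_def cell_eq[OF e]\<close>)
      then show ?thesis using mesh.set_integral_cell_const[OF i] by (simp add: cell_eq[OF e])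
    qed
    moreover have "(LINT t:cell \<l> M e i|pipe (\<l> e). dx \<l> (mh n) e t) = mesh.h * s i"
    proof -
      have "(LINT t:cell \<l> M e i|pipe (\<l> e). dx \<l> (mh n) e t) = (LINT t:cell \<l> M e i|pipe (\<l> e). mesh.step s t)"
        unfolding cell_eq[OF e]
        using has_L2_derivD(1)[OF s mesh.cell_range(1-3)[OF i]] has_L2_derivD(1)[OF mh_H1[OF n(2) e] mesh.cell_range(1-3)[OF i]] by simp
      also have "\<dots> = (LINT t:cell \<l> M e i|pipe (\<l> e). s i)"
        unfolding cell_eq[OF e] by (rule mesh.set_integral_cell_cong) (simp add: mesh.step_cell)
      finally show ?thesis using mesh.set_integral_cell_const[OF i] by (simp add: cell_eq[OF e])
    qed
    ultimately have "mesh.h * (a e * ((c i - d i) / dt) + s i) = 0" by (simp add: distrib_left)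
    then have "a e * ((c i - d i) / dt) + s i = 0" using mesh.h_pos by simp
    then show ?thesis by simp
  qed
  show ?thesis
  proof (rule has_L2_deriv_cong_AE[OF s])
    show "(\<lambda>x. - a e * (\<rho>h n e x - \<rho>h (n - 1) e x) / dt) \<in> Lp 2 (\<l> e)"
      by (intro ess_bounded_Lp2 ess_bounded_mult ess_bounded_divide ess_bounded_diff ess_bounded_const
        ess_bounded_rhoh[OF n(2) e, of "\<lambda>r. r"] ess_bounded_rhoh[OF n1 e, of "\<lambda>r. r"])
    show "AE x in pipe (\<l> e). mesh.step s x = - a e * (\<rho>h n e x - \<rho>h (n - 1) e x) / dt"
    proof (rule mesh.AE_by_cells)
      fix i x assume i: "i < M e" and x: "x \<in> {mesh.node i<..<mesh.node (Suc i)}"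
      then show "mesh.step s x = - a e * (\<rho>h n e x - \<rho>h (n - 1) e x) / dt"
        using c[OF i, of x] d[OF i, of x] by (simp only: mesh.step_cell[OF x] sc[OF i] cell_eq[OF e])
    qed
  qed
qed

lemma initial_density:
  assumes e: "e \<in> arcs G"
  shows "AE x in pipe (\<l> e). \<rho>h 0 e x = uniform_mesh.proj (\<l> e) (M e) (\<rho> 0 e) x"
proof -
  interpret mesh: uniform_mesh "\<l> e" "M e" by (rule mesh[OF e])
  have T0: "0 \<in> {0..T}" using params by simp
  obtain c where c: "\<And>i x. i < M e \<Longrightarrow> x \<in> cell \<l> M e i \<Longrightarrow> \<rho>h 0 e x = c i" by (rule rhoh_cells[OF le0 e]) blast
  show ?thesis
  proof (rule mesh.AE_by_cells)
    fix i x assume i: "i < M e" and x: "x \<in> {mesh.node i<..<mesh.node (Suc i)}"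
    have "ipE G \<l> (\<rho>h 0) (probe e i) = ipE G \<l> (\<rho> 0) (probe e i)"
      using discrete probe_Qh[OF e, of i] by (auto simp: discrete_solution_def is_L2_projection_def)
    then have "(LINT t:cell \<l> M e i|pipe (\<l> e). \<rho>h 0 e t) = (LINT t:cell \<l> M e i|pipe (\<l> e). \<rho> 0 e t)"
      using ipE_probe[OF e i, of "\<rho>h 0", OF ess_bounded_Lp2[OF ess_bounded_rhoh[OF le0 e, of "\<lambda>r. r"]]]
        ipE_probe[OF e i, of "\<rho> 0", OF Lp2_continuous[OF cont_rho[OF e T0]]] by simp
    moreover have "(LINT t:cell \<l> M e i|pipe (\<l> e). \<rho>h 0 e t) = (LINT t:cell \<l> M e i|pipe (\<l> e). c i)"
      unfolding cell_eq[OF e] by (rule mesh.set_integral_cell_cong) (use c[OF i] in \<open>simp add: cell_eq[OF e]\<close>)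
    ultimately have "mesh.h * c i = (LINT t:{mesh.node i<..<mesh.node (Suc i)}|pipe (\<l> e). \<rho> 0 e t)"
      using mesh.set_integral_cell_const[OF i] by (simp add: cell_eq[OF e])
    then have "c i = mesh.avg (\<rho> 0 e) i" using mesh.h_pos by (simp add: mesh.avg_def field_simps)
    then show "\<rho>h 0 e x = mesh.proj (\<rho> 0 e) x"
      using c[OF i, of x] x by (simp add: mesh.proj_def mesh.step_cell[OF x] cell_eq[OF e])
  qed
qed

section \<open>The interpolated exact flux and the test function\<close>

definition Ihm :: "nat \<Rightarrow> 'e netfun" where
  "Ihm n e = uniform_mesh.interp (\<l> e) (M e) (m (\<tau> n) e) (\<lambda>x. - a e * \<rho>' (\<tau> n) e x)"

text \<open>By the exact mass balance the derivative of the interpolated flux is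
  \<open>- a e * pr n e\<close>, so the scheme sees the exact density rate only through its
  projection.\<close>

definition pr :: "nat \<Rightarrow> 'e netfun" where "pr n e = uniform_mesh.proj (\<l> e) (M e) (\<rho>' (\<tau> n) e)"

definition \<phi> :: "nat \<Rightarrow> 'e netfun" where "\<phi> n e x = Ihm n e x - m (\<tau> n) e x"

definition r :: "nat \<Rightarrow> 'e netfun" where "r n e x = mh n e x - Ihm n e x"

definition r' :: "nat \<Rightarrow> 'e netfun" where
  "r' n e x = - a e * (\<rho>h n e x - \<rho>h (n - 1) e x) / dt + a e * pr n e x"

lemma Ihm_deriv:
  assumes n: "n \<le> N" and e: "e \<in> arcs G"
  shows "has_L2_deriv (\<l> e) (Ihm n e) (uniform_mesh.proj (\<l> e) (M e) (\<lambda>x. - a e * \<rho>' (\<tau> n) e x))"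
    and "uniform_mesh.proj (\<l> e) (M e) (\<lambda>x. - a e * \<rho>' (\<tau> n) e x) = (\<lambda>x. - a e * pr n e x)"
proof -
  interpret mesh: uniform_mesh "\<l> e" "M e" by (rule mesh[OF e])
  show "has_L2_deriv (\<l> e) (Ihm n e) (mesh.proj (\<lambda>x. - a e * \<rho>' (\<tau> n) e x))"
    unfolding Ihm_def by (rule mesh.interp_has_L2_deriv)
  have i: "integrable (pipe (\<l> e)) (\<rho>' (\<tau> n) e)" by (rule Lp2_integrable[OF rho'_Lp2[OF e \<tau>(1)[OF n]]])
  show "mesh.proj (\<lambda>x. - a e * \<rho>' (\<tau> n) e x) = (\<lambda>x. - a e * pr n e x)"
    using mesh.proj_linear[OF i i, of "- a e" 0] by (auto simp: pr_def)
qed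

lemma Ihm_node:
  assumes n: "n \<le> N" and e: "e \<in> arcs G" and i: "i \<le> M e"
  shows "Ihm n e (uniform_mesh.node (\<l> e) (M e) i) = m (\<tau> n) e (uniform_mesh.node (\<l> e) (M e) i)"
  unfolding Ihm_def by (rule uniform_mesh.interp_node[OF mesh[OF e] m_deriv[OF e \<tau>(1)[OF n]] i])

lemma pr_Lp2: "e \<in> arcs G \<Longrightarrow> pr n e \<in> Lp 2 (\<l> e)"
  unfolding pr_def by (rule uniform_mesh.proj_Lp2[OF mesh])

lemma r_deriv:
  assumes n: "1 \<le> n" "n \<le> N" and e: "e \<in> arcs G"
  shows "has_L2_deriv (\<l> e) (r n e) (r' n e)"
  using has_L2_deriv_diff[OF discrete_mass[OF n e] Ihm_deriv(1)[OF n(2) e, unfolded Ihm_deriv(2)[OF n(2) e]]]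
  by (simp add: r_def[abs_def] r'_def[abs_def])

text \<open>Interpolation preserves the values at the ends of a pipe, so the Kirchhoff condition of
  the exact flux carries over. The exact conditions are given for positive times, hence
  \<open>1 \<le> n\<close>.\<close>

lemma r_Rh:
  assumes n: "1 \<le> n" "n \<le> N"
  shows "r n \<in> Rh G \<l> M"
    and "v \<in> inner_verts G \<Longrightarrow> (\<Sum>e\<in>incident_arcs G v. vertex_value G \<l> (r n) e v * edge_sign G e v) = 0"
proof -
  have ends: "vertex_value G \<l> (Ihm n) e v = vertex_value G \<l> (m (\<tau> n)) e v" if e: "e \<in> arcs G" for e v
    using Ihm_node[OF n(2) e, of 0] Ihm_node[OF n(2) e, of "M e"] uniform_mesh.node_0[OF mesh[OF e]] uniform_mesh.node_k[OF mesh[OF e]]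
    by (simp add: vertex_value_def)
  show kirchhoff: "(\<Sum>e\<in>incident_arcs G v. vertex_value G \<l> (r n) e v * edge_sign G e v) = 0"
    if v: "v \<in> inner_verts G" for v
  proof -
    have "(\<Sum>e\<in>incident_arcs G v. vertex_value G \<l> (r n) e v * edge_sign G e v)
      = (\<Sum>e\<in>incident_arcs G v. vertex_value G \<l> (mh n) e v * edge_sign G e v - vertex_value G \<l> (m (\<tau> n)) e v * edge_sign G e v)"
    proof (intro sum.cong refl)
      fix e assume "e \<in> incident_arcs G v"
      then have "e \<in> arcs G" by (simp add: incident_arcs_def)
      from ends[OF this, of v] show "vertex_value G \<l> (r n) e v * edge_sign G e v
        = vertex_value G \<l> (mh n) e v * edge_sign G e v - vertex_value G \<l> (m (\<tau> n)) e v * edge_sign G e v"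
        by (auto simp: vertex_value_def r_def left_diff_distrib split: if_splits)
    qed
    also have "\<dots> = 0"
      using mh_Rh[OF n(2)] inner[OF \<tau>(2)[OF n] v] v by (simp add: sum_subtractf Rh_def Hdiv_def m_def)
    finally show ?thesis .
  qed
  show "r n \<in> Rh G \<l> M"
    unfolding Rh_def Hdiv_def H1pw_def
  proof (intro CollectI conjI ballI allI impI)
    fix e assume e: "e \<in> arcs G"
    show "r n e \<in> H1 (\<l> e)" using has_L2_deriv_imp_H1[OF r_deriv[OF n e]] network(3)[OF e] by simp
    interpret mesh: uniform_mesh "\<l> e" "M e" by (rule mesh[OF e])
    fix i assume i: "i < M e"
    obtain c d where cd: "\<forall>x\<in>cell \<l> M e i. mh n e x = c + d * x"
      using mh_Rh[OF n(2)] e i unfolding Rh_def by blast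
    define s where "s = mesh.avg (\<lambda>x. - a e * \<rho>' (\<tau> n) e x) i"
    have "r n e x = (c - (Ihm n e (mesh.node i) - s * mesh.node i)) + (d - s) * x" if x: "x \<in> cell \<l> M e i" for x
      using cd x mesh.L2_deriv_step_affine[OF Ihm_deriv(1)[OF n(2) e, unfolded mesh.proj_def] i, of x]
      by (simp add: r_def s_def cell_eq[OF e] algebra_simps)
    then show "\<exists>c d. \<forall>x\<in>cell \<l> M e i. r n e x = c + d * x" by blast
  qed (rule kirchhoff)
qed

section \<open>The error identity for the momentum balance\<close>

lemma ess_bounded_enth_h:
  assumes n: "n \<le> N" and e: "e \<in> arcs G"
  shows "ess_bounded (\<l> e) (\<lambda>x. enth \<epsilon> (\<rho>h n e x) (wh n e x))"
  unfolding enth_def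
  by (intro ess_bounded_add ess_bounded_mult ess_bounded_const ess_bounded_power ess_bounded_wh[OF n e]
      ess_bounded_rhoh[OF n e, of "deriv P"])

lemma ess_bounded_\<eta>:
  assumes e: "e \<in> arcs G" and t: "t \<in> {0..T}"
  shows "ess_bounded (\<l> e) (\<lambda>x. enth \<epsilon> (\<rho> t e x) (w t e x))"
proof -
  have "continuous_on {\<rho>lo..\<rho>hi} (deriv P)"
  proof (rule continuous_at_imp_continuous_on, rule ballI)
    fix q assume "q \<in> {\<rho>lo..\<rho>hi}"
    then have "0 < q" using pos by auto
    then show "isCont (deriv P) q" by (rule DERIV_isCont[OF dP1])
  qed
  then have "continuous_on {0..\<l> e} (\<lambda>x. deriv P (\<rho> t e x))"
    by (rule continuous_on_compose2[OF _ cont_rho[OF e t]]) (use range(1)[OF e t] in auto)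
  then show ?thesis
    unfolding enth_def
    by (intro ess_bounded_add ess_bounded_mult ess_bounded_const ess_bounded_power ess_bounded_continuous cont_w[OF e t])
qed

definition enthalpy_error :: "nat \<Rightarrow> 'e netfun" where
  "enthalpy_error n e x = enth \<epsilon> (\<rho>h n e x) (wh n e x) - enth \<epsilon> (\<rho> (\<tau> n) e x) (w (\<tau> n) e x)"

definition friction_error :: "nat \<Rightarrow> 'e netfun" where
  "friction_error n e x = \<bar>wh n e x\<bar> * wh n e x - \<bar>w (\<tau> n) e x\<bar> * w (\<tau> n) e x"

text \<open>The integrand of the discrete minus the exact momentum balance, both tested with
  \<open>r n\<close>, before integration.\<close>

definition momentum_defect :: "nat \<Rightarrow> 'e netfun" where
  "momentum_defect n e x = \<epsilon>\<^sup>2 * ((wh n e x - wh (n - 1) e x) / dt - w' (\<tau> n) e x) * r n e x - enthalpy_error n e x * r' n e x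
     + \<gamma> e * friction_error n e x * r n e x"

text \<open>The two balances have the same boundary terms, since the scheme evaluates the data at
  the new time level. Only the sum over all pipes vanishes, not the integral on each pipe.\<close>

lemma momentum_error:
  assumes n: "1 \<le> n" "n \<le> N"
  shows "e \<in> arcs G \<Longrightarrow> integrable (pipe (\<l> e)) (momentum_defect n e)"
    and "(\<Sum>e\<in>arcs G. \<integral>x. momentum_defect n e x \<partial>pipe (\<l> e)) = 0"
proof -
  have n1: "n - 1 \<le> N" using n by simp
  note t = \<tau>(1)[OF n(2)]
  define A1 A2 A3 B1 B2 B3 where
    "A1 e x = \<epsilon>\<^sup>2 * backward_diff dt wh n e x * r n e x" and
    "A2 e x = enth \<epsilon> (\<rho>h n e x) (wh n e x) * r' n e x" and
    "A3 e x = \<gamma> e * \<bar>wh n e x\<bar> * wh n e x * r n e x" and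
    "B1 e x = \<epsilon>\<^sup>2 * w' (\<tau> n) e x * r n e x" and
    "B2 e x = \<eta> (\<tau> n) e x * r' n e x" and
    "B3 e x = \<gamma> e * \<bar>w (\<tau> n) e x\<bar> * w (\<tau> n) e x * r n e x" for e x
  have i: "integrable (pipe (\<l> e)) (A1 e)" "integrable (pipe (\<l> e)) (A2 e)" "integrable (pipe (\<l> e)) (A3 e)"
    "integrable (pipe (\<l> e)) (B1 e)" "integrable (pipe (\<l> e)) (B2 e)" "integrable (pipe (\<l> e)) (B3 e)"
    if e: "e \<in> arcs G" for e
  proof -
    have rb: "ess_bounded (\<l> e) (r n e)"
      by (rule ess_bounded_continuous[OF has_L2_deriv_imp_continuous_on[OF r_deriv[OF n e]]])
    have r'L: "r' n e \<in> Lp 2 (\<l> e)" by (rule has_L2_derivD(2)[OF r_deriv[OF n e]])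
    have whb: "ess_bounded (\<l> e) (wh n e)" "ess_bounded (\<l> e) (wh (n - 1) e)" by (rule ess_bounded_wh[OF _ e], use n in simp)+
    have wb: "ess_bounded (\<l> e) (w (\<tau> n) e)" by (rule ess_bounded_continuous[OF cont_w[OF e t]])
    show "integrable (pipe (\<l> e)) (A1 e)" unfolding A1_def backward_diff_def
      by (intro ess_bounded_integrable ess_bounded_mult ess_bounded_const ess_bounded_divide ess_bounded_diff whb rb)
    show "integrable (pipe (\<l> e)) (A2 e)" unfolding A2_def
      by (intro Lp2_integrable ess_bounded_mult_Lp2 ess_bounded_enth_h[OF n(2) e] r'L)
    show "integrable (pipe (\<l> e)) (A3 e)" unfolding A3_def
      by (intro ess_bounded_integrable ess_bounded_mult ess_bounded_const ess_bounded_abs whb rb)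
    show "integrable (pipe (\<l> e)) (B1 e)" unfolding B1_def
      by (intro Lp2_mult Lp2_cmult w'_Lp2[OF e t] ess_bounded_Lp2[OF rb])
    show "integrable (pipe (\<l> e)) (B2 e)" unfolding B2_def \<eta>_eq
      by (intro Lp2_integrable ess_bounded_mult_Lp2 ess_bounded_\<eta>[OF e t] r'L)
    show "integrable (pipe (\<l> e)) (B3 e)" unfolding B3_def
      by (intro ess_bounded_integrable ess_bounded_mult ess_bounded_const ess_bounded_abs wb rb)
  qed
  have mom_eq: "momentum_defect n e = (\<lambda>x. (A1 e x - A2 e x + A3 e x) - (B1 e x - B2 e x + B3 e x))" for e
    by (auto simp: momentum_defect_def A1_def A2_def A3_def B1_def B2_def B3_def enthalpy_error_def friction_error_def \<eta>_eq backward_diff_def algebra_simps diff_divide_distrib)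
  show "integrable (pipe (\<l> e)) (momentum_defect n e)" if "e \<in> arcs G" for e
    unfolding mom_eq using i[OF that] by simp
  have whdef: "wh = (\<lambda>k. discrete_velocity a (\<rho>h k) (mh k))" by (simp add: wh_def fun_eq_iff)
  have enth_h: "discrete_enthalpy P \<epsilon> a (\<rho>h n) (mh n) e x = enth \<epsilon> (\<rho>h n e x) (wh n e x)" for e x
    by (simp add: discrete_enthalpy_def enth_def wh_def discrete_velocity_def power_divide power_mult_distrib)
  have "ipE G \<l> (\<lambda>e x. \<epsilon>\<^sup>2 * backward_diff dt wh n e x) (r n) - ipE G \<l> (discrete_enthalpy P \<epsilon> a (\<rho>h n) (mh n)) (dx \<l> (r n))
      + ipE G \<l> (\<lambda>e x. \<gamma> e * \<bar>wh n e x\<bar> * wh n e x) (r n)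
    = - (\<Sum>v\<in>boundary_verts G. \<Sum>e\<in>incident_arcs G v. \<eta>b v (real n * dt) * vertex_value G \<l> (r n) e v * edge_sign G e v)"
    using discrete n r_Rh(1)[OF n] unfolding discrete_solution_def Let_def whdef by fastforce
  moreover have "ipE G \<l> (discrete_enthalpy P \<epsilon> a (\<rho>h n) (mh n)) (dx \<l> (r n)) = (\<Sum>e\<in>arcs G. \<integral>x. A2 e x \<partial>pipe (\<l> e))"
    unfolding ipE_def
  proof (intro sum.cong refl)
    \<comment> \<open>The scheme contains the chosen representative \<open>dx\<close> of the weak
      derivative, which agrees with \<open>r'\<close> only almost everywhere.\<close>
    fix e assume e: "e \<in> arcs G"
    have "has_L2_deriv (\<l> e) (r n e) (dx \<l> (r n) e)"
      using has_L2_deriv_imp_H1[OF r_deriv[OF n e]] network(3)[OF e] unfolding dx_def by (intro H1_has_L2_deriv) auto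
    from has_L2_deriv_unique[OF this r_deriv[OF n e]] network(3)[OF e]
    have ae: "AE x in pipe (\<l> e). dx \<l> (r n) e x = r' n e x" by simp
    show "(\<integral>x. discrete_enthalpy P \<epsilon> a (\<rho>h n) (mh n) e x * dx \<l> (r n) e x \<partial>pipe (\<l> e)) = (\<integral>x. A2 e x \<partial>pipe (\<l> e))"
      unfolding enth_h
    proof (rule integral_cong_AE)
      show "(\<lambda>x. enth \<epsilon> (\<rho>h n e x) (wh n e x) * dx \<l> (r n) e x) \<in> borel_measurable (pipe (\<l> e))"
        by (intro borel_measurable_times ess_bounded_measurable[OF ess_bounded_enth_h[OF n(2) e]]
            Lp2_measurable[OF has_L2_derivD(2)[OF \<open>has_L2_deriv (\<l> e) (r n e) (dx \<l> (r n) e)\<close>]])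
      show "A2 e \<in> borel_measurable (pipe (\<l> e))" using i(2)[OF e] by (rule borel_measurable_integrable)
      show "AE x in pipe (\<l> e). enth \<epsilon> (\<rho>h n e x) (wh n e x) * dx \<l> (r n) e x = A2 e x"
        using ae by (rule eventually_mono) (simp add: A2_def)
    qed
  qed
  ultimately have 1: "(\<Sum>e\<in>arcs G. \<integral>x. A1 e x \<partial>pipe (\<l> e)) - (\<Sum>e\<in>arcs G. \<integral>x. A2 e x \<partial>pipe (\<l> e)) + (\<Sum>e\<in>arcs G. \<integral>x. A3 e x \<partial>pipe (\<l> e))
    = - (\<Sum>v\<in>boundary_verts G. \<Sum>e\<in>incident_arcs G v. \<eta>b v (\<tau> n) * vertex_value G \<l> (r n) e v * edge_sign G e v)"
    by (simp add: ipE_def A1_def A3_def \<tau>_def)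
  have 2: "(\<Sum>e\<in>arcs G. (\<integral>x. B1 e x \<partial>pipe (\<l> e)) - (\<integral>x. B2 e x \<partial>pipe (\<l> e)) + (\<integral>x. B3 e x \<partial>pipe (\<l> e)))
    = - (\<Sum>v\<in>boundary_verts G. \<Sum>e\<in>incident_arcs G v. \<eta>b v (\<tau> n) * vertex_value G \<l> (r n) e v * edge_sign G e v)"
    unfolding B1_def B2_def B3_def by (rule weak_momentum_balance[OF \<tau>(2)[OF n] r_deriv[OF n] r_Rh(2)[OF n]])
  have "(\<Sum>e\<in>arcs G. \<integral>x. momentum_defect n e x \<partial>pipe (\<l> e)) = (\<Sum>e\<in>arcs G. ((\<integral>x. A1 e x \<partial>pipe (\<l> e)) - (\<integral>x. A2 e x \<partial>pipe (\<l> e)) + (\<integral>x. A3 e x \<partial>pipe (\<l> e)))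
      - ((\<integral>x. B1 e x \<partial>pipe (\<l> e)) - (\<integral>x. B2 e x \<partial>pipe (\<l> e)) + (\<integral>x. B3 e x \<partial>pipe (\<l> e))))"
    unfolding mom_eq using i by (intro sum.cong refl) simp
  also have "\<dots> = 0" using 1 2 by (simp add: sum_subtractf sum.distrib)
  finally show "(\<Sum>e\<in>arcs G. \<integral>x. momentum_defect n e x \<partial>pipe (\<l> e)) = 0" .
qed

end

section \<open>The error estimate\<close>

definition increment_const :: "('v, 'e) pre_digraph \<Rightarrow> ('e \<Rightarrow> real) \<Rightarrow> real \<Rightarrow> real" where
  "increment_const G \<l> K = (\<Sum>e\<in>arcs G. sqrt (2 / \<l> e + 2 * \<l> e) * K)"

text \<open>A bound for the squared L2 norm of the space derivative of the exact flux on a pipe, by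
  the mass balance and \<open>time_deriv_bound\<close> with \<open>b = \<rho>hi\<close>.\<close>

definition flux_const :: "('e \<Rightarrow> real) \<Rightarrow> real \<Rightarrow> real \<Rightarrow> real \<Rightarrow> real \<Rightarrow> 'e \<Rightarrow> real" where
  "flux_const \<l> T K ahi \<rho>hi e = ahi\<^sup>2 * (6 * (K * T)\<^sup>2 + 4 * \<l> e * (2 * \<rho>hi / T)\<^sup>2)"

text \<open>The summands belong to the interpolation error, its difference quotient, and the mass
  and momentum residuals with shares \<open>2 * K\<^sup>2\<close> and
  \<open>K\<^sup>2\<close>.\<close>

definition residual_const :: "('v, 'e) pre_digraph \<Rightarrow> ('e \<Rightarrow> real) \<Rightarrow> real \<Rightarrow> real \<Rightarrow> real \<Rightarrow> real \<Rightarrow> real" where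
  "residual_const G \<l> T K ahi \<rho>hi = (\<Sum>e\<in>arcs G. flux_const \<l> T K ahi \<rho>hi e + ahi\<^sup>2 * K\<^sup>2 + 3 * K\<^sup>2)"

context gas_law
begin

text \<open>The inequality of \<open>step_bound\<close> as a predicate of its two constants, so that
  these can be fixed once, before the discretization is known.\<close>

definition dissipation :: "real \<Rightarrow> real \<Rightarrow> real \<Rightarrow> real \<Rightarrow> real \<Rightarrow> real \<Rightarrow> bool" where
  "dissipation alo ahi \<gamma>lo \<gamma>hi C c \<longleftrightarrow> (\<forall>\<epsilon> a \<gamma> r w R W \<phi> \<psi> \<zeta> \<theta> e.
    0 \<le> \<epsilon> \<longrightarrow> \<epsilon> \<le> \<epsilon>bar \<longrightarrow> alo \<le> a \<longrightarrow> a \<le> ahi \<longrightarrow> \<gamma>lo \<le> \<gamma> \<longrightarrow> \<gamma> \<le> \<gamma>hi \<longrightarrow>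
    r \<in> {\<rho>lo..\<rho>hi} \<longrightarrow> \<bar>w\<bar> \<le> wbar \<longrightarrow> R \<in> {2 * \<rho>lo / 3..3 * \<rho>hi / 2} \<longrightarrow> \<bar>W\<bar> \<le> 3 * wbar / 2 \<longrightarrow>
    a * (enth \<epsilon> R W - enth \<epsilon> r w) * \<zeta> + \<epsilon>\<^sup>2 * \<theta> * (a * R * W - a * r * w - \<phi>)
      - \<gamma> * (\<bar>W\<bar> * W - \<bar>w\<bar> * w) * (a * R * W - a * r * w - \<phi>) - \<epsilon>\<^sup>2 * \<psi> * e
    \<le> C * ((R - r)\<^sup>2 + \<epsilon>\<^sup>2 * (W - w)\<^sup>2 + \<epsilon>\<^sup>2 * e\<^sup>2 + \<phi>\<^sup>2 + \<psi>\<^sup>2 + \<zeta>\<^sup>2 + \<theta>\<^sup>2)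
      - c * \<bar>a * R * W - a * r * w\<bar> ^ 3)"

text \<open>The factor \<open>3 / (2 * alo * \<rho>lo)\<close> is the reciprocal of the lower bound
  of \<open>a * R\<close>; it converts a flux error into a velocity error.\<close>

definition initial_const :: "('v, 'e) pre_digraph \<Rightarrow> ('e \<Rightarrow> real) \<Rightarrow> real \<Rightarrow> real \<Rightarrow> real \<Rightarrow> real \<Rightarrow> real" where
  "initial_const G \<l> T K alo ahi = (\<Sum>e\<in>arcs G. (2 * K\<^sup>2 + 2) + \<epsilon>bar\<^sup>2 * (3 / (2 * alo * \<rho>lo))\<^sup>2 *
     (2 * flux_const \<l> T K ahi \<rho>hi e + 2 * (ahi * wbar)\<^sup>2 * (2 * K\<^sup>2 + 2)))"

text \<open>The coefficient in the Gronwall argument: \<open>2 / (alo * c0)\<close> expresses the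
  squared error by the shifted energy, and the residual constant covers the source term.\<close>

definition growth_const :: "('v, 'e) pre_digraph \<Rightarrow> ('e \<Rightarrow> real) \<Rightarrow> real \<Rightarrow> real \<Rightarrow> real \<Rightarrow> real \<Rightarrow> real \<Rightarrow> real" where
  "growth_const G \<l> T K alo ahi C = (C + ahi * (L + \<epsilon>bar\<^sup>2 + 1) * increment_const G \<l> K) *
     (2 / (alo * c0) + residual_const G \<l> T K ahi \<rho>hi)"

definition start_const :: "('v, 'e) pre_digraph \<Rightarrow> ('e \<Rightarrow> real) \<Rightarrow> real \<Rightarrow> real \<Rightarrow> real \<Rightarrow> real \<Rightarrow> real" where
  "start_const G \<l> T K alo ahi = (ahi * C0 + 1) * initial_const G \<l> T K alo ahi
     + \<epsilon>bar\<^sup>2 * residual_const G \<l> T K ahi \<rho>hi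
     + \<epsilon>bar\<^sup>2 / (2 * alo * c0) * residual_const G \<l> T K ahi \<rho>hi + 1"

definition error_const :: "('v, 'e) pre_digraph \<Rightarrow> ('e \<Rightarrow> real) \<Rightarrow> real \<Rightarrow> real \<Rightarrow> real \<Rightarrow> real \<Rightarrow> real \<Rightarrow> real \<Rightarrow> real" where
  "error_const G \<l> T K alo ahi C c =
     ((1 + (2 * (2 * ahi * \<rho>hi)\<^sup>2 + 2 * \<epsilon>bar\<^sup>2 * (ahi * wbar)\<^sup>2)) * (2 / (alo * c0)) + 1 / c) *
     (exp (4 * growth_const G \<l> T K alo ahi C * T) * start_const G \<l> T K alo ahi)"

end

section \<open>Interpolation errors and consistency residuals\<close>

context discretization
begin

definition hm :: real where "hm = max_mesh_size G \<l> M"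

definition he :: "'e \<Rightarrow> real" where "he e = uniform_mesh.h (\<l> e) (M e)"

lemma he: "e \<in> arcs G \<Longrightarrow> 0 < he e" "e \<in> arcs G \<Longrightarrow> he e \<le> hm"
proof -
  assume e: "e \<in> arcs G"
  show "0 < he e" unfolding he_def by (rule uniform_mesh.h_pos[OF mesh[OF e]])
  have "he e = mesh_size \<l> M e" by (simp add: he_def uniform_mesh.h_def[OF mesh[OF e]] mesh_size_def)
  then show "he e \<le> hm" unfolding hm_def max_mesh_size_def using e fin_arcs by (simp add: Max_ge)
qed

lemma he_square: "e \<in> arcs G \<Longrightarrow> (he e)\<^sup>2 \<le> hm\<^sup>2"
  using he by (intro power_mono) (auto intro: less_imp_le)

lemma \<phi>_cont: "e \<in> arcs G \<Longrightarrow> n \<le> N \<Longrightarrow> continuous_on {0..\<l> e} (\<phi> n e)"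
  unfolding \<phi>_def
  by (intro continuous_on_diff has_L2_deriv_imp_continuous_on[OF Ihm_deriv(1)]
      has_L2_deriv_imp_continuous_on[OF m_deriv[OF _ \<tau>(1)]])

lemma flux_derivative_bound:
  assumes e: "e \<in> arcs G" and t: "t \<in> {0..T}"
  shows "(\<integral>x. (- a e * \<rho>' t e x)\<^sup>2 \<partial>pipe (\<l> e)) \<le> flux_const \<l> T K ahi \<rho>hi e"
proof -
  have T0: "0 \<in> {0..T}" "T \<in> {0..T}" using params by auto
  have b: "\<bar>\<rho> s e x\<bar> \<le> \<rho>hi" if "x \<in> {0..\<l> e}" "s \<in> {0..T}" for s x
    using range(1)[OF e that(2), of x] that(1) pos by auto
  have "(\<integral>x. (\<rho>' t e x)\<^sup>2 \<partial>pipe (\<l> e)) \<le> 6 * (K * T)\<^sup>2 + 4 * \<l> e * (2 * \<rho>hi / T)\<^sup>2"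
    by (rule regular_edge.time_deriv_bound[OF regular(1)[OF e] b b t]) (use T0 in auto)
  moreover have "(a e)\<^sup>2 \<le> ahi\<^sup>2" using coeffs[OF e] params by (intro power_mono) auto
  ultimately have "(a e)\<^sup>2 * (\<integral>x. (\<rho>' t e x)\<^sup>2 \<partial>pipe (\<l> e)) \<le> flux_const \<l> T K ahi \<rho>hi e"
    unfolding flux_const_def by (intro mult_mono) auto
  then show ?thesis by (simp add: power_mult_distrib)
qed

lemma interpolation_residual:
  assumes e: "e \<in> arcs G" and n: "n \<le> N"
  shows "(\<integral>x. (\<phi> n e x)\<^sup>2 \<partial>pipe (\<l> e)) \<le> (he e)\<^sup>2 * flux_const \<l> T K ahi \<rho>hi e"
proof -
  interpret mesh: uniform_mesh "\<l> e" "M e" by (rule mesh[OF e])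
  have "(\<integral>x. (m (\<tau> n) e x - Ihm n e x)\<^sup>2 \<partial>pipe (\<l> e)) \<le> mesh.h\<^sup>2 * (\<integral>x. (- a e * \<rho>' (\<tau> n) e x)\<^sup>2 \<partial>pipe (\<l> e))"
    by (rule mesh.interp_error[OF m_deriv[OF e \<tau>(1)[OF n]] Ihm_deriv(1)[OF n e, unfolded mesh.proj_def] Ihm_node[OF n e]])
  also have "\<dots> \<le> (he e)\<^sup>2 * flux_const \<l> T K ahi \<rho>hi e"
    unfolding he_def by (intro mult_left_mono flux_derivative_bound[OF e \<tau>(1)[OF n]]) auto
  finally show ?thesis by (simp add: \<phi>_def power2_commute)
qed

text \<open>The increment of \<open>\<phi>\<close> is, up to sign, the interpolation error of the
  increment of \<open>m\<close>. The space derivative of the latter is an increment of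
  \<open>- a e * \<rho>'\<close>, of order \<open>dt\<close> in L2, which cancels the division by
  \<open>dt\<close>.\<close>

lemma interpolation_increment_residual:
  assumes e: "e \<in> arcs G" and n: "1 \<le> n" "n \<le> N"
  shows "(\<integral>x. ((\<phi> n e x - \<phi> (n - 1) e x) / dt)\<^sup>2 \<partial>pipe (\<l> e)) \<le> (he e)\<^sup>2 * (ahi\<^sup>2 * K\<^sup>2)"
proof -
  interpret mesh: uniform_mesh "\<l> e" "M e" by (rule mesh[OF e])
  have n1: "n - 1 \<le> N" using n by simp
  define g where "g k x = - a e * \<rho>' (\<tau> k) e x" for k x
  have u: "has_L2_deriv (\<l> e) (\<lambda>x. m (\<tau> n) e x - m (\<tau> (n - 1)) e x) (\<lambda>x. g n x - g (n - 1) x)"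
    unfolding g_def by (intro has_L2_deriv_diff m_deriv[OF e] \<tau>(1) n(2) n1)
  have "has_L2_deriv (\<l> e) (\<lambda>x. Ihm n e x - Ihm (n - 1) e x) (\<lambda>x. mesh.proj (g n) x - mesh.proj (g (n - 1)) x)"
    unfolding g_def by (intro has_L2_deriv_diff Ihm_deriv(1) n(2) n1 e)
  then have v: "has_L2_deriv (\<l> e) (\<lambda>x. Ihm n e x - Ihm (n - 1) e x) (mesh.step (\<lambda>i. mesh.avg (g n) i - mesh.avg (g (n - 1)) i))"
    by (simp add: mesh.proj_def mesh.step_def[abs_def])
  have "(\<integral>x. ((m (\<tau> n) e x - m (\<tau> (n - 1)) e x) - (Ihm n e x - Ihm (n - 1) e x))\<^sup>2 \<partial>pipe (\<l> e))
      \<le> mesh.h\<^sup>2 * (\<integral>x. (g n x - g (n - 1) x)\<^sup>2 \<partial>pipe (\<l> e))"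
    by (rule mesh.interp_error[OF u v]) (simp only: Ihm_node[OF n(2) e] Ihm_node[OF n1 e])
  also have "(\<lambda>x. ((m (\<tau> n) e x - m (\<tau> (n - 1)) e x) - (Ihm n e x - Ihm (n - 1) e x))\<^sup>2) = (\<lambda>x. (\<phi> n e x - \<phi> (n - 1) e x)\<^sup>2)"
  proof
    fix x
    have "(m (\<tau> n) e x - m (\<tau> (n - 1)) e x) - (Ihm n e x - Ihm (n - 1) e x) = - (\<phi> n e x - \<phi> (n - 1) e x)" by (simp add: \<phi>_def)
    then show "((m (\<tau> n) e x - m (\<tau> (n - 1)) e x) - (Ihm n e x - Ihm (n - 1) e x))\<^sup>2 = (\<phi> n e x - \<phi> (n - 1) e x)\<^sup>2"
      by (simp only: power2_minus)
  qed
  also have "(\<integral>x. (g n x - g (n - 1) x)\<^sup>2 \<partial>pipe (\<l> e)) = (a e)\<^sup>2 * (\<integral>x. (\<rho>' (\<tau> n) e x - \<rho>' (\<tau> (n - 1)) e x)\<^sup>2 \<partial>pipe (\<l> e))"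
  proof -
    have "(g n x - g (n - 1) x)\<^sup>2 = (a e)\<^sup>2 * (\<rho>' (\<tau> n) e x - \<rho>' (\<tau> (n - 1)) e x)\<^sup>2" for x
      by (simp add: g_def power2_eq_square algebra_simps)
    then show ?thesis by simp
  qed
  also have "mesh.h\<^sup>2 * \<dots> \<le> (he e)\<^sup>2 * (ahi\<^sup>2 * (K * dt)\<^sup>2)"
  proof -
    have "(a e)\<^sup>2 \<le> ahi\<^sup>2" using coeffs[OF e] params by (intro power_mono) auto
    moreover have "(\<integral>x. (\<rho>' (\<tau> n) e x - \<rho>' (\<tau> (n - 1)) e x)\<^sup>2 \<partial>pipe (\<l> e)) \<le> (K * dt)\<^sup>2"
      using regular_edge.time_deriv_Lipschitz[OF regular(1)[OF e] \<tau>(1)[OF n1] \<tau>(1)[OF n(2)]] \<tau>(3)[OF n(1)] dt_pos by simp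
    ultimately show ?thesis unfolding he_def by (intro mult_left_mono mult_mono) auto
  qed
  finally have "(\<integral>x. (\<phi> n e x - \<phi> (n - 1) e x)\<^sup>2 \<partial>pipe (\<l> e)) / dt\<^sup>2 \<le> (he e)\<^sup>2 * (ahi\<^sup>2 * (K * dt)\<^sup>2) / dt\<^sup>2"
    by (intro divide_right_mono) auto
  then show ?thesis using dt_pos by (simp add: power_divide power_mult_distrib)
qed

lemma mass_residual:
  assumes e: "e \<in> arcs G" and n: "1 \<le> n" "n \<le> N"
  shows "(\<lambda>x. pr n e x - (\<rho> (\<tau> n) e x - \<rho> (\<tau> (n - 1)) e x) / dt) \<in> Lp 2 (\<l> e)"
    and "(\<integral>x. (pr n e x - (\<rho> (\<tau> n) e x - \<rho> (\<tau> (n - 1)) e x) / dt)\<^sup>2 \<partial>pipe (\<l> e)) \<le> 2 * K\<^sup>2 * (dt\<^sup>2 + (he e)\<^sup>2)"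
proof -
  interpret mesh: uniform_mesh "\<l> e" "M e" by (rule mesh[OF e])
  have n1: "n - 1 \<le> N" using n by simp
  note t = \<tau>(1)[OF n(2)] and s = \<tau>(1)[OF n1]
  define \<delta> where "\<delta> x = \<rho> (\<tau> n) e x - \<rho> (\<tau> (n - 1)) e x" for x
  have \<delta>: "\<delta> \<in> Lp 2 (\<l> e)" unfolding \<delta>_def by (intro Lp2_diff Lp2_continuous cont_rho[OF e] t s)
  define f where "f x = \<rho>' (\<tau> n) e x - \<delta> x / dt" for x
  have f: "f \<in> Lp 2 (\<l> e)" unfolding f_def by (intro Lp2_diff Lp2_divide \<delta> rho'_Lp2[OF e t])
  show L: "(\<lambda>x. pr n e x - (\<rho> (\<tau> n) e x - \<rho> (\<tau> (n - 1)) e x) / dt) \<in> Lp 2 (\<l> e)"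
    using Lp2_diff[OF pr_Lp2[OF e] Lp2_divide[OF \<delta>]] by (simp add: \<delta>_def)
  \<comment> \<open>Linearity of the projection: the residual is the projected consistency error of
    the difference quotient, minus the projection error of that quotient. The first is bounded by
    contraction, the second by \<open>projection_increment\<close>.\<close>
  have eq: "pr n e x - \<delta> x / dt = mesh.proj f x - (\<delta> x - mesh.proj \<delta> x) / dt" for x
  proof -
    have "mesh.proj f x = mesh.proj (\<lambda>x. 1 * \<rho>' (\<tau> n) e x + (- 1 / dt) * \<delta> x) x" by (simp add: f_def[abs_def])
    also have "\<dots> = 1 * mesh.proj (\<rho>' (\<tau> n) e) x + (- 1 / dt) * mesh.proj \<delta> x"
      by (rule mesh.proj_linear) (intro Lp2_integrable \<delta> rho'_Lp2[OF e t])+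
    finally show ?thesis by (simp add: pr_def diff_divide_distrib)
  qed
  have dq: "\<tau> (n - 1) < \<tau> n" using \<tau>(3)[OF n(1)] dt_pos by linarith
  have "(\<integral>x. (mesh.proj f x)\<^sup>2 \<partial>pipe (\<l> e)) \<le> (\<integral>x. (f x)\<^sup>2 \<partial>pipe (\<l> e))" by (rule mesh.proj_contraction[OF f])
  also have "(\<lambda>x. (f x)\<^sup>2) = (\<lambda>x. ((\<rho> (\<tau> n) e x - \<rho> (\<tau> (n - 1)) e x) / dt - \<rho>' (\<tau> n) e x)\<^sup>2)"
    by (simp add: f_def \<delta>_def power2_commute)
  also have "(\<integral>x. ((\<rho> (\<tau> n) e x - \<rho> (\<tau> (n - 1)) e x) / dt - \<rho>' (\<tau> n) e x)\<^sup>2 \<partial>pipe (\<l> e)) \<le> (K * dt)\<^sup>2"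
    using regular_edge.difference_quotient[OF regular(1)[OF e] _ dq] s t \<tau>(3)[OF n(1)] by simp
  finally have 1: "(\<integral>x. (mesh.proj f x)\<^sup>2 \<partial>pipe (\<l> e)) \<le> (K * dt)\<^sup>2" .
  have "(\<integral>x. (\<delta> x - mesh.proj \<delta> x)\<^sup>2 \<partial>pipe (\<l> e)) \<le> (mesh.h * K * dt)\<^sup>2"
    using regular_edge.projection_increment[OF regular(1)[OF e] _ _ _ M[OF e], of "\<tau> (n - 1)" "\<tau> n"] s t dq \<tau>(3)[OF n(1)]
    by (simp add: \<delta>_def[abs_def])
  then have "(\<integral>x. (\<delta> x - mesh.proj \<delta> x)\<^sup>2 \<partial>pipe (\<l> e)) / dt\<^sup>2 \<le> (mesh.h * K * dt)\<^sup>2 / dt\<^sup>2" by (intro divide_right_mono) auto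
  then have 2: "(\<integral>x. ((\<delta> x - mesh.proj \<delta> x) / dt)\<^sup>2 \<partial>pipe (\<l> e)) \<le> (he e * K)\<^sup>2"
    using dt_pos by (simp add: power_divide power_mult_distrib he_def)
  have i: "integrable (pipe (\<l> e)) (\<lambda>x. (mesh.proj f x)\<^sup>2)" "integrable (pipe (\<l> e)) (\<lambda>x. ((\<delta> x - mesh.proj \<delta> x) / dt)\<^sup>2)"
    by (intro Lp2_square mesh.proj_Lp2) (intro Lp2_square Lp2_divide Lp2_diff \<delta> mesh.proj_Lp2)
  have "(\<integral>x. (pr n e x - \<delta> x / dt)\<^sup>2 \<partial>pipe (\<l> e)) \<le> (\<integral>x. 2 * (mesh.proj f x)\<^sup>2 + 2 * ((\<delta> x - mesh.proj \<delta> x) / dt)\<^sup>2 \<partial>pipe (\<l> e))"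
  proof (rule integral_mono)
    show "integrable (pipe (\<l> e)) (\<lambda>x. (pr n e x - \<delta> x / dt)\<^sup>2)" using Lp2_square[OF L] by (simp add: \<delta>_def)
    show "(pr n e x - \<delta> x / dt)\<^sup>2 \<le> 2 * (mesh.proj f x)\<^sup>2 + 2 * ((\<delta> x - mesh.proj \<delta> x) / dt)\<^sup>2" for x
      unfolding eq using square_sum_le(1)[of "mesh.proj f x" "- ((\<delta> x - mesh.proj \<delta> x) / dt)"] by simp
  qed (use i in auto)
  also have "\<dots> = 2 * (\<integral>x. (mesh.proj f x)\<^sup>2 \<partial>pipe (\<l> e)) + 2 * (\<integral>x. ((\<delta> x - mesh.proj \<delta> x) / dt)\<^sup>2 \<partial>pipe (\<l> e))"
    using i by simp
  also have "\<dots> \<le> 2 * (K * dt)\<^sup>2 + 2 * (he e * K)\<^sup>2" using 1 2 by simp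
  also have "\<dots> = 2 * K\<^sup>2 * (dt\<^sup>2 + (he e)\<^sup>2)" by (simp add: power_mult_distrib algebra_simps)
  finally show "(\<integral>x. (pr n e x - (\<rho> (\<tau> n) e x - \<rho> (\<tau> (n - 1)) e x) / dt)\<^sup>2 \<partial>pipe (\<l> e)) \<le> 2 * K\<^sup>2 * (dt\<^sup>2 + (he e)\<^sup>2)"
    by (simp add: \<delta>_def)
qed

lemma momentum_residual:
  assumes e: "e \<in> arcs G" and n: "1 \<le> n" "n \<le> N"
  shows "(\<lambda>x. w' (\<tau> n) e x - (w (\<tau> n) e x - w (\<tau> (n - 1)) e x) / dt) \<in> Lp 2 (\<l> e)"
    and "(\<integral>x. (w' (\<tau> n) e x - (w (\<tau> n) e x - w (\<tau> (n - 1)) e x) / dt)\<^sup>2 \<partial>pipe (\<l> e)) \<le> K\<^sup>2 * dt\<^sup>2"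
proof -
  have n1: "n - 1 \<le> N" using n by simp
  note t = \<tau>(1)[OF n(2)] and s = \<tau>(1)[OF n1]
  show "(\<lambda>x. w' (\<tau> n) e x - (w (\<tau> n) e x - w (\<tau> (n - 1)) e x) / dt) \<in> Lp 2 (\<l> e)"
    by (intro Lp2_diff Lp2_divide Lp2_continuous cont_w[OF e] t s w'_Lp2[OF e t])
  have dq: "\<tau> (n - 1) < \<tau> n" using \<tau>(3)[OF n(1)] dt_pos by linarith
  have "(\<integral>x. ((w (\<tau> n) e x - w (\<tau> (n - 1)) e x) / dt - w' (\<tau> n) e x)\<^sup>2 \<partial>pipe (\<l> e)) \<le> (K * dt)\<^sup>2"
    using regular_edge.difference_quotient[OF regular(2)[OF e] _ dq] s t \<tau>(3)[OF n(1)] by simp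
  then show "(\<integral>x. (w' (\<tau> n) e x - (w (\<tau> n) e x - w (\<tau> (n - 1)) e x) / dt)\<^sup>2 \<partial>pipe (\<l> e)) \<le> K\<^sup>2 * dt\<^sup>2"
    by (simp add: power2_commute power_mult_distrib)
qed

lemma increment_term_nonneg: "e \<in> arcs G \<Longrightarrow> 0 \<le> sqrt (2 / \<l> e + 2 * \<l> e) * K"
  using network(3)[of e] params(2) by simp

lemma increments:
  assumes e: "e \<in> arcs G" and n: "1 \<le> n" "n \<le> N"
  shows "AE x in pipe (\<l> e). \<bar>\<rho> (\<tau> n) e x - \<rho> (\<tau> (n - 1)) e x\<bar> \<le> increment_const G \<l> K * dt \<and>
    \<bar>w (\<tau> n) e x - w (\<tau> (n - 1)) e x\<bar> \<le> increment_const G \<l> K * dt"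
proof -
  have n1: "n - 1 \<le> N" using n by simp
  note t = \<tau>(1)[OF n(2)] and s = \<tau>(1)[OF n1]
  have le: "sqrt (2 / \<l> e + 2 * \<l> e) * K * dt \<le> increment_const G \<l> K * dt"
    unfolding increment_const_def using e fin_arcs dt_pos increment_term_nonneg
    by (intro mult_right_mono member_le_sum[of e "arcs G" "\<lambda>e. sqrt (2 / \<l> e + 2 * \<l> e) * K"]) simp_all
  have st: "0 \<le> \<tau> (n - 1)" "\<tau> (n - 1) \<le> \<tau> n" "\<tau> n \<le> T" using s t \<tau>(3)[OF n(1)] dt_pos by auto
  have "AE x in pipe (\<l> e). \<bar>\<rho> (\<tau> n) e x - \<rho> (\<tau> (n - 1)) e x\<bar> \<le> sqrt (2 / \<l> e + 2 * \<l> e) * K * dt"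
    "AE x in pipe (\<l> e). \<bar>w (\<tau> n) e x - w (\<tau> (n - 1)) e x\<bar> \<le> sqrt (2 / \<l> e + 2 * \<l> e) * K * dt"
    using regular_edge.increment_bound[OF regular(1)[OF e] st] regular_edge.increment_bound[OF regular(2)[OF e] st]
    unfolding regular_edge.sup_const_def[OF regular(1)[OF e]] regular_edge.sup_const_def[OF regular(2)[OF e]] \<tau>(3)[OF n(1)]
    by simp_all
  then show ?thesis by eventually_elim (use le in linarith)
qed

section \<open>The energy balance on one pipe\<close>

definition energy_at :: "nat \<Rightarrow> 'e netfun" where
  "energy_at n e = energy \<epsilon> (a e) (\<rho> (\<tau> n) e) (w (\<tau> n) e) (\<rho>h n e) (wh n e) (\<phi> n e)"

definition error_at :: "nat \<Rightarrow> 'e netfun" where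
  "error_at n e x = (\<rho>h n e x - \<rho> (\<tau> n) e x)\<^sup>2 + \<epsilon>\<^sup>2 * (wh n e x - w (\<tau> n) e x)\<^sup>2"

definition flux_error_at :: "nat \<Rightarrow> 'e netfun" where "flux_error_at n e x = \<bar>m (\<tau> n) e x - mh n e x\<bar> ^ 3"

lemma ess_bounded_exact:
  assumes e: "e \<in> arcs G" and n: "n \<le> N"
  shows "ess_bounded (\<l> e) (\<rho> (\<tau> n) e)" "ess_bounded (\<l> e) (w (\<tau> n) e)" "ess_bounded (\<l> e) (m (\<tau> n) e)"
    "ess_bounded (\<l> e) (mh n e)" "ess_bounded (\<l> e) (\<phi> n e)" "ess_bounded (\<l> e) (\<rho>h n e)"
  using ess_bounded_rhoh[OF n e, of "\<lambda>r. r"]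
  by (auto intro!: ess_bounded_continuous cont_rho[OF e] cont_w[OF e] \<tau>(1)[OF n] cont_mh[OF n e] \<phi>_cont[OF e n]
      has_L2_deriv_imp_continuous_on[OF m_deriv[OF e \<tau>(1)[OF n]]])

lemma integrable_densities:
  assumes e: "e \<in> arcs G" and n: "n \<le> N"
  shows "integrable (pipe (\<l> e)) (energy_at n e)" "integrable (pipe (\<l> e)) (error_at n e)" "integrable (pipe (\<l> e)) (flux_error_at n e)"
    "integrable (pipe (\<l> e)) (\<lambda>x. (\<phi> n e x)\<^sup>2)"
proof -
  note b = ess_bounded_exact[OF e n] ess_bounded_wh[OF n e] ess_bounded_rhoh[OF n e, of P]
  have "continuous_on {\<rho>lo..\<rho>hi} P"
  proof (rule continuous_at_imp_continuous_on, rule ballI)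
    fix q assume "q \<in> {\<rho>lo..\<rho>hi}"
    then have "0 < q" using pos by auto
    then show "isCont P q" by (rule DERIV_isCont[OF dP])
  qed
  then have "continuous_on {0..\<l> e} (\<lambda>x. P (\<rho> (\<tau> n) e x))"
    by (rule continuous_on_compose2[OF _ cont_rho[OF e \<tau>(1)[OF n]]]) (use range(1)[OF e \<tau>(1)[OF n]] in auto)
  note bP = ess_bounded_continuous[OF this] ess_bounded_\<eta>[OF e \<tau>(1)[OF n]]
  show "integrable (pipe (\<l> e)) (energy_at n e)"
    unfolding energy_at_def energy_def[abs_def] rel_energy_def U_def
    by (intro ess_bounded_integrable ess_bounded_diff ess_bounded_add ess_bounded_mult ess_bounded_power ess_bounded_const b bP)
  show "integrable (pipe (\<l> e)) (error_at n e)"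
    unfolding error_at_def
    by (intro ess_bounded_integrable ess_bounded_diff ess_bounded_add ess_bounded_mult ess_bounded_power ess_bounded_const b)
  show "integrable (pipe (\<l> e)) (flux_error_at n e)"
    unfolding flux_error_at_def
    by (intro ess_bounded_integrable ess_bounded_diff ess_bounded_abs ess_bounded_power b)
  show "integrable (pipe (\<l> e)) (\<lambda>x. (\<phi> n e x)\<^sup>2)" by (intro ess_bounded_integrable ess_bounded_power b)
qed

lemma AE_inner: "AE x in pipe (\<l> e). 0 \<le> x \<and> x \<le> \<l> e"
  by (rule AE_I2) auto

text \<open>The pointwise inequalities are combined and integrated. The momentum defect is left
  unestimated, because it cancels only in the sum over the network.\<close>

lemma edge_energy_step:
  assumes sb: "dissipation alo ahi \<gamma>lo \<gamma>hi C c" and C: "0 \<le> C" and small: "increment_const G \<l> K * dt \<le> \<kappa>"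
    and e: "e \<in> arcs G" and n: "1 \<le> n" "n \<le> N"
  shows "(\<integral>x. energy_at n e x \<partial>pipe (\<l> e)) - (\<integral>x. energy_at (n - 1) e x \<partial>pipe (\<l> e)) + dt * (c * (\<integral>x. flux_error_at n e x \<partial>pipe (\<l> e)))
    \<le> dt * (\<integral>x. momentum_defect n e x \<partial>pipe (\<l> e)) + dt * ((C + ahi * (L + \<epsilon>bar\<^sup>2 + 1) * increment_const G \<l> K) *
       ((\<integral>x. error_at n e x \<partial>pipe (\<l> e)) + (\<integral>x. error_at (n - 1) e x \<partial>pipe (\<l> e))
        + (flux_const \<l> T K ahi \<rho>hi e + ahi\<^sup>2 * K\<^sup>2 + 3 * K\<^sup>2) * (dt\<^sup>2 + hm\<^sup>2)))"
proof -
  have n1: "n - 1 \<le> N" using n by simp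
  define B where "B = increment_const G \<l> K"
  have B0: "0 \<le> B" unfolding B_def increment_const_def by (intro sum_nonneg increment_term_nonneg)
  define J where "J = ahi * (L + \<epsilon>bar\<^sup>2 + 1) * B"
  have J0: "0 \<le> J" unfolding J_def using params pos B0 by (intro mult_nonneg_nonneg) auto
  define \<psi> \<zeta> \<theta> where "\<psi> x = (\<phi> n e x - \<phi> (n - 1) e x) / dt"
    and "\<zeta> x = pr n e x - (\<rho> (\<tau> n) e x - \<rho> (\<tau> (n - 1)) e x) / dt"
    and "\<theta> x = w' (\<tau> n) e x - (w (\<tau> n) e x - w (\<tau> (n - 1)) e x) / dt" for x
  have i\<psi>: "integrable (pipe (\<l> e)) (\<lambda>x. (\<psi> x)\<^sup>2)" unfolding \<psi>_def
    by (intro ess_bounded_integrable ess_bounded_power ess_bounded_divide ess_bounded_diff ess_bounded_exact(5)[OF e n(2)] ess_bounded_exact(5)[OF e n1])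
  have i\<zeta>: "integrable (pipe (\<l> e)) (\<lambda>x. (\<zeta> x)\<^sup>2)" unfolding \<zeta>_def by (rule Lp2_square[OF mass_residual(1)[OF e n]])
  have i\<theta>: "integrable (pipe (\<l> e)) (\<lambda>x. (\<theta> x)\<^sup>2)" unfolding \<theta>_def by (rule Lp2_square[OF momentum_residual(1)[OF e n]])
  note I = integrable_densities[OF e n(2)] integrable_densities[OF e n1] momentum_error(1)[OF n e] i\<psi> i\<zeta> i\<theta>
  \<comment> \<open>Everything apart from the momentum defect and the dissipation. Both error levels
    carry the sum of the two constants, which costs nothing as all terms are nonnegative.\<close>
  define F where "F x = (C + J) * (error_at n e x + error_at (n - 1) e x + ((\<phi> n e x)\<^sup>2 + (\<psi> x)\<^sup>2 + (\<zeta> x)\<^sup>2 + (\<theta> x)\<^sup>2))" for x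
  have ae: "AE x in pipe (\<l> e). energy_at n e x - energy_at (n - 1) e x + dt * (c * flux_error_at n e x) \<le> dt * momentum_defect n e x + dt * F x"
    using admissible_AE[OF n(2) e] admissible_AE[OF n1 e] increments[OF e n] AE_inner[of e]
  proof eventually_elim
    case (elim x)
    have r0: "\<rho> (\<tau> (n - 1)) e x \<in> {\<rho>lo..\<rho>hi}" and w0: "\<bar>w (\<tau> (n - 1)) e x\<bar> \<le> wbar"
      and r1: "\<rho> (\<tau> n) e x \<in> {\<rho>lo..\<rho>hi}" and w1: "\<bar>w (\<tau> n) e x\<bar> \<le> wbar"
      using range[OF e \<tau>(1)[OF n(2)]] range[OF e \<tau>(1)[OF n1]] elim by auto
    have z: "r n e x = a e * \<rho>h n e x * wh n e x - a e * \<rho> (\<tau> n) e x * w (\<tau> n) e x - \<phi> n e x"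
      using elim by (simp add: r_def \<phi>_def m_eq)
    have q: "a e * \<rho>h n e x * wh n e x - a e * \<rho> (\<tau> n) e x * w (\<tau> n) e x = - (m (\<tau> n) e x - mh n e x)"
      using elim by (simp add: m_eq)
    have ab: "0 < a e" "a e \<le> ahi" using coeffs[OF e] params by auto
    have "energy_at n e x - energy_at (n - 1) e x
      \<le> dt * (\<epsilon>\<^sup>2 * ((wh n e x - wh (n - 1) e x) / dt - w' (\<tau> n) e x) * r n e x
          - (enth \<epsilon> (\<rho>h n e x) (wh n e x) - enth \<epsilon> (\<rho> (\<tau> n) e x) (w (\<tau> n) e x)) * r' n e x)
        + dt * (a e * (enth \<epsilon> (\<rho>h n e x) (wh n e x) - enth \<epsilon> (\<rho> (\<tau> n) e x) (w (\<tau> n) e x)) * (pr n e x - (\<rho> (\<tau> n) e x - \<rho> (\<tau> (n - 1)) e x) / dt)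
          + \<epsilon>\<^sup>2 * (w' (\<tau> n) e x - (w (\<tau> n) e x - w (\<tau> (n - 1)) e x) / dt) * r n e x
          - \<epsilon>\<^sup>2 * ((\<phi> n e x - \<phi> (n - 1) e x) / dt) * (wh (n - 1) e x - w (\<tau> (n - 1)) e x))
        + dt * (ahi * (L + \<epsilon>bar\<^sup>2 + 1) * B * ((\<rho>h (n - 1) e x - \<rho> (\<tau> (n - 1)) e x)\<^sup>2 + \<epsilon>\<^sup>2 * (wh (n - 1) e x - w (\<tau> (n - 1)) e x)\<^sup>2))"
      unfolding energy_at_def
      by (rule energy_increment[where ?r0.0 = "\<rho> (\<tau> (n - 1)) e" and ?r1.0 = "\<rho> (\<tau> n) e" and ?R0.0 = "\<rho>h (n - 1) e"
            and ?R1.0 = "\<rho>h n e" and ?W0.0 = "wh (n - 1) e" and ?W1.0 = "wh n e" and ?w0.0 = "w (\<tau> (n - 1)) e"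
            and ?w1.0 = "w (\<tau> n) e" and ?\<phi>0.0 = "\<phi> (n - 1) e" and ?\<phi>1.0 = "\<phi> n e" and x = x and B = B,
            OF r0 r1 _ _ _ _ _ _ _ params(7,8) ab dt_pos z])
        (use elim small in \<open>auto simp: B_def r'_def\<close>)
    then have 1: "energy_at n e x - energy_at (n - 1) e x
      \<le> dt * (\<epsilon>\<^sup>2 * ((wh n e x - wh (n - 1) e x) / dt - w' (\<tau> n) e x) * r n e x - enthalpy_error n e x * r' n e x)
        + dt * (a e * enthalpy_error n e x * \<zeta> x + \<epsilon>\<^sup>2 * \<theta> x * r n e x - \<epsilon>\<^sup>2 * \<psi> x * (wh (n - 1) e x - w (\<tau> (n - 1)) e x))
        + dt * (J * error_at (n - 1) e x)"
      by (simp only: enthalpy_error_def \<zeta>_def \<theta>_def \<psi>_def J_def error_at_def)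
    have "a e * enthalpy_error n e x * \<zeta> x + \<epsilon>\<^sup>2 * \<theta> x * r n e x - \<gamma> e * friction_error n e x * r n e x
        - \<epsilon>\<^sup>2 * \<psi> x * (wh (n - 1) e x - w (\<tau> (n - 1)) e x)
      \<le> C * ((\<rho>h n e x - \<rho> (\<tau> n) e x)\<^sup>2 + \<epsilon>\<^sup>2 * (wh n e x - w (\<tau> n) e x)\<^sup>2 + \<epsilon>\<^sup>2 * (wh (n - 1) e x - w (\<tau> (n - 1)) e x)\<^sup>2
          + (\<phi> n e x)\<^sup>2 + (\<psi> x)\<^sup>2 + (\<zeta> x)\<^sup>2 + (\<theta> x)\<^sup>2)
        - c * \<bar>a e * \<rho>h n e x * wh n e x - a e * \<rho> (\<tau> n) e x * w (\<tau> n) e x\<bar> ^ 3"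
      unfolding z enthalpy_error_def friction_error_def
      using sb[unfolded dissipation_def, rule_format, of \<epsilon> "a e" "\<gamma> e" "\<rho> (\<tau> n) e x" "w (\<tau> n) e x" "\<rho>h n e x" "wh n e x"]
        params coeffs[OF e] r1 w1 elim by blast
    also have "\<bar>a e * \<rho>h n e x * wh n e x - a e * \<rho> (\<tau> n) e x * w (\<tau> n) e x\<bar> ^ 3 = flux_error_at n e x"
      unfolding q flux_error_at_def abs_minus_cancel by (rule refl)
    also have "C * ((\<rho>h n e x - \<rho> (\<tau> n) e x)\<^sup>2 + \<epsilon>\<^sup>2 * (wh n e x - w (\<tau> n) e x)\<^sup>2 + \<epsilon>\<^sup>2 * (wh (n - 1) e x - w (\<tau> (n - 1)) e x)\<^sup>2
          + (\<phi> n e x)\<^sup>2 + (\<psi> x)\<^sup>2 + (\<zeta> x)\<^sup>2 + (\<theta> x)\<^sup>2)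
        \<le> C * (error_at n e x + error_at (n - 1) e x + ((\<phi> n e x)\<^sup>2 + (\<psi> x)\<^sup>2 + (\<zeta> x)\<^sup>2 + (\<theta> x)\<^sup>2))"
      by (rule mult_left_mono[OF _ C]) (simp add: error_at_def)
    finally have 2: "a e * enthalpy_error n e x * \<zeta> x + \<epsilon>\<^sup>2 * \<theta> x * r n e x - \<gamma> e * friction_error n e x * r n e x
        - \<epsilon>\<^sup>2 * \<psi> x * (wh (n - 1) e x - w (\<tau> (n - 1)) e x)
      \<le> C * (error_at n e x + error_at (n - 1) e x + ((\<phi> n e x)\<^sup>2 + (\<psi> x)\<^sup>2 + (\<zeta> x)\<^sup>2 + (\<theta> x)\<^sup>2)) - c * flux_error_at n e x" by simp
    have 3: "J * error_at (n - 1) e x \<le> J * (error_at n e x + error_at (n - 1) e x + ((\<phi> n e x)\<^sup>2 + (\<psi> x)\<^sup>2 + (\<zeta> x)\<^sup>2 + (\<theta> x)\<^sup>2))"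
      by (rule mult_left_mono[OF _ J0]) (simp add: error_at_def)
    have "energy_at n e x - energy_at (n - 1) e x
      \<le> dt * (\<epsilon>\<^sup>2 * ((wh n e x - wh (n - 1) e x) / dt - w' (\<tau> n) e x) * r n e x - enthalpy_error n e x * r' n e x
        + (a e * enthalpy_error n e x * \<zeta> x + \<epsilon>\<^sup>2 * \<theta> x * r n e x - \<epsilon>\<^sup>2 * \<psi> x * (wh (n - 1) e x - w (\<tau> (n - 1)) e x))
        + J * error_at (n - 1) e x)"
      using 1 unfolding distrib_left[of dt] by linarith
    \<comment> \<open>The friction term is added and subtracted: with it the tested terms form the
      momentum defect, without it the remainder is the left-hand side of the dissipation
      inequality.\<close>
    also have "\<dots> \<le> dt * (momentum_defect n e x + F x - c * flux_error_at n e x)"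
      using 2 3 dt_pos by (intro mult_left_mono) (auto simp: momentum_defect_def F_def distrib_right)
    finally show ?case by (simp add: algebra_simps)
  qed
  have iF: "integrable (pipe (\<l> e)) F" unfolding F_def using I by simp
  have "(\<integral>x. energy_at n e x - energy_at (n - 1) e x + dt * (c * flux_error_at n e x) \<partial>pipe (\<l> e)) \<le> (\<integral>x. dt * momentum_defect n e x + dt * F x \<partial>pipe (\<l> e))"
    using I iF by (intro integral_mono_AE ae) simp_all
  moreover have "(\<integral>x. energy_at n e x - energy_at (n - 1) e x + dt * (c * flux_error_at n e x) \<partial>pipe (\<l> e))
    = (\<integral>x. energy_at n e x \<partial>pipe (\<l> e)) - (\<integral>x. energy_at (n - 1) e x \<partial>pipe (\<l> e)) + dt * (c * (\<integral>x. flux_error_at n e x \<partial>pipe (\<l> e)))"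
    using I by simp
  moreover have "(\<integral>x. dt * momentum_defect n e x + dt * F x \<partial>pipe (\<l> e)) = dt * (\<integral>x. momentum_defect n e x \<partial>pipe (\<l> e)) + dt * (\<integral>x. F x \<partial>pipe (\<l> e))"
    using I iF by simp
  moreover have iFeq: "(\<integral>x. F x \<partial>pipe (\<l> e)) = (C + J) * ((\<integral>x. error_at n e x \<partial>pipe (\<l> e)) + (\<integral>x. error_at (n - 1) e x \<partial>pipe (\<l> e))
     + ((\<integral>x. (\<phi> n e x)\<^sup>2 \<partial>pipe (\<l> e)) + (\<integral>x. (\<psi> x)\<^sup>2 \<partial>pipe (\<l> e)) + (\<integral>x. (\<zeta> x)\<^sup>2 \<partial>pipe (\<l> e)) + (\<integral>x. (\<theta> x)\<^sup>2 \<partial>pipe (\<l> e))))"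
    unfolding F_def using I by simp
  have "(\<integral>x. (\<phi> n e x)\<^sup>2 \<partial>pipe (\<l> e)) + (\<integral>x. (\<psi> x)\<^sup>2 \<partial>pipe (\<l> e)) + (\<integral>x. (\<zeta> x)\<^sup>2 \<partial>pipe (\<l> e)) + (\<integral>x. (\<theta> x)\<^sup>2 \<partial>pipe (\<l> e))
     \<le> (flux_const \<l> T K ahi \<rho>hi e + ahi\<^sup>2 * K\<^sup>2 + 3 * K\<^sup>2) * (dt\<^sup>2 + hm\<^sup>2)"
  proof -
    define D where "D = dt\<^sup>2 + hm\<^sup>2"
    have D: "(he e)\<^sup>2 \<le> D" "dt\<^sup>2 \<le> D" "dt\<^sup>2 + (he e)\<^sup>2 \<le> D" 
      using he_square[OF e] zero_le_power2[of dt] zero_le_power2[of hm] unfolding D_def by linarith+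
    have f0: "0 \<le> flux_const \<l> T K ahi \<rho>hi e" unfolding flux_const_def using network(3)[OF e] by simp
    have "(\<integral>x. (\<phi> n e x)\<^sup>2 \<partial>pipe (\<l> e)) \<le> flux_const \<l> T K ahi \<rho>hi e * D"
      using interpolation_residual[OF e n(2)] mult_right_mono[OF D(1) f0] by (simp add: mult.commute)
    moreover have "(\<integral>x. (\<psi> x)\<^sup>2 \<partial>pipe (\<l> e)) \<le> ahi\<^sup>2 * K\<^sup>2 * D"
      using interpolation_increment_residual[OF e n] mult_right_mono[OF D(1), of "ahi\<^sup>2 * K\<^sup>2"] by (simp add: \<psi>_def mult_ac)
    moreover have "(\<integral>x. (\<zeta> x)\<^sup>2 \<partial>pipe (\<l> e)) \<le> 2 * K\<^sup>2 * D"
      using mass_residual(2)[OF e n] mult_left_mono[OF D(3), of "2 * K\<^sup>2"] by (simp add: \<zeta>_def)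
    moreover have "(\<integral>x. (\<theta> x)\<^sup>2 \<partial>pipe (\<l> e)) \<le> K\<^sup>2 * D"
      using momentum_residual(2)[OF e n] mult_left_mono[OF D(2), of "K\<^sup>2"] by (simp add: \<theta>_def)
    moreover have "(flux_const \<l> T K ahi \<rho>hi e + ahi\<^sup>2 * K\<^sup>2 + 3 * K\<^sup>2) * D
      = flux_const \<l> T K ahi \<rho>hi e * D + ahi\<^sup>2 * K\<^sup>2 * D + 2 * K\<^sup>2 * D + K\<^sup>2 * D" by (simp add: algebra_simps)
    ultimately show ?thesis unfolding D_def[symmetric] by linarith
  qed
  then have fin: "(C + J) * ((\<integral>x. error_at n e x \<partial>pipe (\<l> e)) + (\<integral>x. error_at (n - 1) e x \<partial>pipe (\<l> e))
     + ((\<integral>x. (\<phi> n e x)\<^sup>2 \<partial>pipe (\<l> e)) + (\<integral>x. (\<psi> x)\<^sup>2 \<partial>pipe (\<l> e)) + (\<integral>x. (\<zeta> x)\<^sup>2 \<partial>pipe (\<l> e)) + (\<integral>x. (\<theta> x)\<^sup>2 \<partial>pipe (\<l> e))))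
    \<le> (C + J) * ((\<integral>x. error_at n e x \<partial>pipe (\<l> e)) + (\<integral>x. error_at (n - 1) e x \<partial>pipe (\<l> e))
     + (flux_const \<l> T K ahi \<rho>hi e + ahi\<^sup>2 * K\<^sup>2 + 3 * K\<^sup>2) * (dt\<^sup>2 + hm\<^sup>2))"
    using C J0 by (intro mult_left_mono) auto
  moreover note mult_left_mono[OF fin[folded iFeq] less_imp_le[OF dt_pos]]
  ultimately show ?thesis unfolding J_def[symmetric] B_def[symmetric] by linarith
qed

section \<open>Summation over the network\<close>

lemma flux_const_nonneg: "e \<in> arcs G \<Longrightarrow> 0 \<le> flux_const \<l> T K ahi \<rho>hi e"
  unfolding flux_const_def using network(3)[of e] by simp

lemma residual_const_nonneg: "0 \<le> residual_const G \<l> T K ahi \<rho>hi"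
  unfolding residual_const_def using flux_const_nonneg by (intro sum_nonneg add_nonneg_nonneg) auto

lemma increment_const_nonneg: "0 \<le> increment_const G \<l> K"
  unfolding increment_const_def by (intro sum_nonneg increment_term_nonneg)

definition error_sum :: "nat \<Rightarrow> real" where "error_sum n = (\<Sum>e\<in>arcs G. \<integral>x. error_at n e x \<partial>pipe (\<l> e))"

definition energy_sum :: "nat \<Rightarrow> real" where "energy_sum n = (\<Sum>e\<in>arcs G. \<integral>x. energy_at n e x \<partial>pipe (\<l> e))"

definition flux_error_sum :: "nat \<Rightarrow> real" where "flux_error_sum n = (\<Sum>e\<in>arcs G. \<integral>x. flux_error_at n e x \<partial>pipe (\<l> e))"

definition mesh_error :: real where "mesh_error = dt\<^sup>2 + hm\<^sup>2"

lemma mesh_error_nonneg: "0 \<le> mesh_error" by (simp add: mesh_error_def)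

lemma he_square_mesh_error: "e \<in> arcs G \<Longrightarrow> (he e)\<^sup>2 \<le> mesh_error"
  using he_square[of e] zero_le_power2[of dt] unfolding mesh_error_def by linarith

lemma error_sum_nonneg: "0 \<le> error_sum n" unfolding error_sum_def by (intro sum_nonneg integral_nonneg_AE) (auto simp: error_at_def)

lemma flux_error_sum_nonneg: "0 \<le> flux_error_sum n" unfolding flux_error_sum_def by (intro sum_nonneg integral_nonneg_AE) (auto simp: flux_error_at_def)

lemma energy_step:
  assumes sb: "dissipation alo ahi \<gamma>lo \<gamma>hi C c" and C: "0 \<le> C" and small: "increment_const G \<l> K * dt \<le> \<kappa>"
    and n: "1 \<le> n" "n \<le> N"
  shows "energy_sum n - energy_sum (n - 1) + dt * (c * flux_error_sum n)
    \<le> dt * ((C + ahi * (L + \<epsilon>bar\<^sup>2 + 1) * increment_const G \<l> K) * (error_sum n + error_sum (n - 1) + residual_const G \<l> T K ahi \<rho>hi * mesh_error))"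
proof -
  define J where "J = C + ahi * (L + \<epsilon>bar\<^sup>2 + 1) * increment_const G \<l> K"
  have sum: "(\<Sum>e\<in>arcs G. dt * f1 e + dt * (J * (f2 e + f3 e + f4 e * mesh_error)))
    = dt * (\<Sum>e\<in>arcs G. f1 e) + dt * (J * ((\<Sum>e\<in>arcs G. f2 e) + (\<Sum>e\<in>arcs G. f3 e) + (\<Sum>e\<in>arcs G. f4 e) * mesh_error))"
    for f1 f2 f3 f4 :: "'e \<Rightarrow> real"
    by (simp only: sum.distrib sum_distrib_left[symmetric] sum_distrib_right[symmetric])
  have "energy_sum n - energy_sum (n - 1) + dt * (c * flux_error_sum n)
    = (\<Sum>e\<in>arcs G. (\<integral>x. energy_at n e x \<partial>pipe (\<l> e)) - (\<integral>x. energy_at (n - 1) e x \<partial>pipe (\<l> e)) + dt * (c * (\<integral>x. flux_error_at n e x \<partial>pipe (\<l> e))))"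
    by (simp add: energy_sum_def flux_error_sum_def sum_subtractf sum.distrib sum_distrib_left)
  also have "\<dots> \<le> (\<Sum>e\<in>arcs G. dt * (\<integral>x. momentum_defect n e x \<partial>pipe (\<l> e)) + dt * (J *
       ((\<integral>x. error_at n e x \<partial>pipe (\<l> e)) + (\<integral>x. error_at (n - 1) e x \<partial>pipe (\<l> e))
        + (flux_const \<l> T K ahi \<rho>hi e + ahi\<^sup>2 * K\<^sup>2 + 3 * K\<^sup>2) * (dt\<^sup>2 + hm\<^sup>2))))"
    unfolding J_def by (intro sum_mono edge_energy_step[OF sb C small _ n])
  also have "\<dots> = dt * (\<Sum>e\<in>arcs G. \<integral>x. momentum_defect n e x \<partial>pipe (\<l> e)) + dt * (J * (error_sum n + error_sum (n - 1) + residual_const G \<l> T K ahi \<rho>hi * mesh_error))"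
    unfolding error_sum_def residual_const_def mesh_error_def[symmetric] by (rule sum)
  also have "\<dots> = dt * (J * (error_sum n + error_sum (n - 1) + residual_const G \<l> T K ahi \<rho>hi * mesh_error))" using momentum_error(2)[OF n] by simp
  finally show ?thesis by (simp only: J_def)
qed

lemma sum_\<phi>_bound:
  assumes n: "n \<le> N"
  shows "(\<Sum>e\<in>arcs G. \<integral>x. (\<phi> n e x)\<^sup>2 \<partial>pipe (\<l> e)) \<le> residual_const G \<l> T K ahi \<rho>hi * mesh_error"
  unfolding residual_const_def sum_distrib_right
proof (rule sum_mono)
  fix e assume e: "e \<in> arcs G"
  have "(\<integral>x. (\<phi> n e x)\<^sup>2 \<partial>pipe (\<l> e)) \<le> (he e)\<^sup>2 * flux_const \<l> T K ahi \<rho>hi e" by (rule interpolation_residual[OF e n])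
  also have "\<dots> \<le> mesh_error * (flux_const \<l> T K ahi \<rho>hi e + ahi\<^sup>2 * K\<^sup>2 + 3 * K\<^sup>2)"
    using he_square_mesh_error[OF e] flux_const_nonneg[OF e] by (intro mult_mono) (auto simp: mesh_error_def add_nonneg_nonneg intro: order_trans)
  finally show "(\<integral>x. (\<phi> n e x)\<^sup>2 \<partial>pipe (\<l> e)) \<le> (flux_const \<l> T K ahi \<rho>hi e + ahi\<^sup>2 * K\<^sup>2 + 3 * K\<^sup>2) * mesh_error"
    by (simp only: mult.commute)
qed

lemma energy_estimates:
  assumes n: "n \<le> N"
  shows "alo * c0 / 2 * error_sum n - \<epsilon>bar\<^sup>2 / (2 * alo * c0) * (residual_const G \<l> T K ahi \<rho>hi * mesh_error) \<le> energy_sum n"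
    and "energy_sum n \<le> (ahi * C0 + 1) * error_sum n + \<epsilon>bar\<^sup>2 * (residual_const G \<l> T K ahi \<rho>hi * mesh_error)"
proof -
  define k where "k = \<epsilon>bar\<^sup>2 / (2 * alo * c0)"
  have k: "0 \<le> k" unfolding k_def using params c0_pos by simp
  define \<Phi> where "\<Phi> = (\<Sum>e\<in>arcs G. \<integral>x. (\<phi> n e x)\<^sup>2 \<partial>pipe (\<l> e))"
  have \<Phi>: "\<Phi> \<le> residual_const G \<l> T K ahi \<rho>hi * mesh_error" unfolding \<Phi>_def by (rule sum_\<phi>_bound[OF n])
  have ae: "AE x in pipe (\<l> e). alo * c0 / 2 * error_at n e x - k * (\<phi> n e x)\<^sup>2 \<le> energy_at n e x \<and>
      energy_at n e x \<le> (ahi * C0 + 1) * error_at n e x + \<epsilon>bar\<^sup>2 * (\<phi> n e x)\<^sup>2" if e: "e \<in> arcs G" for e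
    using admissible_AE[OF n e] AE_inner[of e]
  proof eventually_elim
    case (elim x)
    note b = range[OF e \<tau>(1)[OF n], of x]
    show ?case
      unfolding energy_at_def error_at_def k_def
      using energy_bounds[where r = "\<rho> (\<tau> n) e" and w = "w (\<tau> n) e" and R = "\<rho>h n e" and W = "wh n e" and x = x and \<phi> = "\<phi> n e",
          OF b(1) b(2) _ _ params(7,8) params(3)] elim coeffs[OF e] by blast
  qed
  have "alo * c0 / 2 * error_sum n - k * \<Phi> = (\<Sum>e\<in>arcs G. \<integral>x. alo * c0 / 2 * error_at n e x - k * (\<phi> n e x)\<^sup>2 \<partial>pipe (\<l> e))"
    using integrable_densities[OF _ n] by (simp add: error_sum_def \<Phi>_def sum_distrib_left sum_subtractf)
  also have "\<dots> \<le> energy_sum n"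
    unfolding energy_sum_def
  proof (intro sum_mono integral_mono_AE)
    fix e assume e: "e \<in> arcs G"
    note I = integrable_densities[OF e n]
    show "integrable (pipe (\<l> e)) (\<lambda>x. alo * c0 / 2 * error_at n e x - k * (\<phi> n e x)\<^sup>2)" using I by simp
    show "integrable (pipe (\<l> e)) (energy_at n e)" by (rule I)
    show "AE x in pipe (\<l> e). alo * c0 / 2 * error_at n e x - k * (\<phi> n e x)\<^sup>2 \<le> energy_at n e x"
      using ae[OF e] by (rule eventually_mono) blast
  qed
  finally show "alo * c0 / 2 * error_sum n - k * (residual_const G \<l> T K ahi \<rho>hi * mesh_error) \<le> energy_sum n"
    using mult_left_mono[OF \<Phi> k] by linarith
  have "energy_sum n \<le> (\<Sum>e\<in>arcs G. \<integral>x. (ahi * C0 + 1) * error_at n e x + \<epsilon>bar\<^sup>2 * (\<phi> n e x)\<^sup>2 \<partial>pipe (\<l> e))"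
    unfolding energy_sum_def
  proof (intro sum_mono integral_mono_AE)
    fix e assume e: "e \<in> arcs G"
    note I = integrable_densities[OF e n]
    show "integrable (pipe (\<l> e)) (\<lambda>x. (ahi * C0 + 1) * error_at n e x + \<epsilon>bar\<^sup>2 * (\<phi> n e x)\<^sup>2)" using I by simp
    show "integrable (pipe (\<l> e)) (energy_at n e)" by (rule I)
    show "AE x in pipe (\<l> e). energy_at n e x \<le> (ahi * C0 + 1) * error_at n e x + \<epsilon>bar\<^sup>2 * (\<phi> n e x)\<^sup>2"
      using ae[OF e] by (rule eventually_mono) blast
  qed
  also have "\<dots> = (ahi * C0 + 1) * error_sum n + \<epsilon>bar\<^sup>2 * \<Phi>"
    using integrable_densities[OF _ n] by (simp add: error_sum_def \<Phi>_def sum_distrib_left sum.distrib)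
  finally show "energy_sum n \<le> (ahi * C0 + 1) * error_sum n + \<epsilon>bar\<^sup>2 * (residual_const G \<l> T K ahi \<rho>hi * mesh_error)"
    using mult_left_mono[OF \<Phi>, of "\<epsilon>bar\<^sup>2"] by simp
qed

text \<open>The initial density is a projection and the initial flux an interpolant, but the
  velocity is their quotient: its error is recovered from the other two by dividing by
  \<open>a * R\<close>, bounded below for admissible states.\<close>

lemma initial_error: "error_sum 0 \<le> initial_const G \<l> T K alo ahi * mesh_error"
  unfolding error_sum_def initial_const_def sum_distrib_right
proof (rule sum_mono)
  fix e assume e: "e \<in> arcs G"
  interpret mesh: uniform_mesh "\<l> e" "M e" by (rule mesh[OF e])
  have T0: "0 \<in> {0..T}" using params by simp
  note b = ess_bounded_exact[OF e le0, unfolded \<tau>(4)]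
  define fc where "fc = flux_const \<l> T K ahi \<rho>hi e"
  have fc: "0 \<le> fc" unfolding fc_def by (rule flux_const_nonneg[OF e])
  define X where "X = (\<integral>x. (\<rho>h 0 e x - \<rho> 0 e x)\<^sup>2 \<partial>pipe (\<l> e))"
  define Y where "Y = (\<integral>x. (m 0 e x - mh 0 e x)\<^sup>2 \<partial>pipe (\<l> e))"
  have iX: "integrable (pipe (\<l> e)) (\<lambda>x. (\<rho>h 0 e x - \<rho> 0 e x)\<^sup>2)"
    by (intro ess_bounded_integrable ess_bounded_power ess_bounded_diff b)
  have iY: "integrable (pipe (\<l> e)) (\<lambda>x. (m 0 e x - mh 0 e x)\<^sup>2)"
    by (intro ess_bounded_integrable ess_bounded_power ess_bounded_diff b)
  have X: "X \<le> (2 * K\<^sup>2 + 2) * mesh_error"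
  proof -
    obtain q where q: "has_L2_deriv (\<l> e) (\<rho> 0 e) q" "(\<integral>x. (q x)\<^sup>2 \<partial>pipe (\<l> e)) \<le> 2 * K\<^sup>2 + 2"
      by (rule regular_edge.initial_H1_bound[OF regular(1)[OF e]]) blast
    have "X = (\<integral>x. (\<rho> 0 e x - mesh.proj (\<rho> 0 e) x)\<^sup>2 \<partial>pipe (\<l> e))"
      unfolding X_def
    proof (rule integral_cong_AE)
      show "(\<lambda>x. (\<rho>h 0 e x - \<rho> 0 e x)\<^sup>2) \<in> borel_measurable (pipe (\<l> e))" using iX by (rule borel_measurable_integrable)
      show "(\<lambda>x. (\<rho> 0 e x - mesh.proj (\<rho> 0 e) x)\<^sup>2) \<in> borel_measurable (pipe (\<l> e))"
        by (intro borel_measurable_power borel_measurable_diff ess_bounded_measurable[OF b(1)] Lp2_measurable[OF mesh.proj_Lp2])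
      show "AE x in pipe (\<l> e). (\<rho>h 0 e x - \<rho> 0 e x)\<^sup>2 = (\<rho> 0 e x - mesh.proj (\<rho> 0 e) x)\<^sup>2"
        using initial_density[OF e] by (rule eventually_mono) (simp add: power2_commute)
    qed
    also have "\<dots> \<le> mesh.h\<^sup>2 * (\<integral>x. (q x)\<^sup>2 \<partial>pipe (\<l> e))" by (rule mesh.proj_error[OF q(1)])
    also have "\<dots> \<le> mesh_error * (2 * K\<^sup>2 + 2)"
      using q(2) he_square_mesh_error[OF e] unfolding he_def by (intro mult_mono) (auto simp: mesh_error_def intro: order_trans)
    finally show ?thesis by (simp only: mult.commute)
  qed
  have Y: "Y \<le> fc * mesh_error"
  proof -
    obtain s where s: "has_L2_deriv (\<l> e) (mh 0 e) (mesh.step s)" by (rule mh_deriv_step[OF le0 e])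
    have nodes: "mh 0 e (mesh.node i) = m 0 e (mesh.node i)" if "i \<le> M e" for i
      using discrete e that
      by (auto simp: discrete_solution_def is_nodal_interpolation_def m_def mesh_size_def mesh.node_def mesh.h_def)
    have "Y \<le> mesh.h\<^sup>2 * (\<integral>x. (- a e * \<rho>' 0 e x)\<^sup>2 \<partial>pipe (\<l> e))"
      unfolding Y_def by (rule mesh.interp_error[OF m_deriv[OF e T0] s nodes])
    also have "\<dots> \<le> mesh_error * fc"
      using flux_derivative_bound[OF e T0] he_square_mesh_error[OF e] unfolding he_def fc_def by (intro mult_mono) (auto simp: mesh_error_def intro: order_trans)
    finally show ?thesis by (simp only: mult.commute)
  qed
  define k where "k = (3 / (2 * alo * \<rho>lo))\<^sup>2"
  have "AE x in pipe (\<l> e). error_at 0 e x \<le> (\<rho>h 0 e x - \<rho> 0 e x)\<^sup>2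
      + \<epsilon>bar\<^sup>2 * k * (2 * (m 0 e x - mh 0 e x)\<^sup>2 + 2 * (ahi * wbar)\<^sup>2 * (\<rho>h 0 e x - \<rho> 0 e x)\<^sup>2)"
    using admissible_AE[OF le0 e] AE_inner[of e]
  proof eventually_elim
    case (elim x)
    define R r v W where "R = \<rho>h 0 e x" and "r = \<rho> 0 e x" and "v = w 0 e x" and "W = wh 0 e x"
    have v: "\<bar>v\<bar> \<le> wbar" using range(2)[OF e T0, of x] elim by (simp add: v_def)
    have ab: "0 < a e" "alo \<le> a e" "a e \<le> ahi" using coeffs[OF e] params by auto
    have aR: "alo * (2 * \<rho>lo / 3) \<le> a e * R" using elim ab params pos by (intro mult_mono) (auto simp: R_def)
    have aR0: "0 < alo * (2 * \<rho>lo / 3)" using params pos by simp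
    have eq: "a e * R * (W - v) = - (m 0 e x - mh 0 e x) + - (a e * v) * (R - r)"
      using elim by (simp add: m_eq R_def r_def v_def W_def algebra_simps)
    have "(alo * (2 * \<rho>lo / 3))\<^sup>2 * (W - v)\<^sup>2 \<le> (a e * R)\<^sup>2 * (W - v)\<^sup>2"
      using aR aR0 by (intro mult_right_mono power_mono) auto
    also have "\<dots> = (- (m 0 e x - mh 0 e x) + - (a e * v) * (R - r))\<^sup>2" by (simp only: power_mult_distrib[symmetric] eq)
    also have "\<dots> \<le> 2 * (- (m 0 e x - mh 0 e x))\<^sup>2 + 2 * (- (a e * v) * (R - r))\<^sup>2" by (rule square_sum_le(1))
    also have "\<dots> = 2 * (m 0 e x - mh 0 e x)\<^sup>2 + 2 * ((a e * v)\<^sup>2 * (R - r)\<^sup>2)"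
      by (simp only: power2_minus power_mult_distrib)
    also have "\<dots> \<le> 2 * (m 0 e x - mh 0 e x)\<^sup>2 + 2 * ((ahi * wbar)\<^sup>2 * (R - r)\<^sup>2)"
    proof -
      have "\<bar>a e * v\<bar> \<le> ahi * wbar" unfolding abs_mult using ab v by (intro mult_mono) auto
      then have "(a e * v)\<^sup>2 \<le> (ahi * wbar)\<^sup>2" using power_mono[of "\<bar>a e * v\<bar>" "ahi * wbar" 2] by simp
      then show ?thesis by (intro add_left_mono mult_left_mono mult_right_mono) auto
    qed
    finally have "k * ((alo * (2 * \<rho>lo / 3))\<^sup>2 * (W - v)\<^sup>2) \<le> k * (2 * (m 0 e x - mh 0 e x)\<^sup>2 + 2 * ((ahi * wbar)\<^sup>2 * (R - r)\<^sup>2))"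
      by (intro mult_left_mono) (auto simp: k_def)
    moreover have "k * ((alo * (2 * \<rho>lo / 3))\<^sup>2 * (W - v)\<^sup>2) = (W - v)\<^sup>2"
    proof -
      have "k * (alo * (2 * \<rho>lo / 3))\<^sup>2 = 1"
        unfolding k_def power_mult_distrib[symmetric] using params pos by simp
      then show ?thesis by (simp only: mult.assoc[symmetric] mult_1_left)
    qed
    ultimately have "(W - v)\<^sup>2 \<le> k * (2 * (m 0 e x - mh 0 e x)\<^sup>2 + 2 * ((ahi * wbar)\<^sup>2 * (R - r)\<^sup>2))" by (simp only:)
    moreover have "\<epsilon>\<^sup>2 \<le> \<epsilon>bar\<^sup>2" using params by (intro power_mono) auto
    ultimately have "\<epsilon>\<^sup>2 * (W - v)\<^sup>2 \<le> \<epsilon>bar\<^sup>2 * (k * (2 * (m 0 e x - mh 0 e x)\<^sup>2 + 2 * ((ahi * wbar)\<^sup>2 * (R - r)\<^sup>2)))"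
      by (intro mult_mono) auto
    then show ?case by (simp add: error_at_def \<tau>(4) R_def r_def v_def W_def mult.assoc)
  qed
  from integral_mono_AE[OF _ _ this] integrable_densities(2)[OF e le0] iX iY
  have "(\<integral>x. error_at 0 e x \<partial>pipe (\<l> e)) \<le> (\<integral>x. (\<rho>h 0 e x - \<rho> 0 e x)\<^sup>2
      + \<epsilon>bar\<^sup>2 * k * (2 * (m 0 e x - mh 0 e x)\<^sup>2 + 2 * (ahi * wbar)\<^sup>2 * (\<rho>h 0 e x - \<rho> 0 e x)\<^sup>2) \<partial>pipe (\<l> e))" by simp
  also have "\<dots> = X + \<epsilon>bar\<^sup>2 * k * (2 * Y + 2 * (ahi * wbar)\<^sup>2 * X)"
    using iX iY by (simp add: X_def Y_def)
  also have "\<dots> \<le> (2 * K\<^sup>2 + 2) * mesh_error + \<epsilon>bar\<^sup>2 * k * (2 * (fc * mesh_error) + 2 * (ahi * wbar)\<^sup>2 * ((2 * K\<^sup>2 + 2) * mesh_error))"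
    using X Y by (intro add_mono mult_left_mono) (auto simp: k_def)
  also have "\<dots> = ((2 * K\<^sup>2 + 2) + \<epsilon>bar\<^sup>2 * k * (2 * fc + 2 * (ahi * wbar)\<^sup>2 * (2 * K\<^sup>2 + 2))) * mesh_error"
    by (simp add: algebra_simps)
  finally show "(\<integral>x. error_at 0 e x \<partial>pipe (\<l> e)) \<le> (2 * K\<^sup>2 + 2 + \<epsilon>bar\<^sup>2 * (3 / (2 * alo * \<rho>lo))\<^sup>2 *
     (2 * flux_const \<l> T K ahi \<rho>hi e + 2 * (ahi * wbar)\<^sup>2 * (2 * K\<^sup>2 + 2))) * mesh_error"
    by (simp only: k_def fc_def)
qed

theorem error_estimate:
  assumes sb: "dissipation alo ahi \<gamma>lo \<gamma>hi C c" and C: "0 < C" "0 < c" and small: "increment_const G \<l> K * dt \<le> \<kappa>"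
    and growth: "growth_const G \<l> T K alo ahi C * dt \<le> 1 / 2" and n: "n \<le> N"
  shows "(LpE_norm G \<l> 2 (\<lambda>e x. \<rho> (\<tau> n) e x - \<rho>h n e x))\<^sup>2
      + \<epsilon>\<^sup>2 * (LpE_norm G \<l> 2 (\<lambda>e x. m (\<tau> n) e x - mh n e x))\<^sup>2
      + (\<Sum>k=1..n. dt * (LpE_norm G \<l> 3 (\<lambda>e x. m (\<tau> k) e x - mh k e x)) ^ 3)
    \<le> error_const G \<l> T K alo ahi C c * (dt\<^sup>2 + hm\<^sup>2)"
proof -
  define KR where "KR = residual_const G \<l> T K ahi \<rho>hi"
  define J where "J = C + ahi * (L + \<epsilon>bar\<^sup>2 + 1) * increment_const G \<l> K"
  define g where "g = 2 / (alo * c0)"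
  define k where "k = \<epsilon>bar\<^sup>2 / (2 * alo * c0)"
  \<comment> \<open>The shift makes up for the correction in \<open>energy\<close>, so that
    \<open>S\<close> is nonnegative and dominates the squared error.\<close>
  define S where "S n = energy_sum n + k * (KR * mesh_error)" for n
  have g0: "0 < g" unfolding g_def using params c0_pos by simp
  have KR0: "0 \<le> KR" unfolding KR_def by (rule residual_const_nonneg)
  have J0: "0 \<le> J" unfolding J_def using C params pos increment_const_nonneg by (intro add_nonneg_nonneg mult_nonneg_nonneg) auto
  have G: "growth_const G \<l> T K alo ahi C = J * (g + KR)" by (simp add: growth_const_def J_def g_def KR_def)
  have AS: "error_sum n \<le> g * S n" if "n \<le> N" for n
  proof -
    have "alo * c0 / 2 * error_sum n \<le> S n" using energy_estimates(1)[OF that] by (simp add: S_def k_def KR_def)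
    then have "g * (alo * c0 / 2 * error_sum n) \<le> g * S n" using g0 by (intro mult_left_mono) auto
    then show ?thesis using params c0_pos by (simp add: g_def)
  qed
  have S0: "0 \<le> S n" if "n \<le> N" for n
    using AS[OF that] error_sum_nonneg[of n] g0 by (meson order_trans zero_le_mult_iff not_less)
  have step: "S n + dt * (c * flux_error_sum n) \<le> S (n - 1) + J * (g + KR) * dt * (S n + S (n - 1) + mesh_error)" if n: "1 \<le> n" "n \<le> N" for n
  proof -
    have n1: "n - 1 \<le> N" using n by simp
    have "S n + dt * (c * flux_error_sum n) \<le> S (n - 1) + dt * (J * (error_sum n + error_sum (n - 1) + KR * mesh_error))"
      using energy_step[OF sb less_imp_le[OF C(1)] small n] by (simp add: S_def J_def KR_def)
    also have "dt * (J * (error_sum n + error_sum (n - 1) + KR * mesh_error)) \<le> dt * (J * (g * S n + g * S (n - 1) + KR * mesh_error))"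
      using AS[OF n(2)] AS[OF n1] dt_pos J0 by (intro mult_left_mono add_mono order_refl) auto
    \<comment> \<open>A single factor for the errors and the source brings the inequality into the
      form of the Gronwall lemma with \<open>D = mesh_error\<close>.\<close>
    also have "\<dots> \<le> dt * (J * ((g + KR) * (S n + S (n - 1) + mesh_error)))"
    proof (intro mult_left_mono)
      have "0 \<le> KR * (S n + S (n - 1))" "0 \<le> g * mesh_error" using KR0 S0[OF n(2)] S0[OF n1] g0 mesh_error_nonneg by auto
      then show "g * S n + g * S (n - 1) + KR * mesh_error \<le> (g + KR) * (S n + S (n - 1) + mesh_error)" by (simp add: algebra_simps)
    qed (use dt_pos J0 in auto)
    finally show ?thesis by (simp add: mult_ac)
  qed
  have "S n + (\<Sum>k=1..n. dt * (c * flux_error_sum k)) \<le> exp (4 * (J * (g + KR)) * (real n * dt)) * (S 0 + mesh_error)"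
  proof (rule discrete_Gronwall[where S = S and Q = "\<lambda>k. c * flux_error_sum k" and N = N, OF step S0])
    show "0 \<le> c * flux_error_sum n" for n using C flux_error_sum_nonneg[of n] by simp
    show "0 \<le> J * (g + KR)" using J0 g0 KR0 by simp
    show "J * (g + KR) * dt \<le> 1 / 2" using growth by (simp add: G)
  qed (use dt_pos mesh_error_nonneg n in auto)
  also have "\<dots> \<le> exp (4 * (J * (g + KR)) * T) * (start_const G \<l> T K alo ahi * mesh_error)"
  proof (intro mult_mono)
    have "real n * dt \<le> T" using \<tau>(1)[OF n] by (simp add: \<tau>_def)
    then have "4 * (J * (g + KR)) * (real n * dt) \<le> 4 * (J * (g + KR)) * T"
      using J0 g0 KR0 by (intro mult_left_mono) auto
    then show "exp (4 * (J * (g + KR)) * (real n * dt)) \<le> exp (4 * (J * (g + KR)) * T)" by simp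
    have "energy_sum 0 \<le> (ahi * C0 + 1) * error_sum 0 + \<epsilon>bar\<^sup>2 * (KR * mesh_error)" unfolding KR_def by (rule energy_estimates(2)) simp
    also have "(ahi * C0 + 1) * error_sum 0 \<le> (ahi * C0 + 1) * (initial_const G \<l> T K alo ahi * mesh_error)"
      using params C0_pos by (intro mult_left_mono initial_error) auto
    finally show "S 0 + mesh_error \<le> start_const G \<l> T K alo ahi * mesh_error"
      unfolding S_def start_const_def KR_def[symmetric] k_def[symmetric] by (simp add: algebra_simps)
    show "0 \<le> S 0 + mesh_error" using S0[of 0] mesh_error_nonneg by simp
  qed auto
  finally have main: "S n + c * (\<Sum>k=1..n. dt * flux_error_sum k) \<le> exp (4 * (J * (g + KR)) * T) * (start_const G \<l> T K alo ahi * mesh_error)"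
    by (simp add: sum_distrib_left mult_ac)
  define Z where "Z = exp (4 * (J * (g + KR)) * T) * (start_const G \<l> T K alo ahi * mesh_error)"
  have sQ: "0 \<le> (\<Sum>k=1..n. dt * flux_error_sum k)" using dt_pos flux_error_sum_nonneg by (intro sum_nonneg mult_nonneg_nonneg) auto
  have SZ: "S n \<le> Z" using main mult_nonneg_nonneg[OF less_imp_le[OF C(2)] sQ] unfolding Z_def by linarith
  have "c * (\<Sum>k=1..n. dt * flux_error_sum k) \<le> Z" using main S0[OF n] unfolding Z_def by linarith
  then have QZ: "(\<Sum>k=1..n. dt * flux_error_sum k) \<le> 1 / c * Z" using C by (simp add: field_simps)
  \<comment> \<open>Bounds the \<open>\<epsilon>\<close>-weighted flux error by the density and
    velocity errors; the density part uses \<open>\<epsilon>\<close> at most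
    \<open>\<epsilon>bar\<close>.\<close>
  define H where "H = 2 * (2 * ahi * \<rho>hi)\<^sup>2 + 2 * \<epsilon>bar\<^sup>2 * (ahi * wbar)\<^sup>2"
  have H0: "0 \<le> H" by (simp add: H_def)
  have rho: "(LpE_norm G \<l> 2 (\<lambda>e x. \<rho> (\<tau> n) e x - \<rho>h n e x))\<^sup>2 \<le> error_sum n"
    unfolding LpE_norm_2_square error_sum_def
  proof (intro sum_mono integral_mono)
    fix e assume e: "e \<in> arcs G"
    show "integrable (pipe (\<l> e)) (error_at n e)" by (rule integrable_densities(2)[OF e n])
    show "integrable (pipe (\<l> e)) (\<lambda>x. (\<rho> (\<tau> n) e x - \<rho>h n e x)\<^sup>2)"
      by (intro ess_bounded_integrable ess_bounded_power ess_bounded_diff ess_bounded_exact[OF e n])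
    show "(\<rho> (\<tau> n) e x - \<rho>h n e x)\<^sup>2 \<le> error_at n e x" for x by (simp add: error_at_def power2_commute)
  qed
  have flux: "\<epsilon>\<^sup>2 * (LpE_norm G \<l> 2 (\<lambda>e x. m (\<tau> n) e x - mh n e x))\<^sup>2 \<le> H * error_sum n"
    unfolding LpE_norm_2_square error_sum_def sum_distrib_left
  proof (intro sum_mono)
    fix e assume e: "e \<in> arcs G"
    have "(\<integral>x. \<epsilon>\<^sup>2 * (m (\<tau> n) e x - mh n e x)\<^sup>2 \<partial>pipe (\<l> e)) \<le> (\<integral>x. H * error_at n e x \<partial>pipe (\<l> e))"
    proof (rule integral_mono_AE)
      show "integrable (pipe (\<l> e)) (\<lambda>x. H * error_at n e x)" using integrable_densities(2)[OF e n] by simp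
      show "integrable (pipe (\<l> e)) (\<lambda>x. \<epsilon>\<^sup>2 * (m (\<tau> n) e x - mh n e x)\<^sup>2)"
        by (intro ess_bounded_integrable ess_bounded_mult ess_bounded_const ess_bounded_power ess_bounded_diff ess_bounded_exact[OF e n])
      show "AE x in pipe (\<l> e). \<epsilon>\<^sup>2 * (m (\<tau> n) e x - mh n e x)\<^sup>2 \<le> H * error_at n e x"
        using admissible_AE[OF n e] AE_inner[of e]
      proof eventually_elim
        case (elim x)
        define R r v W where "R = \<rho>h n e x" and "r = \<rho> (\<tau> n) e x" and "v = w (\<tau> n) e x" and "W = wh n e x"
        have v: "\<bar>v\<bar> \<le> wbar" using range(2)[OF e \<tau>(1)[OF n], of x] elim by (simp add: v_def)
        have ab: "0 < a e" "a e \<le> ahi" using coeffs[OF e] params by auto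
        have Rb: "0 \<le> R" "R \<le> 2 * \<rho>hi" using elim pos by (auto simp: R_def)
        have 1: "(a e * R)\<^sup>2 \<le> (2 * ahi * \<rho>hi)\<^sup>2"
        proof (intro power_mono)
          have "a e * R \<le> ahi * (2 * \<rho>hi)" using ab Rb by (intro mult_mono) auto
          then show "a e * R \<le> 2 * ahi * \<rho>hi" by (simp add: mult_ac)
        qed (use ab Rb in auto)
        have "\<bar>a e * v\<bar> \<le> ahi * wbar" unfolding abs_mult using ab v by (intro mult_mono) auto
        then have 2: "(a e * v)\<^sup>2 \<le> (ahi * wbar)\<^sup>2" using power_mono[of "\<bar>a e * v\<bar>" "ahi * wbar" 2] by simp
        have \<epsilon>2: "\<epsilon>\<^sup>2 \<le> \<epsilon>bar\<^sup>2" using params by (intro power_mono) auto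
        have "m (\<tau> n) e x - mh n e x = - (a e * R * (W - v) + (a e * v) * (R - r))"
          using elim by (simp add: m_eq R_def r_def v_def W_def algebra_simps)
        then have "(m (\<tau> n) e x - mh n e x)\<^sup>2 = (a e * R * (W - v) + (a e * v) * (R - r))\<^sup>2" by (simp only: power2_minus)
        also have "\<dots> \<le> 2 * (a e * R * (W - v))\<^sup>2 + 2 * ((a e * v) * (R - r))\<^sup>2" by (rule square_sum_le(1))
        finally have "\<epsilon>\<^sup>2 * (m (\<tau> n) e x - mh n e x)\<^sup>2 \<le> \<epsilon>\<^sup>2 * (2 * (a e * R * (W - v))\<^sup>2 + 2 * ((a e * v) * (R - r))\<^sup>2)"
          by (intro mult_left_mono) auto
        also have "\<dots> = 2 * ((a e * R)\<^sup>2 * (\<epsilon>\<^sup>2 * (W - v)\<^sup>2)) + 2 * (\<epsilon>\<^sup>2 * (a e * v)\<^sup>2 * (R - r)\<^sup>2)"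
          by (simp only: power_mult_distrib distrib_left mult_ac)
        also have "\<dots> \<le> 2 * ((2 * ahi * \<rho>hi)\<^sup>2 * (\<epsilon>\<^sup>2 * (W - v)\<^sup>2)) + 2 * (\<epsilon>bar\<^sup>2 * (ahi * wbar)\<^sup>2 * (R - r)\<^sup>2)"
          using 1 2 \<epsilon>2 by (intro add_mono mult_left_mono mult_mono) auto
        also have "\<dots> \<le> H * (\<epsilon>\<^sup>2 * (W - v)\<^sup>2) + H * (R - r)\<^sup>2"
          unfolding mult.assoc[symmetric, of 2] by (intro add_mono mult_right_mono) (auto simp: H_def mult.assoc)
        finally show ?case by (simp add: error_at_def R_def r_def v_def W_def distrib_left)
      qed
    qed
    then show "\<epsilon>\<^sup>2 * (\<integral>x. (m (\<tau> n) e x - mh n e x)\<^sup>2 \<partial>pipe (\<l> e)) \<le> H * (\<integral>x. error_at n e x \<partial>pipe (\<l> e))" by simp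
  qed
  have cubes: "(\<Sum>k=1..n. dt * (LpE_norm G \<l> 3 (\<lambda>e x. m (\<tau> k) e x - mh k e x)) ^ 3) = (\<Sum>k=1..n. dt * flux_error_sum k)"
    by (simp add: LpE_norm_3_cube flux_error_sum_def flux_error_at_def)
  have "error_sum n \<le> g * Z" using AS[OF n] mult_left_mono[OF SZ less_imp_le[OF g0]] by simp
  then have "(1 + H) * error_sum n \<le> (1 + H) * (g * Z)" using H0 by (intro mult_left_mono) auto
  then have "error_sum n + H * error_sum n + (\<Sum>k=1..n. dt * flux_error_sum k) \<le> ((1 + H) * g + 1 / c) * Z" using QZ by (simp add: algebra_simps)
  also have "\<dots> = error_const G \<l> T K alo ahi C c * (dt\<^sup>2 + hm\<^sup>2)"
    unfolding error_const_def H_def[symmetric] g_def[symmetric] G Z_def mesh_error_def by (simp only: mult.assoc)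
  finally show ?thesis using rho flux unfolding cubes by linarith
qed

end

section \<open>From the assumptions to the estimate\<close>

lemma smooth_on_derivs:
  assumes "smooth_on {0<..} f" "(0::real) < r"
  shows "(((deriv ^^ k) f) has_real_derivative (deriv ^^ Suc k) f r) (at r)"
proof -
  have "(deriv ^^ k) f differentiable (at r within {0<..})"
    using assms unfolding smooth_on_def differentiable_on_def by auto
  then have "(deriv ^^ k) f field_differentiable at r"
    using assms(2) by (simp add: at_within_open[of r "{0<..}"] real_differentiable_def field_differentiable_def)
  then show ?thesis by (simp add: DERIV_deriv_iff_field_differentiable)
qed

text \<open>Compactness of \<open>[\<rho>lo/2, 2 \<rho>hi]\<close> inside the positive half-line
  bounds the second and third derivatives of \<open>P\<close>; the third derivative supplies the
  Lipschitz constant.\<close>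

lemma gas_law_exists:
  assumes P: "smooth_on {0<..} P" and pos: "0 < \<rho>lo" "\<rho>lo \<le> \<rho>hi" "0 < wbar" "0 < \<epsilon>bar"
    and b: "\<forall>r\<in>{2 * \<rho>lo / 3..3 * \<rho>hi / 2}. r * deriv (deriv P) r \<ge> 4 * \<epsilon>bar\<^sup>2 * \<bar>wbar\<bar>\<^sup>2"
  obtains L where "gas_law P (deriv P) (deriv (deriv P)) \<rho>lo \<rho>hi wbar \<epsilon>bar L"
proof -
  define I where "I = {\<rho>lo / 2..2 * \<rho>hi}"
  have I0: "0 < r" if "r \<in> I" for r using that pos by (auto simp: I_def)
  have d: "((deriv ^^ k) P has_real_derivative (deriv ^^ Suc k) P r) (at r)" if "0 < r" for k r
    by (rule smooth_on_derivs[OF P that])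
  have "\<exists>B. \<forall>r\<in>I. \<bar>(deriv ^^ k) P r\<bar> \<le> B" for k
  proof -
    have "continuous_on I ((deriv ^^ k) P)"
      using DERIV_isCont[OF d[OF I0]] by (simp add: continuous_at_imp_continuous_on)
    then have "bounded ((deriv ^^ k) P ` I)" unfolding I_def by (intro compact_imp_bounded compact_continuous_image) auto
    then show ?thesis by (auto simp: bounded_iff)
  qed
  then obtain B where B: "\<And>k r. r \<in> I \<Longrightarrow> \<bar>(deriv ^^ k) P r\<bar> \<le> B k" by metis
  define L where "L = \<bar>B 2\<bar> + \<bar>B 3\<bar> + 1"
  have "gas_law P (deriv P) (deriv (deriv P)) \<rho>lo \<rho>hi wbar \<epsilon>bar L"
  proof
    show "(P has_real_derivative deriv P r) (at r)" "(deriv P has_real_derivative deriv (deriv P) r) (at r)" if "0 < r" for r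
      using d[OF that, of 0] d[OF that, of 1] by simp_all
    show "\<bar>deriv (deriv P) r\<bar> \<le> L" if "r \<in> {\<rho>lo / 2..2 * \<rho>hi}" for r
      using B[of r 2] that by (simp add: L_def I_def eval_nat_numeral)
    show "\<bar>deriv (deriv P) r - deriv (deriv P) s\<bar> \<le> L * \<bar>r - s\<bar>" if "r \<in> {\<rho>lo / 2..2 * \<rho>hi}" "s \<in> {\<rho>lo / 2..2 * \<rho>hi}" for r s
    proof -
      have "norm (deriv (deriv P) r - deriv (deriv P) s) \<le> L * norm (r - s)"
      proof (rule field_differentiable_bound[where S = I and f' = "(deriv ^^ 3) P"])
        show "convex I" by (simp add: I_def)
        show "(deriv (deriv P) has_field_derivative (deriv ^^ 3) P z) (at z within I)" if "z \<in> I" for z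
          using has_field_derivative_at_within[OF d[OF I0[OF that], of 2]] by (simp add: eval_nat_numeral)
        show "norm ((deriv ^^ 3) P z) \<le> L" if "z \<in> I" for z using B[OF that, of 3] by (simp add: L_def)
      qed (use that in \<open>auto simp: I_def\<close>)
      then show ?thesis by simp
    qed
  qed (use pos b in \<open>auto simp: L_def\<close>)
  then show ?thesis by (rule that)
qed

lemma LpE_norm_no_arcs: "arcs G = {} \<Longrightarrow> LpE_norm G \<l> p u = 0"
  by (simp add: LpE_norm_def)

lemma AE_pipe_nontrivial:
  assumes "0 < l" "AE x in pipe l. Q" shows Q
proof (rule ccontr)
  assume "\<not> Q"
  then have "AE x in pipe l. \<not> True" using assms(2) by simp
  then have "emeasure (pipe l) {x \<in> space (pipe l). True} = 0" by (rule emeasure_eq_0_AE)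
  then show False using assms(1) emeasure_lborel_Ioo[of 0 l]
    by (simp add: pipe_def emeasure_restrict_space space_restrict_space greaterThanLessThan_def greaterThan_def lessThan_def Int_def)
qed

theorem theorem25:
  fixes G :: "('v,'e) pre_digraph" and \<l> :: "'e \<Rightarrow> real" and P :: "real \<Rightarrow> real"
    and T c1 c2 \<epsilon>bar \<gamma>lo \<gamma>hi alo ahi \<rho>lo \<rho>hi wbar Cbar :: real
  assumes network: "fin_digraph G" "loopfree_digraph G" "Digraph_Component.connected G"
      "\<forall>e\<in>arcs G. 0 < \<l> e"
    and consts_pos: "0 < T" "0 < c1" "0 < c2" "0 < \<epsilon>bar" "0 < \<gamma>lo" "0 < \<gamma>hi" "0 < alo" "0 < ahi"
      "0 < \<rho>lo" "0 < \<rho>hi" "0 < wbar" "0 < Cbar"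
    and P_regular: "smooth_on {0<..} P" "strongly_convex_on {0<..} P"
    and P_bound: "\<forall>r\<in>{2 * \<rho>lo / 3..3 * \<rho>hi / 2}. r * deriv (deriv P) r \<ge> 4 * \<epsilon>bar\<^sup>2 * \<bar>wbar\<bar>\<^sup>2"
  shows "\<exists>C>0. \<exists>dt0>0. \<forall>\<epsilon> (a :: 'e \<Rightarrow> real) (\<gamma> :: 'e \<Rightarrow> real)
      (\<eta>b :: 'v \<Rightarrow> real \<Rightarrow> real) (\<rho> :: real \<Rightarrow> 'e netfun) (w :: real \<Rightarrow> 'e netfun).
    0 \<le> \<epsilon> \<and> \<epsilon> \<le> \<epsilon>bar \<longrightarrow>
    (\<forall>e\<in>arcs G. \<gamma>lo \<le> \<gamma> e \<and> \<gamma> e \<le> \<gamma>hi \<and> alo \<le> a e \<and> a e \<le> ahi) \<longrightarrow>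
    classical_solution G \<l> P \<epsilon> a \<gamma> T \<eta>b \<rho> w \<longrightarrow>
    (\<forall>\<tau>\<in>{0..T}. \<forall>e\<in>arcs G. AE x in pipe (\<l> e).
       \<rho>lo \<le> \<rho> \<tau> e x \<and> \<rho> \<tau> e x \<le> \<rho>hi \<and> - wbar \<le> w \<tau> e x \<and> w \<tau> e x \<le> wbar) \<longrightarrow>
    (\<forall>u\<in>{\<rho>, w}. Winf_time_le G \<l> (LpE G \<l> 2) (LpE_norm G \<l> 2) 2 T Cbar u \<and>
                 Winf_time_le G \<l> (H1pw G \<l>) (H1pw_norm G \<l>) 1 T Cbar u) \<longrightarrow>
    (\<forall>(N :: nat) (M :: 'e \<Rightarrow> nat) (\<rho>h :: nat \<Rightarrow> 'e netfun) (mh :: nat \<Rightarrow> 'e netfun).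
       let dt = T / real N;
           h = max_mesh_size G \<l> M;
           m = (\<lambda>\<tau>. mass_flow a (\<rho> \<tau>) (w \<tau>))
       in
         1 \<le> N \<longrightarrow> dt \<le> dt0 \<longrightarrow>
         (\<forall>e\<in>arcs G. 1 \<le> M e \<and> c1 * dt \<le> mesh_size \<l> M e \<and> mesh_size \<l> M e \<le> c2 * dt) \<longrightarrow>
         discrete_solution G \<l> P \<epsilon> a \<gamma> \<eta>b (\<rho> 0) (m 0) M dt N \<rho>h mh \<longrightarrow>
         admissible_state G \<l> a \<rho>lo \<rho>hi wbar N \<rho>h mh \<longrightarrow>
         (\<forall>n\<le>N.
            (LpE_norm G \<l> 2 (\<lambda>e x. \<rho> (real n * dt) e x - \<rho>h n e x))\<^sup>2
            + \<epsilon>\<^sup>2 * (LpE_norm G \<l> 2 (\<lambda>e x. m (real n * dt) e x - mh n e x))\<^sup>2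
            + (\<Sum>k=1..n. dt * (LpE_norm G \<l> 3 (\<lambda>e x. m (real k * dt) e x - mh k e x)) ^ 3)
            \<le> C * (dt\<^sup>2 + h\<^sup>2)))"
proof (cases "arcs G = {} \<or> \<rho>hi < \<rho>lo")
  \<comment> \<open>With \<open>\<rho>hi < \<rho>lo\<close> the range condition is contradictory on
    any pipe, as pipes have positive measure; so there are no arcs in either case. Then all norms
    vanish, and the right-hand side is a sum of squares whatever the maximal mesh size of an empty
    network is.\<close>
  case True
  show ?thesis
  proof (rule exI[of _ 1], intro conjI zero_less_one, rule exI[of _ 1], intro conjI zero_less_one allI impI, unfold Let_def, intro allI impI)
    fix \<epsilon> and a \<gamma> :: "'e \<Rightarrow> real" and \<eta>b :: "'v \<Rightarrow> real \<Rightarrow> real" and \<rho> w :: "real \<Rightarrow> 'e netfun"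
      and N :: nat and M :: "'e \<Rightarrow> nat" and \<rho>h mh :: "nat \<Rightarrow> 'e netfun" and n :: nat
    assume range: "\<forall>\<tau>\<in>{0..T}. \<forall>e\<in>arcs G. AE x in pipe (\<l> e).
       \<rho>lo \<le> \<rho> \<tau> e x \<and> \<rho> \<tau> e x \<le> \<rho>hi \<and> - wbar \<le> w \<tau> e x \<and> w \<tau> e x \<le> wbar"
    have empty: "arcs G = {}"
    proof (rule ccontr)
      assume "arcs G \<noteq> {}"
      then obtain e where e: "e \<in> arcs G" by blast
      have "AE x in pipe (\<l> e). False"
        using range e consts_pos(1) True \<open>arcs G \<noteq> {}\<close> by (auto intro: eventually_mono[OF range[rule_format, of 0 e]])
      then show False using AE_pipe_nontrivial network(4) e by blast
    qed
    show "(LpE_norm G \<l> 2 (\<lambda>e x. \<rho> (real n * (T / real N)) e x - \<rho>h n e x))\<^sup>2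
        + \<epsilon>\<^sup>2 * (LpE_norm G \<l> 2 (\<lambda>e x. mass_flow a (\<rho> (real n * (T / real N))) (w (real n * (T / real N))) e x - mh n e x))\<^sup>2
        + (\<Sum>k=1..n. T / real N * (LpE_norm G \<l> 3 (\<lambda>e x. mass_flow a (\<rho> (real k * (T / real N))) (w (real k * (T / real N))) e x - mh k e x)) ^ 3)
        \<le> 1 * ((T / real N)\<^sup>2 + (max_mesh_size G \<l> M)\<^sup>2)"
      by (simp add: LpE_norm_no_arcs[OF empty])
  qed
next
  case False
  obtain L where "gas_law P (deriv P) (deriv (deriv P)) \<rho>lo \<rho>hi wbar \<epsilon>bar L"
    using gas_law_exists[OF P_regular(1) _ _ _ _ P_bound] consts_pos False by (metis not_less)
  then interpret gas: gas_law P "deriv P" "deriv (deriv P)" \<rho>lo \<rho>hi wbar \<epsilon>bar L .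
  \<comment> \<open>These depend on the gas law and the coefficient bounds only and are fixed before
    \<open>\<epsilon>\<close>, the coefficients and the solution are introduced.\<close>
  obtain C c where Cc: "0 < C" "0 < c" and sb: "gas.dissipation alo ahi \<gamma>lo \<gamma>hi C c"
    using gas.step_bound[OF consts_pos(7,8,5,6)] unfolding gas.dissipation_def by metis
  define E where "E = \<bar>gas.error_const G \<l> T Cbar alo ahi C c\<bar> + 1"
  \<comment> \<open>The two smallness conditions on \<open>dt\<close>: increments of the exact
    solution within the margin \<open>\<kappa>\<close>, and absorption of the implicit term in the
    Gronwall argument. Absolute values plus 1 keep the denominators positive.\<close>
  define \<delta> where "\<delta> = min (gas.\<kappa> / (\<bar>increment_const G \<l> Cbar\<bar> + 1)) (1 / (2 * (\<bar>gas.growth_const G \<l> T Cbar alo ahi C\<bar> + 1)))"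
  have \<delta>: "0 < \<delta>" using gas.\<kappa>(1) by (simp add: \<delta>_def)
  show ?thesis
  proof (rule exI[of _ E], intro conjI, simp add: E_def, rule exI[of _ \<delta>], intro conjI \<delta> allI impI, unfold Let_def, intro allI impI)
    fix \<epsilon> and a \<gamma> :: "'e \<Rightarrow> real" and \<eta>b :: "'v \<Rightarrow> real \<Rightarrow> real" and \<rho> w :: "real \<Rightarrow> 'e netfun"
      and N :: nat and M :: "'e \<Rightarrow> nat" and \<rho>h mh :: "nat \<Rightarrow> 'e netfun" and n :: nat
    assume \<epsilon>: "0 \<le> \<epsilon> \<and> \<epsilon> \<le> \<epsilon>bar"
      and coeffs: "\<forall>e\<in>arcs G. \<gamma>lo \<le> \<gamma> e \<and> \<gamma> e \<le> \<gamma>hi \<and> alo \<le> a e \<and> a e \<le> ahi"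
      and sol: "classical_solution G \<l> P \<epsilon> a \<gamma> T \<eta>b \<rho> w"
      and range: "\<forall>\<tau>\<in>{0..T}. \<forall>e\<in>arcs G. AE x in pipe (\<l> e).
         \<rho>lo \<le> \<rho> \<tau> e x \<and> \<rho> \<tau> e x \<le> \<rho>hi \<and> - wbar \<le> w \<tau> e x \<and> w \<tau> e x \<le> wbar"
      and reg: "\<forall>u\<in>{\<rho>, w}. Winf_time_le G \<l> (LpE G \<l> 2) (LpE_norm G \<l> 2) 2 T Cbar u \<and>
                 Winf_time_le G \<l> (H1pw G \<l>) (H1pw_norm G \<l>) 1 T Cbar u"
      and N: "1 \<le> N" and dt: "T / real N \<le> \<delta>"
      and mesh: "\<forall>e\<in>arcs G. 1 \<le> M e \<and> c1 * (T / real N) \<le> mesh_size \<l> M e \<and> mesh_size \<l> M e \<le> c2 * (T / real N)"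
      and disc: "discrete_solution G \<l> P \<epsilon> a \<gamma> \<eta>b (\<rho> 0) (mass_flow a (\<rho> 0) (w 0)) M (T / real N) N \<rho>h mh"
      and adm: "admissible_state G \<l> a \<rho>lo \<rho>hi wbar N \<rho>h mh"
      and n: "n \<le> N"
    obtain \<rho>' w' where C1: "C1_time_deriv (LpE G \<l> 2) (LpE_norm G \<l> 2) T \<rho> \<rho>'"
        "C1_time_deriv (LpE G \<l> 2) (LpE_norm G \<l> 2) T w w'"
      and eqs: "\<forall>\<tau>\<in>{0<..T}. \<forall>e\<in>arcs G. AE x in pipe (\<l> e).
           a e * \<rho>' \<tau> e x + dx \<l> (mass_flow a (\<rho> \<tau>) (w \<tau>)) e x = 0 \<and>
           \<epsilon>\<^sup>2 * w' \<tau> e x + dx \<l> (enthalpy P \<epsilon> (\<rho> \<tau>) (w \<tau>)) e x = - \<gamma> e * \<bar>w \<tau> e x\<bar> * w \<tau> e x"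
      using sol unfolding classical_solution_def by blast
    note sol' = sol[unfolded classical_solution_def]
    have d: "discretization P \<rho>lo \<rho>hi wbar \<epsilon>bar L G \<l> \<epsilon> a \<gamma> T Cbar alo ahi \<gamma>lo \<gamma>hi \<eta>b \<rho> w \<rho>' w' N M (T / real N) \<rho>h mh"
    proof (intro discretization.intro exact_solution.intro gas.gas_law_axioms exact_solution_axioms.intro discretization_axioms.intro)
      show "AE x in pipe (\<l> e). \<rho>lo \<le> \<rho> t e x \<and> \<rho> t e x \<le> \<rho>hi \<and> - wbar \<le> w t e x \<and> w t e x \<le> wbar"
        if "t \<in> {0..T}" "e \<in> arcs G" for t e using range that by blast
      show "AE x in pipe (\<l> e). a e * \<rho>' t e x + dx \<l> (mass_flow a (\<rho> t) (w t)) e x = 0 \<and>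
           \<epsilon>\<^sup>2 * w' t e x + dx \<l> (enthalpy P \<epsilon> (\<rho> t) (w t)) e x = - \<gamma> e * \<bar>w t e x\<bar> * w t e x"
        if "t \<in> {0<..T}" "e \<in> arcs G" for t e using eqs that by blast
      show "(\<Sum>e\<in>incident_arcs G v. vertex_value G \<l> (mass_flow a (\<rho> t) (w t)) e v * edge_sign G e v) = 0 \<and>
          (\<exists>\<eta>v. \<forall>e\<in>incident_arcs G v. vertex_value G \<l> (enthalpy P \<epsilon> (\<rho> t) (w t)) e v = \<eta>v)"
        if "t \<in> {0<..T}" "v \<in> inner_verts G" for t v using sol' that by blast
      show "vertex_value G \<l> (enthalpy P \<epsilon> (\<rho> t) (w t)) e v = \<eta>b v t"
        if "t \<in> {0<..T}" "v \<in> boundary_verts G" "e \<in> incident_arcs G v" for t v e using sol' that by blast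
      show "C0_time (H1pw G \<l>) (H1pw_norm G \<l>) T \<rho>" "C0_time (H1pw G \<l>) (H1pw_norm G \<l>) T w"
        using sol' by blast+
    qed (use network consts_pos \<epsilon> coeffs C1 reg N mesh disc adm in \<open>blast+\<close>)
    have dt0: "0 < T / real N" using N consts_pos(1) by simp
    have small: "increment_const G \<l> Cbar * (T / real N) \<le> gas.\<kappa>"
    proof -
      have "increment_const G \<l> Cbar * (T / real N) \<le> (\<bar>increment_const G \<l> Cbar\<bar> + 1) * (gas.\<kappa> / (\<bar>increment_const G \<l> Cbar\<bar> + 1))"
        using dt dt0 by (intro mult_mono) (auto simp: \<delta>_def)
      then show ?thesis by simp
    qed
    have growth: "gas.growth_const G \<l> T Cbar alo ahi C * (T / real N) \<le> 1 / 2"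
    proof -
      define g where "g = gas.growth_const G \<l> T Cbar alo ahi C"
      have "g * (T / real N) \<le> (\<bar>g\<bar> + 1) * (1 / (2 * (\<bar>g\<bar> + 1)))"
        using dt dt0 by (intro mult_mono) (auto simp: \<delta>_def g_def)
      also have "\<dots> = 1 / 2" using abs_ge_zero[of g] by (simp add: field_simps)
      finally show ?thesis unfolding g_def .
    qed
    note discretization.error_estimate[OF d sb Cc small growth n, unfolded discretization.\<tau>_def[OF d] exact_solution.m_def[OF discretization.axioms(1)[OF d]] discretization.hm_def[OF d]]
    also have "gas.error_const G \<l> T Cbar alo ahi C c * ((T / real N)\<^sup>2 + (max_mesh_size G \<l> M)\<^sup>2)
        \<le> E * ((T / real N)\<^sup>2 + (max_mesh_size G \<l> M)\<^sup>2)"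
      by (intro mult_right_mono) (auto simp: E_def)
    finally show "(LpE_norm G \<l> 2 (\<lambda>e x. \<rho> (real n * (T / real N)) e x - \<rho>h n e x))\<^sup>2
        + \<epsilon>\<^sup>2 * (LpE_norm G \<l> 2 (\<lambda>e x. mass_flow a (\<rho> (real n * (T / real N))) (w (real n * (T / real N))) e x - mh n e x))\<^sup>2
        + (\<Sum>k=1..n. T / real N * (LpE_norm G \<l> 3 (\<lambda>e x. mass_flow a (\<rho> (real k * (T / real N))) (w (real k * (T / real N))) e x - mh k e x)) ^ 3)
        \<le> E * ((T / real N)\<^sup>2 + (max_mesh_size G \<l> M)\<^sup>2)" .
  qed
qed

end
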